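(* With the data described in the context, assume: (a) there exist nonnegative measurable functions $\kappa_1,\kappa_2,\kappa_3,\kappa_4$ on $\Xi$ with $\mathbb{E}[\kappa_i(\xi)]<\infty$ ($i=1,2,3,4$) such that for all $z_1,z_2\in\mathbb{R}^n$, $|F(z_1,\xi)-F(z_2,\xi)|\le\kappa_1(\xi)\|z_1-z_2\|$ and $\|g(z_1,\xi)\|\le\kappa_2(\xi)\|z_1\|$ for a.e. $\xi\in\Xi$, and $\|M(\xi)\|\le\kappa_3(\xi)$, $\|q(\xi)\|\le\kappa_4(\xi)$ for all $\xi\in\Xi$; (b) $D\in\mathbb{R}^{l\times m}$ has full row rank with $l<m$, and the matrix $\mathcal{R}=[BY\;\;(A-BD^\dag C)BY\;\;(A-BD^\dag C)^2BY\;\cdots\;(A-BD^\dag C)^{n-1}BY]\in\mathbb{R}^{n\times n(m-l)}$ has full row rank, where $Y\in\mathbb{R}^{m\times(m-l)}$ is a matrix of full column rank $m-l$ with $DY=0$; (c) $\mathcal{B}(0,\beta\,\mathbb{E}[\kappa_2(\xi)]\,\|\mathbb{E}[q(\xi)]\|_1)\subseteq K$; (d) the set $\mathcal{V}=\{v\in\mathbb{R}^n:\ \mathbb{E}[M(\xi)v+q(\xi)]\ge 0,\ v\ge 0\}$ is nonempty; (e) $\mathbb{E}[M(\xi)]$ is an adequate matrix or a Z-matrix; (f) $\mathbb{E}[F(\cdot,\xi)]$ is bounded from below. Then $$\lim_{\epsilon\downarrow0}\ \lim_{\nu\to\infty}\ \lim_{h\downarrow0}\ \mathbb{D}(\hat{\mathcal{S}}^{\epsilon,\nu}_h,\hat{\mathcal{S}})=0\quad\text{with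 probability 1},$$ where $\hat{\mathcal{S}}$ is the set of optimal solutions of (P) and $\hat{\mathcal{S}}^{\epsilon,\nu}_h$ is the set of interpolants of optimal solutions of the time-stepping problem (P$^{\epsilon,\nu}_h$).
   Context: $\|\cdot\|$ is the Euclidean norm of a vector and a matrix; $\|\cdot\|_1$ is the 1-norm. $L^2(0,T)^n$ carries the norm $\|x\|_{L^2}=(\int_0^T\|x(t)\|^2dt)^{1/2}$; $H^1(0,T)^n$ is the space of $x\in L^2(0,T)^n$ with weak derivative $\dot x\in L^2(0,T)^n$, with $\|x\|_{H^1}=(\|x\|_{L^2}^2+\|\dot x\|_{L^2}^2)^{1/2}$. $\mathcal{B}(v,\varepsilon)=\{w:\|w-v\|\le\varepsilon\}$; $\mathrm{dist}(z,K)=\inf_{z'\in K}\|z-z'\|$; $K^\epsilon=\{z:\mathrm{dist}(z,K)\le\epsilon\}$. For $S_1,S_2\subseteq H^1(0,T)^n\times L^2(0,T)^m$: $\mathrm{dist}((v_1,v_2),S_1)=\inf_{(v_1',v_2')\in S_1}(\|v_1-v_1'\|_{H^1}+\|v_2-v_2'\|_{L^2})$ and $\mathbb{D}(S_1,S_2)=\sup_{(v_1,v_2)\in S_1}\mathrm{dist}((v_1,v_2),S_2)$. $D^\dag$ is the pseudoinverse of $D$ ($D^\dag=D^\top(DD^\top)^{-1}$ when $D$ has full row rank). $a\perp b$ means $a^\top b=0$; vector inequalities and $\min$ of vectors are componentwise. Data: $\xi$ is a random variable on a probability space $(\Omega,\mathcal{F},\mathcal{P})$ with support $\Xi=\xi(\Omega)\subseteq\mathbb{R}^d$,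 and $\xi_1,\dots,\xi_\nu$ is an i.i.d. sample of $\xi$. $A\in\mathbb{R}^{n\times n}$, $B\in\mathbb{R}^{n\times m}$, $C\in\mathbb{R}^{l\times n}$, $D\in\mathbb{R}^{l\times m}$, $x_0\in\mathbb{R}^n$, $f\in L^2(0,T)^l$, $\delta>0$, $x_d\in L^2(0,T)^n$, $u_d\in L^2(0,T)^m$; $K\subseteq\mathbb{R}^{\ell}$ is nonempty, closed, convex. $F:\mathbb{R}^n\times\Xi\to\mathbb{R}$ and $g:\mathbb{R}^n\times\Xi\to\mathbb{R}^{\ell}$ are continuously differentiable in the first variable for a.e. $\xi\in\Xi$ and measurable in $\xi$ for each first argument; $M:\Xi\to\mathbb{R}^{n\times n}$ and $q:\Xi\to\mathbb{R}^n$ are measurable. Problem (P): minimize over $(x,u)\in H^1(0,T)^n\times L^2(0,T)^m$ $$\Phi(x,u)=\mathbb{E}[F(x(T),\xi)]+\tfrac12\|x-x_d\|_{L^2}^2+\tfrac{\delta}{2}\|u-u_d\|_{L^2}^2$$ subject to $\dot x(t)=Ax(t)+Bu(t)$ and $Cx(t)+Du(t)-f(t)\le 0$ for a.e. $t\in(0,T)$; $0\le x(T)\perp\mathbb{E}[M(\xi)x(T)+q(\xi)]\ge 0$; $x(0)=x_0$; $\mathbb{E}[g(x(T),\xi)]\in K$. Time-stepping: for a positive integer $N$, $h=T/N=t_{i+1}-t_i$, $i=0,\dots,N-1$, with $t_0=0$; $x_{d,i}=x_d(t_i)$, $u_{d,i}=u_d(t_i)$, $f_i=f(t_i)$. Problem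 (P$^{\epsilon,\nu}_h$): with $\mathbf{x}_0=x_0$, minimize over $\{\mathbf{x}_i,\mathbf{u}_i\}_{i=1}^N$, $\mathbf{x}_i\in\mathbb{R}^n$, $\mathbf{u}_i\in\mathbb{R}^m$, $$\frac1\nu\sum_{j=1}^\nu F(\mathbf{x}_N,\xi_j)+\frac h2\sum_{i=1}^N\big(\|\mathbf{x}_i-x_{d,i}\|^2+\delta\|\mathbf{u}_i-u_{d,i}\|^2\big)$$ subject to $\mathbf{x}_{i+1}-\mathbf{x}_i=hA\mathbf{x}_{i+1}+hB\mathbf{u}_{i+1}$ and $C\mathbf{x}_{i+1}+D\mathbf{u}_{i+1}-f_{i+1}\le0$ for $i=0,\dots,N-1$; $\left\|\min\{\mathbf{x}_N,\frac1\nu\sum_{j=1}^\nu[M(\xi_j)\mathbf{x}_N+q(\xi_j)]\}\right\|\le\epsilon$; $\frac1\nu\sum_{j=1}^\nu g(\mathbf{x}_N,\xi_j)\in K^\epsilon$. Interpolants: given $\{\mathbf{x}_i,\mathbf{u}_i\}_{i=1}^N$ (and $\mathbf{x}_0=x_0$), define for $t\in(t_i,t_{i+1}]$, $x_h(t)=\mathbf{x}_i+\frac{t-t_i}{h}(\mathbf{x}_{i+1}-\mathbf{x}_i)$ and $u_h(t)=\mathbf{u}_{i+1}$. $\hat{\mathcal{S}}^{\epsilon,\nu}_h\subseteq H^1(0,T)^n\times L^2(0,T)^m$ is the set of all such $(x_h,u_h)$ built from optimal solutions of (P$^{\epsilon,\nu}_h$). For $J\subseteq\{1,\dots,n\}$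 nonempty, $\mathbb{E}[M_{J,J}(\xi)]$ is the principal submatrix of $\mathbb{E}[M(\xi)]$ with rows and columns in $J$. Let $\mathcal{J}=\{J:\mathbb{E}[M_{J,J}(\xi)]\text{ is nonsingular}\}$; $\beta=1$ if $\mathcal{J}=\emptyset$, and $\beta=\max\{\|(\mathbb{E}[M_{J,J}(\xi)])^{-1}\|_1: J\in\mathcal{J}\}$ otherwise. A square matrix is a Z-matrix if its off-diagonal entries are non-positive. A matrix $N\in\mathbb{R}^{n\times n}$ is column adequate if for each $z\in\mathbb{R}^n$, $z_i(Nz)_i\le 0$ for all $i$ implies $Nz=0$; row adequate if $N^\top$ is column adequate; adequate if both.
   Formalization: Point samples of f, x_d, u_d are undefined for L^2 classes, so the step functions built from these samples are assumed to converge to f, x_d, u_d in L^2; the inner limits over h and ν need not exist and are taken as limsups; F(z,ξ) is assumed integrable for each z. *)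

theory Defs
  imports "HOL-Probability.Probability"
begin

text \<open>
  Elements of \<open>L\<^sup>2\<close> and \<open>H\<^sup>1\<close> are represented by functions on the real line; only their values on
  (0,T) (for \<open>H\<^sup>1\<close>: on [0,T]) matter.
\<close>

definition L2_space :: "real \<Rightarrow> (real \<Rightarrow> 'a::euclidean_space) set" where
  "L2_space T = {x. x \<in> borel_measurable (lebesgue_on {0<..<T}) \<and>
                    integrable (lebesgue_on {0<..<T}) (\<lambda>t. (norm (x t))\<^sup>2)}"

definition norm_L2 :: "real \<Rightarrow> (real \<Rightarrow> 'a::euclidean_space) \<Rightarrow> real" where
  "norm_L2 T x = sqrt (LINT t|lebesgue_on {0<..<T}. (norm (x t))\<^sup>2)"

definition test_functions :: "real \<Rightarrow> (real \<Rightarrow> real) set" where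
  "test_functions T = {\<phi>. (\<forall>k t. ((deriv ^^ k) \<phi>) differentiable (at t)) \<and>
                          (\<exists>a b. 0 < a \<and> a < b \<and> b < T \<and> (\<forall>t. t \<notin> {a..b} \<longrightarrow> \<phi> t = 0))}"

definition has_weak_deriv :: "real \<Rightarrow> (real \<Rightarrow> 'a::euclidean_space) \<Rightarrow> (real \<Rightarrow> 'a) \<Rightarrow> bool" where
  "has_weak_deriv T x y \<longleftrightarrow>
     (\<forall>\<phi>\<in>test_functions T.
        (LINT t|lebesgue_on {0<..<T}. deriv \<phi> t *\<^sub>R x t) =
        - (LINT t|lebesgue_on {0<..<T}. \<phi> t *\<^sub>R y t))"

text \<open>
  Every class in \<open>H\<^sup>1(0,T)\<close> has exactly one representative that is continuous on [0,T]. The set below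
  consists of these representatives, so that the end point values x(0) and x(T) are plain function
  values.
\<close>

definition H1_space :: "real \<Rightarrow> (real \<Rightarrow> 'a::euclidean_space) set" where
  "H1_space T = {x. x \<in> L2_space T \<and> continuous_on {0..T} x \<and>
                    (\<exists>y\<in>L2_space T. has_weak_deriv T x y)}"

text \<open>The weak derivative is unique up to a null set, so the choice is immaterial.\<close>

definition weak_deriv :: "real \<Rightarrow> (real \<Rightarrow> 'a::euclidean_space) \<Rightarrow> real \<Rightarrow> 'a" where
  "weak_deriv T x = (SOME y. y \<in> L2_space T \<and> has_weak_deriv T x y)"

definition norm_H1 :: "real \<Rightarrow> (real \<Rightarrow> 'a::euclidean_space) \<Rightarrow> real" where
  "norm_H1 T x = sqrt ((norm_L2 T x)\<^sup>2 + (norm_L2 T (weak_deriv T x))\<^sup>2)"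

text \<open>
  Infimum and supremum are taken in the extended nonnegative reals: the distance to the empty set is
  infinite and the excess of the empty set over any set is 0.
\<close>

definition dist_set ::
  "real \<Rightarrow> (real \<Rightarrow> 'a::euclidean_space) \<times> (real \<Rightarrow> 'b::euclidean_space) \<Rightarrow>
   ((real \<Rightarrow> 'a) \<times> (real \<Rightarrow> 'b)) set \<Rightarrow> ennreal" where
  "dist_set T v S =
     (INF w\<in>S. ennreal (norm_H1 T (\<lambda>t. fst v t - fst w t) + norm_L2 T (\<lambda>t. snd v t - snd w t)))"

definition excess ::
  "real \<Rightarrow> ((real \<Rightarrow> 'a::euclidean_space) \<times> (real \<Rightarrow> 'b::euclidean_space)) set \<Rightarrow>
   ((real \<Rightarrow> 'a) \<times> (real \<Rightarrow> 'b)) set \<Rightarrow> ennreal" where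
  "excess T S1 S2 = (SUP v\<in>S1. dist_set T v S2)"

definition C1_fun :: "('a::real_normed_vector \<Rightarrow> 'b::real_normed_vector) \<Rightarrow> bool" where
  "C1_fun f \<longleftrightarrow>
     (\<exists>f'. (\<forall>z. (f has_derivative blinfun_apply (f' z)) (at z)) \<and> continuous_on UNIV f')"

definition norm1 :: "real^'n \<Rightarrow> real" where
  "norm1 v = (\<Sum>i\<in>UNIV. \<bar>v $ i\<bar>)"

text \<open>The Moore-Penrose pseudoinverse, given by the four Penrose equations.\<close>

definition pseudoinverse :: "real^'m^'l \<Rightarrow> real^'l^'m" where
  "pseudoinverse D = (THE X. D ** X ** D = D \<and> X ** D ** X = X \<and>
                             transpose (D ** X) = D ** X \<and> transpose (X ** D) = X ** D)"

lemma pseudoinverse_unique: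
  fixes D :: "real^'m^'l" and X Z :: "real^'l^'m"
  assumes X: "D ** X ** D = D" "X ** D ** X = X" "transpose (D ** X) = D ** X" "transpose (X ** D) = X ** D"
    and Z: "D ** Z ** D = D" "Z ** D ** Z = Z" "transpose (D ** Z) = D ** Z" "transpose (Z ** D) = Z ** D"
  shows "X = Z"
proof -
  have DX: "D ** X = D ** Z"
  proof -
    have "D ** X = transpose (D ** Z ** (D ** X))"
      by (metis X(3) Z(1) matrix_mul_assoc)
    also have "\<dots> = D ** X ** (D ** Z)"
      by (simp only: matrix_transpose_mul[of "D ** Z" "D ** X"] X(3) Z(3))
    also have "\<dots> = D ** Z"
      by (metis X(1) matrix_mul_assoc)
    finally show ?thesis .
  qed
  have XD: "X ** D = Z ** D"
  proof -
    have "X ** D = transpose (X ** D ** (Z ** D))"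
      by (metis X(4) Z(1) matrix_mul_assoc)
    also have "\<dots> = Z ** D ** (X ** D)"
      by (simp only: matrix_transpose_mul[of "X ** D" "Z ** D"] X(4) Z(4))
    also have "\<dots> = Z ** D"
      by (metis X(1) matrix_mul_assoc)
    finally show ?thesis .
  qed
  show ?thesis
    by (metis DX X(2) XD Z(2) matrix_mul_assoc)
qed

lemma pseudoinverse_full_row_rank:
  fixes D :: "real^'m^'l"
  assumes "rank D = CARD('l)"
  shows "pseudoinverse D = transpose D ** matrix_inv (D ** transpose D)"
proof -
  let ?G = "D ** transpose D" and ?X = "transpose D ** matrix_inv (D ** transpose D)"
  have inj: "inj ((*v) (transpose D))"
    using assms full_rank_injective[of "transpose D"] by (simp add: rank_transpose)
  have "v = 0" if "?G *v v = 0" for v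
  proof -
    have "(transpose D *v v) \<bullet> (transpose D *v v) = v \<bullet> (?G *v v)"
      by (metis dot_lmul_matrix matrix_vector_mul_assoc transpose_matrix_vector)
    then have "transpose D *v v = 0" using that by simp
    then show "v = 0"
      by (metis inj injD matrix_vector_mult_0_right)
  qed
  then obtain L where "L ** ?G = mat 1"
    using matrix_left_invertible_ker by blast
  then have "invertible ?G"
    by (meson invertible_left_inverse)
  then have G: "?G ** matrix_inv ?G = mat 1" "matrix_inv ?G ** ?G = mat 1"
    unfolding invertible_def matrix_inv_def
    by (metis (mono_tags, lifting) someI_ex)+
  have sym: "transpose (matrix_inv ?G) = matrix_inv ?G"
  proof -
    have "transpose (matrix_inv ?G) ** ?G = mat 1"
      by (metis G(1) matrix_transpose_mul transpose_mat transpose_transpose)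
    then show ?thesis
      by (metis G(1) matrix_mul_assoc matrix_mul_lid matrix_mul_rid)
  qed
  have DX: "D ** ?X = mat 1"
    by (simp add: matrix_mul_assoc G)
  have *: "D ** ?X ** D = D" "?X ** D ** ?X = ?X" "transpose (D ** ?X) = D ** ?X"
    by (simp_all add: DX flip: matrix_mul_assoc)
  have **: "transpose (?X ** D) = ?X ** D"
    by (simp add: matrix_transpose_mul sym matrix_mul_assoc)
  show ?thesis
    unfolding pseudoinverse_def
    by (rule the_equality) (use * ** pseudoinverse_unique in blast)+
qed

primrec mat_power :: "real^'n^'n \<Rightarrow> nat \<Rightarrow> real^'n^'n" where
  "mat_power G 0 = mat 1"
| "mat_power G (Suc k) = G ** mat_power G k"

text \<open>
  The block matrix \<open>[H, G H, G\<^sup>2 H, \<dots>, G\<^bsup>n-1\<^esup> H]\<close>. Its columns are indexed by pairs (k, j), standing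
  for column j of the block with exponent \<open>to_nat_on UNIV k\<close>; as k runs through the n-element index
  type \<open>'n\<close>, the exponent takes each value 0, ..., n-1 exactly once.
\<close>

definition controllability_matrix :: "real^'n^'n \<Rightarrow> real^'p^'n \<Rightarrow> real^('n \<times> 'p)^'n" where
  "controllability_matrix G H =
     (\<chi> i c. (mat_power G (to_nat_on (UNIV :: 'n set) (fst c)) ** H) $ i $ snd c)"

definition Z_matrix :: "real^'n^'n \<Rightarrow> bool" where
  "Z_matrix A \<longleftrightarrow> (\<forall>i j. i \<noteq> j \<longrightarrow> A $ i $ j \<le> 0)"

definition column_adequate :: "real^'n^'n \<Rightarrow> bool" where
  "column_adequate A \<longleftrightarrow> (\<forall>z. (\<forall>i. z $ i * (A *v z) $ i \<le> 0) \<longrightarrow> A *v z = 0)"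

definition adequate :: "real^'n^'n \<Rightarrow> bool" where
  "adequate A \<longleftrightarrow> column_adequate A \<and> column_adequate (transpose A)"

text \<open>
  A square matrix with rows and columns in J is a function of two indices of which only the values
  on \<open>J \<times> J\<close> are relevant.
\<close>

definition principal_inverse :: "real^'n^'n \<Rightarrow> 'n set \<Rightarrow> ('n \<Rightarrow> 'n \<Rightarrow> real) \<Rightarrow> bool" where
  "principal_inverse A J R \<longleftrightarrow>
     (\<forall>i\<in>J. \<forall>j\<in>J. (\<Sum>k\<in>J. A $ i $ k * R k j) = (if i = j then 1 else 0) \<and>
                   (\<Sum>k\<in>J. R i k * A $ k $ j) = (if i = j then 1 else 0))"

definition nonsingular_index_sets :: "real^'n^'n \<Rightarrow> 'n set set" where
  "nonsingular_index_sets A = {J. J \<noteq> {} \<and> (\<exists>R. principal_inverse A J R)}"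

text \<open>The matrix norm induced by the 1-norm of vectors, i.e. the maximal absolute column sum.\<close>

definition principal_norm1 :: "'n set \<Rightarrow> ('n \<Rightarrow> 'n \<Rightarrow> real) \<Rightarrow> real" where
  "principal_norm1 J R = Max ((\<lambda>j. \<Sum>i\<in>J. \<bar>R i j\<bar>) ` J)"

definition lcp_beta :: "real^'n^'n \<Rightarrow> real" where
  "lcp_beta A =
     (if nonsingular_index_sets A = {} then 1
      else Max ((\<lambda>J. principal_norm1 J (SOME R. principal_inverse A J R)) ` nonsingular_index_sets A))"

text \<open>The measurable structure on \<open>\<Xi> = \<xi>(\<Omega>)\<close> and the distribution of \<open>\<xi>\<close> as a measure on \<open>\<Xi>\<close>.\<close>

definition Xi_space :: "'w measure \<Rightarrow> ('w \<Rightarrow> real^'d) \<Rightarrow> (real^'d) measure" where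
  "Xi_space P \<xi> = restrict_space borel (\<xi> ` space P)"

definition Xi_law :: "'w measure \<Rightarrow> ('w \<Rightarrow> real^'d) \<Rightarrow> (real^'d) measure" where
  "Xi_law P \<xi> = distr P (Xi_space P \<xi>) \<xi>"

definition iid_sample :: "'w measure \<Rightarrow> ('w \<Rightarrow> real^'d) \<Rightarrow> (nat \<Rightarrow> 'w \<Rightarrow> real^'d) \<Rightarrow> bool" where
  "iid_sample P \<xi> \<xi>s \<longleftrightarrow>
     prob_space.indep_vars P (\<lambda>_. Xi_space P \<xi>) \<xi>s {1..} \<and>
     (\<forall>j\<ge>1. distr P (Xi_space P \<xi>) (\<xi>s j) = Xi_law P \<xi>)"

definition sample_mean :: "nat \<Rightarrow> (nat \<Rightarrow> 'a::real_vector) \<Rightarrow> 'a" where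
  "sample_mean \<nu> y = (1 / real \<nu>) *\<^sub>R (\<Sum>j=1..\<nu>. y j)"

text \<open>
  Both problems are formulated for an arbitrary terminal cost \<open>\<phi>\<close>, complementarity map \<open>G\<close> and
  constraint map \<open>H\<close> of the terminal state; these are instantiated by expectations in the continuous
  problem and by sample means in the discrete one.
\<close>

definition minimizers :: "'a set \<Rightarrow> ('a \<Rightarrow> real) \<Rightarrow> 'a set" where
  "minimizers S J = {s \<in> S. \<forall>s'\<in>S. J s \<le> J s'}"

definition ocp_feasible ::
  "real \<Rightarrow> real^'n^'n \<Rightarrow> real^'m^'n \<Rightarrow> real^'n^'l \<Rightarrow> real^'m^'l \<Rightarrow> (real \<Rightarrow> real^'l) \<Rightarrow> real^'n \<Rightarrow>
   (real^'n \<Rightarrow> real^'n) \<Rightarrow> (real^'n \<Rightarrow> real^'k) \<Rightarrow> (real^'k) set \<Rightarrow>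
   ((real \<Rightarrow> real^'n) \<times> (real \<Rightarrow> real^'m)) set" where
  "ocp_feasible T A B C D f x0 G H K =
     {(x, u). x \<in> H1_space T \<and> u \<in> L2_space T \<and>
        (AE t in lebesgue_on {0<..<T}. weak_deriv T x t = A *v x t + B *v u t) \<and>
        (AE t in lebesgue_on {0<..<T}. C *v x t + D *v u t - f t \<le> 0) \<and>
        0 \<le> x T \<and> x T \<bullet> G (x T) = 0 \<and> 0 \<le> G (x T) \<and>
        x 0 = x0 \<and> H (x T) \<in> K}"

definition ocp_cost ::
  "real \<Rightarrow> real \<Rightarrow> (real \<Rightarrow> real^'n) \<Rightarrow> (real \<Rightarrow> real^'m) \<Rightarrow> (real^'n \<Rightarrow> real) \<Rightarrow>
   (real \<Rightarrow> real^'n) \<times> (real \<Rightarrow> real^'m) \<Rightarrow> real" where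
  "ocp_cost T \<delta> xd ud \<phi> = (\<lambda>(x, u).
     \<phi> (x T) + 1/2 * (norm_L2 T (\<lambda>t. x t - xd t))\<^sup>2 + \<delta>/2 * (norm_L2 T (\<lambda>t. u t - ud t))\<^sup>2)"

definition node :: "real \<Rightarrow> nat \<Rightarrow> nat \<Rightarrow> real" where
  "node T N i = real i * (T / real N)"

definition tsp_feasible ::
  "real \<Rightarrow> nat \<Rightarrow> real^'n^'n \<Rightarrow> real^'m^'n \<Rightarrow> real^'n^'l \<Rightarrow> real^'m^'l \<Rightarrow> (real \<Rightarrow> real^'l) \<Rightarrow> real^'n \<Rightarrow>
   real \<Rightarrow> (real^'n \<Rightarrow> real^'n) \<Rightarrow> (real^'n \<Rightarrow> real^'k) \<Rightarrow> (real^'k) set \<Rightarrow>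
   ((nat \<Rightarrow> real^'n) \<times> (nat \<Rightarrow> real^'m)) set" where
  "tsp_feasible T N A B C D f x0 \<epsilon> G H K =
     {(X, U). X 0 = x0 \<and>
        (\<forall>i<N. X (Suc i) - X i = (T / real N) *\<^sub>R (A *v X (Suc i)) + (T / real N) *\<^sub>R (B *v U (Suc i)) \<and>
               C *v X (Suc i) + D *v U (Suc i) - f (node T N (Suc i)) \<le> 0) \<and>
        norm (\<chi> i. min (X N $ i) (G (X N) $ i)) \<le> \<epsilon> \<and>
        infdist (H (X N)) K \<le> \<epsilon>}"

definition tsp_cost ::
  "real \<Rightarrow> nat \<Rightarrow> real \<Rightarrow> (real \<Rightarrow> real^'n) \<Rightarrow> (real \<Rightarrow> real^'m) \<Rightarrow> (real^'n \<Rightarrow> real) \<Rightarrow>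
   (nat \<Rightarrow> real^'n) \<times> (nat \<Rightarrow> real^'m) \<Rightarrow> real" where
  "tsp_cost T N \<delta> xd ud \<phi> = (\<lambda>(X, U).
     \<phi> (X N) + (T / real N) / 2 *
       (\<Sum>i=1..N. (norm (X i - xd (node T N i)))\<^sup>2 + \<delta> * (norm (U i - ud (node T N i)))\<^sup>2))"

text \<open>The index i with t in \<open>(t\<^sub>i, t\<^bsub>i+1\<^esub>]\<close>; it is 0 at t = 0, so that the state interpolant starts at \<open>x\<^sub>0\<close>.\<close>

definition cell :: "real \<Rightarrow> nat \<Rightarrow> real \<Rightarrow> nat" where
  "cell T N t = nat \<lceil>t / (T / real N)\<rceil> - 1"

definition state_interpolant :: "real \<Rightarrow> nat \<Rightarrow> (nat \<Rightarrow> real^'n) \<Rightarrow> real \<Rightarrow> real^'n" where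
  "state_interpolant T N X t =
     (let i = cell T N t in X i + ((t - node T N i) / (T / real N)) *\<^sub>R (X (Suc i) - X i))"

definition control_interpolant :: "real \<Rightarrow> nat \<Rightarrow> (nat \<Rightarrow> real^'m) \<Rightarrow> real \<Rightarrow> real^'m" where
  "control_interpolant T N U t = U (Suc (cell T N t))"

definition interpolants ::
  "real \<Rightarrow> nat \<Rightarrow> ((nat \<Rightarrow> real^'n) \<times> (nat \<Rightarrow> real^'m)) set \<Rightarrow>
   ((real \<Rightarrow> real^'n) \<times> (real \<Rightarrow> real^'m)) set" where
  "interpolants T N S = (\<lambda>(X, U). (state_interpolant T N X, control_interpolant T N U)) ` S"

lemma cell_eq:
  assumes "0 < T" "0 < N" "node T N i < t" "t \<le> node T N (Suc i)"
  shows "cell T N t = i"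
proof -
  have h: "0 < T / real N" using assms by simp
  have "real i < t / (T / real N)" "t / (T / real N) \<le> real i + 1"
    using assms h unfolding node_def by (auto simp: pos_less_divide_eq pos_divide_le_eq algebra_simps simp del: divide_divide_eq_right)
  then have "\<lceil>t / (T / real N)\<rceil> = int i + 1"
    by (intro ceiling_unique) auto
  then show ?thesis by (simp only: cell_def)
qed

lemma state_interpolant_0: "state_interpolant T N X 0 = X 0"
  by (simp add: state_interpolant_def cell_def node_def)

text \<open>
  The discretization samples the data at the nodes, which is meaningful only for functions whose point
  values determine them as elements of \<open>L\<^sup>2\<close>: the step functions with value \<open>y(t\<^bsub>i+1\<^esub>)\<close> on
  \<open>(t\<^sub>i, t\<^bsub>i+1\<^esub>]\<close> have to converge to y in \<open>L\<^sup>2(0,T)\<close>. An arbitrary representative of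
  an \<open>L\<^sup>2\<close> class may fail this, since the set of all nodes is a null set.
\<close>

definition sampling_consistent :: "real \<Rightarrow> (real \<Rightarrow> 'a::euclidean_space) \<Rightarrow> bool" where
  "sampling_consistent T y \<longleftrightarrow>
     (\<lambda>N. norm_L2 T (\<lambda>t. y (node T N (Suc (cell T N t))) - y t)) \<longlonglongrightarrow> 0"

lemma node_cell_bounds:
  assumes "0 < N" "0 < t" "t < T"
  shows "t \<le> node T N (Suc (cell T N t))" "node T N (Suc (cell T N t)) \<le> T"
    "node T N (Suc (cell T N t)) - t < T / real N"
proof -
  define h s where "h = T / real N" and "s = t / h"
  have h: "0 < h" and T: "T = real N * h" and t: "t = s * h"
    using assms by (auto simp: h_def s_def)
  have s: "0 < s" "s < real N"
    using assms h T t by (auto simp: zero_less_mult_iff)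
  have "0 < \<lceil>s\<rceil>" using s by simp
  then have "real (Suc (cell T N t)) = of_int \<lceil>s\<rceil>"
    unfolding cell_def h_def[symmetric] s_def[symmetric] by (simp add: nat_diff_distrib of_nat_diff)
  then have n: "node T N (Suc (cell T N t)) = of_int \<lceil>s\<rceil> * h"
    by (simp add: node_def h_def)
  have "s \<le> of_int \<lceil>s\<rceil>" "of_int \<lceil>s\<rceil> < s + 1" by linarith+
  moreover have "\<lceil>s\<rceil> \<le> int N" using s by (simp add: ceiling_le_iff)
  then have "(of_int \<lceil>s\<rceil> :: real) \<le> real N" by linarith
  ultimately have "s * h \<le> of_int \<lceil>s\<rceil> * h" "of_int \<lceil>s\<rceil> * h < (s + 1) * h"
    "of_int \<lceil>s\<rceil> * h \<le> real N * h"
    using h by (auto intro: mult_right_mono mult_strict_right_mono)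
  then show "t \<le> node T N (Suc (cell T N t))" "node T N (Suc (cell T N t)) \<le> T"
    "node T N (Suc (cell T N t)) - t < T / real N"
    unfolding n h_def[symmetric] using t T by (simp_all only: distrib_right mult_1)
qed

lemma sampling_consistent_continuous:
  fixes y :: "real \<Rightarrow> 'a::euclidean_space"
  assumes T: "0 < T" and cont: "continuous_on {0..T} y"
  shows "sampling_consistent T y"
  unfolding sampling_consistent_def
proof (rule tendstoI)
  fix e :: real
  assume e: "0 < e"
  define c where "c = e / (2 * sqrt T)"
  have c: "0 < c" using e T by (simp add: c_def)
  obtain d where d: "0 < d" "\<And>s t. s \<in> {0..T} \<Longrightarrow> t \<in> {0..T} \<Longrightarrow> dist s t < d \<Longrightarrow> dist (y s) (y t) < c"
    using compact_uniformly_continuous[OF cont] c unfolding uniformly_continuous_on_def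
    by (metis compact_Icc)
  have "(\<lambda>N. T / real N) \<longlonglongrightarrow> 0" by (rule lim_const_over_n)
  then have "\<forall>\<^sub>F N in sequentially. T / real N < d"
    using d(1) order_tendstoD(2) by blast
  then show "\<forall>\<^sub>F N in sequentially.
      dist (norm_L2 T (\<lambda>t. y (node T N (Suc (cell T N t))) - y t)) 0 < e"
    using eventually_gt_at_top[of 0]
  proof eventually_elim
    case (elim N)
    let ?g = "\<lambda>t. (norm (y (node T N (Suc (cell T N t))) - y t))\<^sup>2"
    let ?M = "lebesgue_on {0<..<T}"
    have fin: "finite_measure ?M"
      by (rule finite_measureI) (use T in \<open>simp add: space_restrict_space emeasure_restrict_space\<close>)
    have le: "?g t \<le> c\<^sup>2" if "t \<in> space ?M" for t
    proof -
      have t: "0 < t" "t < T" using that by (auto simp: space_restrict_space)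
      note b = node_cell_bounds[OF elim(2) t]
      have "dist (y (node T N (Suc (cell T N t)))) (y t) < c"
        by (rule d(2)) (use b t elim(1) in \<open>auto simp: dist_real_def\<close>)
      then show ?thesis by (auto simp: dist_norm intro!: power_mono)
    qed
    have "(LINT t|?M. ?g t) \<le> c\<^sup>2 * T"
    proof (cases "integrable ?M ?g")
      case True
      have "(LINT t|?M. ?g t) \<le> (LINT t|?M. c\<^sup>2)"
        by (rule integral_mono[OF True _ le]) (simp_all add: finite_measure.integrable_const[OF fin])
      also have "\<dots> = c\<^sup>2 * T"
        using T by (simp add: measure_restrict_space space_restrict_space)
      finally show ?thesis .
    next
      case False
      then show ?thesis using T by (simp add: not_integrable_integral_eq)
    qed
    then have "norm_L2 T (\<lambda>t. y (node T N (Suc (cell T N t))) - y t) \<le> sqrt (c\<^sup>2 * T)"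
      unfolding norm_L2_def by (rule real_sqrt_le_mono)
    also have "\<dots> = e / 2"
      using e T by (simp add: real_sqrt_mult c_def)
    also have "\<dots> < e" using e by simp
    finally show ?case by (simp add: norm_L2_def)
  qed
qed

end

theory Submission
  imports Defs
begin

text \<open>
  A convergent subsequence argument. If the excess did not tend to 0, there would be parameters
  \<open>\<epsilon>\<^sub>k \<rightarrow> 0\<close>, \<open>\<nu>\<^sub>k \<rightarrow> \<infinity>\<close>, \<open>h\<^sub>k \<rightarrow> 0\<close> and discrete optimal solutions whose interpolants stay away from
  the optimal solutions of the continuous problem. Almost surely, the sample means converge to the
  expectations jointly in the sample size and the argument, so the end state of a continuous optimal
  solution satisfies the relaxed terminal conditions, and by controllability that solution is
  approximated by discrete trajectories with the same end state. Comparison with these bounds the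
  discrete optimal values from above, hence the discrete controls in \<open>L\<^sup>2\<close> and the end states, which
  subconverge to a point that satisfies the exact terminal conditions. Controllability corrects the
  interpolants to exactly feasible trajectories ending at this point, at a vanishing price. They form
  a minimizing sequence, and since the cost is strongly convex in the control for a fixed end state,
  the sequence converges strongly to an optimal solution.

  Feasible end states exist because an adequate or Z-matrix complementarity problem that is feasible
  has a solution whose norm is bounded by \<open>\<beta>\<close> times the 1-norm of the constant vector.
\<close>

section \<open>Linear complementarity problems\<close>

text \<open>Complementarity makes the set of admissible end states nonconvex, and the expected cost
  of the end state need not be convex either. Both depend on the finite-dimensional end state alone;
  once it is frozen, a strongly convex quadratic problem over a convex set remains. Hence all
  trajectories are compared with others that have the same end state. Prescribing the end state
  takes control directions that survive the mixed constraint: a right inverse of D meets that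
  constraint, the kernel of D, spanned by the columns of Y, stays free, and the rank condition is
  Kalman's for the system under this feedback. The correction estimates are linear, with constants
  independent of the mesh. The constant \<beta> appears because a complementarity solution can be
  chosen whose principal submatrix on the support is nonsingular; there it is minus the inverse
  applied to the constant vector. The order of the limits matters: a fixed end state meets the
  \<epsilon>-relaxed conditions only once the sample is large relative to \<epsilon>. Sample means
  of F need not be bounded below, so compactness rests on their linear growth against the quadratic
  control cost.\<close>

definition lcp_solution :: "real^'n^'n \<Rightarrow> real^'n \<Rightarrow> real^'n \<Rightarrow> bool" where
  "lcp_solution M q z \<longleftrightarrow>
     (\<forall>i. 0 \<le> z $ i \<and> 0 \<le> (M *v z + q) $ i \<and> z $ i * (M *v z + q) $ i = 0)"

section \<open>Adequate matrices: box problems, recession directions, least support\<close>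

text \<open>Brouwer's theorem for the projected map \<open>z - (M z + q)\<close>, clipped to the
  box. Its fixed points solve the variational inequality on the box, so complementarity can fail
  only at the upper face.\<close>

lemma box_complementarity_exists:
  fixes M :: "real^'n^'n" and k :: real
  assumes "0 \<le> k"
  shows "\<exists>z. \<forall>i. 0 \<le> z $ i \<and> z $ i \<le> k \<and> (0 < z $ i \<longrightarrow> (M *v z + q) $ i \<le> 0) \<and>
                (z $ i < k \<longrightarrow> 0 \<le> (M *v z + q) $ i)"
proof -
  let ?S = "cbox (0::real^'n) (\<chi> i. k)"
  let ?f = "\<lambda>z::real^'n. \<chi> i. max 0 (min k (z $ i - (M *v z + q) $ i))"
  obtain z where z: "z \<in> ?S" "?f z = z"
  proof (rule brouwer)
    show "compact ?S" "convex ?S" by auto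
    have "0 \<in> ?S" using assms by (simp add: mem_box_cart)
    then show "?S \<noteq> {}" by blast
    show "continuous_on ?S ?f"
      unfolding matrix_vector_mult_def by (intro continuous_intros)
    show "?f \<in> ?S \<rightarrow> ?S" using assms by (auto simp: mem_box_cart)
  qed
  have "max 0 (min k (z $ i - (M *v z + q) $ i)) = z $ i" for i
    using z(2) by (metis vec_lambda_beta)
  then have "0 \<le> z $ i \<and> z $ i \<le> k \<and> (0 < z $ i \<longrightarrow> (M *v z + q) $ i \<le> 0) \<and>
                (z $ i < k \<longrightarrow> 0 \<le> (M *v z + q) $ i)" for i
    using assms by (smt (verit, best))
  then show ?thesis by blast
qed

text \<open>Stiemke's alternative on the support of d; column adequacy excludes the other alternative.\<close>

lemma adequate_positive_left_kernel:
  fixes M :: "real^'n^'n"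
  assumes ad: "adequate M" and d: "\<And>i. 0 \<le> d $ i" "M *v d = 0"
  obtains y where "\<And>i. 0 \<le> y $ i" "\<And>i. 0 < y $ i \<longleftrightarrow> 0 < d $ i" "transpose M *v y = 0"
proof -
  let ?S = "{i. 0 < d $ i}"
  let ?P = "\<lambda>z::real^'n. \<chi> i. if i \<in> ?S then (M *v z) $ i else 0"
  \<comment> \<open>Vectors supported on \<open>?S\<close>; \<open>?P\<close> applies the rows of
    \<open>M\<close> in \<open>?S\<close>. Thus \<open>?L\<close> is the range of the principal
    submatrix, and \<open>?C\<close> is the simplex spanned by the unit vectors of
    \<open>?S\<close>.\<close>
  let ?Z = "{z::real^'n. \<forall>i. i \<notin> ?S \<longrightarrow> z $ i = 0}"
  let ?L = "?P ` ?Z"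
  let ?C = "convex hull ((\<lambda>i. axis i (1::real)) ` ?S)"
  have linP: "linear ?P"
    by (rule linearI)
      (auto simp: vec_eq_iff matrix_vector_mult_add_rdistrib matrix_vector_right_distrib matrix_vector_mult_scaleR)
  have subZ: "subspace ?Z" by (auto simp: subspace_def)
  have subL: "subspace ?L"
    by (rule linear_subspace_image[OF linP subZ])
  have C: "?C \<subseteq> {p. (\<forall>i. 0 \<le> p $ i) \<and> (\<Sum>i\<in>UNIV. p $ i) = 1}"
  proof (rule hull_minimal)
    show "(\<lambda>i. axis i (1::real)) ` ?S \<subseteq> {p. (\<forall>i. 0 \<le> p $ i) \<and> (\<Sum>i\<in>UNIV. p $ i) = 1}"
      by (auto simp: axis_def)
    show "convex {p::real^'n. (\<forall>i. 0 \<le> p $ i) \<and> (\<Sum>i\<in>UNIV. p $ i) = 1}"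
      by (auto simp: convex_def sum.distrib simp flip: sum_distrib_left)
  qed
  have disj: "?L \<inter> ?C = {}"
  proof (rule ccontr)
    assume "?L \<inter> ?C \<noteq> {}"
    then obtain z where z: "z \<in> ?Z" and p: "?P z \<in> ?C" by blast
    \<comment> \<open>So large that \<open>z - t d\<close> is nonpositive on \<open>?S\<close>. As
      \<open>M d = 0\<close>, the image does not change, and column adequacy applies to a vector
      whose image is nonnegative on its support.\<close>
    define t where "t = 1 + (\<Sum>i\<in>?S. \<bar>z $ i\<bar> / d $ i)"
    define x where "x = z - t *\<^sub>R d"
    have Mx: "M *v x = M *v z"
      by (simp add: x_def matrix_vector_mult_diff_distrib d(2) matrix_vector_mult_scaleR)
    have "x $ i * (M *v x) $ i \<le> 0" for i
    proof (cases "i \<in> ?S")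
      case True
      have "\<bar>z $ i\<bar> / d $ i \<le> (\<Sum>i\<in>?S. \<bar>z $ i\<bar> / d $ i)"
        using True d(1) by (intro member_le_sum) auto
      then have "\<bar>z $ i\<bar> / d $ i \<le> t" by (simp add: t_def)
      then have "\<bar>z $ i\<bar> \<le> t * d $ i" using True by (simp add: pos_divide_le_eq)
      then have "x $ i \<le> 0" by (simp add: x_def)
      moreover have "0 \<le> (M *v z) $ i"
        using subsetD[OF C p] True by (auto dest!: spec[of _ i])
      ultimately show ?thesis unfolding Mx by (simp add: mult_nonneg_nonpos2 mult.commute)
    next
      case False
      then have "d $ i = 0" using d(1)[of i] by simp
      then show ?thesis using False z by (simp add: x_def)
    qed
    then have "M *v z = 0"
      using ad Mx unfolding adequate_def column_adequate_def by metis
    then have "?P z = 0" by (simp add: vec_eq_iff)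
    then show False using subsetD[OF C p] by simp
  qed
  obtain a b where ab: "\<And>x. x \<in> ?L \<Longrightarrow> a \<bullet> x < b" "\<And>x. x \<in> ?C \<Longrightarrow> b < a \<bullet> x"
  proof (cases "?S = {}")
    case True
    then have "?L = {0}" "?C = {}" by (auto simp: vec_eq_iff image_iff intro!: exI[of _ 0])
    then show ?thesis using that[of 0 1] by simp
  next
    case False
    have "\<exists>a b. (\<forall>x\<in>?L. a \<bullet> x < b) \<and> (\<forall>x\<in>?C. b < a \<bullet> x)"
    proof (rule separating_hyperplane_closed_compact)
      show "convex ?L" "closed ?L" using subL by (auto simp: subspace_imp_convex closed_subspace)
      show "compact ?C" by (intro finite_imp_compact_convex_hull) auto
      show "?C \<noteq> {}" using False by simp
    qed (use disj in auto)
    then show ?thesis using that by blast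
  qed
  \<comment> \<open>A linear functional bounded above on a subspace vanishes there; the multiple of
    \<open>x\<close> used would take the value \<open>b\<close>.\<close>
  have L0: "a \<bullet> x = 0" if "x \<in> ?L" for x
  proof (rule ccontr)
    assume ne: "a \<bullet> x \<noteq> 0"
    have "(b / (a \<bullet> x)) *\<^sub>R x \<in> ?L" using subL that by (simp add: subspace_scale)
    from ab(1)[OF this] ne show False by simp
  qed
  have b0: "0 < b" using ab(1)[of 0] subspace_0[OF subL] by simp
  define y where "y = (\<chi> i. if i \<in> ?S then a $ i else 0)"
  have apos: "0 < a $ i" if "i \<in> ?S" for i
  proof -
    have "axis i 1 \<in> ?C" using that by (intro hull_inc) auto
    from ab(2)[OF this] b0 show ?thesis by (simp add: inner_axis)
  qed
  have T0: "(transpose M *v y) $ i = 0" if "i \<in> ?S" for i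
  proof -
    have "?P (axis i 1) \<in> ?L" using that by (intro imageI) (auto simp: axis_def)
    then have "a \<bullet> ?P (axis i 1) = 0" by (rule L0)
    moreover have "a \<bullet> ?P (axis i 1) = (transpose M *v y) $ i"
      by (simp add: inner_vec_def y_def matrix_vector_mult_def transpose_def axis_def if_distrib
          cong: if_cong) (auto intro!: sum.cong)
    ultimately show ?thesis by simp
  qed
  \<comment> \<open>So far the left kernel equation is known only on \<open>?S\<close>. Since
    \<open>y\<close> vanishes elsewhere, column adequacy of the transpose extends it to all
    rows.\<close>
  have "y $ i * (transpose M *v y) $ i \<le> 0" for i
    using T0[of i] by (cases "i \<in> ?S") (simp_all add: y_def)
  then have "transpose M *v y = 0"
    using ad unfolding adequate_def column_adequate_def by blast
  moreover have "0 \<le> y $ i" "0 < y $ i \<longleftrightarrow> 0 < d $ i" for i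
    using apos[of i] by (auto simp: y_def less_imp_le)
  ultimately show ?thesis using that by blast
qed

text \<open>Suppose there is no solution. Box solutions for growing boxes, rescaled to the unit box,
  subconverge to a direction \<open>d\<close>, and complementarity forces \<open>M d = 0\<close>. A
  left kernel vector \<open>y\<close> with the support of \<open>d\<close> turns feasibility into
  \<open>y \<bullet> w \<ge> 0\<close>, although each summand is nonpositive. So \<open>w\<close>
  vanishes on the support of \<open>d\<close>, and off it the upper face is not reached: the box
  solution solves the unrestricted problem.\<close>

lemma adequate_lcp_solution_exists:
  fixes M :: "real^'n^'n"
  assumes ad: "adequate M" and v: "\<And>i. 0 \<le> v $ i" "\<And>i. 0 \<le> (M *v v + q) $ i"
  shows "\<exists>z. lcp_solution M q z"
proof (rule ccontr)
  assume none: "\<nexists>z. lcp_solution M q z"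
  define K where "K k = real (Suc k)" for k
  have K0: "0 < K k" for k by (simp add: K_def)
  define w where "w z = M *v z + q" for z
  obtain Z where Z: "\<And>k i. 0 \<le> Z k $ i" "\<And>k i. Z k $ i \<le> K k"
      "\<And>k i. 0 < Z k $ i \<Longrightarrow> w (Z k) $ i \<le> 0" "\<And>k i. Z k $ i < K k \<Longrightarrow> 0 \<le> w (Z k) $ i"
    using box_complementarity_exists[OF less_imp_le[OF K0], of _ M q] unfolding w_def[symmetric] by metis
  \<comment> \<open>A positive component has \<open>w \<le> 0\<close>, so a box solution with
    \<open>w \<ge> 0\<close> everywhere would already be a solution of the unrestricted
    problem.\<close>
  have neg: "\<not> (\<forall>i. 0 \<le> w (Z k) $ i)" for k
  proof
    assume a: "\<forall>i. 0 \<le> w (Z k) $ i"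
    have "Z k $ i * w (Z k) $ i = 0" for i
      using a[rule_format, of i] Z(1,3)[of k i] by (cases "Z k $ i = 0") auto
    then show False using none a Z(1) unfolding lcp_solution_def w_def by blast
  qed
  define u where "u k = (1 / K k) *\<^sub>R Z k" for k
  have "u k \<in> cbox 0 1" for k
    using Z(1,2) by (auto simp: u_def mem_box_cart K0 less_imp_le)
  then obtain d r where d: "d \<in> cbox 0 1" and r: "strict_mono (r::nat\<Rightarrow>nat)" and lim: "(u \<circ> r) \<longlonglongrightarrow> d"
    using compact_cbox[of "0::real^'n" 1] unfolding compact_def by metis
  have d0: "0 \<le> d $ i" for i using d by (simp add: mem_box_cart)
  have limi: "(\<lambda>k. u (r k) $ i) \<longlonglongrightarrow> d $ i" for i
    using tendsto_vec_nth[OF lim] by (simp add: o_def)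
  have Kinf: "filterlim (\<lambda>k. K (r k)) at_top sequentially"
    unfolding K_def
    by (rule filterlim_compose[OF filterlim_real_sequentially])
      (intro filterlim_compose[OF filterlim_Suc] filterlim_subseq r)
  have wlim: "(\<lambda>k. w (Z (r k)) $ i / K (r k)) \<longlonglongrightarrow> (M *v d) $ i" for i
  proof -
    have "(\<lambda>k. (M *v u (r k)) $ i + q $ i / K (r k)) \<longlonglongrightarrow> (M *v d) $ i + 0"
      using lim unfolding o_def
      by (intro tendsto_intros tendsto_vec_nth real_tendsto_divide_at_top[OF tendsto_const Kinf]
          bounded_linear.tendsto[OF matrix_vector_mul_bounded_linear])
    moreover have "(M *v u k) $ i + q $ i / K k = w (Z k) $ i / K k" for k
      by (simp add: u_def w_def matrix_vector_mult_scaleR add_divide_distrib)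
    ultimately show ?thesis by simp
  qed
  have pos: "\<forall>\<^sub>F k in sequentially. 0 < Z (r k) $ i" if "0 < d $ i" for i
    using order_tendstoD(1)[OF limi that]
    by eventually_elim (use K0 in \<open>auto simp: u_def zero_less_divide_iff dest: less_asym\<close>)
  have "d $ i * (M *v d) $ i \<le> 0" for i
  proof (cases "0 < d $ i")
    case True
    have "\<forall>\<^sub>F k in sequentially. w (Z (r k)) $ i / K (r k) \<le> 0"
      using pos[OF True] by eventually_elim (use Z(3) in \<open>simp add: divide_le_0_iff less_imp_le[OF K0]\<close>)
    then have "(M *v d) $ i \<le> 0"
      using tendsto_upperbound[OF wlim] by simp
    then show ?thesis using True by (simp add: mult_nonneg_nonpos)
  qed (use d0[of i] in auto)
  then have Md: "M *v d = 0"
    using ad unfolding adequate_def column_adequate_def by blast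
  obtain y where y: "\<And>i. 0 \<le> y $ i" "\<And>i. 0 < y $ i \<longleftrightarrow> 0 < d $ i" "transpose M *v y = 0"
    using adequate_positive_left_kernel[OF ad d0 Md] by metis
  have yM: "y \<bullet> (M *v x) = 0" for x
    using y(3) by (metis dot_lmul_matrix inner_zero_left transpose_matrix_vector)
  \<comment> \<open>The value does not depend on \<open>x\<close> because \<open>y\<close>
    annihilates the range of \<open>M\<close>; it can be computed at the feasible point
    \<open>v\<close>.\<close>
  have yw: "0 \<le> y \<bullet> w x" for x
  proof -
    have "y \<bullet> w x = y \<bullet> (M *v v + q)" by (simp add: w_def inner_add_right yM)
    also have "\<dots> \<ge> 0"
      unfolding inner_vec_def using y(1) v(2) by (auto intro!: sum_nonneg)
    finally show ?thesis .
  qed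
  have "\<forall>\<^sub>F k in sequentially. \<forall>i. (0 < d $ i \<longrightarrow> 0 < Z (r k) $ i) \<and> (\<not> 0 < d $ i \<longrightarrow> 0 \<le> w (Z (r k)) $ i)"
  proof (intro eventually_all_finite)
    fix i
    show "\<forall>\<^sub>F k in sequentially. (0 < d $ i \<longrightarrow> 0 < Z (r k) $ i) \<and> (\<not> 0 < d $ i \<longrightarrow> 0 \<le> w (Z (r k)) $ i)"
    proof (cases "0 < d $ i")
      case False
      \<comment> \<open>A limit component below 1 keeps the box solution below the upper face
        eventually, which is what \<open>w \<ge> 0\<close> requires.\<close>
      then have "d $ i < 1" by simp
      from order_tendstoD(2)[OF limi this] show ?thesis
        by eventually_elim (use False K0 Z(4) in \<open>auto simp: u_def\<close>)
    qed (use pos in auto)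
  qed
  then obtain k where k: "\<And>i. 0 < d $ i \<Longrightarrow> 0 < Z (r k) $ i"
      "\<And>i. \<not> 0 < d $ i \<Longrightarrow> 0 \<le> w (Z (r k)) $ i"
    unfolding eventually_sequentially by blast
  have le: "y $ i * w (Z (r k)) $ i \<le> 0" for i
    using y(1,2)[of i] k(1)[of i] Z(3)[of "r k" i]
    by (cases "0 < d $ i") (auto simp: mult_nonneg_nonpos)
  have "(\<Sum>i\<in>UNIV. - (y $ i * w (Z (r k)) $ i)) = 0"
    using yw[of "Z (r k)"] le sum_nonneg[of UNIV "\<lambda>i. - (y $ i * w (Z (r k)) $ i)"]
    by (simp add: inner_vec_def sum_negf)
  then have "y $ i * w (Z (r k)) $ i = 0" for i
    using le by (subst (asm) sum_nonneg_eq_0_iff) auto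
  then have "0 \<le> w (Z (r k)) $ i" for i
    using k(2)[of i] y(2)[of i] by (cases "0 < d $ i") (metis less_irrefl mult_eq_0_iff order_refl, simp)
  then show False using neg by blast
qed


text \<open>Injectivity of the principal submatrix of \<open>M\<close> on the support of
  \<open>z\<close>, phrased with full vectors so that no submatrix type is needed. It is the link to
  the index sets that define \<beta>.\<close>

definition nondegenerate_support :: "real^'n^'n \<Rightarrow> real^'n \<Rightarrow> bool" where
  "nondegenerate_support M z \<longleftrightarrow>
     (\<forall>w. (\<forall>i. z $ i = 0 \<longrightarrow> w $ i = 0) \<longrightarrow> (\<forall>i. z $ i \<noteq> 0 \<longrightarrow> (M *v w) $ i = 0) \<longrightarrow> w = 0)"

text \<open>Take a solution with the fewest nonzero components. A kernel vector of the principal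
  submatrix on its support would lie in the kernel of \<open>M\<close> by column adequacy, and
  moving along it until a component vanishes would give a solution with smaller support.\<close>

lemma adequate_lcp_nondegenerate_solution:
  fixes M :: "real^'n^'n"
  assumes ad: "adequate M" and v: "\<And>i. 0 \<le> v $ i" "\<And>i. 0 \<le> (M *v v + q) $ i"
  obtains z where "lcp_solution M q z" "nondegenerate_support M z"
proof -
  define supp where "supp z = card {i. z $ i \<noteq> 0}" for z :: "real^'n"
  obtain z where z: "lcp_solution M q z" and least: "\<And>y. lcp_solution M q y \<Longrightarrow> supp z \<le> supp y"
    using adequate_lcp_solution_exists[OF ad v] ex_has_least_nat[of "lcp_solution M q" _ supp] by blast
  have step: False
    if w: "\<And>i. z $ i = 0 \<Longrightarrow> w $ i = 0" "M *v w = 0" "0 < w $ i0" for w i0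
  proof -
    let ?I = "{i. 0 < w $ i}"
    \<comment> \<open>The ratio test of the simplex method: the largest step that keeps
      \<open>z - t w\<close> nonnegative. It is attained at some \<open>j\<close>, whose component
      drops out of the support.\<close>
    define t where "t = Min ((\<lambda>i. z $ i / w $ i) ` ?I)"
    have "t \<in> (\<lambda>i. z $ i / w $ i) ` ?I" unfolding t_def using w(3) by (intro Min_in) auto
    then obtain j where j: "0 < w $ j" "t = z $ j / w $ j" by auto
    have t0: "0 \<le> t" using j z by (simp add: lcp_solution_def)
    define y where "y = z - t *\<^sub>R w"
    have My: "M *v y = M *v z"
      by (simp add: y_def matrix_vector_mult_diff_distrib matrix_vector_mult_scaleR w(2))
    have y0: "0 \<le> y $ i" for i
    proof (cases "0 < w $ i")
      case True
      then have "t \<le> z $ i / w $ i" unfolding t_def by (intro Min_le) auto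
      then show ?thesis using True by (simp add: y_def pos_le_divide_eq)
    next
      case False
      then have "t * w $ i \<le> 0" using t0 by (simp add: mult_nonneg_nonpos)
      then show ?thesis using z by (simp add: y_def lcp_solution_def) (meson order_trans)
    qed
    have sub: "y $ i \<noteq> 0 \<Longrightarrow> z $ i \<noteq> 0" for i using w(1)[of i] by (auto simp: y_def)
    have "lcp_solution M q y"
      using z y0 sub unfolding lcp_solution_def My by (metis mult_eq_0_iff)
    moreover have "supp y < supp z"
      unfolding supp_def
    proof (rule psubset_card_mono)
      have "y $ j = 0" using j by (simp add: y_def)
      moreover have "z $ j \<noteq> 0" using w(1)[of j] j by auto
      ultimately show "{i. y $ i \<noteq> 0} \<subset> {i. z $ i \<noteq> 0}" using sub by auto
    qed simp
    ultimately show False using least by fastforce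
  qed
  have "nondegenerate_support M z"
    unfolding nondegenerate_support_def
  proof (intro allI impI)
    fix w assume w: "\<forall>i. z $ i = 0 \<longrightarrow> w $ i = 0" "\<forall>i. z $ i \<noteq> 0 \<longrightarrow> (M *v w) $ i = 0"
    have "w $ i * (M *v w) $ i \<le> 0" for i using w by (cases "z $ i = 0") auto
    then have Mw: "M *v w = 0" using ad unfolding adequate_def column_adequate_def by blast
    have "\<not> 0 < w $ i" "\<not> 0 < (- w) $ i" for i
      using step[of w i] step[of "- w" i] w(1) Mw
      by (auto simp: matrix_vector_mult_diff_distrib[of M 0 w, simplified])
    then show "w = 0" by (simp add: vec_eq_iff) (metis linorder_neqE_linordered_idom neg_0_less_iff_less)
  qed
  with z that show ?thesis by blast
qed

section \<open>Z-matrices: minimal elements of the feasible set\<close>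

text \<open>Only off-diagonal terms of row \<open>i\<close> change, and their coefficients are
  nonpositive.\<close>

lemma Z_matrix_antimono_row:
  fixes M :: "real^'n^'n"
  assumes "Z_matrix M" "\<And>j. m $ j \<le> x $ j" "m $ i = x $ i"
  shows "(M *v x) $ i \<le> (M *v m) $ i"
  unfolding matrix_vector_mult_def vec_lambda_beta
proof (rule sum_mono)
  fix j
  show "M $ i $ j * x $ j \<le> M $ i $ j * m $ j"
    using assms unfolding Z_matrix_def by (cases "j = i") (auto intro: mult_left_mono_neg)
qed

text \<open>A feasible point of least coordinate sum has no other feasible point below it. Lowering
  a positive coordinate that has slack keeps feasibility for a Z-matrix, so complementarity holds at
  the minimum. Lowering along a kernel direction of the support submatrix, by a componentwise
  minimum of two points, is excluded in the same way, which gives nondegeneracy.\<close>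

lemma Z_matrix_lcp_nondegenerate_solution:
  fixes M :: "real^'n^'n"
  assumes Z: "Z_matrix M" and v: "\<And>i. 0 \<le> v $ i" "\<And>i. 0 \<le> (M *v v + q) $ i"
  obtains z where "lcp_solution M q z" "nondegenerate_support M z"
proof -
  define V where "V = {z. \<forall>i. 0 \<le> z $ i \<and> 0 \<le> (M *v z + q) $ i}"
  define s where "s z = (\<Sum>i\<in>UNIV. z $ i)" for z :: "real^'n"
  have conts: "continuous_on A s" for A unfolding s_def by (intro continuous_intros)
  have clV: "closed V"
    unfolding V_def matrix_vector_mult_def by (intro closed_Collect_all closed_Collect_conj closed_Collect_le continuous_intros)
  have vV: "v \<in> V" using v by (simp add: V_def)
  let ?W = "V \<inter> {z. s z \<le> s v}"
  have "?W \<subseteq> cbox 0 (\<chi> i. s v)"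
  proof
    fix z assume z: "z \<in> ?W"
    have "z $ i \<le> s z" for i
      unfolding s_def using z by (intro member_le_sum) (auto simp: V_def)
    then have "z $ i \<le> s v" for i using z by (meson IntD2 mem_Collect_eq order_trans)
    then show "z \<in> cbox 0 (\<chi> i. s v)" using z by (auto simp: mem_box_cart V_def)
  qed
  moreover have "closed ?W"
    using clV conts by (intro closed_Int closed_Collect_le) auto
  ultimately have "compact ?W" by (meson bounded_cbox bounded_subset compact_eq_bounded_closed)
  then obtain x where x: "x \<in> ?W" and xmin: "\<And>y. y \<in> ?W \<Longrightarrow> s x \<le> s y"
    using continuous_attains_inf[OF _ _ conts, of ?W] vV by blast
  have min: "s x \<le> s y" if "y \<in> V" for y
    using xmin[of y] xmin[of v] that vV by fastforce
  have x0: "0 \<le> x $ i" "0 \<le> (M *v x) $ i + q $ i" for i using x by (auto simp: V_def)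
  \<comment> \<open>The form in which minimality is used throughout: the coordinate sum cannot drop,
    so all differences vanish.\<close>
  have cut: "m $ i = x $ i" if "m \<in> V" "\<And>j. m $ j \<le> x $ j" for m i
  proof -
    have "(\<Sum>i\<in>UNIV. x $ i - m $ i) = 0"
      using min[OF that(1)] sum_mono[of UNIV "\<lambda>i. m $ i" "\<lambda>i. x $ i"] that(2)
      by (simp add: sum_subtractf s_def)
    then show ?thesis using that(2) by (subst (asm) sum_nonneg_eq_0_iff) auto
  qed
  have "x $ i * (M *v x + q) $ i = 0" for i
  proof (rule ccontr)
    let ?w = "(M *v x + q) $ i"
    assume "x $ i * ?w \<noteq> 0"
    then have pos: "0 < x $ i" "0 < ?w" using x0[of i] by (auto simp: order.order_iff_strict)
    \<comment> \<open>The first term keeps the coordinate nonnegative, the second keeps row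
      \<open>i\<close> feasible; \<open>1 + |M_ii|\<close> avoids a zero or negative
      denominator.\<close>
    define t where "t = min (x $ i) (?w / (1 + \<bar>M $ i $ i\<bar>))"
    have t0: "0 < t" using pos by (auto simp: t_def intro!: divide_pos_pos)
    define y where "y = x - t *\<^sub>R axis i 1"
    have yi: "y $ j = (if j = i then x $ i - t else x $ j)" for j by (simp add: y_def axis_def)
    have "y \<in> V"
      unfolding V_def mem_Collect_eq
    proof (intro allI conjI)
      fix j
      show "0 \<le> y $ j" using x0(1)[of j] by (auto simp: yi t_def)
      show "0 \<le> (M *v y + q) $ j"
      proof (cases "j = i")
        case False
        then have "(M *v x) $ j \<le> (M *v y) $ j"
          using t0 by (intro Z_matrix_antimono_row[OF Z]) (auto simp: yi)
        then show ?thesis using x0(2)[of j] by simp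
      next
        case True
        have "t * M $ i $ i \<le> t * (1 + \<bar>M $ i $ i\<bar>)" using t0 by (intro mult_left_mono) auto
        also have "\<dots> \<le> ?w" unfolding t_def
          by (metis abs_ge_zero add_pos_nonneg min.cobounded2 pos_le_divide_eq zero_less_one)
        finally have "t * M $ i $ i \<le> ?w" .
        moreover have "(M *v y) $ i = (M *v x) $ i - t * M $ i $ i"
          by (simp add: y_def matrix_vector_mult_diff_distrib matrix_vector_mult_scaleR
              matrix_vector_mult_basis column_def)
        ultimately show ?thesis using True by simp
      qed
    qed
    moreover have "y $ j \<le> x $ j" for j using t0 by (simp add: yi)
    ultimately have "y $ i = x $ i" by (rule cut)
    then show False using t0 by (simp add: yi)
  qed
  then have sol: "lcp_solution M q x" using x0 by (simp add: lcp_solution_def)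
  have half: "w $ i \<le> 0"
    if w: "\<And>i. x $ i = 0 \<Longrightarrow> w $ i = 0" "\<And>i. x $ i \<noteq> 0 \<Longrightarrow> (M *v w) $ i = 0" for w i
  proof -
    \<comment> \<open>Makes \<open>t\<close> so small that \<open>x - t w\<close> stays nonnegative.
      Where \<open>x\<close> vanishes so does \<open>w\<close>, and division by zero contributes 0
      to the sum.\<close>
    define r where "r = (\<Sum>i\<in>UNIV. \<bar>w $ i\<bar> / x $ i)"
    define t where "t = 1 / (1 + r)"
    have r0: "0 \<le> r" unfolding r_def using x0 by (intro sum_nonneg) auto
    then have t0: "0 < t" by (simp add: t_def)
    have tw: "t * w $ i \<le> x $ i" for i
    proof (cases "x $ i = 0")
      case False
      then have xi: "0 < x $ i" using x0(1)[of i] by simp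
      have "\<bar>w $ i\<bar> / x $ i \<le> r" unfolding r_def using x0 by (intro member_le_sum) auto
      then have "w $ i \<le> (1 + r) * x $ i" using xi by (simp add: pos_divide_le_eq distrib_right)
      then show ?thesis using r0 by (simp add: t_def pos_divide_le_eq mult.commute)
    qed (simp add: w(1))
    \<comment> \<open>The meet of \<open>x\<close> and \<open>x - t w\<close>. In each row one of
      the two points coincides with \<open>m\<close> in the diagonal coordinate, and the other
      coordinates only go down, so the row value does not decrease.\<close>
    define m where "m = (\<chi> i. min (x $ i) (x $ i - t * w $ i))"
    have "m \<in> V"
      unfolding V_def mem_Collect_eq
    proof (intro allI conjI)
      fix i
      show "0 \<le> m $ i" using x0(1)[of i] tw[of i] by (simp add: m_def)
      have "(M *v x) $ i \<le> (M *v m) $ i"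
      proof (cases "m $ i = x $ i")
        case True
        then show ?thesis by (intro Z_matrix_antimono_row[OF Z]) (auto simp: m_def)
      next
        case False
        then have xi: "x $ i \<noteq> 0" and mi: "m $ i = (x - t *\<^sub>R w) $ i"
          using w(1)[of i] by (auto simp: m_def min_def)
        have "(M *v (x - t *\<^sub>R w)) $ i \<le> (M *v m) $ i"
          by (rule Z_matrix_antimono_row[OF Z _ mi]) (simp add: m_def)
        then show ?thesis
          by (simp add: matrix_vector_mult_diff_distrib matrix_vector_mult_scaleR w(2)[OF xi])
      qed
      then show "0 \<le> (M *v m + q) $ i" using x0(2)[of i] by simp
    qed
    moreover have "m $ j \<le> x $ j" for j by (simp add: m_def)
    ultimately have "m $ i = x $ i" by (rule cut)
    then have "t * w $ i \<le> 0" by (simp add: m_def min_def split: if_splits)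
    then show ?thesis using t0 by (simp add: mult_le_0_iff)
  qed
  have "nondegenerate_support M x"
    unfolding nondegenerate_support_def
  proof (intro allI impI)
    fix w assume w: "\<forall>i. x $ i = 0 \<longrightarrow> w $ i = 0" "\<forall>i. x $ i \<noteq> 0 \<longrightarrow> (M *v w) $ i = 0"
    have "w $ i \<le> 0" "(- w) $ i \<le> 0" for i
      using half[of w i] half[of "- w" i] w
      by (auto simp: matrix_vector_mult_diff_distrib[of M 0 w, simplified])
    then show "w = 0" by (simp add: vec_eq_iff antisym)
  qed
  with sol that show ?thesis by blast
qed

section \<open>The norm bound through inverses of principal submatrices\<close>

text \<open>Pad the principal submatrix with an identity block to a full square matrix. It has
  trivial kernel, and the J block of its inverse inverts the J block of \<open>M\<close>.\<close>

lemma principal_inverse_exists: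
  fixes M :: "real^'n^'n"
  assumes inj: "\<And>w. (\<And>i. i \<notin> J \<Longrightarrow> w $ i = 0) \<Longrightarrow> (\<And>i. i \<in> J \<Longrightarrow> (M *v w) $ i = 0) \<Longrightarrow> w = 0"
  shows "\<exists>R. principal_inverse M J R"
proof -
  define M' :: "real^'n^'n" where
    "M' = (\<chi> i j. if i \<in> J \<and> j \<in> J then M $ i $ j else if i = j then 1 else 0)"
  have row_out: "(M' *v w) $ i = w $ i" if "i \<notin> J" for w i
    using that by (simp add: M'_def matrix_vector_mult_def if_distrib[of "\<lambda>x. x * _"] cong: if_cong)
  have row_in: "(M' *v w) $ i = (M *v w) $ i" if "i \<in> J" "\<And>i. i \<notin> J \<Longrightarrow> w $ i = 0" for w i
    using that by (auto simp: M'_def matrix_vector_mult_def intro!: sum.cong)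
  have "w = 0" if w: "M' *v w = 0" for w
  proof -
    have "w $ i = 0" if "i \<notin> J" for i using row_out[OF that, of w] w by simp
    with row_in[of _ w] w show "w = 0" by (intro inj) auto
  qed
  then obtain R where R: "R ** M' = mat 1" using matrix_left_invertible_ker by blast
  then have R': "M' ** R = mat 1" by (simp add: matrix_left_right_inverse)
  have "(\<Sum>k\<in>J. M $ i $ k * R $ k $ j) = (if i = j then 1 else 0) \<and>
        (\<Sum>k\<in>J. R $ i $ k * M $ k $ j) = (if i = j then 1 else 0)" if ij: "i \<in> J" "j \<in> J" for i j
  proof
    have "(if i = j then 1 else 0) = (\<Sum>k\<in>UNIV. M' $ i $ k * R $ k $ j)"
      using R' by (simp add: vec_eq_iff matrix_matrix_mult_def mat_def)
    also have "\<dots> = (\<Sum>k\<in>J. M $ i $ k * R $ k $ j)"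
      using ij by (intro sum.mono_neutral_cong_right) (auto simp: M'_def)
    finally show "(\<Sum>k\<in>J. M $ i $ k * R $ k $ j) = (if i = j then 1 else 0)" by simp
    have "(if i = j then 1 else 0) = (\<Sum>k\<in>UNIV. R $ i $ k * M' $ k $ j)"
      using R by (simp add: vec_eq_iff matrix_matrix_mult_def mat_def)
    also have "\<dots> = (\<Sum>k\<in>J. R $ i $ k * M $ k $ j)"
      using ij by (intro sum.mono_neutral_cong_right) (auto simp: M'_def)
    finally show "(\<Sum>k\<in>J. R $ i $ k * M $ k $ j) = (if i = j then 1 else 0)" by simp
  qed
  then show ?thesis unfolding principal_inverse_def by (intro exI[of _ "\<lambda>i j. R $ i $ j"]) blast
qed

lemma norm_le_norm1: "norm (z :: real^'n) \<le> norm1 z"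
  unfolding norm1_def by (rule norm_le_l1_cart)

text \<open>On the support J complementarity reads \<open>M_JJ z_J = - q_J\<close>, hence
  \<open>z_J\<close> is minus the inverse applied to \<open>q_J\<close>; estimate in the 1-norm. The
  inverse is the one selected by \<open>SOME\<close> in \<open>lcp_beta\<close>, so its norm is
  among those maximized there. For empty support \<open>z = 0\<close>, and nonnegativity of \<beta>
  suffices.\<close>

lemma nondegenerate_lcp_solution_bound:
  fixes M :: "real^'n^'n"
  assumes z: "lcp_solution M q z" and nd: "nondegenerate_support M z"
  shows "norm z \<le> lcp_beta M * norm1 q"
proof -
  define J where "J = {i. z $ i \<noteq> 0}"
  define N where "N J = principal_norm1 J (SOME R. principal_inverse M J R)" for J
  have N0: "0 \<le> N I" if "I \<noteq> {}" for I
  proof -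
    obtain j where "j \<in> I" using \<open>I \<noteq> {}\<close> by blast
    then show ?thesis unfolding N_def principal_norm1_def
      by (subst Max_ge_iff) (auto intro!: sum_nonneg bexI[of _ j])
  qed
  have beta: "lcp_beta M = (if nonsingular_index_sets M = {} then 1 else Max (N ` nonsingular_index_sets M))"
    unfolding lcp_beta_def N_def by simp
  have fin: "finite (nonsingular_index_sets M)" by simp
  have b0: "0 \<le> lcp_beta M"
  proof (cases "nonsingular_index_sets M = {}")
    case False
    then obtain I where I: "I \<in> nonsingular_index_sets M" by blast
    then have "0 \<le> N I" by (intro N0) (auto simp: nonsingular_index_sets_def)
    also have "N I \<le> Max (N ` nonsingular_index_sets M)" using I by (intro Max_ge) auto
    finally show ?thesis using False by (simp add: beta)
  qed (simp add: beta)
  have q0: "0 \<le> norm1 q" by (simp add: norm1_def sum_nonneg)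
  show ?thesis
  proof (cases "J = {}")
    case True
    then have "z = 0" by (simp add: J_def vec_eq_iff)
    then show ?thesis using b0 q0 by simp
  next
    case False
    define R where "R = (SOME R. principal_inverse M J R)"
    have ex: "\<exists>R. principal_inverse M J R"
      by (rule principal_inverse_exists) (use nd in \<open>auto simp: nondegenerate_support_def J_def\<close>)
    then have R: "principal_inverse M J R" unfolding R_def by (rule someI_ex)
    have Mz: "(\<Sum>k\<in>J. M $ i $ k * z $ k) = - q $ i" if "i \<in> J" for i
    proof -
      have "(\<Sum>k\<in>J. M $ i $ k * z $ k) = (M *v z) $ i"
        unfolding matrix_vector_mult_def vec_lambda_beta by (intro sum.mono_neutral_left) (auto simp: J_def)
      moreover have "(M *v z + q) $ i = 0"
        using z that by (auto simp: lcp_solution_def J_def)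
      ultimately show ?thesis by simp
    qed
    have zi: "z $ i = - (\<Sum>k\<in>J. R i k * q $ k)" if i: "i \<in> J" for i
    proof -
      have "(\<Sum>k\<in>J. R i k * q $ k) = - (\<Sum>k\<in>J. R i k * (\<Sum>j\<in>J. M $ k $ j * z $ j))"
        using Mz by (simp add: sum_negf[symmetric])
      also have "(\<Sum>k\<in>J. R i k * (\<Sum>j\<in>J. M $ k $ j * z $ j)) = (\<Sum>j\<in>J. (\<Sum>k\<in>J. R i k * M $ k $ j) * z $ j)"
        unfolding sum_distrib_left sum_distrib_right by (subst sum.swap) (simp add: mult.assoc)
      also have "\<dots> = (\<Sum>j\<in>J. (if i = j then 1 else 0) * z $ j)"
        using R i unfolding principal_inverse_def by (intro sum.cong) auto
      also have "\<dots> = z $ i" using i by (simp add: if_distrib[of "\<lambda>x. x * _"] cong: if_cong)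
      finally show ?thesis by simp
    qed
    have "norm z \<le> norm1 z" by (rule norm_le_norm1)
    also have "\<dots> = (\<Sum>i\<in>J. \<bar>z $ i\<bar>)"
      unfolding norm1_def by (intro sum.mono_neutral_right) (auto simp: J_def)
    also have "\<dots> \<le> (\<Sum>i\<in>J. \<Sum>k\<in>J. \<bar>R i k\<bar> * \<bar>q $ k\<bar>)"
      by (intro sum_mono) (simp add: zi sum_abs[THEN order_trans] flip: abs_mult)
    also have "\<dots> = (\<Sum>k\<in>J. (\<Sum>i\<in>J. \<bar>R i k\<bar>) * \<bar>q $ k\<bar>)"
      unfolding sum_distrib_right by (rule sum.swap)
    also have "\<dots> \<le> (\<Sum>k\<in>J. N J * \<bar>q $ k\<bar>)"
      unfolding N_def principal_norm1_def R_def[symmetric] by (intro sum_mono mult_right_mono Max_ge) auto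
    also have "\<dots> = N J * (\<Sum>k\<in>J. \<bar>q $ k\<bar>)" by (simp add: sum_distrib_left)
    also have "\<dots> \<le> N J * norm1 q"
      unfolding norm1_def using N0[OF False] by (intro mult_left_mono sum_mono2) auto
    also have "\<dots> \<le> lcp_beta M * norm1 q"
    proof (intro mult_right_mono q0)
      have J: "J \<in> nonsingular_index_sets M" using False ex by (simp add: nonsingular_index_sets_def)
      then show "N J \<le> lcp_beta M" unfolding beta by (auto intro!: Max_ge)
    qed
    finally show ?thesis .
  qed
qed

lemma lcp_bounded_solution:
  fixes M :: "real^'n^'n"
  assumes "adequate M \<or> Z_matrix M" "\<And>i. 0 \<le> v $ i" "\<And>i. 0 \<le> (M *v v + q) $ i"
  obtains z where "lcp_solution M q z" "norm z \<le> lcp_beta M * norm1 q"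
  using assms adequate_lcp_nondegenerate_solution[of M v q] Z_matrix_lcp_nondegenerate_solution[of M v q]
    nondegenerate_lcp_solution_bound[of M q] by metis

section \<open>Laws of large numbers\<close>

lemma cesaro_mean_tendsto:
  fixes a :: "nat \<Rightarrow> real"
  assumes "a \<longlonglongrightarrow> l"
  shows "(\<lambda>n. (\<Sum>i<n. a i) / real n) \<longlonglongrightarrow> l"
proof (rule LIMSEQ_I)
  fix e :: real assume e: "0 < e"
  obtain N where N: "\<And>i. i \<ge> N \<Longrightarrow> \<bar>a i - l\<bar> < e / 2"
    using LIMSEQ_D[OF assms, of "e/2"] e by (auto simp: real_norm_def)
  define c where "c = (\<Sum>i<N. \<bar>a i - l\<bar>)"
  have c0: "0 \<le> c" by (simp add: c_def sum_nonneg)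
  obtain n0 :: nat where n0: "2 * c / e < real n0" using reals_Archimedean2 by blast
  show "\<exists>no. \<forall>n\<ge>no. norm ((\<Sum>i<n. a i) / real n - l) < e"
  proof (intro exI[of _ "max (Suc N) n0"] allI impI)
    fix n assume n: "max (Suc N) n0 \<le> n"
    then have npos: "0 < real n" by simp
    have "\<bar>(\<Sum>i<n. a i) - real n * l\<bar> = \<bar>\<Sum>i<n. a i - l\<bar>" by (simp add: sum_subtractf)
    also have "\<dots> \<le> (\<Sum>i<n. \<bar>a i - l\<bar>)" by (rule sum_abs)
    also have "\<dots> = c + (\<Sum>i\<in>{N..<n}. \<bar>a i - l\<bar>)"
      unfolding c_def using n by (subst sum.union_disjoint[symmetric]) (auto intro!: sum.cong)
    also have "(\<Sum>i\<in>{N..<n}. \<bar>a i - l\<bar>) \<le> (\<Sum>i\<in>{N..<n}. e / 2)"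
      using N by (intro sum_mono) (auto intro: less_imp_le)
    also have "\<dots> \<le> real n * (e / 2)" using e by (simp add: mult_right_mono)
    also have "c < real n * (e / 2)"
    proof -
      have "2 * c / e < real n" using n0 n by linarith
      then show ?thesis using e by (simp add: field_simps)
    qed
    finally have "\<bar>(\<Sum>i<n. a i) - real n * l\<bar> < e * real n" by (simp add: mult.commute)
    moreover have "(\<Sum>i<n. a i) / real n - l = ((\<Sum>i<n. a i) - real n * l) / real n"
      using npos by (simp add: field_simps)
    ultimately show "norm ((\<Sum>i<n. a i) / real n - l) < e"
      using npos by (simp add: pos_divide_less_eq)
  qed
qed

text \<open>The pointwise form of the estimate of the truncated second moments, weighted by inverse
  squares, by twice the mean: summands vanish below the level \<open>x\<close>, and the tail of the
  inverse squares is of order \<open>1 / x\<close>.\<close>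

lemma sum_truncated_squares_le:
  fixes x :: real
  assumes x: "0 \<le> x"
  shows "(\<Sum>i<n. (if x \<le> real (Suc i) then x\<^sup>2 else 0) / (real (Suc i))\<^sup>2) \<le> 2 * x"
proof -
  \<comment> \<open>Strengthened for the induction by the remaining tail:
    \<open>1 / m^2 \<le> 2 / m - 2 / (m + 1)\<close> telescopes from the first level above
    \<open>x\<close> on.\<close>
  have "(\<Sum>i<n. (if x \<le> real (Suc i) then x\<^sup>2 else 0) / (real (Suc i))\<^sup>2)
      \<le> (if x \<le> real n then 2 * x - 2 * x\<^sup>2 / (real n + 1) else 0)"
  proof (induction n)
    case 0
    then show ?case using x by simp
  next
    case (Suc n)
    define m where "m = real n + 1"
    have m: "1 \<le> m" by (simp add: m_def)
    show ?case
    proof (cases "x \<le> real n")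
      case True
      have "m * (m + 1) \<le> 2 * m\<^sup>2" using m by (simp add: power2_eq_square algebra_simps)
      then have "2 / (2 * m\<^sup>2) \<le> 2 / (m * (m + 1))" using m by (intro divide_left_mono) auto
      also have "2 / (m * (m + 1)) = 2 / m - 2 / (m + 1)" using m by (simp add: field_simps)
      finally have "1 / m\<^sup>2 \<le> 2 / m - 2 / (m + 1)" by simp
      then have "x\<^sup>2 * (1 / m\<^sup>2) \<le> x\<^sup>2 * (2 / m - 2 / (m + 1))" by (intro mult_left_mono) auto
      then have "x\<^sup>2 / m\<^sup>2 \<le> 2 * x\<^sup>2 / m - 2 * x\<^sup>2 / (m + 1)"
        by (simp add: right_diff_distrib mult.commute)
      then show ?thesis using Suc True by (simp add: m_def add.commute)
    next
      case False
      show ?thesis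
      proof (cases "x \<le> m")
        case True
        have "x / m\<^sup>2 + 2 * x / (m + 1) \<le> m / m\<^sup>2 + 2 * m / (m + 1)"
          using True m by (intro add_mono divide_right_mono) auto
        also have "\<dots> \<le> 2"
        proof -
          have "m / m\<^sup>2 = 2 / (2 * m)" using m by (simp add: power2_eq_square)
          also have "2 / (2 * m) \<le> 2 / (m + 1)" using m by (intro divide_left_mono) auto
          finally have "m / m\<^sup>2 + 2 * m / (m + 1) \<le> (2 + 2 * m) / (m + 1)" by (simp add: add_divide_distrib)
          also have "\<dots> = 2" using m by (simp add: nonzero_divide_eq_eq)
          finally show ?thesis .
        qed
        finally have "x * (x / m\<^sup>2 + 2 * x / (m + 1)) \<le> x * 2" using x by (intro mult_left_mono)
        then have "x\<^sup>2 / m\<^sup>2 \<le> 2 * x - 2 * x\<^sup>2 / (m + 1)"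
          by (simp add: distrib_left power2_eq_square mult.assoc mult.left_commute)
        then show ?thesis using Suc False True by (simp add: m_def add.commute)
      qed (use Suc False in \<open>simp add: m_def add.commute\<close>)
    qed
  qed
  also have "\<dots> \<le> 2 * x" using x by simp
  finally show ?thesis .
qed

text \<open>As \<open>k n\<close> is comparable with \<open>\<alpha> ^ n\<close>, the terms with
  \<open>i < k n\<close> are dominated by a geometric series. Its sum is a multiple of its first
  term, and that term is at most the inverse square of \<open>Suc i\<close>.\<close>

lemma sum_inverse_squares_geometric_le:
  fixes \<alpha> :: real
  assumes \<alpha>: "1 < \<alpha>" and k: "\<And>n. \<alpha> ^ n / 2 \<le> real (k n)" "\<And>n. real (k n) \<le> \<alpha> ^ n"
  shows "(\<Sum>n<L. if i < k n then 1 / (real (k n))\<^sup>2 else 0) \<le> 4 / (1 - 1 / \<alpha>\<^sup>2) * (1 / (real (Suc i))\<^sup>2)"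
proof -
  define b where "b = 1 / \<alpha>\<^sup>2"
  have b: "0 < b" "b < 1" using \<alpha> by (auto simp: b_def one_less_power)
  have bn: "b ^ n = 1 / (\<alpha> ^ n)\<^sup>2" for n
    by (simp add: b_def power_one_over power_mult[symmetric] mult.commute)
  have kb: "1 / (real (k n))\<^sup>2 \<le> 4 * b ^ n" for n
  proof -
    have "(\<alpha> ^ n / 2)\<^sup>2 \<le> (real (k n))\<^sup>2" using k(1)[of n] \<alpha> by (intro power_mono) auto
    moreover have pos: "0 < (\<alpha> ^ n / 2)\<^sup>2" using \<alpha> by simp
    ultimately have "1 / (real (k n))\<^sup>2 \<le> 1 / (\<alpha> ^ n / 2)\<^sup>2"
      by (intro divide_left_mono mult_pos_pos less_le_trans[OF pos]) auto
    then show ?thesis by (simp add: bn power_divide)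
  qed
  let ?I = "{n\<in>{..<L}. i < k n}"
  have "(\<Sum>n<L. if i < k n then 1 / (real (k n))\<^sup>2 else 0) = (\<Sum>n\<in>?I. 1 / (real (k n))\<^sup>2)"
    by (rule sum.inter_filter[symmetric]) simp
  also have "\<dots> \<le> (\<Sum>n\<in>?I. 4 * b ^ n)" by (intro sum_mono kb)
  also have "\<dots> \<le> 4 / (1 - b) * (1 / (real (Suc i))\<^sup>2)"
  proof (cases "?I = {}")
    case False
    define n0 where "n0 = Min ?I"
    have n0: "n0 \<in> ?I" unfolding n0_def using False by (intro Min_in) auto
    have "(\<Sum>n\<in>?I. 4 * b ^ n) \<le> (\<Sum>n\<in>{n0..<L}. 4 * b ^ n)"
      using b by (intro sum_mono2) (auto simp: n0_def)
    also have "\<dots> = 4 * b ^ n0 * (\<Sum>j<L - n0. b ^ j)"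
      using n0 sum.shift_bounds_nat_ivl[of "\<lambda>n. 4 * b ^ n" 0 n0 "L - n0"]
      by (simp add: sum_distrib_left power_add atLeast0LessThan mult_ac)
    also have "\<dots> \<le> 4 * b ^ n0 * (1 / (1 - b))"
    proof (intro mult_left_mono)
      have "(1 - b) * (\<Sum>j<L - n0. b ^ j) = 1 - b ^ (L - n0)" by (rule one_diff_power_eq[symmetric])
      also have "\<dots> \<le> 1" using b by simp
      finally show "(\<Sum>j<L - n0. b ^ j) \<le> 1 / (1 - b)" using b by (simp add: pos_le_divide_eq mult.commute)
    qed (use b in auto)
    also have "b ^ n0 \<le> 1 / (real (Suc i))\<^sup>2"
    proof -
      have "real (Suc i) \<le> real (k n0)" using n0 by simp
      also have "\<dots> \<le> \<alpha> ^ n0" by (rule k(2))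
      finally have "(real (Suc i))\<^sup>2 \<le> (\<alpha> ^ n0)\<^sup>2" by (intro power_mono) auto
      then show ?thesis unfolding bn using \<alpha> by (intro divide_left_mono) auto
    qed
    finally show ?thesis using b by (simp add: mult_right_mono divide_right_mono mult.commute)
  next
    case True
    show ?thesis unfolding True using b by simp
  qed
  finally show ?thesis by (simp add: b_def)
qed

text \<open>A monotone sequence is controlled between consecutive members of a geometric subsequence.\<close>

lemma mono_mean_geometric_subsequence:
  fixes T :: "nat \<Rightarrow> real" and \<alpha> \<mu> e :: real
  assumes T: "mono T" "\<And>n. 0 \<le> T n"
    and k: "k 0 = 1" "\<And>n. 1 \<le> k n" "filterlim k at_top sequentially"
    and ratio: "(\<lambda>n. real (k (Suc n)) / real (k n)) \<longlonglongrightarrow> \<alpha>" and \<alpha>: "0 < \<alpha>"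
    and lim: "(\<lambda>n. T (k n) / real (k n)) \<longlonglongrightarrow> \<mu>" and e: "0 < e"
  shows "\<forall>\<^sub>F m in sequentially. \<mu> / \<alpha> - e < T m / real m \<and> T m / real m < \<mu> * \<alpha> + e"
proof -
  have kpos: "0 < real (k n)" for n using k(2)[of n] by simp
  have "(\<lambda>n. T (k (Suc n)) / real (k (Suc n)) * (real (k (Suc n)) / real (k n))) \<longlonglongrightarrow> \<mu> * \<alpha>"
    by (intro tendsto_mult ratio LIMSEQ_Suc[OF lim])
  then have up: "(\<lambda>n. T (k (Suc n)) / real (k n)) \<longlonglongrightarrow> \<mu> * \<alpha>"
    using kpos by (simp add: less_imp_neq[THEN not_sym])
  have "(\<lambda>n. T (k n) / real (k n) / (real (k (Suc n)) / real (k n))) \<longlonglongrightarrow> \<mu> / \<alpha>"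
    using \<alpha> by (intro tendsto_divide ratio lim) auto
  then have lo: "(\<lambda>n. T (k n) / real (k (Suc n))) \<longlonglongrightarrow> \<mu> / \<alpha>"
    using kpos by (simp add: less_imp_neq[THEN not_sym])
  have "\<forall>\<^sub>F n in sequentially. T (k (Suc n)) / real (k n) < \<mu> * \<alpha> + e \<and> \<mu> / \<alpha> - e < T (k n) / real (k (Suc n))"
    by (intro eventually_conj order_tendstoD[OF up] order_tendstoD[OF lo]) (use e in auto)
  then obtain n0 where n0: "\<And>n. n \<ge> n0 \<Longrightarrow> T (k (Suc n)) / real (k n) < \<mu> * \<alpha> + e"
      "\<And>n. n \<ge> n0 \<Longrightarrow> \<mu> / \<alpha> - e < T (k n) / real (k (Suc n))"
    unfolding eventually_sequentially by blast
  show ?thesis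
    unfolding eventually_sequentially
  proof (intro exI[of _ "Max (k ` {..n0})"] allI impI)
    fix m assume m: "Max (k ` {..n0}) \<le> m"
    then have km: "k n \<le> m" if "n \<le> n0" for n using that by auto
    have m1: "1 \<le> m" using km[of 0] k(1) by simp
    have "\<exists>n. m < k (Suc n)"
    proof -
      have "\<forall>\<^sub>F n in sequentially. m < k n"
        by (rule eventually_compose_filterlim[OF eventually_gt_at_top k(3)])
      then have "\<forall>\<^sub>F n in sequentially. m < k (Suc n)"
        by (rule eventually_sequentially_Suc[THEN iffD2])
      then show ?thesis by (auto simp: eventually_sequentially)
    qed
    \<comment> \<open>The sequence \<open>k\<close> need not be monotone; the least such
      \<open>n\<close> still gives \<open>k n \<le> m < k (Suc n)\<close>.\<close>
    then obtain n where n: "m < k (Suc n)" and least: "\<And>j. j < n \<Longrightarrow> \<not> m < k (Suc j)"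
      using exists_least_iff[of "\<lambda>n. m < k (Suc n)"] by blast
    have nn: "n0 \<le> n" using km[of "Suc n"] n by (metis not_less not_less_eq_eq)
    have kn: "k n \<le> m"
    proof (cases n)
      case (Suc j)
      then show ?thesis using least[of j] by simp
    qed (use m1 k(1) in simp)
    have "T m / real m \<le> T (k (Suc n)) / real (k n)"
      using kn n T kpos[of n] by (intro frac_le) (auto intro: monoD[of T])
    moreover have "T (k n) / real (k (Suc n)) \<le> T m / real m"
      using kn n T m1 by (intro frac_le) (auto intro: monoD[of T])
    ultimately show "\<mu> / \<alpha> - e < T m / real m \<and> T m / real m < \<mu> * \<alpha> + e"
      using n0[OF nn] by linarith
  qed
qed


section \<open>The strong law for pairwise independent nonnegative variables\<close>

context prob_space
begin

text \<open>After centring, pairwise independence kills the cross terms; what is left are variances,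
  each at most the raw second moment. Boundedness supplies all integrability.\<close>

lemma pairwise_indep_sum_second_moment:
  fixes Y :: "nat \<Rightarrow> 'a \<Rightarrow> real"
  assumes indep: "\<And>i j. i \<noteq> j \<Longrightarrow> indep_var borel (Y i) borel (Y j)"
    and bnd: "\<And>i \<omega>. \<bar>Y i \<omega>\<bar> \<le> b i" and meas [measurable]: "\<And>i. Y i \<in> borel_measurable M"
  shows "integrable M (\<lambda>\<omega>. ((\<Sum>i<n. Y i \<omega>) - (\<Sum>i<n. expectation (Y i)))\<^sup>2)"
    and "expectation (\<lambda>\<omega>. ((\<Sum>i<n. Y i \<omega>) - (\<Sum>i<n. expectation (Y i)))\<^sup>2) \<le> (\<Sum>i<n. expectation (\<lambda>\<omega>. (Y i \<omega>)\<^sup>2))"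
proof -
  define Z where "Z i \<omega> = Y i \<omega> - expectation (Y i)" for i \<omega>
  have intY: "integrable M (Y i)" for i
    by (rule integrable_const_bound[where B="b i"]) (auto simp: bnd)
  have intY2: "integrable M (\<lambda>\<omega>. (Y i \<omega>)\<^sup>2)" for i
    by (rule integrable_const_bound[where B="(b i)\<^sup>2"])
      (auto intro!: AE_I2 abs_le_square_iff[THEN iffD1] order_trans[OF bnd])
  have measZ [measurable]: "Z i \<in> borel_measurable M" for i unfolding Z_def by measurable
  have intZ: "integrable M (Z i)" for i unfolding Z_def using intY by simp
  have EZ: "expectation (Z i) = 0" for i
    unfolding Z_def using intY by (simp add: prob_space)
  have Z2: "expectation (\<lambda>\<omega>. Z i \<omega> * Z i \<omega>) \<le> expectation (\<lambda>\<omega>. (Y i \<omega>)\<^sup>2)" for i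
    using variance_eq[OF intY intY2, of i] by (simp add: Z_def power2_eq_square[symmetric])
  have ind: "indep_var borel (Z i) borel (Z j)" if "i \<noteq> j" for i j
    using indep_var_compose[OF indep[OF that], of "\<lambda>x. x - expectation (Y i)" borel "\<lambda>x. x - expectation (Y j)" borel]
    by (simp add: Z_def[abs_def] comp_def)
  have intZZ: "integrable M (\<lambda>\<omega>. Z i \<omega> * Z j \<omega>)" for i j
  proof (cases "i = j")
    case True
    have "integrable M (\<lambda>\<omega>. (Y i \<omega>)\<^sup>2 - 2 * expectation (Y i) * Y i \<omega> + (expectation (Y i))\<^sup>2)"
      using intY intY2 by simp
    also have "(\<lambda>\<omega>. (Y i \<omega>)\<^sup>2 - 2 * expectation (Y i) * Y i \<omega> + (expectation (Y i))\<^sup>2) = (\<lambda>\<omega>. Z i \<omega> * Z j \<omega>)"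
      by (simp add: True Z_def fun_eq_iff power2_eq_square algebra_simps)
    finally show ?thesis .
  qed (rule indep_var_integrable[OF ind intZ intZ])
  have EZZ: "expectation (\<lambda>\<omega>. Z i \<omega> * Z j \<omega>) = 0" if "i \<noteq> j" for i j
    using indep_var_lebesgue_integral[OF ind[OF that] intZ intZ] EZ by simp
  have eq: "((\<Sum>i<n. Y i \<omega>) - (\<Sum>i<n. expectation (Y i)))\<^sup>2 = (\<Sum>i<n. \<Sum>j<n. Z i \<omega> * Z j \<omega>)" for \<omega>
    by (simp add: Z_def sum_subtractf[symmetric] power2_eq_square sum_product)
  show "integrable M (\<lambda>\<omega>. ((\<Sum>i<n. Y i \<omega>) - (\<Sum>i<n. expectation (Y i)))\<^sup>2)"
    unfolding eq by (intro Bochner_Integration.integrable_sum intZZ)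
  have "expectation (\<lambda>\<omega>. ((\<Sum>i<n. Y i \<omega>) - (\<Sum>i<n. expectation (Y i)))\<^sup>2)
      = (\<Sum>i<n. \<Sum>j<n. expectation (\<lambda>\<omega>. Z i \<omega> * Z j \<omega>))"
    unfolding eq
    by (simp add: Bochner_Integration.integral_sum Bochner_Integration.integrable_sum intZZ)
  also have "\<dots> = (\<Sum>i<n. expectation (\<lambda>\<omega>. Z i \<omega> * Z i \<omega>))"
  proof (intro sum.cong refl)
    fix i assume "i \<in> {..<n}"
    then have "(\<Sum>j<n. expectation (\<lambda>\<omega>. Z i \<omega> * Z j \<omega>)) = (\<Sum>j\<in>{i}. expectation (\<lambda>\<omega>. Z i \<omega> * Z j \<omega>))"
      using EZZ by (intro sum.mono_neutral_right) auto
    then show "(\<Sum>j<n. expectation (\<lambda>\<omega>. Z i \<omega> * Z j \<omega>)) = expectation (\<lambda>\<omega>. Z i \<omega> * Z i \<omega>)" by simp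
  qed
  also have "\<dots> \<le> (\<Sum>i<n. expectation (\<lambda>\<omega>. (Y i \<omega>)\<^sup>2))" by (intro sum_mono Z2)
  finally show "expectation (\<lambda>\<omega>. ((\<Sum>i<n. Y i \<omega>) - (\<Sum>i<n. expectation (Y i)))\<^sup>2) \<le> (\<Sum>i<n. expectation (\<lambda>\<omega>. (Y i \<omega>)\<^sup>2))" .
qed

text \<open>By monotone convergence the sum of the squares has finite mean, so it is finite almost
  everywhere and its terms tend to 0.\<close>

lemma AE_tendsto_0_of_summable_second_moments:
  fixes Z :: "nat \<Rightarrow> 'a \<Rightarrow> real"
  assumes int: "\<And>n. integrable M (\<lambda>\<omega>. (Z n \<omega>)\<^sup>2)" and meas [measurable]: "\<And>n. Z n \<in> borel_measurable M"
    and bnd: "\<And>L. (\<Sum>n<L. expectation (\<lambda>\<omega>. (Z n \<omega>)\<^sup>2)) \<le> c"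
  shows "AE \<omega> in M. (\<lambda>n. Z n \<omega>) \<longlonglongrightarrow> 0"
proof -
  have "summable (\<lambda>n. expectation (\<lambda>\<omega>. (Z n \<omega>)\<^sup>2))"
    by (rule bounded_imp_summable[where B=c]) (simp, simp only: lessThan_Suc_atMost[symmetric] bnd)
  then have "(\<Sum>n. ennreal (expectation (\<lambda>\<omega>. (Z n \<omega>)\<^sup>2))) \<noteq> top"
    by (intro ennreal_suminf_neq_top) auto
  also have "(\<Sum>n. ennreal (expectation (\<lambda>\<omega>. (Z n \<omega>)\<^sup>2))) = (\<Sum>n. \<integral>\<^sup>+\<omega>. ennreal ((Z n \<omega>)\<^sup>2) \<partial>M)"
    by (intro suminf_cong nn_integral_eq_integral[symmetric] int) auto
  also have "\<dots> = (\<integral>\<^sup>+\<omega>. (\<Sum>n. ennreal ((Z n \<omega>)\<^sup>2)) \<partial>M)"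
    by (rule nn_integral_suminf[symmetric]) simp
  finally have "AE \<omega> in M. (\<Sum>n. ennreal ((Z n \<omega>)\<^sup>2)) \<noteq> top"
    by (intro nn_integral_PInf_AE[unfolded infinity_ennreal_def]) auto
  then show ?thesis
  proof eventually_elim
    case (elim \<omega>)
    then have "summable (\<lambda>n. (Z n \<omega>)\<^sup>2)" by (intro summable_suminf_not_top) auto
    then have "(\<lambda>n. (Z n \<omega>)\<^sup>2) \<longlonglongrightarrow> 0" by (rule summable_LIMSEQ_zero)
    then have "(\<lambda>n. sqrt ((Z n \<omega>)\<^sup>2)) \<longlonglongrightarrow> sqrt 0" by (rule tendsto_real_sqrt)
    then show ?case by (simp add: tendsto_rabs_zero_iff)
  qed
qed

text \<open>Etemadi's proof: truncation, second moments along geometric subsequences, monotone interpolation.\<close>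

lemma strong_law_nonneg:
  fixes X :: "nat \<Rightarrow> 'a \<Rightarrow> real"
  assumes indep: "\<And>i j. i \<noteq> j \<Longrightarrow> indep_var borel (X i) borel (X j)"
    and meas [measurable]: "\<And>i. X i \<in> borel_measurable M"
    and distr: "\<And>i. distr M borel (X i) = distr M borel (X 0)"
    and int: "integrable M (X 0)" and nonneg: "\<And>i \<omega>. 0 \<le> X i \<omega>"
  shows "AE \<omega> in M. (\<lambda>n. (\<Sum>i<n. X i \<omega>) / real n) \<longlonglongrightarrow> expectation (X 0)"
proof -
  define \<mu> where "\<mu> = expectation (X 0)"
  \<comment> \<open>Indices start at 0, so the truncation level is \<open>i + 1\<close>.\<close>
  define tr where "tr i x = (if x \<le> real (Suc i) then x else 0)" for i and x :: real
  have tr_meas [measurable]: "tr i \<in> borel_measurable borel" for i unfolding tr_def by measurable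
  have tr_b: "0 \<le> tr i x \<and> tr i x \<le> real (Suc i) \<and> tr i x \<le> x" if "0 \<le> x" for i x
    using that by (auto simp: tr_def)
  define Y where "Y i \<omega> = tr i (X i \<omega>)" for i \<omega>
  have Y_meas [measurable]: "Y i \<in> borel_measurable M" for i unfolding Y_def by measurable
  have Yb: "0 \<le> Y i \<omega>" "\<bar>Y i \<omega>\<bar> \<le> real (Suc i)" for i \<omega>
    using tr_b[OF nonneg, of i i \<omega>] by (auto simp: Y_def)
  have indY: "indep_var borel (Y i) borel (Y j)" if "i \<noteq> j" for i j
    using indep_var_compose[OF indep[OF that] tr_meas tr_meas, of i j] by (simp add: Y_def[abs_def] comp_def)
  have law: "expectation (\<lambda>\<omega>. h (X i \<omega>)) = expectation (\<lambda>\<omega>. h (X 0 \<omega>))"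
    if [measurable]: "h \<in> borel_measurable borel" for h :: "real \<Rightarrow> real" and i
    using integral_distr[of "X i" M borel h] integral_distr[of "X 0" M borel h] distr[of i] by simp
  have lawp: "prob {\<omega>\<in>space M. c < X i \<omega>} = prob {\<omega>\<in>space M. c < X 0 \<omega>}" for c i
  proof -
    have "measure (distr M borel (X i)) {c<..} = measure (distr M borel (X 0)) {c<..}"
      using distr[of i] by simp
    then show ?thesis by (simp add: measure_distr vimage_def Int_def conj_commute)
  qed
  \<comment> \<open>Borel-Cantelli: the probabilities that \<open>X 0\<close> exceeds the levels 1,
    2, ... sum to at most its mean, so truncation changes only finitely many terms.\<close>
  have trunc: "AE \<omega> in M. \<forall>\<^sub>F i in sequentially. X i \<omega> = Y i \<omega>"
  proof -
    have "AE \<omega> in M. \<forall>\<^sub>F i in sequentially. \<omega> \<in> space M - {\<omega>\<in>space M. real (Suc i) < X i \<omega>}"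
    proof (rule borel_cantelli_AE1)
      show "summable (\<lambda>i. prob {\<omega>\<in>space M. real (Suc i) < X i \<omega>})"
      proof (rule bounded_imp_summable[where B=\<mu>])
        fix n
        have pt: "(\<Sum>i\<le>n. indicat_real {y. real (Suc i) < y} x) \<le> x" if "0 \<le> x" for x :: real
        proof -
          have "(\<Sum>i\<le>n. indicat_real {y. real (Suc i) < y} x) = real (card {i\<in>{..n}. real (Suc i) < x})"
            by (simp add: indicator_def sum.If_cases Int_def)
          also have "{i\<in>{..n}. real (Suc i) < x} \<subseteq> {..<nat \<lfloor>x\<rfloor>}"
            by (auto simp: less_floor_iff le_floor_iff zless_nat_eq_int_zless)
          then have "card {i\<in>{..n}. real (Suc i) < x} \<le> card {..<nat \<lfloor>x\<rfloor>}"
            by (intro card_mono) auto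
          then have "real (card {i\<in>{..n}. real (Suc i) < x}) \<le> x"
            using that by simp linarith
          finally show ?thesis .
        qed
        have "(\<Sum>i\<le>n. prob {\<omega>\<in>space M. real (Suc i) < X i \<omega>})
            = (\<Sum>i\<le>n. expectation (\<lambda>\<omega>. indicat_real {y. real (Suc i) < y} (X 0 \<omega>)))"
        proof (intro sum.cong refl)
          fix i
          have "expectation (\<lambda>\<omega>. indicat_real {y. real (Suc i) < y} (X 0 \<omega>)) = expectation (indicator {\<omega>\<in>space M. real (Suc i) < X 0 \<omega>})"
            by (intro Bochner_Integration.integral_cong) (auto simp: indicator_def)
          then show "prob {\<omega>\<in>space M. real (Suc i) < X i \<omega>} = expectation (\<lambda>\<omega>. indicat_real {y. real (Suc i) < y} (X 0 \<omega>))"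
            by (simp add: lawp[of _ i])
        qed
        also have "\<dots> = expectation (\<lambda>\<omega>. \<Sum>i\<le>n. indicat_real {y. real (Suc i) < y} (X 0 \<omega>))"
          by (rule Bochner_Integration.integral_sum[symmetric])
            (auto intro!: integrable_const_bound[where B=1] simp: indicator_def)
        also have "\<dots> \<le> \<mu>"
          unfolding \<mu>_def using int
          by (intro integral_mono' pt nonneg) (auto intro!: nonneg)
        finally show "(\<Sum>i\<le>n. prob {\<omega>\<in>space M. real (Suc i) < X i \<omega>}) \<le> \<mu>" .
      qed simp
    qed (auto simp: emeasure_eq_measure)
    then show ?thesis
    proof eventually_elim
      case (elim \<omega>)
      then show ?case by eventually_elim (auto simp: Y_def tr_def)
    qed
  qed
  have EY: "(\<lambda>i. expectation (Y i)) \<longlonglongrightarrow> \<mu>"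
  proof -
    have "(\<lambda>i. expectation (\<lambda>\<omega>. tr i (X 0 \<omega>))) \<longlonglongrightarrow> \<mu>"
      unfolding \<mu>_def
    proof (rule integral_dominated_convergence[where w="X 0"])
      show "AE \<omega> in M. (\<lambda>i. tr i (X 0 \<omega>)) \<longlonglongrightarrow> X 0 \<omega>"
      proof (rule AE_I2)
        fix \<omega>
        obtain n0 :: nat where "X 0 \<omega> < real n0" using reals_Archimedean2 by blast
        then have "\<forall>\<^sub>F i in sequentially. tr i (X 0 \<omega>) = X 0 \<omega>"
          by (intro eventually_sequentiallyI[of n0]) (auto simp: tr_def)
        then show "(\<lambda>i. tr i (X 0 \<omega>)) \<longlonglongrightarrow> X 0 \<omega>" by (rule tendsto_eventually)
      qed
      show "AE \<omega> in M. norm (tr i (X 0 \<omega>)) \<le> X 0 \<omega>" for i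
        using tr_b[OF nonneg] by auto
    qed (use int in auto)
    moreover have "expectation (Y i) = expectation (\<lambda>\<omega>. tr i (X 0 \<omega>))" for i
      unfolding Y_def by (rule law) simp
    ultimately show ?thesis by simp
  qed
  define a where "a i = expectation (\<lambda>\<omega>. (Y i \<omega>)\<^sup>2)" for i
  have a0: "0 \<le> a i" for i by (simp add: a_def)
  have a_sum: "(\<Sum>i<n. a i * (1 / (real (Suc i))\<^sup>2)) \<le> 2 * \<mu>" for n
  proof -
    have "a i = expectation (\<lambda>\<omega>. (tr i (X 0 \<omega>))\<^sup>2)" for i
      unfolding a_def Y_def by (rule law) simp
    then have "(\<Sum>i<n. a i * (1 / (real (Suc i))\<^sup>2)) = (\<Sum>i<n. expectation (\<lambda>\<omega>. (tr i (X 0 \<omega>))\<^sup>2 / (real (Suc i))\<^sup>2))"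
      by simp
    also have "\<dots> = expectation (\<lambda>\<omega>. \<Sum>i<n. (tr i (X 0 \<omega>))\<^sup>2 / (real (Suc i))\<^sup>2)"
    proof (rule Bochner_Integration.integral_sum[symmetric])
      fix i
      show "integrable M (\<lambda>\<omega>. (tr i (X 0 \<omega>))\<^sup>2 / (real (Suc i))\<^sup>2)"
        by (rule integrable_const_bound[where B="(real (Suc i))\<^sup>2 / (real (Suc i))\<^sup>2"])
          (use tr_b[OF nonneg, of i 0] in \<open>auto intro!: divide_right_mono power_mono\<close>)
    qed
    also have "\<dots> \<le> expectation (\<lambda>\<omega>. 2 * X 0 \<omega>)"
    proof (rule integral_mono')
      fix \<omega>
      have "(\<Sum>i<n. (tr i (X 0 \<omega>))\<^sup>2 / (real (Suc i))\<^sup>2) = (\<Sum>i<n. (if X 0 \<omega> \<le> real (Suc i) then (X 0 \<omega>)\<^sup>2 else 0) / (real (Suc i))\<^sup>2)"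
        by (intro sum.cong) (auto simp: tr_def)
      then show "(\<Sum>i<n. (tr i (X 0 \<omega>))\<^sup>2 / (real (Suc i))\<^sup>2) \<le> 2 * X 0 \<omega>"
        using sum_truncated_squares_le[OF nonneg[of 0 \<omega>], of n] by simp
    qed (use int nonneg in auto)
    finally show ?thesis by (simp add: \<mu>_def)
  qed
  define S where "S n \<omega> = (\<Sum>i<n. Y i \<omega>)" for n \<omega>
  define ES where "ES n = (\<Sum>i<n. expectation (Y i))" for n
  have ES: "(\<lambda>n. ES n / real n) \<longlonglongrightarrow> \<mu>" unfolding ES_def by (rule cesaro_mean_tendsto[OF EY])
  have S_meas [measurable]: "S n \<in> borel_measurable M" for n unfolding S_def by measurable
  have mom: "integrable M (\<lambda>\<omega>. (S n \<omega> - ES n)\<^sup>2)" "expectation (\<lambda>\<omega>. (S n \<omega> - ES n)\<^sup>2) \<le> (\<Sum>i<n. a i)" for n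
    unfolding S_def ES_def a_def
    by (rule pairwise_indep_sum_second_moment[where Y=Y and b="\<lambda>i. real (Suc i)"]; use indY Yb(2) Y_meas in blast)+
  define k where "k \<alpha> n = nat \<lfloor>\<alpha> ^ n\<rfloor>" for \<alpha> :: real and n
  have kb: "real (k \<alpha> n) \<le> \<alpha> ^ n" "\<alpha> ^ n / 2 \<le> real (k \<alpha> n)" "\<alpha> ^ n - 1 < real (k \<alpha> n)" "1 \<le> k \<alpha> n" if "1 < \<alpha>" for \<alpha> n
  proof -
    have 1: "1 \<le> \<alpha> ^ n" using that by (simp add: one_le_power)
    have k': "real (k \<alpha> n) = of_int \<lfloor>\<alpha> ^ n\<rfloor>" unfolding k_def using 1 by simp
    then show b: "real (k \<alpha> n) \<le> \<alpha> ^ n" "\<alpha> ^ n - 1 < real (k \<alpha> n)" by linarith+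
    have "1 \<le> real (k \<alpha> n)" unfolding k' using 1 by simp
    then show "1 \<le> k \<alpha> n" "\<alpha> ^ n / 2 \<le> real (k \<alpha> n)" using b by linarith+
  qed
  have sub: "AE \<omega> in M. (\<lambda>n. (S (k \<alpha> n) \<omega> - ES (k \<alpha> n)) / real (k \<alpha> n)) \<longlonglongrightarrow> 0" if \<alpha>: "1 < \<alpha>" for \<alpha>
  proof (rule AE_tendsto_0_of_summable_second_moments)
    let ?C = "4 / (1 - 1 / \<alpha>\<^sup>2)"
    have C: "0 \<le> ?C" using \<alpha> by (simp add: one_le_power)
    show "integrable M (\<lambda>\<omega>. ((S (k \<alpha> n) \<omega> - ES (k \<alpha> n)) / real (k \<alpha> n))\<^sup>2)" for n
      using mom(1) by (simp add: power_divide)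
    show "(\<Sum>n<L. expectation (\<lambda>\<omega>. ((S (k \<alpha> n) \<omega> - ES (k \<alpha> n)) / real (k \<alpha> n))\<^sup>2)) \<le> ?C * (2 * \<mu>)" for L
    proof -
      \<comment> \<open>A common range for the inner sums, so that the order of summation can be
        exchanged; inserting 0 covers \<open>L = 0\<close>.\<close>
      define m where "m = Max (insert 0 (k \<alpha> ` {..<L}))"
      have km: "k \<alpha> n \<le> m" if "n < L" for n unfolding m_def using that by (intro Max_ge) auto
      have "(\<Sum>n<L. expectation (\<lambda>\<omega>. ((S (k \<alpha> n) \<omega> - ES (k \<alpha> n)) / real (k \<alpha> n))\<^sup>2))
          \<le> (\<Sum>n<L. (\<Sum>i<k \<alpha> n. a i) / (real (k \<alpha> n))\<^sup>2)"
        using mom by (intro sum_mono) (simp add: power_divide divide_right_mono)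
      also have "\<dots> = (\<Sum>n<L. \<Sum>i<m. a i * (if i < k \<alpha> n then 1 / (real (k \<alpha> n))\<^sup>2 else 0))"
      proof (intro sum.cong refl)
        fix n assume "n \<in> {..<L}"
        then have "{i \<in> {..<m}. i < k \<alpha> n} = {..<k \<alpha> n}" using km[of n] by auto
        then have "(\<Sum>i<k \<alpha> n. a i / (real (k \<alpha> n))\<^sup>2) = (\<Sum>i<m. if i < k \<alpha> n then a i / (real (k \<alpha> n))\<^sup>2 else 0)"
          by (metis finite_lessThan sum.inter_filter)
        then show "(\<Sum>i<k \<alpha> n. a i) / (real (k \<alpha> n))\<^sup>2 = (\<Sum>i<m. a i * (if i < k \<alpha> n then 1 / (real (k \<alpha> n))\<^sup>2 else 0))"
          by (simp add: sum_divide_distrib if_distrib cong: if_cong)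
      qed
      also have "\<dots> = (\<Sum>i<m. a i * (\<Sum>n<L. if i < k \<alpha> n then 1 / (real (k \<alpha> n))\<^sup>2 else 0))"
        unfolding sum_distrib_left by (rule sum.swap)
      also have "\<dots> \<le> (\<Sum>i<m. a i * (?C * (1 / (real (Suc i))\<^sup>2)))"
        by (intro sum_mono mult_left_mono a0 sum_inverse_squares_geometric_le \<alpha> kb)
      also have "\<dots> = ?C * (\<Sum>i<m. a i * (1 / (real (Suc i))\<^sup>2))"
        unfolding sum_distrib_left by (intro sum.cong) (auto simp: mult_ac)
      also have "\<dots> \<le> ?C * (2 * \<mu>)" by (intro mult_left_mono a_sum C)
      finally show ?thesis .
    qed
  qed simp
  \<comment> \<open>Countably many ratios decreasing to 1: one null set serves them all, and the
    factors \<open>\<mu> * \<alpha> j\<close> and \<open>\<mu> / \<alpha> j\<close> close in on the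
    mean.\<close>
  define \<alpha> where "\<alpha> j = 1 + 1 / real (Suc j)" for j
  have \<alpha>1: "1 < \<alpha> j" for j by (simp add: \<alpha>_def)
  have kinf: "filterlim (k (\<alpha> j)) at_top sequentially" for j
  proof -
    have "filterlim (\<lambda>n. real (k (\<alpha> j) n)) at_top sequentially"
    proof (rule filterlim_at_top_mono)
      have "filterlim (\<lambda>n. \<alpha> j ^ n) at_top sequentially"
        using \<alpha>1[of j] by (intro filterlim_at_infinity_imp_filterlim_at_top filterlim_realpow_sequentially_gt1) auto
      from filterlim_tendsto_pos_mult_at_top[OF tendsto_const[of "1/2"] _ this]
      show "filterlim (\<lambda>n. \<alpha> j ^ n / 2) at_top sequentially" by simp
    qed (use kb(2)[OF \<alpha>1] in auto)
    then show ?thesis using filterlim_sequentially_iff_filterlim_real by blast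
  qed
  have kratio: "(\<lambda>n. real (k (\<alpha> j) (Suc n)) / real (k (\<alpha> j) n)) \<longlonglongrightarrow> \<alpha> j" for j
  proof -
    have p0: "0 < \<alpha> j ^ n" for n using \<alpha>1[of j] by simp
    have inv: "(\<lambda>n. 1 - (1 / \<alpha> j) ^ n) \<longlonglongrightarrow> 1 - 0"
      using \<alpha>1[of j] by (intro tendsto_diff tendsto_const LIMSEQ_realpow_zero) auto
    have c: "(\<lambda>n. real (k (\<alpha> j) n) / \<alpha> j ^ n) \<longlonglongrightarrow> 1"
    proof (rule tendsto_sandwich[OF _ _ inv[simplified] tendsto_const])
      have "1 - (1 / \<alpha> j) ^ n \<le> real (k (\<alpha> j) n) / \<alpha> j ^ n" for n
      proof -
        have "(1 - (1 / \<alpha> j) ^ n) * \<alpha> j ^ n = \<alpha> j ^ n - 1"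
          using \<alpha>1[of j] by (simp add: left_diff_distrib power_mult_distrib[symmetric])
        then show ?thesis using kb(3)[OF \<alpha>1, of j n] p0[of n] by (simp add: pos_le_divide_eq)
      qed
      then show "\<forall>\<^sub>F n in sequentially. 1 - (1 / \<alpha> j) ^ n \<le> real (k (\<alpha> j) n) / \<alpha> j ^ n" by simp
      show "\<forall>\<^sub>F n in sequentially. real (k (\<alpha> j) n) / \<alpha> j ^ n \<le> 1"
        using kb(1)[OF \<alpha>1, of j] p0 by simp
    qed
    have "(\<lambda>n. \<alpha> j * ((real (k (\<alpha> j) (Suc n)) / \<alpha> j ^ Suc n) / (real (k (\<alpha> j) n) / \<alpha> j ^ n))) \<longlonglongrightarrow> \<alpha> j * (1 / 1)"
      by (intro tendsto_mult tendsto_const tendsto_divide LIMSEQ_Suc[OF c] c) simp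
    moreover have "\<alpha> j * ((real (k (\<alpha> j) (Suc n)) / \<alpha> j ^ Suc n) / (real (k (\<alpha> j) n) / \<alpha> j ^ n))
        = real (k (\<alpha> j) (Suc n)) / real (k (\<alpha> j) n)" for n
      using p0[of n] \<alpha>1[of j] by (simp add: field_simps)
    ultimately show ?thesis by (simp only: div_by_1 mult_1_right)
  qed
  have "AE \<omega> in M. \<forall>j. (\<lambda>n. (S (k (\<alpha> j) n) \<omega> - ES (k (\<alpha> j) n)) / real (k (\<alpha> j) n)) \<longlonglongrightarrow> 0"
    unfolding AE_all_countable using sub \<alpha>1 by blast
  with trunc show ?thesis
  proof eventually_elim
    case (elim \<omega>)
    define T where "T n = (\<Sum>i<n. X i \<omega>)" for n
    have T: "mono T" "0 \<le> T n" for n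
      unfolding T_def by (auto intro!: monoI sum_mono2 nonneg sum_nonneg)
    have "(\<lambda>i. X i \<omega> - Y i \<omega>) \<longlonglongrightarrow> 0"
      using elim(1) by (intro tendsto_eventually) (auto elim: eventually_mono)
    from cesaro_mean_tendsto[OF this] have XY: "(\<lambda>n. (T n - S n \<omega>) / real n) \<longlonglongrightarrow> 0"
      by (simp add: T_def S_def sum_subtractf)
    have lim: "(\<lambda>n. T (k (\<alpha> j) n) / real (k (\<alpha> j) n)) \<longlonglongrightarrow> \<mu>" for j
    proof -
      have "(\<lambda>n. (T (k (\<alpha> j) n) - S (k (\<alpha> j) n) \<omega>) / real (k (\<alpha> j) n)
          + (S (k (\<alpha> j) n) \<omega> - ES (k (\<alpha> j) n)) / real (k (\<alpha> j) n) + ES (k (\<alpha> j) n) / real (k (\<alpha> j) n)) \<longlonglongrightarrow> 0 + 0 + \<mu>"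
        using elim(2) by (intro tendsto_add filterlim_compose[OF XY kinf] filterlim_compose[OF ES kinf]) auto
      then show ?thesis by (simp add: diff_divide_distrib)
    qed
    have \<alpha>lim: "\<alpha> \<longlonglongrightarrow> 1"
      unfolding \<alpha>_def using tendsto_add[OF tendsto_const[of 1] LIMSEQ_inverse_real_of_nat] by (simp add: inverse_eq_divide)
    have "(\<lambda>n. T n / real n) \<longlonglongrightarrow> \<mu>"
    proof (rule tendstoI)
      fix e :: real assume e: "0 < e"
      have "(\<lambda>j. \<mu> * \<alpha> j) \<longlonglongrightarrow> \<mu> * 1" "(\<lambda>j. \<mu> / \<alpha> j) \<longlonglongrightarrow> \<mu> / 1"
        by (intro tendsto_intros \<alpha>lim; simp)+
      then have "\<forall>\<^sub>F j in sequentially. \<mu> * \<alpha> j < \<mu> + e / 2 \<and> \<mu> - e / 2 < \<mu> / \<alpha> j"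
        using e by (intro eventually_conj order_tendstoD[where y="\<mu> * 1"] order_tendstoD[where y="\<mu> / 1"]) auto
      then obtain j where j: "\<mu> * \<alpha> j < \<mu> + e / 2" "\<mu> - e / 2 < \<mu> / \<alpha> j"
        by (auto simp: eventually_sequentially)
      have "\<forall>\<^sub>F m in sequentially. \<mu> / \<alpha> j - e / 2 < T m / real m \<and> T m / real m < \<mu> * \<alpha> j + e / 2"
      proof (rule mono_mean_geometric_subsequence[OF T _ _ kinf kratio _ lim])
        show "k (\<alpha> j) 0 = 1" by (simp add: k_def)
      qed (use kb(4)[OF \<alpha>1] \<alpha>1[of j] e in auto)
      then show "\<forall>\<^sub>F m in sequentially. dist (T m / real m) \<mu> < e"
        by eventually_elim (use j in \<open>auto simp: dist_real_def abs_less_iff\<close>)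
    qed
    then show ?case by (simp add: T_def \<mu>_def)
  qed
qed

end

section \<open>Pointwise and locally uniform laws for the given sample\<close>

context
  fixes P :: "'w measure" and \<xi> :: "'w \<Rightarrow> real^'d" and \<xi>s :: "nat \<Rightarrow> 'w \<Rightarrow> real^'d"
  assumes prob: "prob_space P" and xi: "\<xi> \<in> borel_measurable P" and sample: "iid_sample P \<xi> \<xi>s"
begin

interpretation prob_space P by (rule prob)

lemma measurable_Xi: "\<xi> \<in> measurable P (Xi_space P \<xi>)"
  unfolding Xi_space_def by (rule measurable_restrict_space2) (auto simp: xi)

lemma measurable_sample: "1 \<le> j \<Longrightarrow> \<xi>s j \<in> measurable P (Xi_space P \<xi>)"
  using sample unfolding iid_sample_def indep_vars_def by auto

lemma distr_sample: "1 \<le> j \<Longrightarrow> distr P (Xi_space P \<xi>) (\<xi>s j) = Xi_law P \<xi>"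
  using sample unfolding iid_sample_def by auto

lemma AE_law_imp_AE: "AE s in Xi_law P \<xi>. Q s \<Longrightarrow> AE \<omega> in P. Q (\<xi> \<omega>)"
  unfolding Xi_law_def by (rule AE_distrD[OF measurable_Xi])

lemma AE_law_imp_AE_sample:
  assumes "AE s in Xi_law P \<xi>. Q s"
  shows "AE \<omega> in P. \<forall>j\<ge>1. Q (\<xi>s j \<omega>)"
proof -
  have "AE \<omega> in P. 1 \<le> j \<longrightarrow> Q (\<xi>s j \<omega>)" for j
  proof (cases "1 \<le> j")
    case True
    have "AE s in distr P (Xi_space P \<xi>) (\<xi>s j). Q s" unfolding distr_sample[OF True] by (rule assms)
    from AE_distrD[OF measurable_sample[OF True] this] show ?thesis by simp
  qed simp
  then show ?thesis by (simp add: AE_all_countable)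
qed

lemma law_integral:
  fixes \<phi> :: "real^'d \<Rightarrow> 'b::{banach, second_countable_topology}"
  assumes "\<phi> \<in> borel_measurable (Xi_space P \<xi>)" "1 \<le> j"
  shows "(\<integral>\<omega>. \<phi> (\<xi>s j \<omega>) \<partial>P) = (\<integral>\<omega>. \<phi> (\<xi> \<omega>) \<partial>P)"
    and "integrable P (\<lambda>\<omega>. \<phi> (\<xi>s j \<omega>)) \<longleftrightarrow> integrable P (\<lambda>\<omega>. \<phi> (\<xi> \<omega>))"
  using integral_distr[OF measurable_sample[OF assms(2)] assms(1)] integral_distr[OF measurable_Xi assms(1)]
    integrable_distr_eq[OF measurable_sample[OF assms(2)] assms(1)] integrable_distr_eq[OF measurable_Xi assms(1)]
    distr_sample[OF assms(2)] by (simp_all add: Xi_law_def)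

lemma iid_strong_law_nonneg:
  fixes \<phi> :: "real^'d \<Rightarrow> real"
  assumes \<phi>: "\<phi> \<in> borel_measurable (Xi_space P \<xi>)" and int: "integrable P (\<lambda>\<omega>. \<phi> (\<xi> \<omega>))"
    and nonneg: "\<And>s. 0 \<le> \<phi> s"
  shows "AE \<omega> in P. (\<lambda>n. sample_mean n (\<lambda>j. \<phi> (\<xi>s j \<omega>))) \<longlonglongrightarrow> (\<integral>\<omega>. \<phi> (\<xi> \<omega>) \<partial>P)"
proof -
  define X where "X i \<omega> = \<phi> (\<xi>s (Suc i) \<omega>)" for i \<omega>
  have meas: "X i \<in> borel_measurable P" for i
    unfolding X_def by (rule measurable_compose[OF measurable_sample \<phi>]) simp
  have ind: "indep_var borel (X i) borel (X j)" if "i \<noteq> j" for i j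
  proof -
    \<comment> \<open>Joint independence gives independence of the subfamilies over two disjoint
      singletons; evaluation at the single index then yields pairwise independence. The shift by one
      arises because the sample is indexed from 1.\<close>
    let ?I = "{Suc i}" and ?J = "{Suc j}"
    have m: "(\<lambda>h. \<phi> (h k)) \<in> borel_measurable (Pi\<^sub>M {k} (\<lambda>_. Xi_space P \<xi>))" for k :: nat
      by (rule measurable_compose[OF measurable_component_singleton[where M="\<lambda>_. Xi_space P \<xi>"] \<phi>]) simp
    have "indep_var (Pi\<^sub>M ?I (\<lambda>_. Xi_space P \<xi>)) (\<lambda>\<omega>. restrict (\<lambda>k. \<xi>s k \<omega>) ?I)
                    (Pi\<^sub>M ?J (\<lambda>_. Xi_space P \<xi>)) (\<lambda>\<omega>. restrict (\<lambda>k. \<xi>s k \<omega>) ?J)"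
      using sample that unfolding iid_sample_def by (intro indep_var_restrict[where I="{1..}"]) auto
    from indep_var_compose[OF this m m] show ?thesis by (simp add: X_def[abs_def] comp_def)
  qed
  have dist: "distr P borel (X i) = distr (Xi_law P \<xi>) borel \<phi>" for i
  proof -
    have "distr (Xi_law P \<xi>) borel \<phi> = distr (distr P (Xi_space P \<xi>) (\<xi>s (Suc i))) borel \<phi>"
      by (simp add: distr_sample)
    also have "\<dots> = distr P borel (\<phi> \<circ> \<xi>s (Suc i))"
      using \<phi> by (intro distr_distr measurable_sample) auto
    finally show ?thesis by (simp add: X_def[abs_def] comp_def)
  qed
  have "AE \<omega> in P. (\<lambda>n. (\<Sum>i<n. X i \<omega>) / real n) \<longlonglongrightarrow> expectation (X 0)"
  proof (rule strong_law_nonneg[OF ind meas])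
    show "integrable P (X 0)" unfolding X_def using law_integral(2)[OF \<phi>, of "Suc 0"] int by simp
  qed (auto simp: dist X_def nonneg)
  moreover have "expectation (X 0) = (\<integral>\<omega>. \<phi> (\<xi> \<omega>) \<partial>P)"
    unfolding X_def using law_integral(1)[OF \<phi>, of "Suc 0"] by simp
  moreover have "(\<Sum>i<n. X i \<omega>) / real n = sample_mean n (\<lambda>j. \<phi> (\<xi>s j \<omega>))" for n \<omega>
    unfolding X_def sample_mean_def
    by (simp add: sum.atLeast1_atMost_eq lessThan_atLeast0)
  ultimately show ?thesis by simp
qed

lemma iid_strong_law_real:
  fixes \<phi> :: "real^'d \<Rightarrow> real"
  assumes \<phi> [measurable]: "\<phi> \<in> borel_measurable (Xi_space P \<xi>)" and int: "integrable P (\<lambda>\<omega>. \<phi> (\<xi> \<omega>))"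
  shows "AE \<omega> in P. (\<lambda>n. sample_mean n (\<lambda>j. \<phi> (\<xi>s j \<omega>))) \<longlonglongrightarrow> (\<integral>\<omega>. \<phi> (\<xi> \<omega>) \<partial>P)"
proof -
  have i: "integrable P (\<lambda>\<omega>. max 0 (\<phi> (\<xi> \<omega>)))" "integrable P (\<lambda>\<omega>. max 0 (- \<phi> (\<xi> \<omega>)))" using int by auto
  have m1: "AE \<omega> in P. (\<lambda>n. sample_mean n (\<lambda>j. max 0 (\<phi> (\<xi>s j \<omega>)))) \<longlonglongrightarrow> (\<integral>\<omega>. max 0 (\<phi> (\<xi> \<omega>)) \<partial>P)"
    by (rule iid_strong_law_nonneg) (use i in auto)
  have m2: "AE \<omega> in P. (\<lambda>n. sample_mean n (\<lambda>j. max 0 (- \<phi> (\<xi>s j \<omega>)))) \<longlonglongrightarrow> (\<integral>\<omega>. max 0 (- \<phi> (\<xi> \<omega>)) \<partial>P)"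
    by (rule iid_strong_law_nonneg) (use i in auto)
  have split: "x = max 0 x - max 0 (- x)" for x :: real by (simp add: max_def)
  have eqE: "(\<integral>\<omega>. \<phi> (\<xi> \<omega>) \<partial>P) = (\<integral>\<omega>. max 0 (\<phi> (\<xi> \<omega>)) \<partial>P) - (\<integral>\<omega>. max 0 (- \<phi> (\<xi> \<omega>)) \<partial>P)"
    by (subst Bochner_Integration.integral_diff[symmetric, OF i]) (simp only: split[symmetric])
  have eqS: "sample_mean n (\<lambda>j. \<phi> (\<xi>s j \<omega>)) = sample_mean n (\<lambda>j. max 0 (\<phi> (\<xi>s j \<omega>))) - sample_mean n (\<lambda>j. max 0 (- \<phi> (\<xi>s j \<omega>)))" for n \<omega>
    unfolding sample_mean_def scaleR_diff_right[symmetric] sum_subtractf[symmetric] by (simp only: split[symmetric])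
  from m1 m2 have "AE \<omega> in P. (\<lambda>n. sample_mean n (\<lambda>j. max 0 (\<phi> (\<xi>s j \<omega>))) - sample_mean n (\<lambda>j. max 0 (- \<phi> (\<xi>s j \<omega>))))
      \<longlonglongrightarrow> (\<integral>\<omega>. max 0 (\<phi> (\<xi> \<omega>)) \<partial>P) - (\<integral>\<omega>. max 0 (- \<phi> (\<xi> \<omega>)) \<partial>P)"
    by eventually_elim (intro tendsto_diff)
  then show ?thesis by (simp only: eqE eqS)
qed

lemma iid_strong_law:
  fixes \<phi> :: "real^'d \<Rightarrow> 'b::euclidean_space"
  assumes \<phi> [measurable]: "\<phi> \<in> borel_measurable (Xi_space P \<xi>)" and int: "integrable P (\<lambda>\<omega>. \<phi> (\<xi> \<omega>))"
  shows "AE \<omega> in P. (\<lambda>n. sample_mean n (\<lambda>j. \<phi> (\<xi>s j \<omega>))) \<longlonglongrightarrow> (\<integral>\<omega>. \<phi> (\<xi> \<omega>) \<partial>P)"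
proof -
  have "AE \<omega> in P. \<forall>b\<in>Basis. (\<lambda>n. sample_mean n (\<lambda>j. \<phi> (\<xi>s j \<omega>) \<bullet> b)) \<longlonglongrightarrow> (\<integral>\<omega>. \<phi> (\<xi> \<omega>) \<bullet> b \<partial>P)"
    by (intro AE_finite_allI finite_Basis iid_strong_law_real) (use int in auto)
  moreover have "(\<integral>\<omega>. \<phi> (\<xi> \<omega>) \<bullet> b \<partial>P) = (\<integral>\<omega>. \<phi> (\<xi> \<omega>) \<partial>P) \<bullet> b" for b
    by (rule integral_inner_left) (rule int)
  moreover have "sample_mean n (\<lambda>j. \<phi> (\<xi>s j \<omega>) \<bullet> b) = sample_mean n (\<lambda>j. \<phi> (\<xi>s j \<omega>)) \<bullet> b" for n \<omega> b
    by (simp add: sample_mean_def inner_sum_left)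
  ultimately show ?thesis by (subst tendsto_componentwise_iff) simp
qed

text \<open>
  Jennrich's argument: the oscillation of the integrand over a small ball has a small mean, and its
  sample means converge. Countably many centres and radii suffice.
\<close>

lemma uniform_law:
  fixes \<phi> :: "'z::euclidean_space \<Rightarrow> real^'d \<Rightarrow> 'b::euclidean_space"
  assumes \<phi> [measurable]: "\<And>z. \<phi> z \<in> borel_measurable (Xi_space P \<xi>)"
    and cont: "AE s in Xi_law P \<xi>. continuous_on UNIV (\<lambda>z. \<phi> z s)"
    and dom: "AE s in Xi_law P \<xi>. \<forall>z. norm (\<phi> z s) \<le> a s + b s * norm z"
    and ab [measurable]: "a \<in> borel_measurable (Xi_space P \<xi>)" "b \<in> borel_measurable (Xi_space P \<xi>)"
    and int_ab: "integrable P (\<lambda>\<omega>. a (\<xi> \<omega>))" "integrable P (\<lambda>\<omega>. b (\<xi> \<omega>))"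
  shows "AE \<omega> in P. \<forall>z. ((\<lambda>(y, n). sample_mean n (\<lambda>j. \<phi> y (\<xi>s j \<omega>))) \<longlongrightarrow> (\<integral>\<omega>. \<phi> z (\<xi> \<omega>) \<partial>P))
           (nhds z \<times>\<^sub>F sequentially)"
proof -
  obtain Q :: "'z set" where Q: "countable Q" "\<And>X. open X \<Longrightarrow> X \<noteq> {} \<Longrightarrow> \<exists>d\<in>Q. d \<in> X"
    by (rule countable_dense_setE) blast
  have clQ: "closure Q = UNIV"
  proof -
    have "x \<in> closure Q" for x
      unfolding closure_approachable
    proof (intro allI impI)
      fix e :: real assume "0 < e"
      then obtain d where "d \<in> Q" "d \<in> ball x e" using Q(2)[of "ball x e"] by auto
      then show "\<exists>y\<in>Q. dist y x < e" by (auto simp: dist_commute)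
    qed
    then show ?thesis by blast
  qed
  define good where "good s \<longleftrightarrow> continuous_on UNIV (\<lambda>z. \<phi> z s) \<and> (\<forall>z. norm (\<phi> z s) \<le> a s + b s * norm z)" for s
  have good: "AE s in Xi_law P \<xi>. good s" unfolding good_def using cont dom by eventually_elim auto
  define r where "r m = 1 / real (Suc m)" for m
  have r0: "0 < r m" for m by (simp add: r_def)
  \<comment> \<open>The oscillation over the ball, taken over a countable dense set to be measurable
    and in \<open>ennreal\<close> so that the supremum exists for every \<open>s\<close>. For good
    \<open>s\<close> continuity extends the bound to the whole ball.\<close>
  define \<Delta>' where "\<Delta>' z m s = (SUP y\<in>Q \<inter> ball z (r m). ennreal (norm (\<phi> y s - \<phi> z s)))" for z m s
  define \<Delta> where "\<Delta> z m s = enn2real (\<Delta>' z m s)" for z m s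
  have \<Delta>_meas [measurable]: "\<Delta> z m \<in> borel_measurable (Xi_space P \<xi>)" for z m
    unfolding \<Delta>_def \<Delta>'_def
    by (intro borel_measurable_enn2real borel_measurable_SUP) (use Q(1) in auto)
  \<comment> \<open>An integrable majorant of the oscillation. All radii are at most 1, which
    explains \<open>norm z + 1\<close>.\<close>
  define bd where "bd z s = 2 * (a s + \<bar>b s\<bar> * (norm z + 1))" for z :: 'z and s
  have osc: "norm (\<phi> y s - \<phi> z s) \<le> bd z s" if "good s" "y \<in> ball z (r m)" for y z s m
  proof -
    have "norm y \<le> norm z + dist z y" by (metis dist_commute dist_norm norm_triangle_sub)
    also have "\<dots> \<le> norm z + 1" using that(2) by (simp add: r_def) (smt (verit) divide_le_eq_1_pos of_nat_0_le_iff)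
    finally have "b s * norm y \<le> \<bar>b s\<bar> * (norm z + 1)" by (intro mult_mono) auto
    moreover have "b s * norm z \<le> \<bar>b s\<bar> * (norm z + 1)" by (intro mult_mono) auto
    moreover have "norm (\<phi> y s) \<le> a s + b s * norm y" "norm (\<phi> z s) \<le> a s + b s * norm z"
      using that(1) by (auto simp: good_def)
    moreover have "norm (\<phi> y s - \<phi> z s) \<le> norm (\<phi> y s) + norm (\<phi> z s)" by (rule norm_triangle_ineq4)
    ultimately show ?thesis unfolding bd_def by argo
  qed
  have bd0: "0 \<le> bd z s" if "good s" for z s
    using osc[OF that, of z z 0] r0 by simp
  have \<Delta>'_le: "\<Delta>' z m s \<le> ennreal c" if "0 \<le> c" "\<And>y. y \<in> Q \<Longrightarrow> y \<in> ball z (r m) \<Longrightarrow> norm (\<phi> y s - \<phi> z s) \<le> c" for z m s c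
    unfolding \<Delta>'_def using that by (intro SUP_least ennreal_leI) auto
  have \<Delta>_le: "\<Delta> z m s \<le> c" if "0 \<le> c" "\<And>y. y \<in> Q \<Longrightarrow> y \<in> ball z (r m) \<Longrightarrow> norm (\<phi> y s - \<phi> z s) \<le> c" for z m s c
    unfolding \<Delta>_def by (rule enn2real_leI[OF that(1) \<Delta>'_le[OF that]])
  have \<Delta>0: "0 \<le> \<Delta> z m s" for z m s by (simp add: \<Delta>_def)
  have le_\<Delta>: "norm (\<phi> y s - \<phi> z s) \<le> \<Delta> z m s" if g: "good s" and y: "y \<in> ball z (r m)" for y z s m
  proof -
    have fin: "\<Delta>' z m s < top"
    proof (rule le_less_trans)
      show "\<Delta>' z m s \<le> ennreal (bd z s)" by (rule \<Delta>'_le[OF bd0[OF g]]) (rule osc[OF g])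
    qed simp
    have on_Q: "norm (\<phi> y s - \<phi> z s) \<le> \<Delta> z m s" if "y \<in> ball z (r m) \<inter> Q" for y
    proof -
      have "ennreal (norm (\<phi> y s - \<phi> z s)) \<le> \<Delta>' z m s"
        unfolding \<Delta>'_def using that by (intro SUP_upper) auto
      also have "\<dots> = ennreal (\<Delta> z m s)" unfolding \<Delta>_def using fin by simp
      finally show ?thesis using \<Delta>0 by simp
    qed
    have in_cl: "y \<in> closure (ball z (r m) \<inter> Q)"
      using y clQ by (subst closure_open_Int_superset) (auto intro: closure_subset[THEN subsetD])
    have "continuous_on (closure (ball z (r m) \<inter> Q)) (\<lambda>y. norm (\<phi> y s - \<phi> z s))"
      using g unfolding good_def by (auto intro!: continuous_intros intro: continuous_on_subset)
    from continuous_le_on_closure[OF this in_cl on_Q] show ?thesis .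
  qed
  have \<Delta>_bd: "\<Delta> z m s \<le> bd z s" if "good s" for z m s
    by (rule \<Delta>_le[OF bd0[OF that]]) (rule osc[OF that])
  have int_bd: "integrable P (\<lambda>\<omega>. bd z (\<xi> \<omega>))" for z unfolding bd_def using int_ab by auto
  have mP [measurable]: "\<xi> \<in> measurable P (Xi_space P \<xi>)" by (rule measurable_Xi)
  have good\<xi>: "AE \<omega> in P. good (\<xi> \<omega>)" by (rule AE_law_imp_AE[OF good])
  have int_\<Delta>: "integrable P (\<lambda>\<omega>. \<Delta> z m (\<xi> \<omega>))" for z m
  proof (rule Bochner_Integration.integrable_bound[OF int_bd[of z]])
    show "AE \<omega> in P. norm (\<Delta> z m (\<xi> \<omega>)) \<le> norm (bd z (\<xi> \<omega>))"
      using good\<xi> by eventually_elim (simp add: \<Delta>0 bd0 \<Delta>_bd)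
  qed measurable
  have int_\<phi>: "integrable P (\<lambda>\<omega>. \<phi> z (\<xi> \<omega>))" for z
  proof (rule Bochner_Integration.integrable_bound)
    show "integrable P (\<lambda>\<omega>. a (\<xi> \<omega>) + b (\<xi> \<omega>) * norm z)" using int_ab by auto
    show "AE \<omega> in P. norm (\<phi> z (\<xi> \<omega>)) \<le> norm (a (\<xi> \<omega>) + b (\<xi> \<omega>) * norm z)"
      using good\<xi> by eventually_elim (auto simp: good_def intro: order_trans[OF _ abs_ge_self])
  qed measurable
  have E\<Delta>: "(\<lambda>m. \<integral>\<omega>. \<Delta> z m (\<xi> \<omega>) \<partial>P) \<longlonglongrightarrow> 0" for z
  proof -
    have "(\<lambda>m. \<integral>\<omega>. \<Delta> z m (\<xi> \<omega>) \<partial>P) \<longlonglongrightarrow> (\<integral>\<omega>. 0 \<partial>P)"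
    proof (rule integral_dominated_convergence[where w="\<lambda>\<omega>. bd z (\<xi> \<omega>)"])
      show "AE \<omega> in P. (\<lambda>m. \<Delta> z m (\<xi> \<omega>)) \<longlonglongrightarrow> 0"
        using good\<xi>
      proof eventually_elim
        case (elim \<omega>)
        show ?case
        proof (rule LIMSEQ_I)
          fix e :: real assume e: "0 < e"
          have "isCont (\<lambda>z. \<phi> z (\<xi> \<omega>)) z"
            using elim by (auto simp: good_def continuous_on_eq_continuous_at)
          then obtain d where d: "0 < d" "\<And>y. dist y z < d \<Longrightarrow> dist (\<phi> y (\<xi> \<omega>)) (\<phi> z (\<xi> \<omega>)) < e / 2"
            using e unfolding continuous_at_eps_delta by (metis half_gt_zero)
          obtain m0 :: nat where m0: "1 / d < real m0" using reals_Archimedean2 by blast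
          show "\<exists>no. \<forall>m\<ge>no. norm (\<Delta> z m (\<xi> \<omega>) - 0) < e"
          proof (intro exI[of _ m0] allI impI)
            fix m assume m: "m0 \<le> m"
            have "r m < d"
            proof -
              have "1 / d < real (Suc m)" using m m0 by linarith
              then show ?thesis using d(1) by (simp add: r_def field_simps)
            qed
            then have "\<Delta> z m (\<xi> \<omega>) \<le> e / 2"
              using d(2) e by (intro \<Delta>_le) (auto simp: dist_commute dist_norm[symmetric] intro: less_imp_le)
            then show "norm (\<Delta> z m (\<xi> \<omega>) - 0) < e" using \<Delta>0[of z m "\<xi> \<omega>"] e by simp
          qed
        qed
      qed
      show "AE \<omega> in P. norm (\<Delta> z m (\<xi> \<omega>)) \<le> bd z (\<xi> \<omega>)" for m
        using good\<xi> by eventually_elim (simp add: \<Delta>0 \<Delta>_bd)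
    qed (use int_bd in auto)
    then show ?thesis by simp
  qed
  have "AE \<omega> in P. \<forall>z\<in>Q. (\<lambda>n. sample_mean n (\<lambda>j. \<phi> z (\<xi>s j \<omega>))) \<longlonglongrightarrow> (\<integral>\<omega>. \<phi> z (\<xi> \<omega>) \<partial>P)"
    by (intro AE_ball_countable' iid_strong_law \<phi> int_\<phi> Q(1))
  moreover have "AE \<omega> in P. \<forall>z\<in>Q. \<forall>m. (\<lambda>n. sample_mean n (\<lambda>j. \<Delta> z m (\<xi>s j \<omega>))) \<longlonglongrightarrow> (\<integral>\<omega>. \<Delta> z m (\<xi> \<omega>) \<partial>P)"
    by (intro AE_ball_countable' Q(1)) (simp add: AE_all_countable iid_strong_law int_\<Delta>)
  moreover have "AE \<omega> in P. \<forall>j\<ge>1. good (\<xi>s j \<omega>)" by (rule AE_law_imp_AE_sample[OF good])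
  ultimately show ?thesis
  proof eventually_elim
    case (elim \<omega>)
    let ?m = "\<lambda>y n. sample_mean n (\<lambda>j. \<phi> y (\<xi>s j \<omega>))" and ?E = "\<lambda>z. \<integral>\<omega>. \<phi> z (\<xi> \<omega>) \<partial>P"
    show ?case
    proof
      fix z
      show "((\<lambda>(y, n). ?m y n) \<longlongrightarrow> ?E z) (nhds z \<times>\<^sub>F sequentially)"
      proof (rule tendstoI)
        fix e :: real assume e: "0 < e"
        \<comment> \<open>Budget: two fifths for the sample mean of the oscillation around
          \<open>z'\<close>, one for the law at \<open>z'\<close>, one for moving the expectation
          from \<open>z'\<close> to \<open>z\<close>.\<close>
        obtain m where m: "(\<integral>\<omega>. \<Delta> z m (\<xi> \<omega>) \<partial>P) < e / 5"
          using order_tendstoD(2)[OF E\<Delta>[of z], of "e / 5"] e by (auto simp: eventually_sequentially)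
        \<comment> \<open>Halves the radius exactly: \<open>r ?k = r m / 2\<close>. So the small
          ball around \<open>z'\<close> lies in the ball of radius \<open>r m\<close> around
          \<open>z\<close>.\<close>
        let ?k = "2 * m + 1"
        have rk: "2 * r ?k = r m" by (simp add: r_def field_simps)
        obtain z' where z': "z' \<in> Q" "z' \<in> ball z (r ?k)"
          using Q(2)[of "ball z (r ?k)"] r0[of ?k] by auto
        have z'm: "z' \<in> ball z (r m)" using z'(2) rk r0[of ?k] by simp
        have *: "\<Delta> z' ?k s \<le> 2 * \<Delta> z m s" if g: "good s" for s
        proof (rule \<Delta>_le)
          fix y assume "y \<in> Q" "y \<in> ball z' (r ?k)"
          then have "y \<in> ball z (r m)"
            using z'(2) rk by (simp only: mem_ball) (smt (verit) dist_triangle)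
          from le_\<Delta>[OF g this] le_\<Delta>[OF g z'm] show "norm (\<phi> y s - \<phi> z' s) \<le> 2 * \<Delta> z m s"
            using norm_triangle_ineq4[of "\<phi> y s - \<phi> z s" "\<phi> z' s - \<phi> z s"] by simp
        qed (simp add: \<Delta>0)
        have E1: "(\<integral>\<omega>. \<Delta> z' ?k (\<xi> \<omega>) \<partial>P) < 2 * (e / 5)"
        proof -
          have "(\<integral>\<omega>. \<Delta> z' ?k (\<xi> \<omega>) \<partial>P) \<le> (\<integral>\<omega>. 2 * \<Delta> z m (\<xi> \<omega>) \<partial>P)"
            by (rule integral_mono_AE) (use int_\<Delta> good\<xi> * in auto)
          then show ?thesis using m by simp
        qed
        have E2: "norm (?E z' - ?E z) < e / 5"
        proof -
          have "norm (?E z' - ?E z) \<le> (\<integral>\<omega>. norm (\<phi> z' (\<xi> \<omega>) - \<phi> z (\<xi> \<omega>)) \<partial>P)"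
            using int_\<phi> by (simp flip: Bochner_Integration.integral_diff add: integral_norm_bound)
          also have "\<dots> \<le> (\<integral>\<omega>. \<Delta> z m (\<xi> \<omega>) \<partial>P)"
            by (rule integral_mono_AE) (use int_\<Delta> int_\<phi> good\<xi> le_\<Delta>[OF _ z'm] in auto)
          finally show ?thesis using m by simp
        qed
        have ev: "\<forall>\<^sub>F n in sequentially. sample_mean n (\<lambda>j. \<Delta> z' ?k (\<xi>s j \<omega>)) < 2 * (e / 5) \<and> norm (?m z' n - ?E z') < e / 5"
        proof (intro eventually_conj)
          show "\<forall>\<^sub>F n in sequentially. sample_mean n (\<lambda>j. \<Delta> z' ?k (\<xi>s j \<omega>)) < 2 * (e / 5)"
            using elim(2) z'(1) by (intro order_tendstoD(2)[OF _ E1]) blast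
          have "(\<lambda>n. ?m z' n) \<longlonglongrightarrow> ?E z'" using elim(1) z'(1) by blast
          from tendstoD[OF this, of "e / 5"] e show "\<forall>\<^sub>F n in sequentially. norm (?m z' n - ?E z') < e / 5"
            by (simp add: dist_norm)
        qed
        have nb: "\<forall>\<^sub>F y in nhds z. y \<in> ball z' (r ?k)"
          using z'(2) by (intro eventually_nhds_in_open) (auto simp: dist_commute)
        show "\<forall>\<^sub>F p in nhds z \<times>\<^sub>F sequentially. dist (case p of (y, n) \<Rightarrow> ?m y n) (?E z) < e"
        proof (rule eventually_mono[OF eventually_prodI[OF nb ev]], clarify)
          fix y and n :: nat
          assume y: "fst (y, n) \<in> ball z' (r ?k)"
            and n: "sample_mean (snd (y, n)) (\<lambda>j. \<Delta> z' ?k (\<xi>s j \<omega>)) < 2 * (e / 5)" "norm (?m z' (snd (y, n)) - ?E z') < e / 5"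
          have "norm (?m y n - ?m z' n) = (1 / real n) * norm (\<Sum>j=1..n. \<phi> y (\<xi>s j \<omega>) - \<phi> z' (\<xi>s j \<omega>))"
            unfolding sample_mean_def scaleR_diff_right[symmetric] sum_subtractf[symmetric] by simp
          also have "\<dots> \<le> (1 / real n) * (\<Sum>j=1..n. \<Delta> z' ?k (\<xi>s j \<omega>))"
            using elim(3) y by (intro mult_left_mono sum_norm_le le_\<Delta>) auto
          also have "\<dots> = sample_mean n (\<lambda>j. \<Delta> z' ?k (\<xi>s j \<omega>))" by (simp add: sample_mean_def)
          finally have "norm (?m y n - ?m z' n) < 2 * (e / 5)" using n by simp
          moreover have "norm (?m y n - ?E z) \<le> norm (?m y n - ?m z' n) + (norm (?m z' n - ?E z') + norm (?E z' - ?E z))"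
            by (smt (verit, ccfv_SIG) diff_add_cancel add_diff_eq norm_triangle_ineq)
          ultimately show "dist (?m y n) (?E z) < e" using n E2 e unfolding dist_norm fst_conv snd_conv by linarith
        qed
      qed
    qed
  qed
qed

end

section \<open>Square integrable functions and weak derivatives\<close>

lemma L2_spaceD:
  assumes "x \<in> L2_space T"
  shows "x \<in> borel_measurable (lebesgue_on {0<..<T})" "integrable (lebesgue_on {0<..<T}) (\<lambda>t. (norm (x t))\<^sup>2)"
  using assms by (auto simp: L2_space_def)

lemma L2_zero [simp]: "(\<lambda>t. 0) \<in> L2_space T"
  by (simp add: L2_space_def)

lemma finite_measure_lebesgue_on_interval: "finite_measure (lebesgue_on {0<..<T::real})"
  by (rule finite_measure_lebesgue_on) simp

lemma norm_L2_nonneg [simp]: "0 \<le> norm_L2 T x"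
  by (simp add: norm_L2_def)

lemma norm_L2_power2: "(norm_L2 T x)\<^sup>2 = (LINT t|lebesgue_on {0<..<T}. (norm (x t))\<^sup>2)"
  by (simp add: norm_L2_def)

lemma norm_L2_cong_AE:
  assumes "x \<in> borel_measurable (lebesgue_on {0<..<T})" "y \<in> borel_measurable (lebesgue_on {0<..<T})"
    and "AE t in lebesgue_on {0<..<T}. norm (x t) = norm (y t)"
  shows "norm_L2 T x = norm_L2 T y"
  unfolding norm_L2_def using assms by (intro arg_cong[where f=sqrt] integral_cong_AE) auto

lemma L2_space_bound:
  assumes x: "x \<in> borel_measurable (lebesgue_on {0<..<T})" and y: "y \<in> L2_space T"
    and le: "AE t in lebesgue_on {0<..<T}. norm (x t) \<le> c * norm (y t)"
  shows "x \<in> L2_space T" and "0 \<le> c \<Longrightarrow> norm_L2 T x \<le> c * norm_L2 T y"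
proof -
  have le2: "AE t in lebesgue_on {0<..<T}. (norm (x t))\<^sup>2 \<le> c\<^sup>2 * (norm (y t))\<^sup>2"
    using le by eventually_elim (metis norm_ge_zero power_mono power_mult_distrib)
  have int: "integrable (lebesgue_on {0<..<T}) (\<lambda>t. c\<^sup>2 * (norm (y t))\<^sup>2)"
    using y by (simp add: L2_space_def)
  have intx: "integrable (lebesgue_on {0<..<T}) (\<lambda>t. (norm (x t))\<^sup>2)"
    by (rule Bochner_Integration.integrable_bound[OF int]) (use x le2 in auto)
  then show xL: "x \<in> L2_space T" using x by (simp add: L2_space_def)
  assume c: "0 \<le> c"
  have "(norm_L2 T x)\<^sup>2 \<le> (LINT t|lebesgue_on {0<..<T}. c\<^sup>2 * (norm (y t))\<^sup>2)"
    unfolding norm_L2_power2 by (rule integral_mono_AE[OF intx int le2])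
  also have "\<dots> = (c * norm_L2 T y)\<^sup>2" by (simp add: power_mult_distrib norm_L2_power2)
  finally show "norm_L2 T x \<le> c * norm_L2 T y" by (rule power2_le_imp_le) (use c in auto)
qed

lemma L2_space_bounded:
  fixes x :: "real \<Rightarrow> 'a::euclidean_space"
  assumes T: "0 \<le> T" and x: "x \<in> borel_measurable (lebesgue_on {0<..<T})"
    and le: "\<And>t. 0 < t \<Longrightarrow> t < T \<Longrightarrow> norm (x t) \<le> c" and c: "0 \<le> c"
  shows "x \<in> L2_space T" "norm_L2 T x \<le> c * sqrt T"
proof -
  interpret finite_measure "lebesgue_on {0<..<T}" by (rule finite_measure_lebesgue_on_interval)
  have one: "(\<lambda>t. 1::real) \<in> L2_space T" by (auto simp: L2_space_def)
  have n1: "norm_L2 T (\<lambda>t. 1::real) = sqrt T"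
    using T by (simp add: norm_L2_def measure_restrict_space space_restrict_space)
  have ae: "AE t in lebesgue_on {0<..<T}. norm (x t) \<le> c * norm (1::real)"
    using le by (intro AE_I2) (auto simp: space_restrict_space)
  show "x \<in> L2_space T" "norm_L2 T x \<le> c * sqrt T"
    using L2_space_bound[OF x one ae] c n1 by auto
qed

lemma continuous_on_L2_space:
  fixes x :: "real \<Rightarrow> 'a::euclidean_space"
  assumes "continuous_on {0..T} x"
  shows "x \<in> borel_measurable (lebesgue_on {0<..<T})" "x \<in> L2_space T"
proof -
  show m: "x \<in> borel_measurable (lebesgue_on {0<..<T})"
    by (rule continuous_imp_measurable_on_sets_lebesgue)
      (auto intro: continuous_on_subset[OF assms])
  show "x \<in> L2_space T"
  proof (cases "0 \<le> T")
    case True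
    have "bounded (x ` {0..T})" using assms by (intro compact_imp_bounded compact_continuous_image) auto
    then obtain c where "0 < c" "\<And>t. t \<in> {0..T} \<Longrightarrow> norm (x t) \<le> c" by (auto simp: bounded_pos)
    then show ?thesis using True m by (intro L2_space_bounded(1)[of T x c]) auto
  next
    case False
    then show ?thesis
      by (intro L2_space_bound(1)[OF m L2_zero, of 0] AE_I2) (auto simp: space_restrict_space)
  qed
qed

lemma L2_add:
  fixes x y :: "real \<Rightarrow> 'a::euclidean_space"
  assumes x: "x \<in> L2_space T" and y: "y \<in> L2_space T"
  shows "(\<lambda>t. x t + y t) \<in> L2_space T"
proof -
  let ?M = "lebesgue_on {0<..<T}"
  have le: "(norm (x t + y t))\<^sup>2 \<le> 2 * (norm (x t))\<^sup>2 + 2 * (norm (y t))\<^sup>2" for t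
  proof -
    have "(norm (x t + y t))\<^sup>2 \<le> (norm (x t) + norm (y t))\<^sup>2"
      by (intro power_mono norm_triangle_ineq) simp
    also have "\<dots> \<le> 2 * (norm (x t))\<^sup>2 + 2 * (norm (y t))\<^sup>2"
      using sum_squares_bound[of "norm (x t)" "norm (y t)"] by (simp add: power2_sum)
    finally show ?thesis .
  qed
  have m: "(\<lambda>t. x t + y t) \<in> borel_measurable ?M"
    by (intro borel_measurable_add L2_spaceD(1) x y)
  have "integrable ?M (\<lambda>t. 2 * (norm (x t))\<^sup>2 + 2 * (norm (y t))\<^sup>2)"
    by (intro Bochner_Integration.integrable_add integrable_mult_right L2_spaceD(2) x y)
  then have "integrable ?M (\<lambda>t. (norm (x t + y t))\<^sup>2)"
  proof (rule Bochner_Integration.integrable_bound)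
    show "(\<lambda>t. (norm (x t + y t))\<^sup>2) \<in> borel_measurable ?M" using m by measurable
    show "AE t in ?M. norm ((norm (x t + y t))\<^sup>2) \<le> norm (2 * (norm (x t))\<^sup>2 + 2 * (norm (y t))\<^sup>2)"
      by (intro AE_I2) (simp only: real_norm_def, rule order_trans[OF _ abs_ge_self], simp add: le)
  qed
  with m show ?thesis by (simp add: L2_space_def)
qed

lemma L2_scaleR: "x \<in> L2_space T \<Longrightarrow> (\<lambda>t. c *\<^sub>R x t) \<in> L2_space T"
  by (auto simp: L2_space_def power_mult_distrib)

lemma norm_L2_scaleR: "norm_L2 T (\<lambda>t. c *\<^sub>R x t) = \<bar>c\<bar> * norm_L2 T x"
  by (simp add: norm_L2_def power_mult_distrib real_sqrt_mult)

lemma L2_uminus: "x \<in> L2_space T \<Longrightarrow> (\<lambda>t. - x t) \<in> L2_space T"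
  by (auto simp: L2_space_def)

lemma norm_L2_uminus [simp]: "norm_L2 T (\<lambda>t. - x t) = norm_L2 T x"
  by (simp add: norm_L2_def)

lemma norm_L2_minus_commute: "norm_L2 T (\<lambda>t. x t - y t) = norm_L2 T (\<lambda>t. y t - x t)"
  by (simp add: norm_L2_def norm_minus_commute)

lemma L2_diff: "x \<in> L2_space T \<Longrightarrow> y \<in> L2_space T \<Longrightarrow> (\<lambda>t. x t - y t) \<in> L2_space T"
  using L2_add[OF _ L2_uminus, of x T y] by simp

lemma L2_sum: "(\<And>i. i \<in> I \<Longrightarrow> x i \<in> L2_space T) \<Longrightarrow> (\<lambda>t. \<Sum>i\<in>I. x i t) \<in> L2_space T"
  by (induction I rule: infinite_finite_induct) (auto intro: L2_add)

lemma L2_matrix: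
  fixes A :: "real^'n^'m"
  assumes x: "x \<in> L2_space T"
  shows "(\<lambda>t. A *v x t) \<in> L2_space T" "norm_L2 T (\<lambda>t. A *v x t) \<le> onorm ((*v) A) * norm_L2 T x"
proof -
  have bl: "bounded_linear ((*v) A)" by (rule matrix_vector_mul_bounded_linear)
  have m: "(\<lambda>t. A *v x t) \<in> borel_measurable (lebesgue_on {0<..<T})"
    using L2_spaceD(1)[OF x] by (rule borel_measurable_continuous_on[OF linear_continuous_on[OF bl]])
  have le: "AE t in lebesgue_on {0<..<T}. norm (A *v x t) \<le> onorm ((*v) A) * norm (x t)"
    by (intro AE_I2 onorm[OF bl])
  show "(\<lambda>t. A *v x t) \<in> L2_space T" "norm_L2 T (\<lambda>t. A *v x t) \<le> onorm ((*v) A) * norm_L2 T x"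
    using L2_space_bound[OF m x le] onorm_pos_le[OF bl] by auto
qed

lemma L2_inner_integrable:
  fixes x y :: "real \<Rightarrow> 'a::euclidean_space"
  assumes x: "x \<in> L2_space T" and y: "y \<in> L2_space T"
  shows "integrable (lebesgue_on {0<..<T}) (\<lambda>t. x t \<bullet> y t)"
proof (rule Bochner_Integration.integrable_bound)
  show "integrable (lebesgue_on {0<..<T}) (\<lambda>t. (norm (x t))\<^sup>2 + (norm (y t))\<^sup>2)"
    using x y by (auto simp: L2_space_def)
  show "AE t in lebesgue_on {0<..<T}. norm (x t \<bullet> y t) \<le> norm ((norm (x t))\<^sup>2 + (norm (y t))\<^sup>2)"
  proof (rule AE_I2)
    fix t
    have "\<bar>x t \<bullet> y t\<bar> \<le> norm (x t) * norm (y t)" by (rule Cauchy_Schwarz_ineq2)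
    also have "\<dots> \<le> (norm (x t))\<^sup>2 + (norm (y t))\<^sup>2"
      using sum_squares_bound[of "norm (x t)" "norm (y t)"] mult_nonneg_nonneg[OF norm_ge_zero norm_ge_zero, of "x t" "y t"]
      by linarith
    finally show "norm (x t \<bullet> y t) \<le> norm ((norm (x t))\<^sup>2 + (norm (y t))\<^sup>2)" by simp
  qed
qed (use x y in \<open>auto simp: L2_space_def\<close>)

lemma norm_L2_power2_add:
  fixes x y :: "real \<Rightarrow> 'a::euclidean_space"
  assumes x: "x \<in> L2_space T" and y: "y \<in> L2_space T"
  shows "(norm_L2 T (\<lambda>t. x t + y t))\<^sup>2 =
    (norm_L2 T x)\<^sup>2 + 2 * (LINT t|lebesgue_on {0<..<T}. x t \<bullet> y t) + (norm_L2 T y)\<^sup>2"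
proof -
  have "(norm_L2 T (\<lambda>t. x t + y t))\<^sup>2 =
     (LINT t|lebesgue_on {0<..<T}. (norm (x t))\<^sup>2 + 2 * (x t \<bullet> y t) + (norm (y t))\<^sup>2)"
    unfolding norm_L2_power2
    by (simp add: power2_norm_eq_inner inner_add_left inner_add_right inner_commute algebra_simps)
  then show ?thesis
    using L2_inner_integrable[OF x y] x y by (simp add: norm_L2_power2 L2_space_def)
qed

lemma L2_Cauchy_Schwarz:
  fixes x y :: "real \<Rightarrow> 'a::euclidean_space"
  assumes x: "x \<in> L2_space T" and y: "y \<in> L2_space T"
  shows "\<bar>LINT t|lebesgue_on {0<..<T}. x t \<bullet> y t\<bar> \<le> norm_L2 T x * norm_L2 T y"
proof -
  define p where "p = (LINT t|lebesgue_on {0<..<T}. x t \<bullet> y t)"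
  have quad: "0 \<le> (norm_L2 T x)\<^sup>2 + 2 * (c * p) + c\<^sup>2 * (norm_L2 T y)\<^sup>2" for c
    using norm_L2_power2_add[OF x L2_scaleR[OF y, of c]]
    by (simp add: norm_L2_scaleR power_mult_distrib p_def)
      (metis zero_le_power2)
  have "p\<^sup>2 \<le> (norm_L2 T x)\<^sup>2 * (norm_L2 T y)\<^sup>2"
  proof (cases "norm_L2 T y = 0")
    case True
    have "p = 0"
    proof (rule ccontr)
      assume "p \<noteq> 0"
      \<comment> \<open>With this coefficient the quadratic, which has no leading term here, takes
        the value -1.\<close>
      then show False using quad[of "- (((norm_L2 T x)\<^sup>2 + 1) / (2 * p))"] True by (simp add: field_simps)
    qed
    then show ?thesis by simp
  next
    case False
    then have N: "0 < (norm_L2 T y)\<^sup>2" by simp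
    have "0 \<le> ((norm_L2 T x)\<^sup>2 + 2 * (- p / (norm_L2 T y)\<^sup>2 * p) + (- p / (norm_L2 T y)\<^sup>2)\<^sup>2 * (norm_L2 T y)\<^sup>2) * (norm_L2 T y)\<^sup>2"
      by (intro mult_nonneg_nonneg quad) (use N in auto)
    also have "\<dots> = (norm_L2 T x)\<^sup>2 * (norm_L2 T y)\<^sup>2 - p\<^sup>2"
      using False by (simp add: field_simps power2_eq_square)
    finally show ?thesis by simp
  qed
  then have "\<bar>p\<bar> \<le> \<bar>norm_L2 T x * norm_L2 T y\<bar>"
    by (subst abs_le_square_iff) (simp add: power_mult_distrib)
  then show ?thesis by (simp add: p_def abs_mult)
qed

lemma norm_L2_triangle:
  fixes x y :: "real \<Rightarrow> 'a::euclidean_space"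
  assumes x: "x \<in> L2_space T" and y: "y \<in> L2_space T"
  shows "norm_L2 T (\<lambda>t. x t + y t) \<le> norm_L2 T x + norm_L2 T y"
proof (rule power2_le_imp_le)
  show "(norm_L2 T (\<lambda>t. x t + y t))\<^sup>2 \<le> (norm_L2 T x + norm_L2 T y)\<^sup>2"
    using norm_L2_power2_add[OF x y] L2_Cauchy_Schwarz[OF x y] by (simp add: power2_sum)
qed simp

lemma norm_L2_triangle_diff:
  fixes x y z :: "real \<Rightarrow> 'a::euclidean_space"
  assumes "x \<in> L2_space T" "y \<in> L2_space T" "z \<in> L2_space T"
  shows "norm_L2 T (\<lambda>t. x t - z t) \<le> norm_L2 T (\<lambda>t. x t - y t) + norm_L2 T (\<lambda>t. y t - z t)"
  using norm_L2_triangle[OF L2_diff[OF assms(1,2)] L2_diff[OF assms(2,3)]] by simp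

lemma norm_L2_abs_diff:
  fixes x y :: "real \<Rightarrow> 'a::euclidean_space"
  assumes "x \<in> L2_space T" "y \<in> L2_space T"
  shows "\<bar>norm_L2 T x - norm_L2 T y\<bar> \<le> norm_L2 T (\<lambda>t. x t - y t)"
  using norm_L2_triangle[OF L2_diff[OF assms] assms(2)] norm_L2_triangle[OF L2_diff[OF assms(2,1)] assms(1)]
  by (simp add: norm_L2_minus_commute[of T x y])

lemma norm_L2_parallelogram:
  fixes x y :: "real \<Rightarrow> 'a::euclidean_space"
  assumes x: "x \<in> L2_space T" and y: "y \<in> L2_space T"
  shows "(norm_L2 T (\<lambda>t. x t - y t))\<^sup>2 = 2 * (norm_L2 T x)\<^sup>2 + 2 * (norm_L2 T y)\<^sup>2 - 4 * (norm_L2 T (\<lambda>t. (1/2) *\<^sub>R (x t + y t)))\<^sup>2"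
  using norm_L2_power2_add[OF x y] norm_L2_power2_add[OF x L2_uminus[OF y]]
  by (simp add: norm_L2_scaleR power_mult_distrib power_divide add_divide_distrib)

lemma L2_norm_integral_le:
  fixes x :: "real \<Rightarrow> 'a::euclidean_space"
  assumes T: "0 \<le> T" and x: "x \<in> L2_space T"
  shows "integrable (lebesgue_on {0<..<T}) x" "(LINT t|lebesgue_on {0<..<T}. norm (x t)) \<le> sqrt T * norm_L2 T x"
proof -
  interpret finite_measure "lebesgue_on {0<..<T}" by (rule finite_measure_lebesgue_on_interval)
  have one: "(\<lambda>t. 1::real) \<in> L2_space T" "norm_L2 T (\<lambda>t. 1::real) = sqrt T"
    using T by (auto simp: L2_space_def norm_L2_def measure_restrict_space space_restrict_space)
  have nx: "(\<lambda>t. norm (x t)) \<in> L2_space T" using x by (auto simp: L2_space_def)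
  have "integrable (lebesgue_on {0<..<T}) (\<lambda>t. norm (x t))"
    using L2_inner_integrable[OF one(1) nx] by simp
  then show "integrable (lebesgue_on {0<..<T}) x"
    using L2_spaceD(1)[OF x] by (simp add: integrable_norm_iff)
  show "(LINT t|lebesgue_on {0<..<T}. norm (x t)) \<le> sqrt T * norm_L2 T x"
    using L2_Cauchy_Schwarz[OF one(1) nx] one(2) by (simp add: norm_L2_def)
qed

text \<open>Fatou's lemma. The distance bound passes to the pointwise limit, and its finiteness
  gives membership in the space.\<close>

lemma L2_closed:
  fixes z :: "nat \<Rightarrow> real \<Rightarrow> 'a::euclidean_space"
  assumes z: "\<And>k. z k \<in> L2_space T" and x: "x \<in> borel_measurable (lebesgue_on {0<..<T})"
    and lim: "AE t in lebesgue_on {0<..<T}. (\<lambda>k. z k t) \<longlonglongrightarrow> x t"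
    and y: "y \<in> L2_space T" and bnd: "\<forall>\<^sub>F k in sequentially. norm_L2 T (\<lambda>t. y t - z k t) \<le> e" and e: "0 \<le> e"
  shows "x \<in> L2_space T" "norm_L2 T (\<lambda>t. y t - x t) \<le> e"
proof -
  let ?M = "lebesgue_on {0<..<T}"
  have ym [measurable]: "y \<in> borel_measurable ?M" and zm [measurable]: "z k \<in> borel_measurable ?M" for k
    using L2_spaceD(1)[OF y] L2_spaceD(1)[OF z] by auto
  note x [measurable]
  have "(\<integral>\<^sup>+t. ennreal ((norm (y t - x t))\<^sup>2) \<partial>?M) = (\<integral>\<^sup>+t. liminf (\<lambda>k. ennreal ((norm (y t - z k t))\<^sup>2)) \<partial>?M)"
  proof (rule nn_integral_cong_AE)
    show "AE t in ?M. ennreal ((norm (y t - x t))\<^sup>2) = liminf (\<lambda>k. ennreal ((norm (y t - z k t))\<^sup>2))"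
      using lim
    proof eventually_elim
      case (elim t)
      then have "(\<lambda>k. ennreal ((norm (y t - z k t))\<^sup>2)) \<longlonglongrightarrow> ennreal ((norm (y t - x t))\<^sup>2)"
        by (intro tendsto_intros tendsto_ennrealI)
      then show ?case by (rule lim_imp_Liminf[symmetric, OF trivial_limit_sequentially])
    qed
  qed
  also have "\<dots> \<le> liminf (\<lambda>k. \<integral>\<^sup>+t. ennreal ((norm (y t - z k t))\<^sup>2) \<partial>?M)"
    by (rule nn_integral_liminf) measurable
  also have "\<dots> \<le> ennreal (e\<^sup>2)"
  proof (rule Liminf_le)
    show "\<forall>\<^sub>F k in sequentially. (\<integral>\<^sup>+t. ennreal ((norm (y t - z k t))\<^sup>2) \<partial>?M) \<le> ennreal (e\<^sup>2)"
      using bnd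
    proof eventually_elim
      case (elim k)
      have "(\<integral>\<^sup>+t. ennreal ((norm (y t - z k t))\<^sup>2) \<partial>?M) = ennreal ((norm_L2 T (\<lambda>t. y t - z k t))\<^sup>2)"
        unfolding norm_L2_power2 using L2_spaceD(2)[OF L2_diff[OF y z]] by (intro nn_integral_eq_integral) auto
      also have "\<dots> \<le> ennreal (e\<^sup>2)" using elim by (intro ennreal_leI power_mono) auto
      finally show ?case .
    qed
  qed simp
  finally have le: "(\<integral>\<^sup>+t. ennreal ((norm (y t - x t))\<^sup>2) \<partial>?M) \<le> ennreal (e\<^sup>2)" .
  then have int: "integrable ?M (\<lambda>t. (norm (y t - x t))\<^sup>2)"
    using ym x by (intro integrableI_bounded) (auto simp: le_less_trans[OF le])
  then have d: "(\<lambda>t. y t - x t) \<in> L2_space T" using ym x by (simp add: L2_space_def)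
  show "x \<in> L2_space T" using L2_diff[OF y d] by simp
  have "ennreal ((norm_L2 T (\<lambda>t. y t - x t))\<^sup>2) \<le> ennreal (e\<^sup>2)"
    unfolding norm_L2_power2 using int le by (subst nn_integral_eq_integral[symmetric]) auto
  then have "(norm_L2 T (\<lambda>t. y t - x t))\<^sup>2 \<le> e\<^sup>2" by simp
  then show "norm_L2 T (\<lambda>t. y t - x t) \<le> e" using e by (rule power2_le_imp_le)
qed

text \<open>Riesz-Fischer: along a fast subsequence the increments are summable in L1, because the
  interval is finite, so the subsequence converges almost everywhere; \<open>L2_closed\<close> turns
  this into convergence in norm.\<close>

lemma L2_complete:
  fixes x :: "nat \<Rightarrow> real \<Rightarrow> 'a::euclidean_space"
  assumes T: "0 \<le> T" and x: "\<And>k. x k \<in> L2_space T"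
    and cauchy: "\<And>e. 0 < e \<Longrightarrow> \<exists>N. \<forall>m\<ge>N. \<forall>n\<ge>N. norm_L2 T (\<lambda>t. x m t - x n t) \<le> e"
  obtains y where "y \<in> L2_space T" "(\<lambda>k. norm_L2 T (\<lambda>t. x k t - y t)) \<longlonglongrightarrow> 0"
proof -
  let ?M = "lebesgue_on {0<..<T}"
  obtain N where N: "\<And>k m n. m \<ge> N k \<Longrightarrow> n \<ge> N k \<Longrightarrow> norm_L2 T (\<lambda>t. x m t - x n t) \<le> (1/2) ^ k"
  proof -
    have "\<forall>k. \<exists>N. \<forall>m\<ge>N. \<forall>n\<ge>N. norm_L2 T (\<lambda>t. x m t - x n t) \<le> (1/2) ^ k"
      by (intro allI cauchy) simp
    then show ?thesis using that by (elim choice[THEN exE]) blast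
  qed
  \<comment> \<open>A monotone index sequence above both \<open>N\<close> and the identity.\<close>
  define r where "r k = (\<Sum>j\<le>k. N j) + k" for k
  have rN: "N k \<le> r k" for k 
  proof -
    have "N k \<le> (\<Sum>j\<le>k. N j)" by (rule member_le_sum) auto
    then show ?thesis by (simp add: r_def)
  qed
  have rmono: "r k \<le> r (Suc k)" for k by (simp add: r_def)
  have rk: "k \<le> r k" for k by (simp add: r_def)
  define d where "d k t = norm (x (r (Suc k)) t - x (r k) t)" for k t
  have xm [measurable]: "x k \<in> borel_measurable ?M" for k using L2_spaceD(1)[OF x] .
  have dint: "integrable ?M (d k)" "(LINT t|?M. d k t) \<le> sqrt T * (1/2) ^ k" for k
  proof -
    note l = L2_norm_integral_le[OF T L2_diff[OF x x], of "r (Suc k)" "r k"]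
    show "integrable ?M (d k)" unfolding d_def using l(1) by simp
    have "norm_L2 T (\<lambda>t. x (r (Suc k)) t - x (r k) t) \<le> (1/2) ^ k"
      using rN[of k] rmono[of k] by (intro N) auto
    then have "sqrt T * norm_L2 T (\<lambda>t. x (r (Suc k)) t - x (r k) t) \<le> sqrt T * (1/2) ^ k"
      using T by (intro mult_left_mono) auto
    then show "(LINT t|?M. d k t) \<le> sqrt T * (1/2) ^ k" unfolding d_def using l(2) by linarith
  qed
  have "summable (\<lambda>k. LINT t|?M. d k t)"
  proof (rule summable_comparison_test'[where N=0])
    show "summable (\<lambda>k. sqrt T * (1/2) ^ k :: real)" by (intro summable_mult summable_geometric) auto
    show "norm (LINT t|?M. d k t) \<le> sqrt T * (1/2) ^ k" for k
      using dint(2)[of k] by (simp add: d_def integral_nonneg_AE)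
  qed
  then have "(\<Sum>k. ennreal (LINT t|?M. d k t)) \<noteq> top"
    by (intro ennreal_suminf_neq_top) (auto simp: d_def)
  also have "(\<Sum>k. ennreal (LINT t|?M. d k t)) = (\<Sum>k. \<integral>\<^sup>+t. ennreal (d k t) \<partial>?M)"
    by (intro suminf_cong nn_integral_eq_integral[symmetric] dint) (auto simp: d_def)
  also have "\<dots> = (\<integral>\<^sup>+t. (\<Sum>k. ennreal (d k t)) \<partial>?M)"
    by (rule nn_integral_suminf[symmetric]) (simp add: d_def)
  finally have "AE t in ?M. (\<Sum>k. ennreal (d k t)) \<noteq> top"
    by (intro nn_integral_PInf_AE[unfolded infinity_ennreal_def]) (auto simp: d_def)
  then have conv: "AE t in ?M. (\<lambda>k. x (r k) t) \<longlonglongrightarrow> lim (\<lambda>k. x (r k) t)"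
  proof eventually_elim
    case (elim t)
    then have "summable (\<lambda>k. d k t)" by (intro summable_suminf_not_top) (auto simp: d_def)
    then have "summable (\<lambda>k. x (r (Suc k)) t - x (r k) t)"
      unfolding d_def by (rule summable_norm_cancel)
    then obtain l where l: "(\<lambda>n. \<Sum>k<n. x (r (Suc k)) t - x (r k) t) \<longlonglongrightarrow> l"
      by (auto simp: summable_def sums_def)
    have "(\<lambda>n. (\<Sum>k<n. x (r (Suc k)) t - x (r k) t) + x (r 0) t) \<longlonglongrightarrow> l + x (r 0) t"
      by (intro tendsto_add l tendsto_const)
    then have "(\<lambda>n. x (r n) t) \<longlonglongrightarrow> l + x (r 0) t" by (simp add: sum_lessThan_telescope[of "\<lambda>k. x (r k) t"])
    then show ?case by (simp add: limI)
  qed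
  define y where "y t = lim (\<lambda>k. x (r k) t)" for t
  have ym: "y \<in> borel_measurable ?M" unfolding y_def by (intro borel_measurable_lim_metric xm)
  have close: "y \<in> L2_space T \<and> norm_L2 T (\<lambda>t. x m t - y t) \<le> e"
    if e: "0 < e" and m: "\<And>m' n. m' \<ge> N' \<Longrightarrow> n \<ge> N' \<Longrightarrow> norm_L2 T (\<lambda>t. x m' t - x n t) \<le> e" "m \<ge> N'" for e m N'
  proof -
    have ev: "\<forall>\<^sub>F k in sequentially. norm_L2 T (\<lambda>t. x m t - x (r k) t) \<le> e"
      using m rk by (intro eventually_sequentiallyI[of N']) (meson order_trans)
    show ?thesis
      using L2_closed[OF x ym conv[folded y_def] x ev] e by auto
  qed
  obtain N1 where "\<And>m n. m \<ge> N1 \<Longrightarrow> n \<ge> N1 \<Longrightarrow> norm_L2 T (\<lambda>t. x m t - x n t) \<le> 1"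
    using cauchy[of 1] by auto
  then have yL: "y \<in> L2_space T" using close[of 1 N1 N1] by simp
  have "(\<lambda>k. norm_L2 T (\<lambda>t. x k t - y t)) \<longlonglongrightarrow> 0"
  proof (rule LIMSEQ_I)
    fix e :: real assume "0 < e"
    then obtain N' where "\<And>m n. m \<ge> N' \<Longrightarrow> n \<ge> N' \<Longrightarrow> norm_L2 T (\<lambda>t. x m t - x n t) \<le> e / 2"
      using cauchy[of "e / 2"] by auto
    then have "norm_L2 T (\<lambda>t. x n t - y t) \<le> e / 2" if "n \<ge> N'" for n
      using close[of "e / 2" N' n] \<open>0 < e\<close> that by simp
    then have "norm (norm_L2 T (\<lambda>t. x n t - y t) - 0) < e" if "n \<ge> N'" for n
      using that \<open>0 < e\<close> by fastforce
    then show "\<exists>no. \<forall>n\<ge>no. norm (norm_L2 T (\<lambda>t. x n t - y t) - 0) < e" by blast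
  qed
  with yL that show ?thesis by blast
qed

lemma L2_dominated_tendsto:
  fixes z :: "nat \<Rightarrow> real \<Rightarrow> 'a::euclidean_space"
  assumes z: "\<And>k. z k \<in> borel_measurable (lebesgue_on {0<..<T})" and x: "x \<in> borel_measurable (lebesgue_on {0<..<T})"
    and lim: "AE t in lebesgue_on {0<..<T}. (\<lambda>k. z k t) \<longlonglongrightarrow> x t"
    and w: "integrable (lebesgue_on {0<..<T}) w"
    and le: "\<And>k. AE t in lebesgue_on {0<..<T}. (norm (x t - z k t))\<^sup>2 \<le> w t"
  shows "(\<lambda>k. norm_L2 T (\<lambda>t. x t - z k t)) \<longlonglongrightarrow> 0"
proof -
  have "(\<lambda>k. LINT t|lebesgue_on {0<..<T}. (norm (x t - z k t))\<^sup>2) \<longlonglongrightarrow> (LINT t|lebesgue_on {0<..<T}. (0::real))"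
  proof (rule integral_dominated_convergence[OF _ _ w])
    show "AE t in lebesgue_on {0<..<T}. (\<lambda>k. (norm (x t - z k t))\<^sup>2) \<longlonglongrightarrow> 0"
      using lim
    proof eventually_elim
      case (elim t)
      have "(\<lambda>k. (norm (x t - z k t))\<^sup>2) \<longlonglongrightarrow> (norm (x t - x t))\<^sup>2" by (intro tendsto_intros elim)
      then show ?case by simp
    qed
  qed (use x z le in auto)
  from tendsto_real_sqrt[OF this] show ?thesis by (simp add: norm_L2_def)
qed

text \<open>Values are projected onto a large ball, which costs little by dominated convergence.
  Continuous functions converging almost everywhere to the bounded function exist by measurability;
  projecting them onto the same ball provides a constant majorant.\<close>

lemma L2_dense_continuous:
  fixes x :: "real \<Rightarrow> 'a::euclidean_space"
  assumes x: "x \<in> L2_space T" and e: "0 < e"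
  obtains c where "continuous_on UNIV c" "c \<in> L2_space T" "norm_L2 T (\<lambda>t. x t - c t) < e"
proof -
  let ?M = "lebesgue_on {0<..<T}"
  interpret finite_measure ?M by (rule finite_measure_lebesgue_on_interval)
  define cl :: "real \<Rightarrow> 'a \<Rightarrow> 'a" where "cl m v = closest_point (cball 0 m) v" for m v
  have clc: "continuous_on UNIV (cl m)" if "0 \<le> m" for m
    unfolding cl_def using that by (intro continuous_on_closest_point) auto
  have clb: "norm (cl m v) \<le> m" if "0 \<le> m" for m v
    using closest_point_in_set[of "cball 0 m" v] that by (auto simp: cl_def)
  have cld: "norm (v - cl m v) \<le> norm v" if "0 \<le> m" for m v
    using closest_point_le[of "cball 0 m" 0 v] that by (simp add: cl_def dist_norm)
  have cli: "cl m v = v" if "norm v \<le> m" for m v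
    unfolding cl_def using that by (intro closest_point_self) auto
  have xm [measurable]: "x \<in> borel_measurable ?M" by (rule L2_spaceD(1)[OF x])
  have clx [measurable]: "(\<lambda>t. cl m (x t)) \<in> borel_measurable ?M" if "0 \<le> m" for m
    by (rule borel_measurable_continuous_on[OF clc[OF that] xm])
  have "(\<lambda>k. norm_L2 T (\<lambda>t. x t - cl (real k) (x t))) \<longlonglongrightarrow> 0"
  proof (rule L2_dominated_tendsto[OF _ xm _ L2_spaceD(2)[OF x]])
    show "AE t in ?M. (\<lambda>k. cl (real k) (x t)) \<longlonglongrightarrow> x t"
    proof (rule AE_I2)
      fix t
      obtain k0 :: nat where "norm (x t) \<le> real k0" using real_arch_simple by blast
      then have "\<forall>\<^sub>F k in sequentially. cl (real k) (x t) = x t"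
        by (intro eventually_sequentiallyI[of k0] cli) simp
      then show "(\<lambda>k. cl (real k) (x t)) \<longlonglongrightarrow> x t" by (rule tendsto_eventually)
    qed
  qed (use clx cld in \<open>auto intro!: AE_I2 power_mono\<close>)
  then have "\<forall>\<^sub>F k in sequentially. norm_L2 T (\<lambda>t. x t - cl (real k) (x t)) < e / 2"
    using e by (intro order_tendstoD(2)[of _ 0]) auto
  then obtain k where k: "norm_L2 T (\<lambda>t. x t - cl (real k) (x t)) < e / 2"
    by (auto simp: eventually_sequentially)
  define m where "m = real k"
  have m0: "0 \<le> m" by (simp add: m_def)
  define b where "b t = cl m (x t)" for t
  have bm [measurable]: "b \<in> borel_measurable ?M" unfolding b_def using clx[OF m0] .
  have bL: "b \<in> L2_space T"
  proof (rule L2_space_bound(1)[OF bm x, of 2], rule AE_I2)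
    fix t
    show "norm (b t) \<le> 2 * norm (x t)"
      using norm_triangle_ineq4[of "x t" "x t - b t"] cld[OF m0, of "x t"] by (simp add: b_def)
  qed
  have "b measurable_on {0<..<T}" using bm by (simp add: measurable_on_iff_borel_measurable)
  then obtain N g where N: "negligible N" and g: "\<And>n. continuous_on UNIV (g n)"
      and lim: "\<And>t. t \<notin> N \<Longrightarrow> (\<lambda>n. g n t) \<longlonglongrightarrow> (if t \<in> {0<..<T} then b t else 0)"
    unfolding measurable_on_def by blast
  define c where "c n t = cl m (g n t)" for n t
  have cc: "continuous_on UNIV (c n)" for n
    unfolding c_def by (intro continuous_on_compose2[OF clc[OF m0] g]) auto
  have cL: "c n \<in> L2_space T" for n
    by (intro continuous_on_L2_space(2) continuous_on_subset[OF cc]) auto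
  have "(\<lambda>n. norm_L2 T (\<lambda>t. b t - c n t)) \<longlonglongrightarrow> 0"
  proof (rule L2_dominated_tendsto[OF _ bm])
    show "c n \<in> borel_measurable ?M" for n using L2_spaceD(1)[OF cL] .
    show "AE t in ?M. (\<lambda>n. c n t) \<longlonglongrightarrow> b t"
    proof -
      have "AE t in lebesgue. t \<notin> N"
        using N by (simp add: negligible_iff_null_sets AE_not_in)
      then have "AE t in ?M. t \<notin> N" by (auto simp: AE_restrict_space_iff elim: eventually_mono)
      moreover have "AE t in ?M. t \<in> {0<..<T}" by (intro AE_I2) (simp add: space_restrict_space)
      ultimately show ?thesis
      proof eventually_elim
        case (elim t)
        have "isCont (cl m) (b t)" using clc[OF m0] by (simp add: continuous_on_eq_continuous_at)
        moreover have "(\<lambda>n. g n t) \<longlonglongrightarrow> b t" using lim[OF elim(1)] elim(2) by simp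
        ultimately have "(\<lambda>n. cl m (g n t)) \<longlonglongrightarrow> cl m (b t)" by (rule isCont_tendsto_compose)
        moreover have "cl m (b t) = b t" by (rule cli) (simp add: b_def clb[OF m0])
        ultimately show ?case by (simp add: c_def)
      qed
    qed
    show "integrable ?M (\<lambda>t. (2 * m)\<^sup>2)" by simp
    show "AE t in ?M. (norm (b t - c n t))\<^sup>2 \<le> (2 * m)\<^sup>2" for n
    proof (intro AE_I2 power_mono)
      fix t
      have "norm (b t - c n t) \<le> norm (b t) + norm (c n t)" by (rule norm_triangle_ineq4)
      also have "\<dots> \<le> m + m" unfolding b_def c_def by (intro add_mono clb m0)
      finally show "norm (b t - c n t) \<le> 2 * m" by simp
    qed simp
  qed
  then have "\<forall>\<^sub>F n in sequentially. norm_L2 T (\<lambda>t. b t - c n t) < e / 2"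
    using e by (intro order_tendstoD(2)[of _ 0]) auto
  then obtain n where n: "norm_L2 T (\<lambda>t. b t - c n t) < e / 2" by (auto simp: eventually_sequentially)
  have "norm_L2 T (\<lambda>t. x t - c n t) < e"
    using norm_L2_triangle_diff[OF x bL cL[of n]] k n by (simp add: b_def m_def)
  with cc cL that show ?thesis by blast
qed

section \<open>Primitives of square integrable functions\<close>

text \<open>The bridge from the Lebesgue integral of the definitions to the gauge integral over the
  closed interval, for which the calculus of primitives is carried out.\<close>

lemma lebesgue_on_open_interval_integral:
  fixes f :: "real \<Rightarrow> 'a::euclidean_space"
  assumes f: "integrable (lebesgue_on {0<..<T}) f"
  shows "f absolutely_integrable_on {0..T}" "integral\<^sup>L (lebesgue_on {0<..<T}) f = integral {0..T} f"
proof -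
  have "f absolutely_integrable_on {0<..<T}"
    using f by (simp add: set_integrable_def integrable_restrict_space)
  then show "f absolutely_integrable_on {0..T}"
    by (rule absolutely_integrable_spike_set)
      (auto intro!: negligible_subset[OF negligible_finite[of "{0, T}"]])
  show "integral\<^sup>L (lebesgue_on {0<..<T}) f = integral {0..T} f"
    using lebesgue_integral_eq_integral[OF f] by (simp add: integral_open_interval_real)
qed

lemma L2_integral_bound:
  fixes y :: "real \<Rightarrow> 'a::euclidean_space"
  assumes T: "0 \<le> T" and y: "y \<in> L2_space T" and st: "0 \<le> s" "t \<le> T"
  shows "y integrable_on {s..t}" "(\<lambda>t. norm (y t)) integrable_on {s..t}"
    "norm (integral {s..t} y) \<le> sqrt T * norm_L2 T y"
proof -
  note i = L2_norm_integral_le[OF T y]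
  have abs: "y absolutely_integrable_on {0..T}"
    by (rule lebesgue_on_open_interval_integral[OF i(1)])
  then have n: "(\<lambda>t. norm (y t)) integrable_on {0..T}" "y integrable_on {0..T}"
    by (auto simp: absolutely_integrable_on_def)
  show yi: "y integrable_on {s..t}" and yn: "(\<lambda>t. norm (y t)) integrable_on {s..t}"
    using n st by (auto intro: integrable_on_subinterval)
  have "norm (integral {s..t} y) \<le> integral {s..t} (\<lambda>t. norm (y t))"
    by (rule integral_norm_bound_integral[OF yi yn]) simp
  also have "\<dots> \<le> integral {0..T} (\<lambda>t. norm (y t))"
    using st n(1) yn by (intro integral_subset_le) auto
  also have "\<dots> = (LINT t|lebesgue_on {0<..<T}. norm (y t))"
    by (rule lebesgue_on_open_interval_integral(2)[symmetric, OF integrable_norm[OF i(1)]])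
  also have "\<dots> \<le> sqrt T * norm_L2 T y" by (rule i(2))
  finally show "norm (integral {s..t} y) \<le> sqrt T * norm_L2 T y" .
qed

text \<open>The working form of H1: absolutely continuous with derivative \<open>y\<close> in L2. It
  names a derivative explicitly, whereas \<open>weak_deriv\<close> is a choice known only almost
  everywhere.\<close>

definition is_primitive :: "real \<Rightarrow> (real \<Rightarrow> 'a::euclidean_space) \<Rightarrow> (real \<Rightarrow> 'a) \<Rightarrow> bool" where
  "is_primitive T x y \<longleftrightarrow> y \<in> L2_space T \<and> (\<forall>t\<in>{0..T}. x t = x 0 + integral {0..t} y)"

lemma is_primitiveD:
  assumes "is_primitive T x y"
  shows "y \<in> L2_space T" "0 \<le> t \<Longrightarrow> t \<le> T \<Longrightarrow> x t = x 0 + integral {0..t} y"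
  using assms unfolding is_primitive_def by (blast, meson atLeastAtMost_iff)

lemma is_primitiveI:
  assumes "y \<in> L2_space T" "\<And>t. 0 \<le> t \<Longrightarrow> t \<le> T \<Longrightarrow> x t = x 0 + integral {0..t} y"
  shows "is_primitive T x y"
  using assms unfolding is_primitive_def by (meson atLeastAtMost_iff)

lemma is_primitive_continuous:
  assumes T: "0 \<le> T" and p: "is_primitive T x y"
  shows "continuous_on {0..T} x"
proof -
  have "continuous_on {0..T} (\<lambda>t. x 0 + integral {0..t} y)"
    using L2_integral_bound(1)[OF T is_primitiveD(1)[OF p], of 0 T] T
    by (intro continuous_intros indefinite_integral_continuous_1) auto
  then show ?thesis by (rule continuous_on_eq) (metis is_primitiveD(2)[OF p] atLeastAtMost_iff)
qed

lemma is_primitive_L2: "0 \<le> T \<Longrightarrow> is_primitive T x y \<Longrightarrow> x \<in> L2_space T"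
  by (rule continuous_on_L2_space(2)[OF is_primitive_continuous])

lemma is_primitive_add:
  assumes T: "0 \<le> T" and "is_primitive T x y" "is_primitive T x' y'"
  shows "is_primitive T (\<lambda>t. x t + x' t) (\<lambda>t. y t + y' t)"
proof -
  have L: "y \<in> L2_space T" "y' \<in> L2_space T" using assms is_primitiveD(1) by auto
  show ?thesis
  proof (rule is_primitiveI[OF L2_add[OF L]])
    fix t assume t: "0 \<le> t" "t \<le> T"
    have i: "y integrable_on {0..t}" "y' integrable_on {0..t}"
      using t by (auto intro: L2_integral_bound(1)[OF T] L)
    show "x t + x' t = x 0 + x' 0 + integral {0..t} (\<lambda>t. y t + y' t)"
      using is_primitiveD(2)[OF assms(2) t] is_primitiveD(2)[OF assms(3) t] integral_add[OF i] by simp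
  qed
qed

lemma is_primitive_scaleR:
  assumes "is_primitive T x y"
  shows "is_primitive T (\<lambda>t. c *\<^sub>R x t) (\<lambda>t. c *\<^sub>R y t)"
proof (rule is_primitiveI[OF L2_scaleR[OF is_primitiveD(1)[OF assms]]])
  fix t assume "0 \<le> t" "t \<le> T"
  from is_primitiveD(2)[OF assms this] have "c *\<^sub>R x t = c *\<^sub>R (x 0 + integral {0..t} y)" by (rule arg_cong)
  then show "c *\<^sub>R x t = c *\<^sub>R x 0 + integral {0..t} (\<lambda>t. c *\<^sub>R y t)" by (simp add: scaleR_add_right)
qed

lemma is_primitive_diff:
  assumes T: "0 \<le> T" and "is_primitive T x y" "is_primitive T x' y'"
  shows "is_primitive T (\<lambda>t. x t - x' t) (\<lambda>t. y t - y' t)"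
  using is_primitive_add[OF T assms(2) is_primitive_scaleR[OF assms(3), of "-1"]] by simp

lemma is_primitive_increment:
  assumes T: "0 \<le> T" and p: "is_primitive T x y" and st: "0 \<le> s" "s \<le> t" "t \<le> T"
  shows "x t - x s = integral {s..t} y"
proof -
  have "integral {0..s} y + integral {s..t} y = integral {0..t} y"
    using L2_integral_bound(1)[OF T is_primitiveD(1)[OF p], of 0 t] st
    by (intro Henstock_Kurzweil_Integration.integral_combine) auto
  then show ?thesis using is_primitiveD(2)[OF p, of s] is_primitiveD(2)[OF p, of t] st by (simp add: algebra_simps)
qed

lemma is_primitive_bound:
  assumes T: "0 \<le> T" and p: "is_primitive T x y" and t: "0 \<le> t" "t \<le> T"
  shows "norm (x t - x 0) \<le> sqrt T * norm_L2 T y"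
  using is_primitiveD(2)[OF p t] L2_integral_bound(3)[OF T is_primitiveD(1)[OF p], of 0 t] t by simp

lemma test_function_props:
  assumes "\<phi> \<in> test_functions T"
  shows "\<And>t. (\<phi> has_real_derivative deriv \<phi> t) (at t)" "continuous_on S \<phi>" "continuous_on S (deriv \<phi>)"
    "\<phi> 0 = 0" "\<phi> T = 0"
proof -
  have d: "((deriv ^^ k) \<phi>) differentiable (at t)" for k t
    using assms by (auto simp: test_functions_def)
  show der: "(\<phi> has_real_derivative deriv \<phi> t) (at t)" for t
    using d[of 0 t] by (simp add: DERIV_deriv_iff_real_differentiable)
  show "continuous_on S \<phi>" using der by (intro DERIV_atLeastAtMost_imp_continuous_on continuous_at_imp_continuous_on) (auto intro: DERIV_isCont)
  have "isCont (deriv \<phi>) t" for t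
    using d[of 1 t] by (simp add: differentiable_imp_continuous_within)
  then show "continuous_on S (deriv \<phi>)" by (simp add: continuous_at_imp_continuous_on)
  obtain a b where "0 < a" "a < b" "b < T" "\<And>t. t \<notin> {a..b} \<Longrightarrow> \<phi> t = 0"
    using assms by (auto simp: test_functions_def)
  then show "\<phi> 0 = 0" "\<phi> T = 0" by auto
qed

lemma L2_mult_continuous:
  fixes x :: "real \<Rightarrow> 'a::euclidean_space"
  assumes T: "0 \<le> T" and \<phi>: "continuous_on {0..T} \<phi>" and x: "x \<in> L2_space T"
  shows "(\<lambda>t. \<phi> t *\<^sub>R x t) \<in> L2_space T"
    and "0 \<le> c \<Longrightarrow> (\<And>t. t \<in> {0..T} \<Longrightarrow> \<bar>\<phi> t\<bar> \<le> c) \<Longrightarrow> norm (LINT t|lebesgue_on {0<..<T}. \<phi> t *\<^sub>R x t) \<le> c * sqrt T * norm_L2 T x"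
proof -
  have m: "(\<lambda>t. \<phi> t *\<^sub>R x t) \<in> borel_measurable (lebesgue_on {0<..<T})"
    by (intro borel_measurable_scaleR continuous_on_L2_space(1)[OF \<phi>] L2_spaceD(1)[OF x])
  have L: "(\<lambda>t. \<phi> t *\<^sub>R x t) \<in> L2_space T \<and> norm_L2 T (\<lambda>t. \<phi> t *\<^sub>R x t) \<le> c * norm_L2 T x"
    if "0 \<le> c" "\<And>t. t \<in> {0..T} \<Longrightarrow> \<bar>\<phi> t\<bar> \<le> c" for c
  proof -
    have "AE t in lebesgue_on {0<..<T}. norm (\<phi> t *\<^sub>R x t) \<le> c * norm (x t)"
      using that(2) by (intro AE_I2) (simp add: mult_right_mono space_restrict_space)
    from L2_space_bound[OF m x this] that(1) show ?thesis by blast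
  qed
  have "bounded (\<phi> ` {0..T})" using \<phi> by (intro compact_imp_bounded compact_continuous_image) auto
  then obtain b where "0 < b" "\<And>t. t \<in> {0..T} \<Longrightarrow> norm (\<phi> t) \<le> b" by (auto simp: bounded_pos)
  with L[of b] show L1: "(\<lambda>t. \<phi> t *\<^sub>R x t) \<in> L2_space T" by simp
  assume c: "0 \<le> c" "\<And>t. t \<in> {0..T} \<Longrightarrow> \<bar>\<phi> t\<bar> \<le> c"
  have "norm (LINT t|lebesgue_on {0<..<T}. \<phi> t *\<^sub>R x t) \<le> sqrt T * norm_L2 T (\<lambda>t. \<phi> t *\<^sub>R x t)"
    using L2_norm_integral_le[OF T L1] integral_norm_bound[of "lebesgue_on {0<..<T}" "\<lambda>t. \<phi> t *\<^sub>R x t"] by linarith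
  also have "\<dots> \<le> sqrt T * (c * norm_L2 T x)" using L[OF c] T by (intro mult_left_mono) auto
  finally show "norm (LINT t|lebesgue_on {0<..<T}. \<phi> t *\<^sub>R x t) \<le> c * sqrt T * norm_L2 T x" by (simp add: mult_ac)
qed

text \<open>Integration by parts; the boundary terms vanish because a test function is zero at 0 and
  at \<open>T\<close>.\<close>

lemma weak_deriv_continuous:
  fixes x y :: "real \<Rightarrow> 'a::euclidean_space"
  assumes T: "0 \<le> T" and p: "is_primitive T x y" and y: "continuous_on {0..T} y" and \<phi>: "\<phi> \<in> test_functions T"
  shows "(LINT t|lebesgue_on {0<..<T}. deriv \<phi> t *\<^sub>R x t) = - (LINT t|lebesgue_on {0<..<T}. \<phi> t *\<^sub>R y t)"
proof -
  note tf = test_function_props[OF \<phi>]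
  have xL: "x \<in> L2_space T" by (rule is_primitive_L2[OF T p])
  note i1 = L2_norm_integral_le(1)[OF T L2_mult_continuous(1)[OF T tf(3) xL]]
  note i2 = L2_norm_integral_le(1)[OF T L2_mult_continuous(1)[OF T tf(2) is_primitiveD(1)[OF p]]]
  have "((\<lambda>t. deriv \<phi> t *\<^sub>R x t + \<phi> t *\<^sub>R y t) has_integral \<phi> T *\<^sub>R x T - \<phi> 0 *\<^sub>R x 0) {0..T}"
  proof (rule fundamental_theorem_of_calculus_interior[OF T])
    show "continuous_on {0..T} (\<lambda>t. \<phi> t *\<^sub>R x t)"
      by (intro continuous_intros tf is_primitive_continuous[OF T p])
    fix t assume t: "t \<in> {0<..<T}"
    have "((\<lambda>t. integral {0..t} y) has_vector_derivative y t) (at t within {0..T})"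
      using t by (intro integral_has_vector_derivative y) auto
    then have "((\<lambda>t. x 0 + integral {0..t} y) has_vector_derivative y t) (at t)"
      using t by (simp add: at_within_Icc_at has_vector_derivative_add_const add.commute[of "x 0"])
    then have "(x has_vector_derivative y t) (at t)"
      by (rule has_vector_derivative_transform_within_open[where S="{0<..<T}"])
        (use t is_primitiveD(2)[OF p, symmetric] in auto)
    then show "((\<lambda>t. \<phi> t *\<^sub>R x t) has_vector_derivative deriv \<phi> t *\<^sub>R x t + \<phi> t *\<^sub>R y t) (at t)"
      using has_vector_derivative_scaleR[OF tf(1)] by (simp add: add.commute)
  qed
  then have "integral {0..T} (\<lambda>t. deriv \<phi> t *\<^sub>R x t + \<phi> t *\<^sub>R y t) = 0"
    using tf(4,5) by (simp add: integral_unique)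
  then have "(LINT t|lebesgue_on {0<..<T}. deriv \<phi> t *\<^sub>R x t + \<phi> t *\<^sub>R y t) = 0"
    using lebesgue_on_open_interval_integral(2)[OF Bochner_Integration.integrable_add[OF i1 i2]] by simp
  then show ?thesis using i1 i2 by (simp add: eq_neg_iff_add_eq_0)
qed

text \<open>The derivative need not be continuous, so the product rule is applied to a continuous L2
  approximation. The functional \<open>I\<close> measuring the failure of the identity is linear and
  bounded in the L2 error of the derivative, hence zero.\<close>

lemma is_primitive_has_weak_deriv:
  fixes x y :: "real \<Rightarrow> 'a::euclidean_space"
  assumes T: "0 \<le> T" and p: "is_primitive T x y"
  shows "has_weak_deriv T x y"
  unfolding has_weak_deriv_def
proof
  fix \<phi> assume \<phi>: "\<phi> \<in> test_functions T"
  note tf = test_function_props[OF \<phi>]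
  have yL: "y \<in> L2_space T" by (rule is_primitiveD(1)[OF p])
  have "bounded (\<phi> ` {0..T} \<union> deriv \<phi> ` {0..T})"
    by (intro compact_imp_bounded compact_Un compact_continuous_image tf) auto
  then obtain c where c: "0 < c" "\<And>t. t \<in> {0..T} \<Longrightarrow> \<bar>\<phi> t\<bar> \<le> c \<and> \<bar>deriv \<phi> t\<bar> \<le> c" 
    by (auto simp: bounded_pos)
  define I where "I x y = (LINT t|lebesgue_on {0<..<T}. deriv \<phi> t *\<^sub>R x t) + (LINT t|lebesgue_on {0<..<T}. \<phi> t *\<^sub>R y t)"
    for x y :: "real \<Rightarrow> 'a"
  define C where "C = c * sqrt T * (T + 1)"
  have C: "0 \<le> C" using c T by (simp add: C_def)
  have bnd: "norm (I x y) \<le> C * e" if e: "0 < e" for e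
  proof -
    obtain z where z: "continuous_on UNIV z" "z \<in> L2_space T" "norm_L2 T (\<lambda>t. y t - z t) < e"
      using L2_dense_continuous[OF yL e] .
    have zc: "continuous_on {0..T} z" using z(1) by (rule continuous_on_subset) simp
    define w where "w t = x 0 + integral {0..t} z" for t
    have pw: "is_primitive T w z" using z by (intro is_primitiveI) (simp_all add: w_def)
    have wL: "w \<in> L2_space T" and xL: "x \<in> L2_space T" using is_primitive_L2[OF T] pw p by auto
    have Iw: "I w z = 0" unfolding I_def using weak_deriv_continuous[OF T pw zc \<phi>] by simp
    note d = is_primitive_diff[OF T p pw]
    have xw: "norm_L2 T (\<lambda>t. x t - w t) \<le> T * norm_L2 T (\<lambda>t. y t - z t)"
    proof -
      have "norm_L2 T (\<lambda>t. x t - w t) \<le> (sqrt T * norm_L2 T (\<lambda>t. y t - z t)) * sqrt T"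
      proof (rule L2_space_bounded(2)[OF T L2_spaceD(1)[OF L2_diff[OF xL wL]]])
        show "norm (x t - w t) \<le> sqrt T * norm_L2 T (\<lambda>t. y t - z t)" if "0 < t" "t < T" for t
          using is_primitive_bound[OF T d, of t] that by (simp add: w_def)
      qed (use T in simp)
      also have "\<dots> = (sqrt T * sqrt T) * norm_L2 T (\<lambda>t. y t - z t)" by (simp only: mult_ac)
      finally show ?thesis using T by simp
    qed
    have "I x y = I (\<lambda>t. x t - w t) (\<lambda>t. y t - z t)"
    proof -
      have *: "integrable (lebesgue_on {0<..<T}) (\<lambda>t. deriv \<phi> t *\<^sub>R v t)" "integrable (lebesgue_on {0<..<T}) (\<lambda>t. \<phi> t *\<^sub>R v t)"
        if "v \<in> L2_space T" for v :: "real \<Rightarrow> 'a"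
        by (intro L2_norm_integral_le(1)[OF T] L2_mult_continuous(1)[OF T] tf that)+
      have "I (\<lambda>t. x t - w t) (\<lambda>t. y t - z t) = I x y - I w z"
        unfolding I_def scaleR_diff_right using * xL wL yL z(2) by simp
      then show ?thesis using Iw by simp
    qed
    also have "norm \<dots> \<le> c * sqrt T * norm_L2 T (\<lambda>t. x t - w t) + c * sqrt T * norm_L2 T (\<lambda>t. y t - z t)"
      unfolding I_def using c L2_diff[OF xL wL] L2_diff[OF yL z(2)]
      by (intro norm_triangle_mono L2_mult_continuous(2)[OF T] tf) auto
    also have "\<dots> \<le> c * sqrt T * (T * norm_L2 T (\<lambda>t. y t - z t)) + c * sqrt T * norm_L2 T (\<lambda>t. y t - z t)"
      using c T by (intro add_mono mult_left_mono xw) auto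
    also have "\<dots> = C * norm_L2 T (\<lambda>t. y t - z t)" by (simp add: C_def algebra_simps)
    also have "\<dots> \<le> C * e" using C z(3) by (intro mult_left_mono) auto
    finally show ?thesis .
  qed
  have *: "norm (I x y) \<le> C * (e / (C + 1))" if "0 < e" for e
    by (rule bnd) (use that C in simp)
  have "norm (I x y) \<le> 0 + e" if e: "0 < e" for e
  proof -
    have "C * e \<le> e * (C + 1)" using C e by (simp add: algebra_simps)
    then have "C * (e / (C + 1)) \<le> e" using C by (simp add: pos_divide_le_eq)
    then show ?thesis using *[OF e] by simp
  qed
  then have "norm (I x y) \<le> 0" by (rule field_le_epsilon)
  then show "(LINT t|lebesgue_on {0<..<T}. deriv \<phi> t *\<^sub>R x t) = - (LINT t|lebesgue_on {0<..<T}. \<phi> t *\<^sub>R y t)"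
    by (simp add: I_def eq_neg_iff_add_eq_0)
qed

lemma is_primitive_H1:
  assumes "0 \<le> T" "is_primitive T x y"
  shows "x \<in> H1_space T"
  unfolding H1_space_def mem_Collect_eq
  using is_primitive_L2[OF assms] is_primitive_continuous[OF assms] is_primitiveD(1)[OF assms(2)]
    is_primitive_has_weak_deriv[OF assms] by (intro conjI bexI[of _ y])

section \<open>Smooth bump functions and the converse for weak derivatives\<close>

text \<open>The polynomial parameter makes the family closed under differentiation: with
  \<open>u = 1 / s\<close>, the derivative of \<open>p(u) exp(-u)\<close> in \<open>s\<close> is
  \<open>u^2 (p(u) - p'(u)) exp(-u)\<close>. The value 0 on the left half line is the smooth
  continuation.\<close>

definition expbump :: "real poly \<Rightarrow> real \<Rightarrow> real" where
  "expbump p s = (if 0 < s then poly p (1 / s) * exp (- (1 / s)) else 0)"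

lemma poly_times_exp_tendsto_0: "((\<lambda>u. poly q u * exp (- u)) \<longlongrightarrow> 0) (at_top :: real filter)"
proof -
  have "((\<lambda>u. \<Sum>i\<le>degree q. coeff q i * (u ^ i / exp u)) \<longlongrightarrow> (\<Sum>i\<le>degree q. coeff q i * 0)) at_top"
    by (intro tendsto_sum tendsto_mult tendsto_const tendsto_power_div_exp_0)
  moreover have "(\<Sum>i\<le>degree q. coeff q i * (u ^ i / exp u)) = poly q u * exp (- u)" for u
    by (simp add: poly_altdef sum_distrib_right exp_minus divide_inverse mult.assoc)
  ultimately show ?thesis by simp
qed

lemma expbump_deriv: "(expbump p has_real_derivative expbump ([:0, 0, 1:] * (p - pderiv p)) s) (at s)"
proof -
  consider "0 < s" | "s < 0" | "s = 0" by linarith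
  then show ?thesis
  proof cases
    case 1
    have "((\<lambda>s. poly p (1 / s) * exp (- (1 / s))) has_real_derivative
        poly (pderiv p) (1 / s) * (- (1 / s\<^sup>2)) * exp (- (1 / s)) + poly p (1 / s) * (exp (- (1 / s)) * (1 / s\<^sup>2))) (at s)"
      using 1 by (auto intro!: derivative_eq_intros poly_DERIV[THEN DERIV_chain2] simp: power2_eq_square divide_inverse)
    also have "poly (pderiv p) (1 / s) * (- (1 / s\<^sup>2)) * exp (- (1 / s)) + poly p (1 / s) * (exp (- (1 / s)) * (1 / s\<^sup>2))
        = expbump ([:0, 0, 1:] * (p - pderiv p)) s"
      using 1 by (simp add: expbump_def power2_eq_square algebra_simps)
    finally show ?thesis
      by (rule has_field_derivative_transform_within_open[where S="{0<..}"]) (use 1 in \<open>auto simp: expbump_def\<close>)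
  next
    case 2
    have "((\<lambda>s. 0) has_real_derivative 0) (at s)" by simp
    then have "(expbump p has_real_derivative 0) (at s)"
      by (rule has_field_derivative_transform_within_open[where S="{..<0}"]) (use 2 in \<open>auto simp: expbump_def\<close>)
    then show ?thesis using 2 by (simp add: expbump_def)
  next
    \<comment> \<open>At the gluing point the right difference quotient is again a polynomial in
      \<open>1 / h\<close> times \<open>exp (- 1 / h)\<close>, which tends to 0; the left one is
      constantly 0.\<close>
    case 3
    have r: "((\<lambda>h. expbump p h / h) \<longlongrightarrow> 0) (at_right 0)"
    proof -
      have "((\<lambda>h. poly (p * [:0, 1:]) (inverse h) * exp (- inverse h)) \<longlongrightarrow> 0) (at_right 0)"
        by (rule filterlim_compose[OF poly_times_exp_tendsto_0 filterlim_inverse_at_top_right])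
      then show ?thesis
        by (rule Lim_transform_eventually)
          (auto simp: eventually_at_right_less expbump_def divide_inverse intro!: eventually_mono[OF eventually_at_right_less])
    qed
    have l: "((\<lambda>h. expbump p h / h) \<longlongrightarrow> 0) (at_left 0)"
      by (rule tendsto_eventually)
        (auto simp: expbump_def eventually_at_filter intro!: always_eventually)
    show ?thesis using filterlim_split_at_real[OF l r] 3
      by (simp add: has_field_derivative_iff expbump_def)
  qed
qed

text \<open>Test functions are defined through iterates of \<open>deriv\<close>. A class closed
  under \<open>deriv\<close> all of whose members are differentiable gives every order at once by
  induction.\<close>

inductive bump_sum :: "(real \<Rightarrow> real) \<Rightarrow> bool" where
  product: "bump_sum (\<lambda>t. expbump p (t - a) * expbump q (b - t))"
| add: "bump_sum f \<Longrightarrow> bump_sum g \<Longrightarrow> bump_sum (\<lambda>t. f t + g t)"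

lemma bump_sum_deriv: "bump_sum f \<Longrightarrow> bump_sum (deriv f) \<and> (\<forall>t. (f has_real_derivative deriv f t) (at t))"
proof (induction rule: bump_sum.induct)
  case (product p a q b)
  define p' q' where "p' = [:0, 0, 1:] * (p - pderiv p)" and "q' = [:0, 0, 1:] * (q - pderiv q)"
  let ?g = "\<lambda>t. expbump p' (t - a) * expbump q (b - t) + expbump p (t - a) * expbump (- q') (b - t)"
  have neg: "expbump (- r) s = - expbump r s" for r s by (simp add: expbump_def)
  have d: "((\<lambda>t. expbump p (t - a) * expbump q (b - t)) has_real_derivative ?g t) (at t)" for t
  proof -
    have "((\<lambda>t. expbump p (t - a)) has_real_derivative expbump p' (t - a) * 1) (at t)"
      unfolding p'_def by (rule DERIV_chain2[OF expbump_deriv]) (auto intro!: derivative_eq_intros)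
    moreover have "((\<lambda>t. expbump q (b - t)) has_real_derivative expbump q' (b - t) * (- 1)) (at t)"
      unfolding q'_def by (rule DERIV_chain2[OF expbump_deriv]) (auto intro!: derivative_eq_intros)
    ultimately have "((\<lambda>t. expbump p (t - a) * expbump q (b - t)) has_real_derivative
        (expbump p' (t - a) * 1) * expbump q (b - t) + (expbump q' (b - t) * (- 1)) * expbump p (t - a)) (at t)"
      by (rule DERIV_mult)
    then show ?thesis by (simp add: neg mult.commute)
  qed
  have eq: "deriv (\<lambda>t. expbump p (t - a) * expbump q (b - t)) = ?g" by (intro ext DERIV_imp_deriv d)
  have "bump_sum ?g" by (intro bump_sum.intros)
  then show ?case unfolding eq using d by blast
next
  case (add f g)
  then have d: "((\<lambda>t. f t + g t) has_real_derivative deriv f t + deriv g t) (at t)" for t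
    by (auto intro: derivative_intros)
  have eq: "deriv (\<lambda>t. f t + g t) = (\<lambda>t. deriv f t + deriv g t)" by (intro ext DERIV_imp_deriv d)
  have "bump_sum (\<lambda>t. deriv f t + deriv g t)" using add by (intro bump_sum.add) auto
  then show ?case unfolding eq using d by blast
qed

lemma bump_sum_smooth: "bump_sum f \<Longrightarrow> bump_sum ((deriv ^^ k) f)"
  by (induction k) (auto simp: bump_sum_deriv)

lemma bump_sum_differentiable: "bump_sum f \<Longrightarrow> ((deriv ^^ k) f) differentiable (at t)"
  using bump_sum_deriv[OF bump_sum_smooth] real_differentiable_def by blast

definition bump :: "real \<Rightarrow> real \<Rightarrow> real" where
  "bump r t = expbump 1 (t + r) * expbump 1 (r - t)"

lemma bump_props:
  assumes r: "0 < r"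
  shows "0 \<le> bump r t" "r \<le> \<bar>t\<bar> \<Longrightarrow> bump r t = 0" "0 < bump r 0" "continuous_on S (bump r)"
    and bump_sum_shift: "bump_sum (\<lambda>t. bump r (t - a))" "bump_sum (\<lambda>t. - bump r (t - a))"
proof -
  show "0 \<le> bump r t" "r \<le> \<bar>t\<bar> \<Longrightarrow> bump r t = 0" "0 < bump r 0"
    using r by (auto simp: bump_def expbump_def)
  \<comment> \<open>The class \<open>bump_sum\<close> has no rule for scaling, so the minus sign is
    carried by the polynomial.\<close>
  have *: "expbump (- 1) s = - expbump 1 s" for s by (simp add: expbump_def)
  show sh: "bump_sum (\<lambda>t. bump r (t - a))" for a
    using bump_sum.product[of 1 "a - r" 1 "a + r"] by (simp add: bump_def[abs_def] algebra_simps)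
  show "bump_sum (\<lambda>t. - bump r (t - a))" for a
    using bump_sum.product[of "-1" "a - r" 1 "a + r"] by (simp add: bump_def[abs_def] algebra_simps *)
  have "isCont (bump r) t" for t
    using bump_sum_deriv[OF sh[of 0]] by (auto intro: DERIV_isCont)
  then show "continuous_on S (bump r)" by (simp add: continuous_at_imp_continuous_on)
qed

text \<open>The lower limit lies strictly left of the support, so that the fundamental theorem also
  applies at \<open>- r\<close> as an interior point.\<close>

definition bump_primitive :: "real \<Rightarrow> real \<Rightarrow> real" where
  "bump_primitive r t = integral {- r - 1..t} (bump r)"

lemma bump_primitive_props:
  assumes r: "0 < r"
  shows "(bump_primitive r has_real_derivative bump r t) (at t)"
    "t \<le> - r \<Longrightarrow> bump_primitive r t = 0" "r \<le> t \<Longrightarrow> bump_primitive r t = bump_primitive r r" "0 < bump_primitive r r"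
proof -
  note b = bump_props[OF r]
  have int: "bump r integrable_on {a..b}" for a b by (rule integrable_continuous_real[OF b(4)])
  show low: "bump_primitive r t = 0" if "t \<le> - r" for t
  proof -
    have "integral {- r - 1..t} (bump r) = integral {- r - 1..t} (\<lambda>_. 0)"
      using that r by (intro integral_cong b(2)) auto
    then show ?thesis by (simp add: bump_primitive_def)
  qed
  show "(bump_primitive r has_real_derivative bump r t) (at t)" for t
  proof (cases "t < - r")
    case True
    have "((\<lambda>t. 0) has_real_derivative 0) (at t)" by simp
    then have "(bump_primitive r has_real_derivative 0) (at t)"
      by (rule has_field_derivative_transform_within_open[where S="{..<- r}"]) (use True low in auto)
    then show ?thesis using b(2)[of t] True r by simp
  next
    case False
    have "((\<lambda>t. integral {- r - 1..t} (bump r)) has_real_derivative bump r t) (at t within {- r - 1..t + 1})"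
      using False r by (intro integral_has_real_derivative b(4)) auto
    then show ?thesis using False r
      by (simp add: at_within_Icc_at bump_primitive_def[abs_def])
  qed
  show "bump_primitive r t = bump_primitive r r" if "r \<le> t"
  proof -
    have "bump_primitive r r + integral {r..t} (bump r) = bump_primitive r t"
      unfolding bump_primitive_def using that r int by (intro Henstock_Kurzweil_Integration.integral_combine) auto
    moreover have "integral {r..t} (bump r) = integral {r..t} (\<lambda>_. 0)"
      using that r by (intro integral_cong b(2)) auto
    ultimately show ?thesis by simp
  qed
  have "bump_primitive r r \<noteq> 0"
  proof
    assume "bump_primitive r r = 0"
    then have "\<forall>t\<in>{- r - 1..r}. bump r t = 0"
      unfolding bump_primitive_def using r b(1,4) by (subst (asm) integral_eq_0_iff) auto
    with b(3) r show False by (auto dest: bspec[of _ _ 0])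
  qed
  moreover have "0 \<le> bump_primitive r r"
    unfolding bump_primitive_def by (intro integral_nonneg int b(1))
  ultimately show "0 < bump_primitive r r" by simp
qed

text \<open>Each primitive is constant to the right of its bump, with the same plateau; the
  difference therefore vanishes beyond both bumps and has compact support.\<close>

lemma bump_difference_test_function:
  assumes r: "0 < r" and ab: "r < a" "a < b" "b + r < T"
  defines "\<phi> \<equiv> \<lambda>t. bump_primitive r (t - a) - bump_primitive r (t - b)"
  shows "\<phi> \<in> test_functions T" "deriv \<phi> = (\<lambda>t. bump r (t - a) - bump r (t - b))"
proof -
  note p = bump_primitive_props[OF r]
  have d: "(\<phi> has_real_derivative bump r (t - a) - bump r (t - b)) (at t)" for t
    unfolding \<phi>_def
    by (intro derivative_intros DERIV_chain2[OF p(1), where g="\<lambda>t. t - _" and Db=1, simplified])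
      (auto intro!: derivative_eq_intros)
  then show dd: "deriv \<phi> = (\<lambda>t. bump r (t - a) - bump r (t - b))" by (auto intro: DERIV_imp_deriv)
  have s: "bump_sum (deriv \<phi>)"
    unfolding dd using bump_sum.add[OF bump_sum_shift(1)[OF r, of a] bump_sum_shift(2)[OF r, of b]] by simp
  have smooth: "((deriv ^^ k) \<phi>) differentiable (at t)" for k t
  proof (cases k)
    case 0
    then show ?thesis using d[of t] by (auto simp: real_differentiable_def)
  next
    case (Suc j)
    then show ?thesis using bump_sum_differentiable[OF s, of j t] by (simp add: funpow_swap1)
  qed
  have "\<phi> t = 0" if "t \<notin> {a - r..b + r}" for t
  proof (cases "t < a - r")
    case True
    then show ?thesis using ab by (simp add: \<phi>_def p(2))
  next
    case False
    then have "r \<le> t - a" "r \<le> t - b" using that ab by auto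
    then show ?thesis using p(3)[of "t - a"] p(3)[of "t - b"] by (simp add: \<phi>_def)
  qed
  moreover have "0 < a - r" "a - r < b + r" "b + r < T" using r ab by auto
  ultimately show "\<phi> \<in> test_functions T" using smooth unfolding test_functions_def by blast
qed

text \<open>Du Bois-Reymond: differences of bumps around two points are derivatives of test functions.\<close>

lemma weak_deriv_zero_imp_constant:
  fixes d :: "real \<Rightarrow> 'a::euclidean_space"
  assumes T: "0 < T" and d: "continuous_on {0..T} d"
    and zero: "\<And>\<phi>. \<phi> \<in> test_functions T \<Longrightarrow> (LINT t|lebesgue_on {0<..<T}. deriv \<phi> t *\<^sub>R d t) = 0"
    and t: "t \<in> {0..T}"
  shows "d t = d 0"
proof -
  have interior: "d a = d b" if ab: "0 < a" "a < b" "b < T" for a b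
  proof -
    have "dist (d a) (d b) \<le> 0 + e" if e: "0 < e" for e
    proof -
      have at: "\<exists>r>0. \<forall>s\<in>{0..T}. \<bar>s - c\<bar> < r \<longrightarrow> dist (d c) (d s) \<le> e / 2" if c: "c \<in> {0..T}" for c
        using d c e unfolding continuous_on_iff
        by (metis dist_commute dist_real_def half_gt_zero less_imp_le)
      obtain ra where ra: "0 < ra" "\<And>s. s \<in> {0..T} \<Longrightarrow> \<bar>s - a\<bar> < ra \<Longrightarrow> dist (d a) (d s) \<le> e / 2"
        using at[of a] ab by auto
      obtain rb where rb: "0 < rb" "\<And>s. s \<in> {0..T} \<Longrightarrow> \<bar>s - b\<bar> < rb \<Longrightarrow> dist (d b) (d s) \<le> e / 2"
        using at[of b] ab by auto
      \<comment> \<open>Small enough for continuity at both points and for both bumps to stay inside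
        the open interval.\<close>
      define r where "r = min (min ra rb) (min (a / 2) ((T - b) / 2))"
      have rle: "r \<le> a / 2" "r \<le> (T - b) / 2"
        unfolding r_def by (rule min.coboundedI2, rule min.cobounded1, rule min.coboundedI2, rule min.cobounded2)
      have r: "0 < r" "r \<le> ra" "r \<le> rb" using ra(1) rb(1) ab by (simp_all add: r_def)
      have rab: "r < a" "b + r < T" using rle ab by (simp_all add: field_simps)
      define m where "m = bump_primitive r r"
      have m: "0 < m" unfolding m_def by (rule bump_primitive_props(4)[OF r(1)])
      note td = bump_difference_test_function[OF r(1) rab(1) ab(2) rab(2)]
      have contb: "continuous_on {0..T} (\<lambda>t. bump r (t - c))" for c
        by (intro continuous_on_compose2[OF bump_props(4)[OF r(1), of UNIV]] continuous_intros) auto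
      have ci: "(\<lambda>t. bump r (t - c) *\<^sub>R v t) integrable_on {0..T}" if "continuous_on {0..T} v" for c and v :: "real \<Rightarrow> 'a"
        by (intro integrable_continuous_real continuous_intros contb that)
      have cL: "(\<lambda>t. bump r (t - a) *\<^sub>R d t - bump r (t - b) *\<^sub>R d t) \<in> L2_space T"
        by (intro continuous_on_L2_space(2) continuous_intros contb d)
      have "integral {0..T} (\<lambda>t. bump r (t - a) *\<^sub>R d t - bump r (t - b) *\<^sub>R d t) = 0"
        using zero[OF td(1)] unfolding td(2)
        by (subst lebesgue_on_open_interval_integral(2)[symmetric, OF L2_norm_integral_le(1)[OF less_imp_le[OF T] cL]])
          (simp add: scaleR_diff_left)
      then have eq: "integral {0..T} (\<lambda>t. bump r (t - a) *\<^sub>R d t) = integral {0..T} (\<lambda>t. bump r (t - b) *\<^sub>R d t)"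
        by (subst (asm) integral_diff) (auto intro: ci d)
      have mass: "((\<lambda>t. bump r (t - c)) has_integral m) {0..T}" if c: "r < c" "c + r < T" for c
      proof -
        have "((\<lambda>t. bump r (t - c)) has_integral bump_primitive r (T - c) - bump_primitive r (0 - c)) {0..T}"
        proof (rule fundamental_theorem_of_calculus)
          fix x assume "x \<in> {0..T}"
          have "((\<lambda>t. bump_primitive r (t - c)) has_real_derivative bump r (x - c) * 1) (at x within {0..T})"
            by (rule DERIV_chain2[OF bump_primitive_props(1)[OF r(1)]]) (auto intro!: derivative_eq_intros)
          then show "((\<lambda>t. bump_primitive r (t - c)) has_vector_derivative bump r (x - c)) (at x within {0..T})"
            by (simp add: has_real_derivative_iff_has_vector_derivative)
        qed (use T in simp)
        moreover have "bump_primitive r (T - c) = m" "bump_primitive r (0 - c) = 0"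
          using c r(1) bump_primitive_props(3)[OF r(1), of "T - c"] bump_primitive_props(2)[OF r(1), of "0 - c"] by (auto simp: m_def)
        ultimately show ?thesis by simp
      qed
      \<comment> \<open>Averaging \<open>d\<close> against a bump of mass \<open>m\<close> around
        \<open>c\<close> reproduces \<open>m\<close> times \<open>d c\<close> up to the local
        oscillation; the two averages agree by hypothesis.\<close>
      have near: "norm (integral {0..T} (\<lambda>t. bump r (t - c) *\<^sub>R d t) - m *\<^sub>R d c) \<le> m * (e / 2)"
        if c: "r < c" "c + r < T" "\<And>s. s \<in> {0..T} \<Longrightarrow> \<bar>s - c\<bar> < r \<Longrightarrow> dist (d c) (d s) \<le> e / 2" for c
      proof -
        have "m *\<^sub>R d c = integral {0..T} (\<lambda>t. bump r (t - c) *\<^sub>R d c)"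
          using has_integral_scaleR_left[OF mass[OF c(1,2)], of "d c"] by (simp add: integral_unique)
        then have "integral {0..T} (\<lambda>t. bump r (t - c) *\<^sub>R d t) - m *\<^sub>R d c = integral {0..T} (\<lambda>t. bump r (t - c) *\<^sub>R d t - bump r (t - c) *\<^sub>R d c)"
          by (simp add: integral_diff ci d continuous_on_const)
        also have "norm \<dots> \<le> integral {0..T} (\<lambda>t. bump r (t - c) * (e / 2))"
        proof (rule integral_norm_bound_integral)
          show "(\<lambda>t. bump r (t - c) *\<^sub>R d t - bump r (t - c) *\<^sub>R d c) integrable_on {0..T}"
            by (intro integrable_diff ci d continuous_on_const)
          show "(\<lambda>t. bump r (t - c) * (e / 2)) integrable_on {0..T}"
            by (intro integrable_continuous_real continuous_intros contb)
          fix s assume s: "s \<in> {0..T}"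
          show "norm (bump r (s - c) *\<^sub>R d s - bump r (s - c) *\<^sub>R d c) \<le> bump r (s - c) * (e / 2)"
          proof (cases "\<bar>s - c\<bar> < r")
            case True
            have "norm (bump r (s - c) *\<^sub>R d s - bump r (s - c) *\<^sub>R d c) = bump r (s - c) * dist (d c) (d s)"
              using bump_props(1)[OF r(1), of "s - c"]
              by (simp add: scaleR_diff_right[symmetric] dist_norm norm_minus_commute)
            also have "\<dots> \<le> bump r (s - c) * (e / 2)"
              by (intro mult_left_mono c(3)[OF s True] bump_props(1)[OF r(1)])
            finally show ?thesis .
          next
            case False
            then show ?thesis using bump_props(2)[OF r(1), of "s - c"] by simp
          qed
        qed
        also have "\<dots> = m * (e / 2)"
          using has_integral_mult_left[OF mass[OF c(1,2)], of "e / 2"] by (rule integral_unique)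
        finally show ?thesis .
      qed
      have "norm (m *\<^sub>R d a - m *\<^sub>R d b) \<le> m * (e / 2) + m * (e / 2)"
      proof -
        let ?I = "integral {0..T} (\<lambda>t. bump r (t - a) *\<^sub>R d t)"
        have "norm (?I - m *\<^sub>R d a) \<le> m * (e / 2)" using r rab ab ra by (intro near) auto
        moreover have "norm (?I - m *\<^sub>R d b) \<le> m * (e / 2)" unfolding eq using r rab ab rb by (intro near) auto
        moreover have "norm (m *\<^sub>R d a - m *\<^sub>R d b) \<le> norm (?I - m *\<^sub>R d b) + norm (?I - m *\<^sub>R d a)"
          using norm_triangle_ineq4[of "?I - m *\<^sub>R d b" "?I - m *\<^sub>R d a"] by simp
        ultimately show ?thesis by linarith
      qed
      then have "m * dist (d a) (d b) \<le> m * e"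
        using m by (simp add: scaleR_diff_right[symmetric] dist_norm)
      then show ?thesis using m by simp
    qed
    then have "dist (d a) (d b) \<le> 0" by (rule field_le_epsilon)
    then show ?thesis by simp
  qed
  have const: "d s = d (T / 2)" if "s \<in> {0<..<T}" for s
  proof (cases s "T / 2" rule: linorder_cases)
    case less
    then show ?thesis using interior[of s "T / 2"] that T by simp
  next
    case greater
    then show ?thesis using interior[of "T / 2" s] that T by simp
  next
    case equal
    then show ?thesis by (rule arg_cong)
  qed
  \<comment> \<open>Continuity carries constancy from the open interval to its end points.\<close>
  have "d s = d (T / 2)" if "s \<in> {0..T}" for s
  proof (rule continuous_constant_on_closure[of "{0<..<T}" d])
    show "continuous_on (closure {0<..<T}) d" "s \<in> closure {0<..<T}" using T d that by auto
  qed (rule const)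
  from this[of t] this[of 0] show ?thesis using t T by simp
qed

text \<open>Subtracting the primitive of \<open>y\<close> leaves a continuous function with weak
  derivative zero, hence a constant.\<close>

lemma has_weak_deriv_imp_is_primitive:
  fixes x y :: "real \<Rightarrow> 'a::euclidean_space"
  assumes T: "0 < T" and x: "continuous_on {0..T} x" and y: "y \<in> L2_space T" and w: "has_weak_deriv T x y"
  shows "is_primitive T x y"
proof -
  have T0: "0 \<le> T" using T by simp
  define p where "p t = integral {0..t} y" for t
  have p: "is_primitive T p y" by (rule is_primitiveI[OF y]) (simp add: p_def)
  note pc = is_primitive_continuous[OF T0 p]
  have eq: "x t - p t = x 0 - p 0" if "t \<in> {0..T}" for t
  proof (rule weak_deriv_zero_imp_constant[OF T _ _ that])
    show "continuous_on {0..T} (\<lambda>t. x t - p t)" by (intro continuous_intros x pc)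
    fix \<phi> assume \<phi>: "\<phi> \<in> test_functions T"
    note tf = test_function_props[OF \<phi>]
    have i: "integrable (lebesgue_on {0<..<T}) (\<lambda>t. deriv \<phi> t *\<^sub>R v t)" if "continuous_on {0..T} v" for v :: "real \<Rightarrow> 'a"
      by (intro L2_norm_integral_le(1)[OF T0] L2_mult_continuous(1)[OF T0] tf continuous_on_L2_space(2) that)
    show "(LINT t|lebesgue_on {0<..<T}. deriv \<phi> t *\<^sub>R (x t - p t)) = 0"
      using w is_primitive_has_weak_deriv[OF T0 p] \<phi> i[OF x] i[OF pc]
      by (simp add: scaleR_diff_right has_weak_deriv_def)
  qed
  have "x t = x 0 + integral {0..t} y" if "0 \<le> t" "t \<le> T" for t
  proof -
    have "x t = (x t - p t) + p t" by simp
    also have "x t - p t = x 0 - p 0" using that by (intro eq) simp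
    also have "p 0 = 0" by (simp add: p_def)
    finally show ?thesis by (simp only: p_def diff_0_right)
  qed
  with y show ?thesis by (rule is_primitiveI)
qed

section \<open>Grids, step functions and uniqueness of the derivative\<close>

lemma node_0 [simp]: "node T N 0 = 0"
  by (simp add: node_def)

lemma node_N: "0 < N \<Longrightarrow> node T N N = T"
  by (simp add: node_def)

lemma node_Suc: "node T N (Suc i) = node T N i + T / real N"
  by (simp add: node_def add_divide_distrib algebra_simps)

lemma node_mono: "0 \<le> T \<Longrightarrow> i \<le> j \<Longrightarrow> node T N i \<le> node T N j"
  unfolding node_def by (intro mult_right_mono) auto

lemma node_nonneg: "0 \<le> T \<Longrightarrow> 0 \<le> node T N i"
  by (simp add: node_def)

lemma node_le: "0 < T \<Longrightarrow> 0 < N \<Longrightarrow> i \<le> N \<Longrightarrow> node T N i \<le> T"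
  using node_mono[of T i N N] by (simp add: node_N)

lemma cell_props:
  assumes T: "0 < T" and N: "0 < N" and t: "0 < t" "t \<le> T"
  shows "node T N (cell T N t) < t" "t \<le> node T N (Suc (cell T N t))" "cell T N t < N"
proof -
  define h s where "h = T / real N" and "s = t / h"
  have h: "0 < h" and Th: "T = real N * h" and ts: "t = s * h"
    using T N by (auto simp: h_def s_def)
  have s: "0 < s" "s \<le> real N" using t h Th ts by (auto simp: zero_less_mult_iff)
  have c0: "0 < \<lceil>s\<rceil>" using s by simp
  then have c: "real (Suc (cell T N t)) = of_int \<lceil>s\<rceil>"
    unfolding cell_def h_def[symmetric] s_def[symmetric] by (simp add: nat_diff_distrib of_nat_diff)
  have "s \<le> of_int \<lceil>s\<rceil>" "of_int \<lceil>s\<rceil> < s + 1" by linarith+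
  then have b: "real (cell T N t) < s" "s \<le> real (Suc (cell T N t))" using c by auto
  have "node T N (cell T N t) = real (cell T N t) * h" "node T N (Suc (cell T N t)) = real (Suc (cell T N t)) * h"
    by (simp_all only: node_def h_def)
  moreover have "real (cell T N t) * h < s * h" "s * h \<le> real (Suc (cell T N t)) * h"
    using b h by (simp_all only: mult_less_cancel_right_pos mult_le_cancel_right_pos)
  ultimately show "node T N (cell T N t) < t" "t \<le> node T N (Suc (cell T N t))"
    by (simp_all only: ts[symmetric])
  have "real (cell T N t) < real N" using b s by linarith
  then show "cell T N t < N" by simp
qed

lemma integral_cells:
  fixes g :: "real \<Rightarrow> 'a::euclidean_space"
  assumes T: "0 < T" and N: "0 < N" and g: "g integrable_on {0..T}" and j: "j \<le> N"
  shows "integral {0..node T N j} g = (\<Sum>i<j. integral {node T N i..node T N (Suc i)} g)"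
  using j
proof (induction j)
  case (Suc j)
  have "integral {0..node T N j} g + integral {node T N j..node T N (Suc j)} g = integral {0..node T N (Suc j)} g"
    using T N Suc.prems node_le[OF T N Suc.prems] g
    by (intro Henstock_Kurzweil_Integration.integral_combine node_nonneg node_mono)
       (auto intro: integrable_on_subinterval)
  then show ?case using Suc by simp
qed simp

text \<open>The left node belongs to the preceding cell; as a single point it does not affect the
  integral.\<close>

lemma cell_integral:
  fixes g :: "nat \<Rightarrow> real \<Rightarrow> 'a::euclidean_space"
  assumes T: "0 < T" and N: "0 < N" and s: "s \<le> node T N (Suc i)"
  shows "integral {node T N i..s} (\<lambda>t. g (cell T N t) t) = integral {node T N i..s} (g i)"
proof (rule integral_spike[of "{node T N i}"])
  fix t assume "t \<in> {node T N i..s} - {node T N i}"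
  then have "cell T N t = i" using s by (intro cell_eq[OF T N]) auto
  then show "g i t = g (cell T N t) t" by simp
qed simp

lemma measurable_cell [measurable]: "cell T N \<in> borel \<rightarrow>\<^sub>M count_space UNIV"
  unfolding cell_def by measurable

lemma measurable_step [measurable]:
  "(\<lambda>t. S (cell T N t)) \<in> borel_measurable (lebesgue_on A)"
proof -
  have "(\<lambda>t. S (cell T N t)) \<in> borel_measurable borel"
    by (rule measurable_compose[OF measurable_cell]) simp
  then show ?thesis by (intro measurable_restrict_space1 measurable_completion) simp
qed

lemma step_L2:
  fixes S :: "nat \<Rightarrow> 'a::euclidean_space"
  assumes T: "0 < T" and N: "0 < N"
  shows "(\<lambda>t. S (cell T N t)) \<in> L2_space T"
    "(norm_L2 T (\<lambda>t. S (cell T N t)))\<^sup>2 = T / real N * (\<Sum>i<N. (norm (S i))\<^sup>2)"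
proof -
  show L: "(\<lambda>t. S (cell T N t)) \<in> L2_space T"
  proof (rule L2_space_bounded(1))
    show "norm (S (cell T N t)) \<le> (\<Sum>i<N. norm (S i))" if "0 < t" "t < T" for t
      using cell_props(3)[OF T N that(1)] that by (intro member_le_sum) auto
  qed (use T in \<open>auto intro: sum_nonneg measurable_step\<close>)
  have "(norm_L2 T (\<lambda>t. S (cell T N t)))\<^sup>2 = integral {0..node T N N} (\<lambda>t. (norm (S (cell T N t)))\<^sup>2)"
    unfolding norm_L2_power2 using lebesgue_on_open_interval_integral(2)[OF L2_spaceD(2)[OF L]] N by (simp add: node_N)
  also have "\<dots> = (\<Sum>i<N. integral {node T N i..node T N (Suc i)} (\<lambda>t. (norm (S (cell T N t)))\<^sup>2))"
    using lebesgue_on_open_interval_integral(1)[OF L2_spaceD(2)[OF L]]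
    by (intro integral_cells T N) (auto simp: absolutely_integrable_on_def)
  also have "\<dots> = (\<Sum>i<N. T / real N * (norm (S i))\<^sup>2)"
  proof (intro sum.cong refl)
    fix i
    have "integral {node T N i..node T N (Suc i)} (\<lambda>t. (norm (S (cell T N t)))\<^sup>2)
        = integral {node T N i..node T N (Suc i)} (\<lambda>t. (norm (S i))\<^sup>2)"
      by (rule cell_integral[OF T N order_refl, of i "\<lambda>i t. (norm (S i))\<^sup>2"])
    also have "\<dots> = T / real N * (norm (S i))\<^sup>2" using T by (simp add: node_Suc)
    finally show "integral {node T N i..node T N (Suc i)} (\<lambda>t. (norm (S (cell T N t)))\<^sup>2) = T / real N * (norm (S i))\<^sup>2" .
  qed
  also have "\<dots> = T / real N * (\<Sum>i<N. (norm (S i))\<^sup>2)" by (simp only: sum_distrib_left)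
  finally show "(norm_L2 T (\<lambda>t. S (cell T N t)))\<^sup>2 = T / real N * (\<Sum>i<N. (norm (S i))\<^sup>2)" .
qed

lemma norm_L2_eq_0_AE:
  assumes x: "x \<in> L2_space T" and z: "norm_L2 T x = 0"
  shows "AE t in lebesgue_on {0<..<T}. x t = 0"
proof -
  have "(LINT t|lebesgue_on {0<..<T}. (norm (x t))\<^sup>2) = 0" using norm_L2_power2[of T x] z by simp
  then have "AE t in lebesgue_on {0<..<T}. (norm (x t))\<^sup>2 = 0"
    using L2_spaceD(2)[OF x] by (subst (asm) integral_nonneg_eq_0_iff_AE) auto
  then show ?thesis by simp
qed

text \<open>The function is orthogonal to all step functions, which approximate it.\<close>

lemma norm_L2_eq_0_of_integrals:
  fixes w :: "real \<Rightarrow> 'a::euclidean_space"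
  assumes T: "0 < T" and w: "w \<in> L2_space T" and zero: "\<And>t. 0 \<le> t \<Longrightarrow> t \<le> T \<Longrightarrow> integral {0..t} w = 0"
  shows "norm_L2 T w = 0"
proof -
  have T0: "0 \<le> T" using T by simp
  have "norm_L2 T w \<le> 0 + e" if e: "0 < e" for e
  proof -
    obtain c where c: "continuous_on UNIV c" "c \<in> L2_space T" "norm_L2 T (\<lambda>t. w t - c t) < e / 2"
      using L2_dense_continuous[OF w] e by (metis half_gt_zero)
    have "sampling_consistent T c"
      by (rule sampling_consistent_continuous[OF T]) (rule continuous_on_subset[OF c(1)], simp)
    then have "\<forall>\<^sub>F N in sequentially. norm_L2 T (\<lambda>t. c (node T N (Suc (cell T N t))) - c t) < e / 2"
      unfolding sampling_consistent_def using e by (intro order_tendstoD(2)[of _ 0]) auto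
    then have "\<forall>\<^sub>F N in sequentially. norm_L2 T (\<lambda>t. c (node T N (Suc (cell T N t))) - c t) < e / 2 \<and> 0 < N"
      by (intro eventually_conj eventually_gt_at_top)
    then obtain N where N: "norm_L2 T (\<lambda>t. c (node T N (Suc (cell T N t))) - c t) < e / 2" "0 < N"
      by (auto simp: eventually_sequentially)
    define S where "S i = c (node T N (Suc i))" for i
    have SL: "(\<lambda>t. S (cell T N t)) \<in> L2_space T" by (rule step_L2(1)[OF T N(2)])
    \<comment> \<open>All integrals over \<open>{0..t}\<close> vanish, hence also those over single
      cells, on which the step function is constant.\<close>
    have orth: "(LINT t|lebesgue_on {0<..<T}. w t \<bullet> S (cell T N t)) = 0"
    proof -
      note i = L2_inner_integrable[OF w SL]
      have "(LINT t|lebesgue_on {0<..<T}. w t \<bullet> S (cell T N t)) = integral {0..node T N N} (\<lambda>t. w t \<bullet> S (cell T N t))"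
        using lebesgue_on_open_interval_integral(2)[OF i] N(2) by (simp add: node_N)
      also have "\<dots> = (\<Sum>i<N. integral {node T N i..node T N (Suc i)} (\<lambda>t. w t \<bullet> S (cell T N t)))"
        using lebesgue_on_open_interval_integral(1)[OF i]
        by (intro integral_cells T N) (auto simp: absolutely_integrable_on_def)
      also have "\<dots> = (\<Sum>i<N. 0)"
      proof (intro sum.cong refl)
        fix i assume i: "i \<in> {..<N}"
        have b: "node T N (Suc i) \<le> T" "node T N i \<le> T" using i by (auto intro!: node_le T N)
        have wi: "w integrable_on {node T N i..node T N (Suc i)}"
          using b by (intro L2_integral_bound(1)[OF T0 w] node_nonneg T0) auto
        have "integral {0..node T N i} w + integral {node T N i..node T N (Suc i)} w = integral {0..node T N (Suc i)} w"
          using b by (intro Henstock_Kurzweil_Integration.integral_combine node_nonneg node_mono T0 L2_integral_bound(1)[OF T0 w]) auto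
        then have wz: "integral {node T N i..node T N (Suc i)} w = 0"
          using zero b node_nonneg[OF T0] by simp
        have "integral {node T N i..node T N (Suc i)} (\<lambda>t. w t \<bullet> S (cell T N t))
            = integral {node T N i..node T N (Suc i)} (\<lambda>t. w t \<bullet> S i)"
          by (rule cell_integral[OF T N(2) order_refl, of i "\<lambda>i t. w t \<bullet> S i"])
        also have "\<dots> = 0"
          using has_integral_linear[OF integrable_integral[OF wi] bounded_linear_inner_left[of "S i"]] wz
          by (simp add: integral_unique o_def)
        finally show "integral {node T N i..node T N (Suc i)} (\<lambda>t. w t \<bullet> S (cell T N t)) = 0" .
      qed
      finally show ?thesis by simp
    qed
    have d: "norm_L2 T (\<lambda>t. w t - S (cell T N t)) \<le> e"
      using norm_L2_triangle_diff[OF w c(2) SL] c(3) N(1) by (simp add: S_def norm_L2_minus_commute[of T c])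
    have "(norm_L2 T w)\<^sup>2 = (LINT t|lebesgue_on {0<..<T}. w t \<bullet> w t)"
      by (simp add: norm_L2_power2 power2_norm_eq_inner)
    also have "\<dots> = (LINT t|lebesgue_on {0<..<T}. w t \<bullet> (w t - S (cell T N t)))"
      using orth L2_inner_integrable[OF w w] L2_inner_integrable[OF w SL] by (simp add: inner_diff_right)
    also have "\<dots> \<le> norm_L2 T w * norm_L2 T (\<lambda>t. w t - S (cell T N t))"
      using L2_Cauchy_Schwarz[OF w L2_diff[OF w SL]] by linarith
    also have "\<dots> \<le> norm_L2 T w * e" by (intro mult_left_mono d) simp
    finally have "norm_L2 T w * norm_L2 T w \<le> norm_L2 T w * e" by (simp add: power2_eq_square)
    then show ?thesis using e by (cases "norm_L2 T w = 0") (auto simp: mult_le_cancel_left less_le)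
  qed
  then have "norm_L2 T w \<le> 0" by (rule field_le_epsilon)
  then show ?thesis by (simp add: antisym)
qed

lemma is_primitive_unique:
  assumes T: "0 < T" and "is_primitive T x y" "is_primitive T x z"
  shows "AE t in lebesgue_on {0<..<T}. y t = z t"
proof -
  have T0: "0 \<le> T" using T by simp
  have L: "(\<lambda>t. y t - z t) \<in> L2_space T" using assms is_primitiveD(1) by (blast intro: L2_diff)
  have "integral {0..t} (\<lambda>t. y t - z t) = 0" if "0 \<le> t" "t \<le> T" for t
    using is_primitiveD(2)[OF is_primitive_diff[OF T0 assms(2,3)] that] by simp
  from norm_L2_eq_0_AE[OF L norm_L2_eq_0_of_integrals[OF T L this]] show ?thesis by simp
qed

text \<open>One weak derivative exists, so the choice in \<open>weak_deriv\<close> is a weak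
  derivative too; both make \<open>x\<close> a primitive, and primitives determine the integrand
  almost everywhere.\<close>

lemma weak_deriv_of_primitive:
  assumes T: "0 < T" and p: "is_primitive T x y"
  shows "is_primitive T x (weak_deriv T x)" "AE t in lebesgue_on {0<..<T}. weak_deriv T x t = y t"
proof -
  have T0: "0 \<le> T" using T by simp
  have "y \<in> L2_space T \<and> has_weak_deriv T x y"
    using is_primitive_has_weak_deriv[OF T0 p] is_primitiveD(1)[OF p] by blast
  then have "weak_deriv T x \<in> L2_space T \<and> has_weak_deriv T x (weak_deriv T x)"
    unfolding weak_deriv_def by (rule someI[of "\<lambda>y. y \<in> L2_space T \<and> has_weak_deriv T x y"])
  then show pw: "is_primitive T x (weak_deriv T x)"
    using has_weak_deriv_imp_is_primitive[OF T is_primitive_continuous[OF T0 p]] by blast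
  show "AE t in lebesgue_on {0<..<T}. weak_deriv T x t = y t" by (rule is_primitive_unique[OF T pw p])
qed

lemma H1_is_primitive:
  assumes T: "0 < T" and x: "x \<in> H1_space T"
  shows "is_primitive T x (weak_deriv T x)"
  using x weak_deriv_of_primitive(1)[OF T] has_weak_deriv_imp_is_primitive[OF T]
  unfolding H1_space_def by blast

lemma norm_H1_primitive:
  assumes T: "0 < T" and p: "is_primitive T x y"
  shows "norm_H1 T x \<le> norm_L2 T x + norm_L2 T y"
proof -
  have "norm_L2 T (weak_deriv T x) = norm_L2 T y"
  proof (rule norm_L2_cong_AE)
    show "weak_deriv T x \<in> borel_measurable (lebesgue_on {0<..<T})" "y \<in> borel_measurable (lebesgue_on {0<..<T})"
      using L2_spaceD(1)[OF is_primitiveD(1)[OF weak_deriv_of_primitive(1)[OF T p]]]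
        L2_spaceD(1)[OF is_primitiveD(1)[OF p]] by auto
    show "AE t in lebesgue_on {0<..<T}. norm (weak_deriv T x t) = norm (y t)"
      using weak_deriv_of_primitive(2)[OF T p] by eventually_elim simp
  qed
  then show ?thesis
    unfolding norm_H1_def by (simp only:) (intro sqrt_sum_squares_le_sum norm_L2_nonneg)
qed

lemma is_primitive_AE_cong:
  assumes T: "0 \<le> T" and p: "is_primitive T x y" and z: "z \<in> L2_space T" and ae: "AE t in lebesgue_on {0<..<T}. y t = z t"
  shows "is_primitive T x z"
proof (rule is_primitiveI[OF z])
  fix t assume t: "0 \<le> t" "t \<le> T"
  have L: "(\<lambda>t. y t - z t) \<in> L2_space T" using z is_primitiveD(1)[OF p] by (blast intro: L2_diff)
  have "norm_L2 T (\<lambda>t. y t - z t) = norm_L2 T (\<lambda>t. 0::'a)"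
    using ae by (intro norm_L2_cong_AE L2_spaceD(1)[OF L]) auto
  then have "norm_L2 T (\<lambda>t. y t - z t) = 0" by (simp add: norm_L2_def)
  with L2_integral_bound(3)[OF T L, of 0 t] t have "integral {0..t} (\<lambda>t. y t - z t) = 0" by simp
  then have "integral {0..t} y = integral {0..t} z"
    using L2_integral_bound(1)[OF T is_primitiveD(1)[OF p], of 0 t] L2_integral_bound(1)[OF T z, of 0 t] t
    by (simp add: integral_diff)
  with is_primitiveD(2)[OF p t] show "x t = x 0 + integral {0..t} z" by (simp only:)
qed

text \<open>The slope is a step function; integrating it over full cells telescopes to a node value,
  and the last partial cell gives the linear term.\<close>

lemma state_interpolant_primitive:
  fixes X :: "nat \<Rightarrow> real^'n"
  assumes T: "0 < T" and N: "0 < N"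
  shows "is_primitive T (state_interpolant T N X) (\<lambda>t. (1 / (T / real N)) *\<^sub>R (X (Suc (cell T N t)) - X (cell T N t)))"
proof -
  define h where "h = T / real N"
  have h: "0 < h" using T N by (simp add: h_def)
  define S where "S i = (1 / h) *\<^sub>R (X (Suc i) - X i)" for i
  have T0: "0 \<le> T" using T by simp
  have L: "(\<lambda>t. S (cell T N t)) \<in> L2_space T" by (rule step_L2(1)[OF T N])
  have int: "(\<lambda>t. S (cell T N t)) integrable_on {a..b}" if "0 \<le> a" "b \<le> T" for a b
    by (rule L2_integral_bound(1)[OF T0 L that])
  have "is_primitive T (state_interpolant T N X) (\<lambda>t. S (cell T N t))"
  proof (rule is_primitiveI[OF L])
    fix t assume t: "0 \<le> t" "t \<le> T"
    show "state_interpolant T N X t = state_interpolant T N X 0 + integral {0..t} (\<lambda>t. S (cell T N t))"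
    proof (cases "t = 0")
      case False
      then have tp: "0 < t" using t by simp
      define i where "i = cell T N t"
      note cp = cell_props[OF T N tp t(2), folded i_def]
      have "integral {0..node T N i} (\<lambda>t. S (cell T N t)) + integral {node T N i..t} (\<lambda>t. S (cell T N t)) = integral {0..t} (\<lambda>t. S (cell T N t))"
        using cp t int T0 by (intro Henstock_Kurzweil_Integration.integral_combine) (auto intro: node_nonneg)
      moreover have "integral {node T N i..t} (\<lambda>t. S (cell T N t)) = (t - node T N i) *\<^sub>R S i"
        using cell_integral[OF T N cp(2), of "\<lambda>i t. S i"] cp by simp
      moreover have "integral {0..node T N i} (\<lambda>t. S (cell T N t)) = X i - X 0"
      proof -
        have "integral {0..node T N i} (\<lambda>t. S (cell T N t)) = (\<Sum>j<i. integral {node T N j..node T N (Suc j)} (\<lambda>t. S (cell T N t)))"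
          using cp int[of 0 T] by (intro integral_cells T N) auto
        also have "\<dots> = (\<Sum>j<i. X (Suc j) - X j)"
        proof (intro sum.cong refl)
          fix j
          have "integral {node T N j..node T N (Suc j)} (\<lambda>t. S (cell T N t)) = integral {node T N j..node T N (Suc j)} (\<lambda>t. S j)"
            by (rule cell_integral[OF T N order_refl, of j "\<lambda>i t. S i"])
          also have "\<dots> = h *\<^sub>R S j" using h by (simp add: node_Suc h_def[symmetric])
          also have "\<dots> = X (Suc j) - X j" using h by (simp add: S_def)
          finally show "integral {node T N j..node T N (Suc j)} (\<lambda>t. S (cell T N t)) = X (Suc j) - X j" .
        qed
        also have "\<dots> = X i - X 0" by (rule sum_lessThan_telescope)
        finally show ?thesis .
      qed
      ultimately have int_t: "integral {0..t} (\<lambda>t. S (cell T N t)) = X i - X 0 + (t - node T N i) *\<^sub>R S i" by simp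
      have "state_interpolant T N X t = X i + ((t - node T N i) / h) *\<^sub>R (X (Suc i) - X i)"
        unfolding state_interpolant_def Let_def i_def h_def by (rule refl)
      then show ?thesis unfolding int_t state_interpolant_0 by (simp add: S_def)
    qed simp
  qed
  then show ?thesis by (simp add: S_def h_def)
qed

section \<open>Linear control systems and the implicit Euler scheme\<close>

text \<open>The right-hand side multiplied by \<open>exp (- a t)\<close> has nonpositive derivative,
  precisely by the integral inequality.\<close>

lemma gronwall_integral:
  fixes x :: "real \<Rightarrow> real"
  assumes x: "continuous_on {0..T} x" and a: "0 \<le> a"
    and le: "\<And>t. 0 \<le> t \<Longrightarrow> t \<le> T \<Longrightarrow> x t \<le> b + a * integral {0..t} x"
    and t: "0 \<le> t" "t \<le> T"
  shows "x t \<le> b * exp (a * t)"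
proof -
  define w where "w s = exp (- a * s) * (b + a * integral {0..s} x)" for s
  have "w t \<le> w 0"
  proof (cases "t = 0")
    case False
    show ?thesis
    proof (rule DERIV_nonpos_imp_decreasing_open[where f=w])
      show "0 \<le> t" using t by simp
      have "continuous_on {0..t} (\<lambda>s. integral {0..s} x)"
        using t by (intro indefinite_integral_continuous_1 integrable_continuous_real continuous_on_subset[OF x]) auto
      then show "continuous_on {0..t} w" unfolding w_def by (intro continuous_intros)
      fix s assume s: "0 < s" "s < t"
      have "((\<lambda>s. integral {0..s} x) has_real_derivative x s) (at s within {0..T})"
        using s t by (intro integral_has_real_derivative x) auto
      then have "((\<lambda>s. integral {0..s} x) has_real_derivative x s) (at s)"
        using s t by (simp add: at_within_Icc_at)
      then have "(w has_real_derivative exp (- a * s) * (a * x s) + (- a * exp (- a * s)) * (b + a * integral {0..s} x)) (at s)"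
        unfolding w_def by (auto intro!: derivative_eq_intros)
      moreover have "exp (- a * s) * (a * x s) + (- a * exp (- a * s)) * (b + a * integral {0..s} x)
          = - (a * exp (- a * s) * (b + a * integral {0..s} x - x s))" by (simp add: algebra_simps)
      moreover have "0 \<le> a * exp (- a * s) * (b + a * integral {0..s} x - x s)"
        using a le[of s] s t by (intro mult_nonneg_nonneg) auto
      ultimately show "\<exists>y. (w has_real_derivative y) (at s) \<and> y \<le> 0" by (metis neg_le_0_iff_le)
    qed
  qed simp
  then have "exp (- a * t) * (b + a * integral {0..t} x) \<le> b" by (simp add: w_def)
  then have "exp (a * t) * (exp (- a * t) * (b + a * integral {0..t} x)) \<le> exp (a * t) * b"
    by (rule mult_left_mono) simp
  then have "b + a * integral {0..t} x \<le> b * exp (a * t)"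
    by (simp add: mult.assoc[symmetric] exp_add[symmetric] mult.commute)
  with le[OF t] show ?thesis by linarith
qed

text \<open>The Neumann series of the integral operator. Measured with the weight
  \<open>exp (c t)\<close>, each application gains a factor of one half on the whole interval, so no
  subdivision in time is required.\<close>

lemma picard_exists:
  fixes s :: "real \<Rightarrow> 'a::euclidean_space"
  assumes L: "bounded_linear L" and s: "continuous_on {0..T} s"
  obtains x where "continuous_on {0..T} x" "\<And>t. 0 \<le> t \<Longrightarrow> t \<le> T \<Longrightarrow> x t = s t + integral {0..t} (\<lambda>\<tau>. L (x \<tau>))"
proof -
  define a where "a = onorm L"
  have a: "0 \<le> a" unfolding a_def by (rule onorm_pos_le[OF L])
  \<comment> \<open>Makes \<open>a / c \<le> 1 / 2\<close>; the added 1 keeps \<open>c\<close>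
    positive when \<open>L\<close> is zero.\<close>
  define c where "c = 2 * a + 1"
  have c: "0 < c" using a by (simp add: c_def)
  have La: "norm (L v) \<le> a * norm v" for v unfolding a_def by (rule onorm[OF L])
  have contL: "continuous_on S (\<lambda>t. L (v t))" if "continuous_on S v" for S and v :: "real \<Rightarrow> 'a"
    by (rule bounded_linear.continuous_on[OF L that])
  define z where "z k = ((\<lambda>x t. integral {0..t} (\<lambda>\<tau>. L (x \<tau>))) ^^ k) s" for k
  have z0: "z 0 = s" and zS: "z (Suc k) t = integral {0..t} (\<lambda>\<tau>. L (z k \<tau>))" for k t
    by (simp_all add: z_def)
  have zc: "continuous_on {0..T} (z k)" for k
  proof (induction k)
    case (Suc k)
    show ?case unfolding zS
      by (intro indefinite_integral_continuous_1 integrable_continuous_real contL Suc)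
  qed (simp add: z0 s)
  have "bounded (s ` {0..T})" using s by (intro compact_imp_bounded compact_continuous_image) auto
  then obtain M where M: "0 < M" "\<And>t. t \<in> {0..T} \<Longrightarrow> norm (s t) \<le> M" by (auto simp: bounded_pos)
  have zb: "norm (z k t) \<le> M * (1/2) ^ k * exp (c * t)" if "0 \<le> t" "t \<le> T" for k t
    using that
  proof (induction k arbitrary: t)
    case 0
    have "norm (s t) \<le> M * 1" using M(2)[of t] 0 by simp
    also have "\<dots> \<le> M * exp (c * t)" using M(1) c 0 by (intro mult_left_mono) auto
    finally show ?case by (simp add: z0)
  next
    case (Suc k)
    have E: "((\<lambda>\<tau>. exp (c * \<tau>)) has_integral exp (c * t) / c - exp (c * 0) / c) {0..t}"
    proof (rule fundamental_theorem_of_calculus)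
      fix x assume "x \<in> {0..t}"
      have "((\<lambda>\<tau>. exp (c * \<tau>) / c) has_real_derivative exp (c * x)) (at x within {0..t})"
        using c by (auto intro!: derivative_eq_intros)
      then show "((\<lambda>\<tau>. exp (c * \<tau>) / c) has_vector_derivative exp (c * x)) (at x within {0..t})"
        by (simp add: has_real_derivative_iff_has_vector_derivative)
    qed (use Suc in simp)
    define B where "B = a * (M * (1/2) ^ k)"
    have B: "0 \<le> B" using a M by (simp add: B_def)
    have "norm (z (Suc k) t) \<le> integral {0..t} (\<lambda>\<tau>. B * exp (c * \<tau>))"
      unfolding zS
    proof (rule integral_norm_bound_integral)
      show "(\<lambda>\<tau>. L (z k \<tau>)) integrable_on {0..t}"
        using Suc.prems by (intro integrable_continuous_real contL continuous_on_subset[OF zc]) auto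
      show "(\<lambda>\<tau>. B * exp (c * \<tau>)) integrable_on {0..t}"
        by (intro integrable_continuous_real continuous_intros)
      fix \<tau> assume \<tau>: "\<tau> \<in> {0..t}"
      have "norm (L (z k \<tau>)) \<le> a * norm (z k \<tau>)" by (rule La)
      also have "\<dots> \<le> a * (M * (1/2) ^ k * exp (c * \<tau>))"
        using \<tau> Suc.prems by (intro mult_left_mono Suc.IH a) auto
      finally show "norm (L (z k \<tau>)) \<le> B * exp (c * \<tau>)" by (simp add: B_def mult.assoc)
    qed
    also have "\<dots> = B * (exp (c * t) / c - exp (c * 0) / c)"
      using has_integral_mult_right[OF E, of B] by (rule integral_unique)
    also have "\<dots> \<le> B * (exp (c * t) / c)" using B c by (intro mult_left_mono) auto
    also have "\<dots> = (a / c) * (M * (1/2) ^ k * exp (c * t))" by (simp add: B_def)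
    also have "\<dots> \<le> (1/2) * (M * (1/2) ^ k * exp (c * t))"
      using a M(1) c by (intro mult_right_mono) (auto simp: c_def field_simps)
    finally show ?case by (simp add: mult_ac)
  qed
  define P where "P n t = (\<Sum>k<n. z k t)" for n t
  define x where "x t = (\<Sum>k. z k t)" for t
  have ul: "uniform_limit {0..T} P x sequentially"
    unfolding P_def[abs_def] x_def[abs_def]
  proof (rule Weierstrass_m_test)
    show "norm (z k t) \<le> M * exp (c * T) * (1/2) ^ k" if "t \<in> {0..T}" for k t
    proof -
      have "norm (z k t) \<le> M * (1/2) ^ k * exp (c * t)" using that by (intro zb) auto
      also have "\<dots> \<le> M * (1/2) ^ k * exp (c * T)" using that c M(1) by (intro mult_left_mono) auto
      finally show ?thesis by (simp add: mult_ac)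
    qed
    show "summable (\<lambda>k. M * exp (c * T) * (1/2) ^ k)" by (intro summable_mult summable_geometric) auto
  qed
  have Pc: "continuous_on {0..T} (P n)" for n
    unfolding P_def by (intro continuous_on_sum zc)
  have xc: "continuous_on {0..T} x"
    by (rule uniform_limit_theorem[OF _ ul]) (auto intro: always_eventually Pc)
  have PS: "P (Suc n) t = s t + integral {0..t} (\<lambda>\<tau>. L (P n \<tau>))" if t: "0 \<le> t" "t \<le> T" for n t
  proof -
    have i: "(\<lambda>\<tau>. L (z k \<tau>)) integrable_on {0..t}" for k
      using t by (intro integrable_continuous_real contL continuous_on_subset[OF zc]) auto
    have "P (Suc n) t = z 0 t + (\<Sum>k<n. z (Suc k) t)" unfolding P_def by (rule sum.lessThan_Suc_shift)
    also have "(\<Sum>k<n. z (Suc k) t) = integral {0..t} (\<lambda>\<tau>. \<Sum>k<n. L (z k \<tau>))"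
      unfolding zS by (rule integral_sum[symmetric]) (use i in auto)
    also have "(\<lambda>\<tau>. \<Sum>k<n. L (z k \<tau>)) = (\<lambda>\<tau>. L (P n \<tau>))"
      using L by (simp add: P_def linear_sum bounded_linear.linear)
    finally show ?thesis by (simp add: z0)
  qed
  have "x t = s t + integral {0..t} (\<lambda>\<tau>. L (x \<tau>))" if t: "0 \<le> t" "t \<le> T" for t
  proof -
    have ult: "uniform_limit {0..t} (\<lambda>n \<tau>. L (P n \<tau>)) (\<lambda>\<tau>. L (x \<tau>)) sequentially"
      by (rule bounded_linear.uniform_limit[OF L uniform_limit_on_subset[OF ul]]) (use t in auto)
    have ct: "continuous_on {0..t} (\<lambda>\<tau>. L (P n \<tau>))" for n
      using t by (intro contL continuous_on_subset[OF Pc]) auto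
    obtain I J where IJ: "\<And>n. ((\<lambda>\<tau>. L (P n \<tau>)) has_integral I n) {0..t}" "((\<lambda>\<tau>. L (x \<tau>)) has_integral J) {0..t}" "I \<longlonglongrightarrow> J"
      by (rule uniform_limit_integral[OF ult ct]) auto
    have "(\<lambda>n. integral {0..t} (\<lambda>\<tau>. L (P n \<tau>))) \<longlonglongrightarrow> integral {0..t} (\<lambda>\<tau>. L (x \<tau>))"
      using IJ(3) by (simp add: integral_unique[OF IJ(1)] integral_unique[OF IJ(2)])
    then have "(\<lambda>n. P (Suc n) t) \<longlonglongrightarrow> s t + integral {0..t} (\<lambda>\<tau>. L (x \<tau>))"
      unfolding PS[OF t] by (intro tendsto_add tendsto_const)
    moreover have "(\<lambda>n. P (Suc n) t) \<longlonglongrightarrow> x t"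
      using t by (intro LIMSEQ_Suc tendsto_uniform_limitI[OF ul]) auto
    ultimately show ?thesis by (rule LIMSEQ_unique[symmetric])
  qed
  with xc that show ?thesis by blast
qed

lemma continuous_on_matrix_mult:
  fixes G :: "real^'n^'m"
  shows "continuous_on S x \<Longrightarrow> continuous_on S (\<lambda>t. G *v x t)"
  by (rule bounded_linear.continuous_on[OF matrix_vector_mul_bounded_linear])

text \<open>The forcing enters through its integral, which is continuous although the forcing is
  only square integrable; the Picard argument then applies to the integral equation.\<close>

lemma linear_ode_solution_exists:
  fixes G :: "real^'n^'n" and \<sigma> :: "real \<Rightarrow> real^'n"
  assumes T: "0 \<le> T" and \<sigma>: "\<sigma> \<in> L2_space T"
  obtains x where "x 0 = x0" "is_primitive T x (\<lambda>t. G *v x t + \<sigma> t)"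
proof -
  define s where "s t = x0 + integral {0..t} \<sigma>" for t
  have "continuous_on {0..T} s"
    unfolding s_def using L2_integral_bound(1)[OF T \<sigma>, of 0 T]
    by (intro continuous_intros indefinite_integral_continuous_1) auto
  from picard_exists[OF matrix_vector_mul_bounded_linear[of G] this]
  obtain x where x: "continuous_on {0..T} x" "\<And>t. 0 \<le> t \<Longrightarrow> t \<le> T \<Longrightarrow> x t = s t + integral {0..t} (\<lambda>\<tau>. G *v x \<tau>)"
    by blast
  have x0: "x 0 = x0" using x(2)[of 0] T by (simp add: s_def)
  have Gx: "continuous_on {0..T} (\<lambda>t. G *v x t)" by (rule continuous_on_matrix_mult[OF x(1)])
  have "is_primitive T x (\<lambda>t. G *v x t + \<sigma> t)"
  proof (rule is_primitiveI[OF L2_add[OF continuous_on_L2_space(2)[OF Gx] \<sigma>]])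
    fix t assume t: "0 \<le> t" "t \<le> T"
    have "integral {0..t} (\<lambda>t. G *v x t + \<sigma> t) = integral {0..t} (\<lambda>t. G *v x t) + integral {0..t} \<sigma>"
    proof (rule integral_add)
      show "(\<lambda>t. G *v x t) integrable_on {0..t}"
        using t by (intro integrable_continuous_real continuous_on_subset[OF Gx]) auto
      show "\<sigma> integrable_on {0..t}" using t by (intro L2_integral_bound(1)[OF T \<sigma>]) auto
    qed
    moreover have "x t = s t + integral {0..t} (\<lambda>\<tau>. G *v x \<tau>)" by (rule x(2)[OF t])
    ultimately show "x t = x 0 + integral {0..t} (\<lambda>t. G *v x t + \<sigma> t)"
      by (simp only: x0 s_def ac_simps)
  qed
  with x0 that show ?thesis by blast
qed

lemma linear_ode_bound:
  fixes G :: "real^'n^'n" and \<sigma> :: "real \<Rightarrow> real^'n"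
  assumes T: "0 \<le> T" and \<sigma>: "\<sigma> \<in> L2_space T" and p: "is_primitive T x (\<lambda>t. G *v x t + \<sigma> t)"
    and t: "0 \<le> t" "t \<le> T"
  shows "norm (x t) \<le> exp (onorm ((*v) G) * T) * (norm (x 0) + sqrt T * norm_L2 T \<sigma>)"
proof -
  define a where "a = onorm ((*v) G)"
  have a: "0 \<le> a" unfolding a_def by (rule onorm_pos_le[OF matrix_vector_mul_bounded_linear])
  have Ga: "norm (G *v v) \<le> a * norm v" for v unfolding a_def by (rule onorm[OF matrix_vector_mul_bounded_linear])
  have xc: "continuous_on {0..T} x" by (rule is_primitive_continuous[OF T p])
  have nx: "continuous_on {0..T} (\<lambda>t. norm (x t))" by (intro continuous_intros xc)
  define b where "b = norm (x 0) + sqrt T * norm_L2 T \<sigma>"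
  have b: "0 \<le> b" using T by (simp add: b_def)
  have "norm (x s) \<le> b + a * integral {0..s} (\<lambda>s. norm (x s))" if s: "0 \<le> s" "s \<le> T" for s
  proof -
    have Gc: "(\<lambda>t. G *v x t) integrable_on {0..s}"
      using s by (intro integrable_continuous_real continuous_on_matrix_mult continuous_on_subset[OF xc]) auto
    have \<sigma>i: "\<sigma> integrable_on {0..s}" using s by (intro L2_integral_bound(1)[OF T \<sigma>]) auto
    have "x s = x 0 + (integral {0..s} (\<lambda>t. G *v x t) + integral {0..s} \<sigma>)"
      using is_primitiveD(2)[OF p s] by (simp only: integral_add[OF Gc \<sigma>i])
    then have "norm (x s) \<le> norm (x 0) + (norm (integral {0..s} (\<lambda>t. G *v x t)) + norm (integral {0..s} \<sigma>))"
      by (metis norm_triangle_mono norm_triangle_ineq order_refl)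
    also have "norm (integral {0..s} \<sigma>) \<le> sqrt T * norm_L2 T \<sigma>"
      using s by (intro L2_integral_bound(3)[OF T \<sigma>]) auto
    also have "norm (integral {0..s} (\<lambda>t. G *v x t)) \<le> integral {0..s} (\<lambda>t. a * norm (x t))"
      using s by (intro integral_norm_bound_integral Gc Ga integrable_continuous_real continuous_intros continuous_on_subset[OF xc]) auto
    also have "\<dots> = a * integral {0..s} (\<lambda>t. norm (x t))" by simp
    finally show ?thesis by (simp add: b_def)
  qed
  from gronwall_integral[OF nx a this t] have "norm (x t) \<le> b * exp (a * t)" .
  also have "\<dots> \<le> b * exp (a * T)" using a b t by (intro mult_left_mono) (auto intro: mult_left_mono)
  finally show ?thesis by (simp add: a_def b_def mult.commute)
qed

section \<open>Controllability by Kalman's rank condition\<close>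

lemma is_primitive_has_vector_derivative:
  assumes T: "0 \<le> T" and p: "is_primitive T x y" and y: "continuous_on {0..T} y" and t: "t \<in> {0..T}"
  shows "(x has_vector_derivative y t) (at t within {0..T})"
proof -
  have "((\<lambda>t. integral {0..t} y) has_vector_derivative y t) (at t within {0..T})"
    using t by (intro integral_has_vector_derivative y) auto
  then have "((\<lambda>t. integral {0..t} y + x 0) has_vector_derivative y t) (at t within {0..T})"
    by (simp add: has_vector_derivative_add_const)
  then show ?thesis
  proof (rule has_vector_derivative_transform[rotated 2])
    fix s assume "s \<in> {0..T}"
    then have "0 \<le> s" "s \<le> T" by auto
    from trans[OF is_primitiveD(2)[OF p this] add.commute] show "x s = integral {0..s} y + x 0" .
  qed (use t in auto)
qed

text \<open>Kalman's criterion: a vector orthogonal to the reachable set annihilates the columns of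
  the controllability matrix, as one sees by differentiating along the adjoint trajectory.\<close>

lemma controllable_reachable:
  fixes G :: "real^'n^'n" and H :: "real^'p^'n"
  assumes T: "0 < T" and rk: "rank (controllability_matrix G H) = CARD('n)"
  obtains e v where "continuous_on {0..T} v" "e 0 = 0" "is_primitive T e (\<lambda>t. G *v e t + H *v v t)" "e T = \<zeta>"
proof -
  have T0: "0 \<le> T" using T by simp
  define traj where "traj v e \<longleftrightarrow> continuous_on {0..T} v \<and> e 0 = 0 \<and> is_primitive T e (\<lambda>t. G *v e t + H *v v t)"
    for v :: "real \<Rightarrow> real^'p" and e :: "real \<Rightarrow> real^'n"
  define R where "R = {e T | e v. traj v e}"
  have traj_add: "traj (\<lambda>t. v t + v' t) (\<lambda>t. e t + e' t)" if "traj v e" "traj v' e'" for v e v' e'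
  proof -
    have "is_primitive T (\<lambda>t. e t + e' t) (\<lambda>t. (G *v e t + H *v v t) + (G *v e' t + H *v v' t))"
      using that by (intro is_primitive_add[OF T0]) (auto simp: traj_def)
    moreover have "(\<lambda>t. (G *v e t + H *v v t) + (G *v e' t + H *v v' t)) = (\<lambda>t. G *v (e t + e' t) + H *v (v t + v' t))"
      by (simp add: matrix_vector_right_distrib ac_simps)
    ultimately show ?thesis using that by (simp add: traj_def continuous_on_add)
  qed
  have traj_scale: "traj (\<lambda>t. c *\<^sub>R v t) (\<lambda>t. c *\<^sub>R e t)" if "traj v e" for v e c
  proof -
    have "is_primitive T (\<lambda>t. c *\<^sub>R e t) (\<lambda>t. c *\<^sub>R (G *v e t + H *v v t))"
      using that by (intro is_primitive_scaleR) (auto simp: traj_def)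
    moreover have "(\<lambda>t. c *\<^sub>R (G *v e t + H *v v t)) = (\<lambda>t. G *v (c *\<^sub>R e t) + H *v (c *\<^sub>R v t))"
      by (simp add: matrix_vector_mult_scaleR scaleR_add_right)
    ultimately show ?thesis using that by (simp add: traj_def continuous_on_scaleR)
  qed
  have traj_exists: "\<exists>e. traj v e" if v: "continuous_on {0..T} v" for v
  proof -
    have "(\<lambda>t. H *v v t) \<in> L2_space T" by (intro continuous_on_L2_space(2) continuous_on_matrix_mult v)
    from linear_ode_solution_exists[OF T0 this, of 0 G] v show ?thesis by (auto simp: traj_def)
  qed
  have sub: "subspace R"
    unfolding subspace_def
  proof (intro conjI ballI allI)
    obtain e where "traj (\<lambda>t. 0) e" using traj_exists[of "\<lambda>t. 0"] by auto
    from traj_scale[OF this, of 0] show "0 \<in> R" unfolding R_def by auto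
  next
    fix x y assume "x \<in> R" "y \<in> R"
    then show "x + y \<in> R" unfolding R_def using traj_add by fastforce
  next
    fix c x assume "x \<in> R"
    then show "c *\<^sub>R x \<in> R" unfolding R_def using traj_scale by fastforce
  qed
  have "R = UNIV"
  proof (rule ccontr)
    assume "R \<noteq> UNIV"
    then have "span R \<noteq> UNIV" by (simp add: span_eq_iff[THEN iffD2, OF sub])
    then obtain p where p: "p \<noteq> 0" "\<And>x. x \<in> R \<Longrightarrow> p \<bullet> x = 0"
      using span_not_univ_subset_hyperplane[of R] span_superset[of R] by blast
    \<comment> \<open>The adjoint equation is solved forward and then reversed in time, so
      \<open>l\<close> has end value \<open>p\<close> at \<open>T\<close>.\<close>
    obtain \<mu> where \<mu>: "\<mu> 0 = p" "is_primitive T \<mu> (\<lambda>t. transpose G *v \<mu> t + 0)"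
      using linear_ode_solution_exists[OF T0 L2_zero, of p "transpose G"] by blast
    have \<mu>c: "continuous_on {0..T} \<mu>" by (rule is_primitive_continuous[OF T0 \<mu>(2)])
    have \<mu>d: "(\<mu> has_vector_derivative transpose G *v \<mu> t) (at t within {0..T})" if "t \<in> {0..T}" for t
    proof -
      have "continuous_on {0..T} (\<lambda>t. transpose G *v \<mu> t + 0)"
        by (intro continuous_intros continuous_on_matrix_mult \<mu>c)
      from is_primitive_has_vector_derivative[OF T0 \<mu>(2) this that] show ?thesis by (simp only: add_0_right)
    qed
    define l where "l t = \<mu> (T - t)" for t
    have lc: "continuous_on {0..T} l"
      unfolding l_def by (rule continuous_on_compose2[OF \<mu>c]) (auto intro!: continuous_intros)
    have ld: "(l has_vector_derivative - (transpose G *v l t)) (at t)" if t: "t \<in> {0<..<T}" for t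
    proof -
      have "(\<mu> has_vector_derivative transpose G *v \<mu> (T - t)) (at (T - t))"
        using \<mu>d[of "T - t"] t by (simp add: at_within_Icc_at del: transpose_matrix_vector)
      moreover have "((\<lambda>t. T - t) has_vector_derivative - 1) (at t)"
        by (auto intro!: derivative_eq_intros simp: has_real_derivative_iff_has_vector_derivative[symmetric])
      ultimately have "(\<mu> \<circ> (\<lambda>t. T - t) has_vector_derivative (- 1) *\<^sub>R (transpose G *v \<mu> (T - t))) (at t)"
        by (intro vector_diff_chain_at) auto
      then show ?thesis by (simp add: l_def[abs_def] o_def del: transpose_matrix_vector)
    qed
    \<comment> \<open>The adjoint observation used as control: the derivative of
      \<open>l \<bullet> e\<close> becomes \<open>norm (v t)\<close> squared, whose integral is
      \<open>p \<bullet> e T = 0\<close> because \<open>p\<close> is orthogonal to the reachable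
      set.\<close>
    define v where "v t = transpose H *v l t" for t
    have vc: "continuous_on {0..T} v" unfolding v_def by (rule continuous_on_matrix_mult[OF lc])
    obtain e where e: "traj v e" using traj_exists[OF vc] by blast
    have e0: "e 0 = 0" and ep: "is_primitive T e (\<lambda>t. G *v e t + H *v v t)" using e by (auto simp: traj_def)
    have ec: "continuous_on {0..T} e" by (rule is_primitive_continuous[OF T0 ep])
    have "((\<lambda>t. (norm (v t))\<^sup>2) has_integral l T \<bullet> e T - l 0 \<bullet> e 0) {0..T}"
    proof (rule fundamental_theorem_of_calculus_interior[OF T0])
      show "continuous_on {0..T} (\<lambda>t. l t \<bullet> e t)" by (intro continuous_intros lc ec)
      fix t assume t: "t \<in> {0<..<T}"
      have "(e has_vector_derivative (G *v e t + H *v v t)) (at t within {0..T})"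
        using t by (intro is_primitive_has_vector_derivative[OF T0 ep] continuous_intros continuous_on_matrix_mult ec vc) auto
      then have ed: "(e has_vector_derivative (G *v e t + H *v v t)) (at t)"
        using t by (simp add: at_within_Icc_at)
      have "((\<lambda>t. l t \<bullet> e t) has_vector_derivative l t \<bullet> (G *v e t + H *v v t) + (- (transpose G *v l t)) \<bullet> e t) (at t)"
        by (rule bounded_bilinear.has_vector_derivative[OF bounded_bilinear_inner ld[OF t] ed])
      moreover have "l t \<bullet> (G *v e t + H *v v t) + (- (transpose G *v l t)) \<bullet> e t = (norm (v t))\<^sup>2"
      proof -
        have "(norm (v t))\<^sup>2 = (transpose H *v l t) \<bullet> v t" unfolding power2_norm_eq_inner v_def ..
        then show ?thesis
          by (simp only: transpose_matrix_vector inner_minus_left dot_lmul_matrix inner_add_right)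
      qed
      ultimately show "((\<lambda>t. l t \<bullet> e t) has_vector_derivative (norm (v t))\<^sup>2) (at t)" by simp
    qed
    moreover have "l T \<bullet> e T = 0" using p(2)[of "e T"] e by (auto simp: l_def \<mu>(1) R_def)
    ultimately have "integral {0..T} (\<lambda>t. (norm (v t))\<^sup>2) = 0" using e0 by (simp add: integral_unique)
    then have "\<forall>t\<in>{0..T}. (norm (v t))\<^sup>2 = 0"
      using T by (subst (asm) integral_eq_0_iff) (auto intro!: continuous_intros vc)
    then have v0: "v t = 0" if "t \<in> {0..T}" for t using that by simp
    have ann: "transpose (mat_power G k ** H) *v \<mu> t = 0" if "t \<in> {0..T}" for k t
      using that
    proof (induction k arbitrary: t)
      case 0
      then show ?case using v0[of "T - t"] by (simp add: v_def l_def)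
    next
      case (Suc k)
      let ?Q = "transpose (mat_power G k ** H)"
      have "((\<lambda>t. ?Q *v \<mu> t) has_vector_derivative ?Q *v (transpose G *v \<mu> t)) (at t within {0..T})"
        by (rule bounded_linear.has_vector_derivative[OF matrix_vector_mul_bounded_linear \<mu>d[OF Suc.prems]])
      moreover have "((\<lambda>t. ?Q *v \<mu> t) has_vector_derivative 0) (at t within {0..T})"
        by (rule has_vector_derivative_transform[OF Suc.prems Suc.IH has_vector_derivative_const])
      ultimately have "?Q *v (transpose G *v \<mu> t) = 0"
        using Suc.prems by (intro vector_derivative_unique_within_closed_interval[OF T, of t, unfolded box_real])
      moreover have "transpose (mat_power G (Suc k) ** H) = ?Q ** transpose G"
        by (simp only: mat_power.simps matrix_mul_assoc[symmetric] matrix_transpose_mul[of G])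
      ultimately show ?case by (simp only: matrix_vector_mul_assoc)
    qed
    \<comment> \<open>A column index pairs an exponent, coded through \<open>to_nat_on\<close>, with
      a column of the block; \<open>ann\<close> holds for every exponent, so all columns are
      annihilated.\<close>
    have "transpose (controllability_matrix G H) *v p = 0"
    proof (subst vec_eq_iff, intro allI)
      fix c :: "'n \<times> 'p"
      have "(transpose (mat_power G (to_nat_on (UNIV :: 'n set) (fst c)) ** H) *v \<mu> 0) $ snd c = 0"
        using ann[of 0] T by simp
      then show "(transpose (controllability_matrix G H) *v p) $ c = 0 $ c"
        by (simp add: \<mu>(1) controllability_matrix_def transpose_def matrix_vector_mult_def)
    qed
    moreover have "inj ((*v) (transpose (controllability_matrix G H)))"
      using rk full_rank_injective[of "transpose (controllability_matrix G H)"] by (simp add: rank_transpose)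
    ultimately have "p = 0" by (metis injD matrix_vector_mult_0_right)
    with p(1) show False by simp
  qed
  then have "\<zeta> \<in> R" by simp
  then show ?thesis using that by (auto simp: R_def traj_def)
qed

section \<open>Consistency and stability of the implicit Euler scheme\<close>

lemma is_primitive_sum:
  assumes T: "0 \<le> T" and p: "\<And>j. j \<in> J \<Longrightarrow> is_primitive T (x j) (y j)"
  shows "is_primitive T (\<lambda>t. \<Sum>j\<in>J. x j t) (\<lambda>t. \<Sum>j\<in>J. y j t)"
  using p
proof (induction J rule: infinite_finite_induct)
  case (insert j J)
  then show ?case using is_primitive_add[OF T, of "x j" "y j" "\<lambda>t. \<Sum>j\<in>J. x j t" "\<lambda>t. \<Sum>j\<in>J. y j t"] by simp
qed (auto intro!: is_primitiveI)

text \<open>The consistency error. On each cell the residual is the integral of the derivative minus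
  the step value; the sum over all cells is an L1 norm, bounded through Cauchy-Schwarz by the L2
  norm.\<close>

lemma primitive_increments_residual:
  assumes T: "0 < T" and N: "0 < N" and p: "is_primitive T x y"
  shows "(\<Sum>i<N. norm (x (node T N (Suc i)) - x (node T N i) - (T / real N) *\<^sub>R S i))
    \<le> sqrt T * norm_L2 T (\<lambda>t. y t - S (cell T N t))"
proof -
  have T0: "0 \<le> T" using T by simp
  have yL: "y \<in> L2_space T" by (rule is_primitiveD(1)[OF p])
  have L: "(\<lambda>t. y t - S (cell T N t)) \<in> L2_space T" by (intro L2_diff yL step_L2(1)[OF T N])
  have "(\<Sum>i<N. norm (x (node T N (Suc i)) - x (node T N i) - (T / real N) *\<^sub>R S i))
      \<le> (\<Sum>i<N. integral {node T N i..node T N (Suc i)} (\<lambda>t. norm (y t - S (cell T N t))))"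
  proof (rule sum_mono)
    fix i assume i: "i \<in> {..<N}"
    have b: "0 \<le> node T N i" "node T N (Suc i) \<le> T" "node T N i \<le> node T N (Suc i)"
      using i by (auto intro!: node_le T N node_nonneg node_mono T0)
    have yi: "y integrable_on {node T N i..node T N (Suc i)}" by (rule L2_integral_bound(1)[OF T0 yL b(1,2)])
    have si: "(\<lambda>t. S (cell T N t)) integrable_on {node T N i..node T N (Suc i)}"
      by (rule L2_integral_bound(1)[OF T0 step_L2(1)[OF T N] b(1,2)])
    have "integral {node T N i..node T N (Suc i)} (\<lambda>t. S (cell T N t)) = integral {node T N i..node T N (Suc i)} (\<lambda>t. S i)"
      by (rule cell_integral[OF T N order_refl, of i "\<lambda>i t. S i"])
    also have "\<dots> = (T / real N) *\<^sub>R S i" using T by (simp add: node_Suc)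
    finally have "x (node T N (Suc i)) - x (node T N i) - (T / real N) *\<^sub>R S i
        = integral {node T N i..node T N (Suc i)} (\<lambda>t. y t - S (cell T N t))"
      using is_primitive_increment[OF T0 p b(1,3,2)] integral_diff[OF yi si] by simp
    also have "norm \<dots> \<le> integral {node T N i..node T N (Suc i)} (\<lambda>t. norm (y t - S (cell T N t)))"
      by (intro integral_norm_bound_integral L2_integral_bound(1,2)[OF T0 L b(1,2)] order_refl)
    finally show "norm (x (node T N (Suc i)) - x (node T N i) - (T / real N) *\<^sub>R S i)
        \<le> integral {node T N i..node T N (Suc i)} (\<lambda>t. norm (y t - S (cell T N t)))" .
  qed
  also have "\<dots> = integral {0..node T N N} (\<lambda>t. norm (y t - S (cell T N t)))"
    by (rule integral_cells[symmetric, OF T N]) (auto intro: L2_integral_bound(2)[OF T0 L])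
  also have "\<dots> = (LINT t|lebesgue_on {0<..<T}. norm (y t - S (cell T N t)))"
    unfolding node_N[OF N]
    by (rule lebesgue_on_open_interval_integral(2)[symmetric, OF integrable_norm[OF L2_norm_integral_le(1)[OF T0 L]]])
  also have "\<dots> \<le> sqrt T * norm_L2 T (\<lambda>t. y t - S (cell T N t))" by (rule L2_norm_integral_le(2)[OF T0 L])
  finally show ?thesis .
qed

text \<open>The residual estimate for the zero function, whose increments vanish.\<close>

lemma step_L1_le_L2:
  fixes S :: "nat \<Rightarrow> 'a::euclidean_space"
  assumes T: "0 < T" and N: "0 < N"
  shows "(\<Sum>i<N. T / real N * norm (S i)) \<le> sqrt T * norm_L2 T (\<lambda>t. S (cell T N t))"
proof -
  have "is_primitive T (\<lambda>t. 0::'a) (\<lambda>t. 0)" by (rule is_primitiveI) auto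
  from primitive_increments_residual[OF T N this, of S] show ?thesis using T by simp
qed

lemma step_L2_bound:
  fixes S :: "nat \<Rightarrow> 'a::euclidean_space"
  assumes T: "0 < T" and N: "0 < N" and le: "\<And>i. i < N \<Longrightarrow> norm (S i) \<le> c" and c: "0 \<le> c"
  shows "norm_L2 T (\<lambda>t. S (cell T N t)) \<le> c * sqrt T"
  using T c cell_props(3)[OF T N] by (intro L2_space_bounded(2) measurable_step le) auto

text \<open>For \<open>h\<close> times the operator norm below 1, the map \<open>y - h G y\<close>
  is injective, hence bijective, and each implicit step can be solved.\<close>

lemma implicit_euler_exists:
  fixes G :: "real^'n^'n" and \<sigma> :: "nat \<Rightarrow> real^'n"
  assumes h: "0 \<le> h" and ha: "h * onorm ((*v) G) < 1"
  obtains E where "E 0 = E0" "\<And>i. E (Suc i) - E i = h *\<^sub>R (G *v E (Suc i)) + h *\<^sub>R \<sigma> (Suc i)"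
proof -
  have "\<exists>y. y - h *\<^sub>R (G *v y) = z" for z
  proof -
    let ?L = "\<lambda>y. y - h *\<^sub>R (G *v y)"
    have lin: "linear ?L"
      by (rule linearI) (simp_all add: matrix_vector_right_distrib matrix_vector_mult_scaleR algebra_simps)
    have "inj ?L"
      unfolding linear_injective_0[OF lin]
    proof (intro allI impI)
      fix y assume "y - h *\<^sub>R (G *v y) = 0"
      then have "norm y = norm (h *\<^sub>R (G *v y))" by simp
      also have "\<dots> = h * norm (G *v y)" using h by simp
      also have "\<dots> \<le> h * (onorm ((*v) G) * norm y)"
        by (intro mult_left_mono onorm[OF matrix_vector_mul_bounded_linear] h)
      finally have "(1 - h * onorm ((*v) G)) * norm y \<le> 0" by (simp add: algebra_simps)
      then show "y = 0" using ha by (simp add: mult_le_0_iff)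
    qed
    then have "surj ?L" by (intro linear_injective_imp_surjective[OF lin]) simp_all
    then obtain y where "z = ?L y" by (rule surjE)
    then show ?thesis by (intro exI[of _ y]) (rule sym)
  qed
  then obtain s where s: "\<And>z. s z - h *\<^sub>R (G *v s z) = z" by metis
  define E where "E = rec_nat E0 (\<lambda>i e. s (e + h *\<^sub>R \<sigma> (Suc i)))"
  have E0': "E 0 = E0" and ES: "E (Suc i) = s (E i + h *\<^sub>R \<sigma> (Suc i))" for i by (simp_all add: E_def)
  have "E (Suc i) - E i = h *\<^sub>R (G *v E (Suc i)) + h *\<^sub>R \<sigma> (Suc i)" for i
    using s[of "E i + h *\<^sub>R \<sigma> (Suc i)"] unfolding ES[of i] by (simp add: algebra_simps)
  with E0' that show ?thesis by blast
qed

text \<open>Discrete Gronwall: one step divides by \<open>1 - s\<close> with \<open>s = h a\<close>,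
  and \<open>1 / (1 - s) \<le> exp (2 s)\<close> for \<open>s \<le> 1 / 2\<close>. This is the
  origin of the factor 2 in the exponent; the product of the factors depends only on the final
  time.\<close>

lemma implicit_euler_bound:
  fixes G :: "real^'n^'n" and \<sigma> :: "nat \<Rightarrow> real^'n"
  assumes h: "0 \<le> h" and ha: "h * onorm ((*v) G) \<le> 1 / 2"
    and E: "\<And>i. i < N \<Longrightarrow> E (Suc i) - E i = h *\<^sub>R (G *v E (Suc i)) + h *\<^sub>R \<sigma> (Suc i)" and i: "i \<le> N"
  shows "norm (E i) \<le> exp (2 * onorm ((*v) G) * (h * real N)) * (norm (E 0) + (\<Sum>j<N. h * norm (\<sigma> (Suc j))))"
proof -
  define a where "a = onorm ((*v) G)"
  have a: "0 \<le> a" unfolding a_def by (rule onorm_pos_le[OF matrix_vector_mul_bounded_linear])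
  have step: "norm (E (Suc i)) \<le> exp (2 * (h * a)) * (norm (E i) + h * norm (\<sigma> (Suc i)))" if "i < N" for i
  proof -
    have "E (Suc i) = E i + (h *\<^sub>R (G *v E (Suc i)) + h *\<^sub>R \<sigma> (Suc i))" using E[OF that] by (simp add: algebra_simps)
    then have "norm (E (Suc i)) \<le> norm (E i) + (norm (h *\<^sub>R (G *v E (Suc i))) + norm (h *\<^sub>R \<sigma> (Suc i)))"
      by (metis norm_triangle_ineq norm_triangle_mono order_refl)
    also have "norm (h *\<^sub>R (G *v E (Suc i))) \<le> (h * a) * norm (E (Suc i))"
      using h onorm[OF matrix_vector_mul_bounded_linear[of G], of "E (Suc i)"]
      by (simp add: a_def mult.assoc mult_left_mono)
    finally have 1: "(1 - h * a) * norm (E (Suc i)) \<le> norm (E i) + h * norm (\<sigma> (Suc i))"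
      using h by (simp add: algebra_simps)
    have ha0: "0 \<le> h * a" "h * a \<le> 1 / 2" using h a ha by (auto simp: a_def)
    have "2 * (h * a) * (h * a) \<le> 1 * (h * a)" using ha0 by (intro mult_right_mono) auto
    then have "1 \<le> (1 + 2 * (h * a)) * (1 - h * a)" by (simp add: algebra_simps)
    also have "\<dots> \<le> exp (2 * (h * a)) * (1 - h * a)"
      using ha0 by (intro mult_right_mono exp_ge_add_one_self) auto
    finally have "1 * norm (E (Suc i)) \<le> (exp (2 * (h * a)) * (1 - h * a)) * norm (E (Suc i))"
      by (rule mult_right_mono) simp
    also have "\<dots> = exp (2 * (h * a)) * ((1 - h * a) * norm (E (Suc i)))" by (simp only: mult.assoc)
    also have "\<dots> \<le> exp (2 * (h * a)) * (norm (E i) + h * norm (\<sigma> (Suc i)))"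
      by (intro mult_left_mono 1) simp
    finally show ?thesis by simp
  qed
  have "norm (E i) \<le> exp (2 * (h * a) * real i) * (norm (E 0) + (\<Sum>j<i. h * norm (\<sigma> (Suc j))))" if "i \<le> N" for i
    using that
  proof (induction i)
    case (Suc i)
    define q where "q = norm (E 0) + (\<Sum>j<i. h * norm (\<sigma> (Suc j)))"
    have e1: "1 \<le> exp (2 * (h * a) * real i)" using h a by simp
    have "norm (E (Suc i)) \<le> exp (2 * (h * a)) * (norm (E i) + h * norm (\<sigma> (Suc i)))" using Suc.prems by (intro step) simp
    also have "\<dots> \<le> exp (2 * (h * a)) * (exp (2 * (h * a) * real i) * q + exp (2 * (h * a) * real i) * (h * norm (\<sigma> (Suc i))))"
    proof (intro mult_left_mono add_mono)
      show "norm (E i) \<le> exp (2 * (h * a) * real i) * q" unfolding q_def using Suc by simp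
      show "h * norm (\<sigma> (Suc i)) \<le> exp (2 * (h * a) * real i) * (h * norm (\<sigma> (Suc i)))"
        using mult_right_mono[OF e1, of "h * norm (\<sigma> (Suc i))"] h by simp
    qed simp
    also have "\<dots> = exp (2 * (h * a) * real (Suc i)) * (q + h * norm (\<sigma> (Suc i)))"
      by (simp add: distrib_left exp_add mult.assoc)
    finally show ?case by (simp add: q_def add.assoc)
  qed simp
  from this[OF i] have "norm (E i) \<le> exp (2 * (h * a) * real i) * (norm (E 0) + (\<Sum>j<i. h * norm (\<sigma> (Suc j))))" .
  also have "\<dots> \<le> exp (2 * a * (h * real N)) * (norm (E 0) + (\<Sum>j<N. h * norm (\<sigma> (Suc j))))"
  proof (intro mult_mono add_mono sum_mono2)
    have "h * a * real i \<le> h * a * real N" using i h a by (intro mult_left_mono) auto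
    then show "exp (2 * (h * a) * real i) \<le> exp (2 * a * (h * real N))" by (simp add: mult_ac)
  qed (use h i in \<open>auto intro!: add_nonneg_nonneg sum_nonneg\<close>)
  finally show ?thesis by (simp add: a_def)
qed

lemma eventually_step_small: "0 < c \<Longrightarrow> \<forall>\<^sub>F N in sequentially. 0 < N \<and> T / real N * a < c"
proof (intro eventually_conj eventually_gt_at_top)
  assume "0 < c"
  have "(\<lambda>N. T / real N * a) \<longlonglongrightarrow> 0 * a" by (intro tendsto_mult lim_const_over_n tendsto_const)
  then show "\<forall>\<^sub>F N in sequentially. T / real N * a < c" using \<open>0 < c\<close> by (intro order_tendstoD(2)[of _ 0]) auto
qed

lemma norm_sum_components_le:
  fixes c :: "real^'n" and x :: "'n \<Rightarrow> 'a::real_normed_vector"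
  assumes "\<And>j. norm (x j) \<le> m j"
  shows "norm (\<Sum>j\<in>UNIV. c $ j *\<^sub>R x j) \<le> norm c * (\<Sum>j\<in>UNIV. m j)"
proof -
  have "norm (\<Sum>j\<in>UNIV. c $ j *\<^sub>R x j) \<le> (\<Sum>j\<in>UNIV. norm (c $ j *\<^sub>R x j))" by (rule norm_sum)
  also have "\<dots> \<le> (\<Sum>j\<in>UNIV. norm c * m j)"
    using assms by (intro sum_mono) (simp add: mult_mono component_le_norm_cart)
  finally show ?thesis by (simp add: sum_distrib_left)
qed

lemma matrix_vector_sum_scaleR:
  fixes A :: "real^'n^'m"
  shows "A *v (\<Sum>j\<in>J. c j *\<^sub>R x j) = (\<Sum>j\<in>J. c j *\<^sub>R (A *v x j))"
  using linear_sum[OF bounded_linear.linear[OF matrix_vector_mul_bounded_linear[of A]], of "\<lambda>j. c j *\<^sub>R x j" J]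
  by (simp add: matrix_vector_mult_scaleR)

section \<open>Corrections of defects under the mixed constraint\<close>

text \<open>\<open>R\<close> stands for a right inverse of \<open>D\<close>; the pseudoinverse is
  inserted at the end. \<open>kalman\<close> concerns the dynamics after the feedback that absorbs
  the constraint.\<close>

locale constrained_control =
  fixes T :: real and A :: "real^'n^'n" and B :: "real^'m^'n" and C :: "real^'n^'l" and D :: "real^'m^'l"
    and R :: "real^'l^'m" and Y :: "real^'p^'m"
  assumes T: "0 < T" and DR: "D ** R = mat 1" and DY: "D ** Y = 0"
    and kalman: "rank (controllability_matrix (A - B ** R ** C) (B ** Y)) = CARD('n)"
begin

abbreviation "G \<equiv> A - B ** R ** C"

lemma T0: "0 \<le> T" using T by simp

text \<open>The control \<open>R (r - C e) + Y v\<close> meets the mixed constraint with value r and leaves v free.\<close>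

lemma feedback_constraint: "C *v e + D *v (R *v (r - C *v e) + Y *v v) = r"
proof -
  have "D *v (R *v (r - C *v e) + Y *v v) = (D ** R) *v (r - C *v e) + (D ** Y) *v v"
    by (simp only: matrix_vector_right_distrib matrix_vector_mul_assoc)
  then show ?thesis by (simp add: DR DY)
qed

text \<open>The feedback changes the system matrix to \<open>G\<close>, leaves \<open>v\<close>
  acting through \<open>B Y\<close>, and turns the constraint value into an additional
  forcing.\<close>

lemma feedback_dynamics:
  "A *v e + B *v (R *v (r - C *v e) + Y *v v) + \<rho> = G *v e + (B ** Y) *v v + (\<rho> + (B ** R) *v r)"
proof -
  have "B *v (R *v (r - C *v e) + Y *v v) = (B ** R) *v r - (B ** R ** C) *v e + (B ** Y) *v v"
    by (simp only: matrix_vector_right_distrib matrix_vector_mult_diff_distrib matrix_vector_mul_assoc matrix_mul_assoc)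
  then show ?thesis by (simp add: matrix_vector_mult_diff_rdistrib algebra_simps)
qed

text \<open>Fixing one steering trajectory for each unit vector lets every target be reached by a
  linear combination, with costs proportional to the target.\<close>

lemma basis_trajectories:
  "\<exists>e v. \<forall>j::'n. continuous_on {0..T} (v j) \<and> e j 0 = 0 \<and>
    is_primitive T (e j) (\<lambda>t. G *v e j t + (B ** Y) *v v j t) \<and> e j T = axis j (1::real)"
proof -
  define Q where "Q j e v \<longleftrightarrow> continuous_on {0..T} v \<and> e 0 = 0 \<and>
    is_primitive T e (\<lambda>t. G *v e t + (B ** Y) *v v t) \<and> e T = axis j (1::real)" for j :: 'n and e v
  have "\<exists>e v. Q j e v" for j
    unfolding Q_def using controllable_reachable[OF T kalman, of "axis j 1"] by blast
  then obtain e v where "\<And>j. Q j (e j) (v j)" by metis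
  then show ?thesis unfolding Q_def by blast
qed

lemma continuous_bound:
  assumes "continuous_on {0..T} (x :: real \<Rightarrow> 'z::real_normed_vector)"
  obtains c where "0 \<le> c" "\<And>t. 0 \<le> t \<Longrightarrow> t \<le> T \<Longrightarrow> norm (x t) \<le> c"
proof -
  have "bounded (x ` {0..T})" using assms by (intro compact_imp_bounded compact_continuous_image) auto
  then obtain c where "0 < c" "\<forall>y\<in>x ` {0..T}. norm y \<le> c" by (auto simp: bounded_pos)
  then show ?thesis by (intro that[of c]) auto
qed

lemma axis_expansion: "(\<Sum>j\<in>UNIV. z $ j *\<^sub>R axis j (1::real)) = (z :: real^'n)"
  using basis_expansion[of z] by (simp add: scalar_mult_eq_scaleR)

text \<open>The perturbation \<open>e\<close> absorbs a dynamic defect \<open>\<rho>\<close>,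
  realizes the constraint value \<open>r\<close> and hits the end state \<open>\<zeta>\<close>. With
  \<open>v = 0\<close> one solves for \<open>\<rho>\<close> and \<open>r\<close>; the missed end
  state is then added by basis trajectories, which leave defect and constraint value alone. The
  constant is chosen before the data, so small defects have small corrections.\<close>

lemma continuous_correction:
  "\<exists>c\<ge>0. \<forall>\<rho> r \<zeta>. \<rho> \<in> L2_space T \<longrightarrow> r \<in> L2_space T \<longrightarrow> (\<exists>e w. w \<in> L2_space T \<and> e 0 = 0 \<and>
     is_primitive T e (\<lambda>t. A *v e t + B *v w t + \<rho> t) \<and> (\<forall>t. C *v e t + D *v w t = r t) \<and> e T = \<zeta> \<and>
     (\<forall>t\<in>{0..T}. norm (e t) \<le> c * (norm_L2 T \<rho> + norm_L2 T r + norm \<zeta>)) \<and>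
     norm_L2 T w \<le> c * (norm_L2 T \<rho> + norm_L2 T r + norm \<zeta>))"
proof -
  obtain eb vb where b: "\<forall>j::'n. continuous_on {0..T} (vb j) \<and> eb j 0 = 0 \<and>
      is_primitive T (eb j) (\<lambda>t. G *v eb j t + (B ** Y) *v vb j t) \<and> eb j T = axis j (1::real)"
    using basis_trajectories by blast
  then have vbc: "continuous_on {0..T} (vb j)" and eb0: "eb j 0 = 0"
    and ebp: "is_primitive T (eb j) (\<lambda>t. G *v eb j t + (B ** Y) *v vb j t)"
    and ebT: "eb j T = axis j 1" for j by blast+
  have vbL: "vb j \<in> L2_space T" for j by (rule continuous_on_L2_space(2)[OF vbc])
  have "\<exists>m. \<forall>t. 0 \<le> t \<longrightarrow> t \<le> T \<longrightarrow> norm (eb j t) \<le> m" for j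
    using continuous_bound[OF is_primitive_continuous[OF T0 ebp[of j]]] by blast
  then obtain m where m: "\<And>j t. 0 \<le> t \<Longrightarrow> t \<le> T \<Longrightarrow> norm (eb j t) \<le> m j" by metis
  have m0: "0 \<le> m j" for j using order_trans[OF norm_ge_zero m[of 0 j]] T0 by simp
  define me where "me = (\<Sum>j\<in>UNIV. m j)"
  define mv where "mv = (\<Sum>j\<in>UNIV. norm_L2 T (vb j))"
  have me: "0 \<le> me" and mv: "0 \<le> mv" using m0 by (auto simp: me_def mv_def intro: sum_nonneg)
  define kBR kR kC kY where "kBR = onorm ((*v) (B ** R))" and "kR = onorm ((*v) R)" and "kC = onorm ((*v) C)" and "kY = onorm ((*v) Y)"
  have k: "0 \<le> kBR" "0 \<le> kR" "0 \<le> kC" "0 \<le> kY"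
    unfolding kBR_def kR_def kC_def kY_def by (intro onorm_pos_le matrix_vector_mul_bounded_linear)+
  \<comment> \<open>Multiplied by the data size \<open>S\<close>, the constants bound in turn the
    trajectory with \<open>v = 0\<close>, the corrected trajectory and the corrected
    control.\<close>
  define c0 where "c0 = exp (onorm ((*v) G) * T) * (sqrt T * (1 + kBR))"
  define c1 where "c1 = c0 + (1 + c0) * me"
  define c2 where "c2 = kR * (1 + kC * (c1 * sqrt T)) + kY * ((1 + c0) * mv)"
  have c0: "0 \<le> c0" using k T0 by (simp add: c0_def)
  have c1: "0 \<le> c1" using c0 me by (simp add: c1_def)
  have c2: "0 \<le> c2" using c0 c1 k mv T0 by (simp add: c2_def)
  show ?thesis
  proof (intro exI[of _ "c1 + c2"] conjI allI impI)
    show "0 \<le> c1 + c2" using c1 c2 by simp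
    fix \<rho> :: "real \<Rightarrow> real^'n" and r :: "real \<Rightarrow> real^'l" and \<zeta> :: "real^'n"
    assume \<rho>: "\<rho> \<in> L2_space T" and r: "r \<in> L2_space T"
    define S where "S = norm_L2 T \<rho> + norm_L2 T r + norm \<zeta>"
    have S: "0 \<le> S" by (simp add: S_def)
    define \<sigma> where "\<sigma> t = \<rho> t + (B ** R) *v r t" for t
    have \<sigma>L: "\<sigma> \<in> L2_space T" unfolding \<sigma>_def by (intro L2_add \<rho> L2_matrix r)
    have \<sigma>n: "norm_L2 T \<sigma> \<le> (1 + kBR) * S"
    proof -
      have "norm_L2 T \<sigma> \<le> norm_L2 T \<rho> + norm_L2 T (\<lambda>t. (B ** R) *v r t)"
        unfolding \<sigma>_def by (intro norm_L2_triangle \<rho> L2_matrix r)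
      also have "\<dots> \<le> 1 * S + kBR * S"
      proof (rule add_mono)
        show "norm_L2 T \<rho> \<le> 1 * S" by (simp add: S_def)
        have "norm_L2 T (\<lambda>t. (B ** R) *v r t) \<le> kBR * norm_L2 T r" unfolding kBR_def by (rule L2_matrix(2)[OF r])
        also have "\<dots> \<le> kBR * S" using k by (intro mult_left_mono) (auto simp: S_def)
        finally show "norm_L2 T (\<lambda>t. (B ** R) *v r t) \<le> kBR * S" .
      qed
      finally show ?thesis by (simp add: distrib_right)
    qed
    obtain e0 where e00: "e0 0 = 0" and e0p: "is_primitive T e0 (\<lambda>t. G *v e0 t + \<sigma> t)"
      using linear_ode_solution_exists[OF T0 \<sigma>L] by blast
    have e0b: "norm (e0 t) \<le> c0 * S" if t: "0 \<le> t" "t \<le> T" for t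
    proof -
      have "norm (e0 t) \<le> exp (onorm ((*v) G) * T) * (norm (e0 0) + sqrt T * norm_L2 T \<sigma>)"
        by (rule linear_ode_bound[OF T0 \<sigma>L e0p t])
      also have "\<dots> \<le> exp (onorm ((*v) G) * T) * (sqrt T * ((1 + kBR) * S))"
        unfolding e00 norm_zero add_0_left using T0 by (intro mult_left_mono \<sigma>n) auto
      finally show ?thesis by (simp add: c0_def mult.assoc)
    qed
    define \<zeta>' where "\<zeta>' = \<zeta> - e0 T"
    have \<zeta>': "norm \<zeta>' \<le> (1 + c0) * S"
    proof -
      have "norm \<zeta>' \<le> norm \<zeta> + norm (e0 T)" unfolding \<zeta>'_def by (rule norm_triangle_ineq4)
      also have "\<dots> \<le> S + c0 * S" using T0 by (intro add_mono e0b) (auto simp: S_def)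
      finally show ?thesis by (simp add: distrib_right)
    qed
    define v where "v t = (\<Sum>j\<in>UNIV. \<zeta>' $ j *\<^sub>R vb j t)" for t
    define e where "e t = e0 t + (\<Sum>j\<in>UNIV. \<zeta>' $ j *\<^sub>R eb j t)" for t
    define w where "w t = R *v (r t - C *v e t) + Y *v v t" for t
    have vL: "v \<in> L2_space T" unfolding v_def by (intro L2_sum L2_scaleR vbL)
    have "is_primitive T e (\<lambda>t. (G *v e0 t + \<sigma> t) + (\<Sum>j\<in>UNIV. \<zeta>' $ j *\<^sub>R (G *v eb j t + (B ** Y) *v vb j t)))"
      unfolding e_def by (intro is_primitive_add is_primitive_sum is_primitive_scaleR T0 e0p ebp)
    moreover have "(G *v e0 t + \<sigma> t) + (\<Sum>j\<in>UNIV. \<zeta>' $ j *\<^sub>R (G *v eb j t + (B ** Y) *v vb j t)) = A *v e t + B *v w t + \<rho> t" for t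
    proof -
      have "A *v e t + B *v w t + \<rho> t = G *v e t + (B ** Y) *v v t + \<sigma> t"
        unfolding w_def \<sigma>_def by (rule feedback_dynamics)
      also have "G *v e t = G *v e0 t + (\<Sum>j\<in>UNIV. \<zeta>' $ j *\<^sub>R (G *v eb j t))"
        unfolding e_def by (simp only: matrix_vector_right_distrib matrix_vector_sum_scaleR)
      also have "(B ** Y) *v v t = (\<Sum>j\<in>UNIV. \<zeta>' $ j *\<^sub>R ((B ** Y) *v vb j t))"
        unfolding v_def by (simp only: matrix_vector_sum_scaleR)
      finally show ?thesis by (simp add: scaleR_add_right sum.distrib)
    qed
    ultimately have ep: "is_primitive T e (\<lambda>t. A *v e t + B *v w t + \<rho> t)" by simp
    have eL: "e \<in> L2_space T" by (rule is_primitive_L2[OF T0 ep])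
    have wL: "w \<in> L2_space T" unfolding w_def by (intro L2_add L2_matrix L2_diff r eL vL)
    have eb: "norm (e t) \<le> c1 * S" if t: "0 \<le> t" "t \<le> T" for t
    proof -
      have "norm (e t) \<le> norm (e0 t) + norm (\<Sum>j\<in>UNIV. \<zeta>' $ j *\<^sub>R eb j t)" unfolding e_def by (rule norm_triangle_ineq)
      also have "\<dots> \<le> c0 * S + norm \<zeta>' * me"
        unfolding me_def by (intro add_mono e0b t norm_sum_components_le m)
      also have "\<dots> \<le> c0 * S + ((1 + c0) * S) * me" by (intro add_left_mono mult_right_mono \<zeta>' me)
      finally show ?thesis by (simp add: c1_def algebra_simps)
    qed
    have vn: "norm_L2 T v \<le> ((1 + c0) * mv) * S"
    proof -
      have "norm_L2 T (\<lambda>t. \<Sum>j\<in>J. \<zeta>' $ j *\<^sub>R vb j t) \<le> (\<Sum>j\<in>J. \<bar>\<zeta>' $ j\<bar> * norm_L2 T (vb j))" if "finite J" for J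
        using that
      proof (induction J)
        case empty
        then show ?case by (simp add: norm_L2_def)
      next
        case (insert j J)
        have "norm_L2 T (\<lambda>t. \<zeta>' $ j *\<^sub>R vb j t + (\<Sum>j\<in>J. \<zeta>' $ j *\<^sub>R vb j t))
            \<le> norm_L2 T (\<lambda>t. \<zeta>' $ j *\<^sub>R vb j t) + norm_L2 T (\<lambda>t. \<Sum>j\<in>J. \<zeta>' $ j *\<^sub>R vb j t)"
          by (intro norm_L2_triangle L2_sum L2_scaleR vbL)
        with insert show ?case by (simp add: norm_L2_scaleR)
      qed
      from this[OF finite] have "norm_L2 T v \<le> (\<Sum>j\<in>UNIV. \<bar>\<zeta>' $ j\<bar> * norm_L2 T (vb j))" by (simp add: v_def[abs_def])
      also have "\<dots> \<le> (\<Sum>j\<in>UNIV. norm \<zeta>' * norm_L2 T (vb j))"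
        by (intro sum_mono mult_right_mono component_le_norm_cart) simp
      also have "\<dots> = norm \<zeta>' * mv" by (simp add: mv_def sum_distrib_left)
      also have "\<dots> \<le> ((1 + c0) * S) * mv" by (intro mult_right_mono \<zeta>' mv)
      finally show ?thesis by (simp add: mult_ac)
    qed
    have en: "norm_L2 T e \<le> (c1 * S) * sqrt T"
      using c1 S by (intro L2_space_bounded(2)[OF T0 L2_spaceD(1)[OF eL]] eb) auto
    have wn: "norm_L2 T w \<le> c2 * S"
    proof -
      have Ce: "norm_L2 T (\<lambda>t. C *v e t) \<le> kC * ((c1 * S) * sqrt T)"
        using L2_matrix(2)[OF eL, of C] mult_left_mono[OF en k(3)] unfolding kC_def by (rule order_trans)
      have "norm_L2 T (\<lambda>t. r t - C *v e t) \<le> norm_L2 T r + norm_L2 T (\<lambda>t. C *v e t)"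
        using norm_L2_triangle[OF r L2_uminus[OF L2_matrix(1)[OF eL, of C]]] by simp
      also have "\<dots> \<le> S + kC * ((c1 * S) * sqrt T)" by (intro add_mono Ce) (simp add: S_def)
      finally have "kR * norm_L2 T (\<lambda>t. r t - C *v e t) \<le> kR * (S + kC * ((c1 * S) * sqrt T))"
        using k by (intro mult_left_mono) auto
      moreover have "norm_L2 T (\<lambda>t. R *v (r t - C *v e t)) \<le> kR * norm_L2 T (\<lambda>t. r t - C *v e t)"
        unfolding kR_def by (intro L2_matrix L2_diff r eL)
      moreover have "norm_L2 T (\<lambda>t. Y *v v t) \<le> kY * (((1 + c0) * mv) * S)"
        using L2_matrix(2)[OF vL, of Y] mult_left_mono[OF vn k(4)] unfolding kY_def by (rule order_trans)
      moreover have "norm_L2 T w \<le> norm_L2 T (\<lambda>t. R *v (r t - C *v e t)) + norm_L2 T (\<lambda>t. Y *v v t)"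
        unfolding w_def by (intro norm_L2_triangle L2_matrix L2_diff r eL vL)
      ultimately have "norm_L2 T w \<le> kR * (S + kC * (c1 * S * sqrt T)) + kY * ((1 + c0) * mv * S)" by linarith
      then show ?thesis by (simp add: c2_def algebra_simps)
    qed
    show "\<exists>e w. w \<in> L2_space T \<and> e 0 = 0 \<and>
     is_primitive T e (\<lambda>t. A *v e t + B *v w t + \<rho> t) \<and> (\<forall>t. C *v e t + D *v w t = r t) \<and> e T = \<zeta> \<and>
     (\<forall>t\<in>{0..T}. norm (e t) \<le> (c1 + c2) * (norm_L2 T \<rho> + norm_L2 T r + norm \<zeta>)) \<and>
     norm_L2 T w \<le> (c1 + c2) * (norm_L2 T \<rho> + norm_L2 T r + norm \<zeta>)"
      unfolding S_def[symmetric]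
    proof (intro exI[of _ e] exI[of _ w] conjI wL ep ballI allI)
      show "e 0 = 0" by (simp add: e_def e00 eb0)
      show "C *v e t + D *v w t = r t" for t unfolding w_def by (rule feedback_constraint)
      show "e T = \<zeta>" unfolding e_def ebT axis_expansion by (simp add: \<zeta>'_def)
      have "c1 * S \<le> (c1 + c2) * S" "c2 * S \<le> (c1 + c2) * S" using c1 c2 S by (auto intro: mult_right_mono)
      then show "norm_L2 T w \<le> (c1 + c2) * S" "\<And>t. t \<in> {0..T} \<Longrightarrow> norm (e t) \<le> (c1 + c2) * S"
        using wn eb by (auto intro: order_trans)
    qed
  qed
qed

end

lemma sampling_eventually_small:
  assumes "sampling_consistent T y" "0 < \<delta>"
  shows "\<forall>\<^sub>F N in sequentially. norm_L2 T (\<lambda>t. y (node T N (Suc (cell T N t))) - y t) < \<delta>"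
  using assms unfolding sampling_consistent_def by (intro order_tendstoD(2)[of _ 0]) auto

text \<open>Consistency plus stability: the error at the nodes solves the same scheme, with the
  consistency residual as forcing. Applied to the basis trajectories, it shows that their discrete
  end states are almost unit vectors.\<close>

lemma implicit_euler_converges:
  fixes G :: "real^'n^'n"
  assumes T: "0 < T" and p: "is_primitive T e (\<lambda>t. G *v e t + s t)" and s: "continuous_on {0..T} s" and \<delta>: "0 < \<delta>"
  shows "\<forall>\<^sub>F N in sequentially. \<forall>E. E 0 = e 0 \<longrightarrow>
     (\<forall>i<N. E (Suc i) - E i = (T / real N) *\<^sub>R (G *v E (Suc i)) + (T / real N) *\<^sub>R s (node T N (Suc i))) \<longrightarrow>
     norm (E N - e T) \<le> \<delta>"
proof -
  have T0: "0 \<le> T" using T by simp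
  define y where "y t = G *v e t + s t" for t
  have ec: "continuous_on {0..T} e" by (rule is_primitive_continuous[OF T0 p])
  have yc: "continuous_on {0..T} y" unfolding y_def by (intro continuous_intros continuous_on_matrix_mult ec s)
  have py: "is_primitive T e y" using p by (simp add: y_def[abs_def])
  define k where "k = exp (2 * onorm ((*v) G) * T) * sqrt T"
  have k: "0 < k" using T by (simp add: k_def)
  have "\<forall>\<^sub>F N in sequentially. norm_L2 T (\<lambda>t. y (node T N (Suc (cell T N t))) - y t) < \<delta> / k"
    using k \<delta> by (intro sampling_eventually_small sampling_consistent_continuous T yc) auto
  moreover have "\<forall>\<^sub>F N in sequentially. 0 < N \<and> T / real N * onorm ((*v) G) < 1 / 2"
    by (rule eventually_step_small) simp
  ultimately show ?thesis
  proof eventually_elim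
    case (elim N)
    then have N: "0 < N" by simp
    show ?case
    proof (intro allI impI)
      fix E assume E0: "E 0 = e 0"
        and E: "\<forall>i<N. E (Suc i) - E i = (T / real N) *\<^sub>R (G *v E (Suc i)) + (T / real N) *\<^sub>R s (node T N (Suc i))"
      define h where "h = T / real N"
      have h: "0 < h" using T N by (simp add: h_def)
      define d where "d i = e (node T N i) - E i" for i
      \<comment> \<open>Indexed by the right end of the step, as the scheme reads its forcing at
        \<open>Suc i\<close>; the value at 0 never enters.\<close>
      define \<rho> where "\<rho> i = (1 / h) *\<^sub>R (e (node T N i) - e (node T N (i - 1)) - h *\<^sub>R y (node T N i))" for i
      have rec: "d (Suc i) - d i = h *\<^sub>R (G *v d (Suc i)) + h *\<^sub>R \<rho> (Suc i)" if "i < N" for i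
      proof -
        have inc: "e (node T N (Suc i)) - e (node T N i) = h *\<^sub>R \<rho> (Suc i) + h *\<^sub>R y (node T N (Suc i))"
          using h by (simp add: \<rho>_def)
        have Einc: "E (Suc i) - E i = h *\<^sub>R (G *v E (Suc i)) + h *\<^sub>R s (node T N (Suc i))"
          using E that by (simp add: h_def)
        have "d (Suc i) - d i = (e (node T N (Suc i)) - e (node T N i)) - (E (Suc i) - E i)"
          by (simp add: d_def)
        also have "\<dots> = h *\<^sub>R (G *v d (Suc i)) + h *\<^sub>R \<rho> (Suc i)"
          unfolding inc Einc by (simp add: d_def y_def matrix_vector_mult_diff_distrib scaleR_diff_right scaleR_add_right)
        finally show ?thesis .
      qed
      have sum: "(\<Sum>i<N. h * norm (\<rho> (Suc i))) \<le> sqrt T * norm_L2 T (\<lambda>t. y t - y (node T N (Suc (cell T N t))))"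
      proof -
        have "h * norm (\<rho> (Suc i)) = norm (e (node T N (Suc i)) - e (node T N i) - h *\<^sub>R y (node T N (Suc i)))" for i
          using h by (simp add: \<rho>_def)
        then show ?thesis
          using primitive_increments_residual[OF T N py, of "\<lambda>i. y (node T N (Suc i))"] by (simp add: h_def)
      qed
      have "norm (d N) \<le> exp (2 * onorm ((*v) G) * (h * real N)) * (norm (d 0) + (\<Sum>i<N. h * norm (\<rho> (Suc i))))"
        using elim h by (intro implicit_euler_bound rec) (auto simp: h_def)
      also have "\<dots> \<le> exp (2 * onorm ((*v) G) * T) * (0 + sqrt T * norm_L2 T (\<lambda>t. y t - y (node T N (Suc (cell T N t)))))"
        using N sum by (intro mult_mono add_mono) (auto simp: d_def E0 h_def T0 intro!: sum_nonneg)
      also have "\<dots> = k * norm_L2 T (\<lambda>t. y (node T N (Suc (cell T N t))) - y t)"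
        by (simp add: k_def norm_L2_minus_commute[of T y])
      also have "\<dots> \<le> k * (\<delta> / k)" using elim k by (intro mult_left_mono) auto
      also have "\<dots> = \<delta>" using k by simp
      finally show "norm (E N - e T) \<le> \<delta>" by (simp add: d_def node_N[OF N] norm_minus_commute)
    qed
  qed
qed

context constrained_control
begin

text \<open>The discrete counterpart, with one constant for all fine meshes. The basis controls,
  sampled at the nodes, no longer steer exactly to unit vectors; instead of a discrete rank
  condition, closeness to the continuous end states makes the matrix of discrete end states
  invertible with inverse of norm at most 2.\<close>

lemma discrete_correction:
  "\<exists>c\<ge>0. \<forall>\<^sub>F N in sequentially. \<forall>\<rho> r \<zeta>. \<exists>E W. E 0 = 0 \<and> E N = \<zeta> \<and>
     (\<forall>i<N. E (Suc i) - E i = (T / real N) *\<^sub>R (A *v E (Suc i)) + (T / real N) *\<^sub>R (B *v W (Suc i)) + (T / real N) *\<^sub>R \<rho> (Suc i)) \<and>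
     (\<forall>i. C *v E i + D *v W i = r i) \<and>
     (\<forall>i\<le>N. norm (E i) \<le> c * ((\<Sum>i<N. T / real N * norm (\<rho> (Suc i))) + norm_L2 T (\<lambda>t. r (Suc (cell T N t))) + norm \<zeta>)) \<and>
     norm_L2 T (\<lambda>t. W (Suc (cell T N t))) \<le> c * ((\<Sum>i<N. T / real N * norm (\<rho> (Suc i))) + norm_L2 T (\<lambda>t. r (Suc (cell T N t))) + norm \<zeta>)"
proof -
  obtain eb vb where b: "\<forall>j::'n. continuous_on {0..T} (vb j) \<and> eb j 0 = 0 \<and>
      is_primitive T (eb j) (\<lambda>t. G *v eb j t + (B ** Y) *v vb j t) \<and> eb j T = axis j (1::real)"
    using basis_trajectories by blast
  then have vbc: "continuous_on {0..T} (vb j)" and eb0: "eb j 0 = 0"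
    and ebp: "is_primitive T (eb j) (\<lambda>t. G *v eb j t + (B ** Y) *v vb j t)"
    and ebT: "eb j T = axis j 1" for j by blast+
  have "\<exists>m\<ge>0. \<forall>t. 0 \<le> t \<longrightarrow> t \<le> T \<longrightarrow> norm (vb j t) \<le> m" for j
    using continuous_bound[OF vbc[of j]] by blast
  then obtain m where m: "\<And>j t. 0 \<le> t \<Longrightarrow> t \<le> T \<Longrightarrow> norm (vb j t) \<le> m j" and m0: "\<And>j. 0 \<le> m j" by metis
  define a where "a = onorm ((*v) G)"
  define kBR kR kC kY kBY where "kBR = onorm ((*v) (B ** R))" and "kR = onorm ((*v) R)" and "kC = onorm ((*v) C)"
    and "kY = onorm ((*v) Y)" and "kBY = onorm ((*v) (B ** Y))"
  have k: "0 \<le> kBR" "0 \<le> kR" "0 \<le> kC" "0 \<le> kY" "0 \<le> kBY"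
    unfolding kBR_def kR_def kC_def kY_def kBY_def by (intro onorm_pos_le matrix_vector_mul_bounded_linear)+
  define X where "X = exp (2 * a * T)"
  have X: "0 < X" by (simp add: X_def)
  define mv Q where "mv = (\<Sum>j\<in>UNIV. m j)" and "Q = (\<Sum>j\<in>UNIV. X * (T * (kBY * m j)))"
  have mv: "0 \<le> mv" and Q: "0 \<le> Q" unfolding mv_def Q_def using m0 X T0 k by (auto intro!: sum_nonneg)
  define c0 where "c0 = X * (1 + kBR * sqrt T)"
  define c1 where "c1 = c0 + (2 * (1 + c0)) * Q"
  define c2 where "c2 = kR * (1 + kC * (c1 * sqrt T)) + kY * ((2 * (1 + c0)) * mv * sqrt T)"
  have c0: "0 \<le> c0" using X k T0 by (simp add: c0_def)
  have c1: "0 \<le> c1" using c0 Q by (simp add: c1_def)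
  have c2: "0 \<le> c2" using c0 c1 k mv T0 by (simp add: c2_def)
  \<comment> \<open>With every column within this distance of its unit vector, a combination with
    coefficients \<open>c\<close> misses \<open>c\<close> by at most half of
    \<open>norm c\<close>.\<close>
  define \<delta> where "\<delta> = 1 / (2 * real CARD('n))"
  have \<delta>: "0 < \<delta>" by (simp add: \<delta>_def)
  have conv: "\<forall>\<^sub>F N in sequentially. \<forall>j. \<forall>E. E 0 = eb j 0 \<longrightarrow>
     (\<forall>i<N. E (Suc i) - E i = (T / real N) *\<^sub>R (G *v E (Suc i)) + (T / real N) *\<^sub>R ((B ** Y) *v vb j (node T N (Suc i)))) \<longrightarrow>
     norm (E N - eb j T) \<le> \<delta>"
    by (intro eventually_all_finite implicit_euler_converges[OF T ebp _ \<delta>] continuous_on_matrix_mult vbc)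
  have small: "\<forall>\<^sub>F N in sequentially. 0 < N \<and> T / real N * a < 1 / 2"
    by (rule eventually_step_small) simp
  show ?thesis
  proof (intro exI[of _ "c1 + c2"] conjI)
    show "0 \<le> c1 + c2" using c1 c2 by simp
    from conv small
    show "\<forall>\<^sub>F N in sequentially. \<forall>\<rho> r \<zeta>. \<exists>E W. E 0 = 0 \<and> E N = \<zeta> \<and>
     (\<forall>i<N. E (Suc i) - E i = (T / real N) *\<^sub>R (A *v E (Suc i)) + (T / real N) *\<^sub>R (B *v W (Suc i)) + (T / real N) *\<^sub>R \<rho> (Suc i)) \<and>
     (\<forall>i. C *v E i + D *v W i = r i) \<and>
     (\<forall>i\<le>N. norm (E i) \<le> (c1 + c2) * ((\<Sum>i<N. T / real N * norm (\<rho> (Suc i))) + norm_L2 T (\<lambda>t. r (Suc (cell T N t))) + norm \<zeta>)) \<and>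
     norm_L2 T (\<lambda>t. W (Suc (cell T N t))) \<le> (c1 + c2) * ((\<Sum>i<N. T / real N * norm (\<rho> (Suc i))) + norm_L2 T (\<lambda>t. r (Suc (cell T N t))) + norm \<zeta>)"
    proof eventually_elim
      case (elim N)
      then have N: "0 < N" by simp
      define h where "h = T / real N"
      have h: "0 \<le> h" "0 < h" using T N by (auto simp: h_def)
      have hN: "h * real N = T" using N by (simp add: h_def)
      have ha: "h * onorm ((*v) G) < 1" "h * onorm ((*v) G) \<le> 1 / 2" using elim(2) by (auto simp: h_def a_def)
      note bound = implicit_euler_bound[OF h(1) ha(2), where N=N, unfolded hN a_def[symmetric] X_def[symmetric]]
      have "\<exists>E. E 0 = 0 \<and> (\<forall>i. E (Suc i) - E i = h *\<^sub>R (G *v E (Suc i)) + h *\<^sub>R ((B ** Y) *v vb j (node T N (Suc i))))" for j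
        by (rule implicit_euler_exists[OF h(1) ha(1), of 0 "\<lambda>i. (B ** Y) *v vb j (node T N i)"]) blast
      then obtain EB where EB0: "\<And>j. EB j 0 = 0"
        and EBS: "\<And>j i. EB j (Suc i) - EB j i = h *\<^sub>R (G *v EB j (Suc i)) + h *\<^sub>R ((B ** Y) *v vb j (node T N (Suc i)))"
        by metis
      have EBN: "norm (EB j N - axis j 1) \<le> \<delta>" for j
        using elim(1)[rule_format, of "EB j" j] EB0 EBS by (simp add: eb0 ebT h_def)
      have vbN: "norm (vb j (node T N i)) \<le> m j" if "i \<le> N" for i j
        using that by (intro m node_nonneg T0 node_le T N)
      have EBb: "norm (EB j i) \<le> X * (T * (kBY * m j))" if i: "i \<le> N" for i j
      proof -
        have "norm (EB j i) \<le> X * (norm (EB j 0) + (\<Sum>l<N. h * norm ((B ** Y) *v vb j (node T N (Suc l)))))"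
          by (rule bound[where \<sigma>="\<lambda>l. (B ** Y) *v vb j (node T N l)", OF EBS i])
        also have "\<dots> \<le> X * (0 + (\<Sum>l<N. h * (kBY * m j)))"
        proof (intro mult_left_mono add_mono sum_mono)
          fix l assume "l \<in> {..<N}"
          have "norm ((B ** Y) *v vb j (node T N (Suc l))) \<le> kBY * norm (vb j (node T N (Suc l)))"
            unfolding kBY_def by (rule onorm[OF matrix_vector_mul_bounded_linear])
          also have "\<dots> \<le> kBY * m j" using \<open>l \<in> {..<N}\<close> k by (intro mult_left_mono vbN) auto
          finally show "norm ((B ** Y) *v vb j (node T N (Suc l))) \<le> kBY * m j" .
        qed (use X h in \<open>auto simp: EB0\<close>)
        also have "(\<Sum>l<N. h * (kBY * m j)) = (h * real N) * (kBY * m j)" by simp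
        finally show ?thesis by (simp only: hN add_0_left)
      qed
      \<comment> \<open>A perturbation of the identity by at most one half is injective, and its
        inverse has norm at most 2.\<close>
      have solve: "\<exists>c :: real^'n. (\<Sum>j\<in>UNIV. c $ j *\<^sub>R EB j N) = z \<and> norm c \<le> 2 * norm z" for z
      proof -
        let ?L = "\<lambda>c :: real^'n. \<Sum>j\<in>UNIV. c $ j *\<^sub>R EB j N"
        have lin: "linear ?L"
          by (rule linearI) (simp_all add: scaleR_add_left sum.distrib scaleR_right.sum)
        have low: "norm c \<le> 2 * norm (?L c)" for c
        proof -
          have "norm (\<Sum>j\<in>UNIV. c $ j *\<^sub>R (EB j N - axis j 1)) \<le> norm c * (\<Sum>j\<in>(UNIV::'n set). \<delta>)"
            by (rule norm_sum_components_le[OF EBN])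
          also have "(\<Sum>j\<in>(UNIV::'n set). \<delta>) = 1 / 2" by (simp add: \<delta>_def)
          also have "(\<Sum>j\<in>UNIV. c $ j *\<^sub>R (EB j N - axis j 1)) = ?L c - c"
            by (simp add: scaleR_diff_right sum_subtractf axis_expansion)
          finally have "norm (?L c - c) \<le> norm c * (1 / 2)" .
          moreover have "norm c - norm (?L c) \<le> norm (?L c - c)" 
            using norm_triangle_ineq2[of c "?L c"] by (simp only: norm_minus_commute)
          ultimately show ?thesis by simp
        qed
        have "inj ?L"
          unfolding linear_injective_0[OF lin]
        proof (intro allI impI)
          fix c assume "?L c = 0"
          with low[of c] show "c = 0" by simp
        qed
        then have "surj ?L" by (intro linear_injective_imp_surjective[OF lin]) simp_all
        then obtain c where "z = ?L c" by (rule surjE)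
        then show ?thesis using low[of c] by auto
      qed
      show ?case
      proof (intro allI)
        fix \<rho> :: "nat \<Rightarrow> real^'n" and r :: "nat \<Rightarrow> real^'l" and \<zeta> :: "real^'n"
        define rn where "rn = norm_L2 T (\<lambda>t. r (Suc (cell T N t)))"
        define S where "S = (\<Sum>i<N. h * norm (\<rho> (Suc i))) + rn + norm \<zeta>"
        have parts: "0 \<le> (\<Sum>i<N. h * norm (\<rho> (Suc i)))" "0 \<le> rn" using h by (auto simp: rn_def intro!: sum_nonneg)
        then have S: "0 \<le> S" and rnS: "rn \<le> S" and \<zeta>S: "norm \<zeta> \<le> S" by (auto simp: S_def)
        define \<sigma> where "\<sigma> i = \<rho> i + (B ** R) *v r i" for i
        obtain E0 where E00: "E0 0 = 0" and E0S: "\<And>i. E0 (Suc i) - E0 i = h *\<^sub>R (G *v E0 (Suc i)) + h *\<^sub>R \<sigma> (Suc i)"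
          by (rule implicit_euler_exists[OF h(1) ha(1), of 0 \<sigma>]) blast
        have \<sigma>sum: "(\<Sum>i<N. h * norm (\<sigma> (Suc i))) \<le> (1 + kBR * sqrt T) * S"
        proof -
          have "(\<Sum>i<N. h * norm (\<sigma> (Suc i))) \<le> (\<Sum>i<N. h * norm (\<rho> (Suc i)) + kBR * (h * norm (r (Suc i))))"
          proof (rule sum_mono)
            fix i
            have "norm (\<sigma> (Suc i)) \<le> norm (\<rho> (Suc i)) + kBR * norm (r (Suc i))"
              unfolding \<sigma>_def kBR_def
              using norm_triangle_ineq[of "\<rho> (Suc i)" "(B ** R) *v r (Suc i)"]
                onorm[OF matrix_vector_mul_bounded_linear[of "B ** R"], of "r (Suc i)"] by linarith
            from mult_left_mono[OF this h(1)]
            show "h * norm (\<sigma> (Suc i)) \<le> h * norm (\<rho> (Suc i)) + kBR * (h * norm (r (Suc i)))"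
              by (simp add: distrib_left mult_ac)
          qed
          also have "\<dots> = (\<Sum>i<N. h * norm (\<rho> (Suc i))) + kBR * (\<Sum>i<N. h * norm (r (Suc i)))"
            by (simp add: sum.distrib sum_distrib_left)
          also have "\<dots> \<le> S + kBR * (sqrt T * S)"
          proof (intro add_mono mult_left_mono k)
            have "(\<Sum>i<N. h * norm (r (Suc i))) \<le> sqrt T * rn"
              unfolding rn_def h_def by (rule step_L1_le_L2[OF T N, of "\<lambda>i. r (Suc i)"])
            also have "\<dots> \<le> sqrt T * S" using rnS T0 by (intro mult_left_mono) auto
            finally show "(\<Sum>i<N. h * norm (r (Suc i))) \<le> sqrt T * S" .
          qed (use parts in \<open>simp add: S_def\<close>)
          finally show ?thesis by (simp add: algebra_simps)
        qed
        have E0b: "norm (E0 i) \<le> c0 * S" if i: "i \<le> N" for i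
        proof -
          have "norm (E0 i) \<le> X * (norm (E0 0) + (\<Sum>i<N. h * norm (\<sigma> (Suc i))))" by (rule bound[where \<sigma>=\<sigma>, OF E0S i])
          also have "\<dots> \<le> X * ((1 + kBR * sqrt T) * S)" using \<sigma>sum X by (intro mult_left_mono) (auto simp: E00)
          finally show ?thesis by (simp add: c0_def mult.assoc)
        qed
        define \<zeta>' where "\<zeta>' = \<zeta> - E0 N"
        have \<zeta>': "norm \<zeta>' \<le> (1 + c0) * S"
        proof -
          have "norm \<zeta>' \<le> norm \<zeta> + norm (E0 N)" unfolding \<zeta>'_def by (rule norm_triangle_ineq4)
          also have "\<dots> \<le> S + c0 * S" by (intro add_mono E0b \<zeta>S) simp
          finally show ?thesis by (simp add: distrib_right)
        qed
        obtain c where c: "(\<Sum>j\<in>UNIV. c $ j *\<^sub>R EB j N) = \<zeta>'" "norm c \<le> 2 * norm \<zeta>'" using solve by blast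
        have cn: "norm c \<le> (2 * (1 + c0)) * S" 
        proof -
          note c(2)
          also have "2 * norm \<zeta>' \<le> 2 * ((1 + c0) * S)" by (rule mult_left_mono[OF \<zeta>']) simp
          finally show ?thesis by (simp only: mult.assoc)
        qed
        define V where "V i = (\<Sum>j\<in>UNIV. c $ j *\<^sub>R vb j (node T N i))" for i
        define E where "E i = E0 i + (\<Sum>j\<in>UNIV. c $ j *\<^sub>R EB j i)" for i
        define W where "W i = R *v (r i - C *v E i) + Y *v V i" for i
        have rec: "E (Suc i) - E i = h *\<^sub>R (A *v E (Suc i)) + h *\<^sub>R (B *v W (Suc i)) + h *\<^sub>R \<rho> (Suc i)" for i
        proof -
          have "E (Suc i) - E i = (E0 (Suc i) - E0 i) + (\<Sum>j\<in>UNIV. c $ j *\<^sub>R (EB j (Suc i) - EB j i))"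
            by (simp add: E_def scaleR_diff_right sum_subtractf)
          also have "\<dots> = h *\<^sub>R (G *v E0 (Suc i) + \<sigma> (Suc i) + (\<Sum>j\<in>UNIV. c $ j *\<^sub>R (G *v EB j (Suc i) + (B ** Y) *v vb j (node T N (Suc i)))))"
            by (simp add: E0S EBS scaleR_add_right scaleR_right.sum sum.distrib mult.commute)
          also have "G *v E0 (Suc i) + \<sigma> (Suc i) + (\<Sum>j\<in>UNIV. c $ j *\<^sub>R (G *v EB j (Suc i) + (B ** Y) *v vb j (node T N (Suc i))))
              = A *v E (Suc i) + B *v W (Suc i) + \<rho> (Suc i)"
          proof -
            have "A *v E (Suc i) + B *v W (Suc i) + \<rho> (Suc i) = G *v E (Suc i) + (B ** Y) *v V (Suc i) + \<sigma> (Suc i)"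
              unfolding W_def \<sigma>_def by (rule feedback_dynamics)
            also have "G *v E (Suc i) = G *v E0 (Suc i) + (\<Sum>j\<in>UNIV. c $ j *\<^sub>R (G *v EB j (Suc i)))"
              unfolding E_def by (simp only: matrix_vector_right_distrib matrix_vector_sum_scaleR)
            also have "(B ** Y) *v V (Suc i) = (\<Sum>j\<in>UNIV. c $ j *\<^sub>R ((B ** Y) *v vb j (node T N (Suc i))))"
              unfolding V_def by (simp only: matrix_vector_sum_scaleR)
            finally show ?thesis by (simp add: scaleR_add_right sum.distrib)
          qed
          finally show ?thesis by (simp only: scaleR_add_right)
        qed
        have Eb: "norm (E i) \<le> c1 * S" if i: "i \<le> N" for i
        proof -
          have "norm (E i) \<le> norm (E0 i) + norm (\<Sum>j\<in>UNIV. c $ j *\<^sub>R EB j i)" unfolding E_def by (rule norm_triangle_ineq)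
          also have "\<dots> \<le> c0 * S + norm c * Q"
            unfolding Q_def by (intro add_mono E0b i norm_sum_components_le EBb)
          also have "\<dots> \<le> c0 * S + ((2 * (1 + c0)) * S) * Q" by (intro add_left_mono mult_right_mono cn Q)
          finally show ?thesis by (simp add: c1_def algebra_simps)
        qed
        have Vb: "norm (V i) \<le> (2 * (1 + c0)) * S * mv" if i: "i \<le> N" for i
        proof -
          have "norm (V i) \<le> norm c * mv" unfolding V_def mv_def by (intro norm_sum_components_le vbN i)
          also have "\<dots> \<le> ((2 * (1 + c0)) * S) * mv" by (intro mult_right_mono cn mv)
          finally show ?thesis .
        qed
        have Wn: "norm_L2 T (\<lambda>t. W (Suc (cell T N t))) \<le> c2 * S"
        proof -
          let ?r = "\<lambda>t. r (Suc (cell T N t))" and ?E = "\<lambda>t. E (Suc (cell T N t))" and ?V = "\<lambda>t. V (Suc (cell T N t))"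
          have rL: "?r \<in> L2_space T" and EL: "?E \<in> L2_space T" and VL: "?V \<in> L2_space T"
            by (rule step_L2(1)[OF T N, of "\<lambda>i. r (Suc i)"] step_L2(1)[OF T N, of "\<lambda>i. E (Suc i)"] step_L2(1)[OF T N, of "\<lambda>i. V (Suc i)"])+
          have En: "norm_L2 T ?E \<le> (c1 * S) * sqrt T"
            by (rule step_L2_bound[OF T N, of "\<lambda>i. E (Suc i)"]) (use Eb c1 S in auto)
          have Vn: "norm_L2 T ?V \<le> ((2 * (1 + c0)) * S * mv) * sqrt T"
            by (rule step_L2_bound[OF T N, of "\<lambda>i. V (Suc i)"]) (use Vb c0 S mv in auto)
          have Ce: "norm_L2 T (\<lambda>t. C *v ?E t) \<le> kC * ((c1 * S) * sqrt T)"
            using L2_matrix(2)[OF EL, of C] mult_left_mono[OF En k(3)] unfolding kC_def by (rule order_trans)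
          have "norm_L2 T (\<lambda>t. ?r t - C *v ?E t) \<le> rn + norm_L2 T (\<lambda>t. C *v ?E t)"
            using norm_L2_triangle[OF rL L2_uminus[OF L2_matrix(1)[OF EL, of C]]] by (simp add: rn_def)
          also have "\<dots> \<le> S + kC * ((c1 * S) * sqrt T)" by (intro add_mono Ce rnS)
          finally have "kR * norm_L2 T (\<lambda>t. ?r t - C *v ?E t) \<le> kR * (S + kC * ((c1 * S) * sqrt T))"
            using k by (intro mult_left_mono) auto
          moreover have "norm_L2 T (\<lambda>t. R *v (?r t - C *v ?E t)) \<le> kR * norm_L2 T (\<lambda>t. ?r t - C *v ?E t)"
            unfolding kR_def by (intro L2_matrix L2_diff rL EL)
          moreover have "norm_L2 T (\<lambda>t. Y *v ?V t) \<le> kY * (((2 * (1 + c0)) * S * mv) * sqrt T)"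
            using L2_matrix(2)[OF VL, of Y] mult_left_mono[OF Vn k(4)] unfolding kY_def by (rule order_trans)
          moreover have "norm_L2 T (\<lambda>t. W (Suc (cell T N t))) \<le> norm_L2 T (\<lambda>t. R *v (?r t - C *v ?E t)) + norm_L2 T (\<lambda>t. Y *v ?V t)"
            unfolding W_def by (intro norm_L2_triangle L2_matrix L2_diff rL EL VL)
          ultimately have "norm_L2 T (\<lambda>t. W (Suc (cell T N t))) \<le> kR * (S + kC * ((c1 * S) * sqrt T)) + kY * (((2 * (1 + c0)) * S * mv) * sqrt T)"
            by linarith
          then show ?thesis by (simp add: c2_def algebra_simps)
        qed
        show "\<exists>E W. E 0 = 0 \<and> E N = \<zeta> \<and>
           (\<forall>i<N. E (Suc i) - E i = (T / real N) *\<^sub>R (A *v E (Suc i)) + (T / real N) *\<^sub>R (B *v W (Suc i)) + (T / real N) *\<^sub>R \<rho> (Suc i)) \<and>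
           (\<forall>i. C *v E i + D *v W i = r i) \<and>
           (\<forall>i\<le>N. norm (E i) \<le> (c1 + c2) * ((\<Sum>i<N. T / real N * norm (\<rho> (Suc i))) + norm_L2 T (\<lambda>t. r (Suc (cell T N t))) + norm \<zeta>)) \<and>
           norm_L2 T (\<lambda>t. W (Suc (cell T N t))) \<le> (c1 + c2) * ((\<Sum>i<N. T / real N * norm (\<rho> (Suc i))) + norm_L2 T (\<lambda>t. r (Suc (cell T N t))) + norm \<zeta>)"
          unfolding h_def[symmetric] rn_def[symmetric] S_def[symmetric]
        proof (intro exI[of _ E] exI[of _ W] conjI allI impI)
          show "E 0 = 0" by (simp add: E_def E00 EB0)
          show "E N = \<zeta>" unfolding E_def c(1) by (simp add: \<zeta>'_def)
          show "E (Suc i) - E i = h *\<^sub>R (A *v E (Suc i)) + h *\<^sub>R (B *v W (Suc i)) + h *\<^sub>R \<rho> (Suc i)" for i by (rule rec)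
          show "C *v E i + D *v W i = r i" for i unfolding W_def by (rule feedback_constraint)
          have le: "c1 * S \<le> (c1 + c2) * S" "c2 * S \<le> (c1 + c2) * S" using c1 c2 S by (auto intro: mult_right_mono)
          show "norm (E i) \<le> (c1 + c2) * S" if "i \<le> N" for i by (rule order_trans[OF Eb[OF that] le(1)])
          show "norm_L2 T (\<lambda>t. W (Suc (cell T N t))) \<le> (c1 + c2) * S" by (rule order_trans[OF Wn le(2)])
        qed
      qed
    qed
  qed
qed

end

section \<open>The optimal control problem and its discretization\<close>

definition pos_part :: "real^'l \<Rightarrow> real^'l" where
  "pos_part v = (\<chi> i. max 0 (v $ i))"

lemma pos_part_props:
  shows "v - pos_part v \<le> 0" "pos_part v = 0 \<longleftrightarrow> v \<le> 0" "a \<le> 0 \<Longrightarrow> norm (pos_part v) \<le> norm (v - a)"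
    "continuous_on S pos_part"
proof -
  show "v - pos_part v \<le> 0" by (simp add: pos_part_def less_eq_vec_def)
  have "max 0 a = 0 \<longleftrightarrow> a \<le> 0" for a :: real by (auto simp: max_def)
  then show "pos_part v = 0 \<longleftrightarrow> v \<le> 0" by (simp add: pos_part_def less_eq_vec_def vec_eq_iff)
  show "norm (pos_part v) \<le> norm (v - a)" if "a \<le> 0"
  proof (rule norm_le_componentwise_cart)
    fix i
    have "a $ i \<le> 0" using that by (simp add: less_eq_vec_def)
    then show "norm (pos_part v $ i) \<le> norm ((v - a) $ i)" by (simp add: pos_part_def)
  qed
  show "continuous_on S pos_part" unfolding pos_part_def by (intro continuous_intros)
qed

text \<open>The violation of the constraint by \<open>g\<close> is at most its distance to any
  function that satisfies it; this measures infeasibility without projecting onto the feasible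
  set.\<close>

lemma L2_pos_part:
  fixes g h :: "real \<Rightarrow> real^'l"
  assumes g: "g \<in> L2_space T" and h: "h \<in> L2_space T" and le: "AE t in lebesgue_on {0<..<T}. h t \<le> 0"
  shows "(\<lambda>t. pos_part (g t)) \<in> L2_space T" "norm_L2 T (\<lambda>t. pos_part (g t)) \<le> norm_L2 T (\<lambda>t. g t - h t)"
proof -
  have m: "(\<lambda>t. pos_part (g t)) \<in> borel_measurable (lebesgue_on {0<..<T})"
    by (rule borel_measurable_continuous_on[OF pos_part_props(4) L2_spaceD(1)[OF g]])
  have "AE t in lebesgue_on {0<..<T}. norm (pos_part (g t)) \<le> 1 * norm (g t - h t)"
    using le by eventually_elim (simp add: pos_part_props(3))
  from L2_space_bound[OF m L2_diff[OF g h] this]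
  show "(\<lambda>t. pos_part (g t)) \<in> L2_space T" "norm_L2 T (\<lambda>t. pos_part (g t)) \<le> norm_L2 T (\<lambda>t. g t - h t)"
    by simp_all
qed

text \<open>Here \<open>M\<close> is the complementarity map of the end state, not the random
  matrix; it, the terminal cost and \<open>H\<close> enter only as continuous maps, so that the
  analysis is deterministic.\<close>

locale terminal_problem = constrained_control T A B C D R Y
  for T :: real and A :: "real^'n^'n" and B :: "real^'m^'n" and C :: "real^'n^'l" and D :: "real^'m^'l"
    and R :: "real^'l^'m" and Y :: "real^'p^'m" +
  fixes f :: "real \<Rightarrow> real^'l" and xd :: "real \<Rightarrow> real^'n" and ud :: "real \<Rightarrow> real^'m" and \<delta> :: real and x0 :: "real^'n"
    and \<phi> :: "real^'n \<Rightarrow> real" and M :: "real^'n \<Rightarrow> real^'n" and H :: "real^'n \<Rightarrow> real^'k" and K :: "(real^'k) set"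
  assumes data: "f \<in> L2_space T" "xd \<in> L2_space T" "ud \<in> L2_space T" and \<delta>: "0 < \<delta>"
    and cont: "continuous_on UNIV \<phi>" "continuous_on UNIV M" "continuous_on UNIV H"
    and K: "closed K" and below: "\<exists>b. \<forall>z. b \<le> \<phi> z"
    and terminal_nonempty: "\<exists>z. 0 \<le> z \<and> z \<bullet> M z = 0 \<and> 0 \<le> M z \<and> H z \<in> K"
begin

definition "terminal z \<longleftrightarrow> 0 \<le> z \<and> z \<bullet> M z = 0 \<and> 0 \<le> M z \<and> H z \<in> K"

definition "J x u = 1/2 * (norm_L2 T (\<lambda>t. x t - xd t))\<^sup>2 + \<delta>/2 * (norm_L2 T (\<lambda>t. u t - ud t))\<^sup>2"

definition "adm x u \<longleftrightarrow> u \<in> L2_space T \<and> x 0 = x0 \<and> is_primitive T x (\<lambda>t. A *v x t + B *v u t) \<and>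
  (AE t in lebesgue_on {0<..<T}. C *v x t + D *v u t - f t \<le> 0)"

abbreviation "feas \<equiv> ocp_feasible T A B C D f x0 M H K"
abbreviation "cost \<equiv> ocp_cost T \<delta> xd ud \<phi>"

lemma cost_eq: "cost (x, u) = \<phi> (x T) + J x u"
  by (simp add: ocp_cost_def J_def)

lemma J_nonneg: "0 \<le> J x u"
  using \<delta> by (simp add: J_def)

lemma admD:
  assumes "adm x u"
  shows "u \<in> L2_space T" "x 0 = x0" "is_primitive T x (\<lambda>t. A *v x t + B *v u t)"
    "AE t in lebesgue_on {0<..<T}. C *v x t + D *v u t - f t \<le> 0" "x \<in> L2_space T"
  using assms is_primitive_L2[OF T0] unfolding adm_def by blast+

text \<open>Exchanges the chosen weak derivative for an explicit primitive, so that sums and limits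
  of trajectories can be taken without comparing choices.\<close>

lemma feas_iff: "(x, u) \<in> feas \<longleftrightarrow> adm x u \<and> terminal (x T)"
proof
  assume "(x, u) \<in> feas"
  then have x: "x \<in> H1_space T" and u: "u \<in> L2_space T"
    and ode: "AE t in lebesgue_on {0<..<T}. weak_deriv T x t = A *v x t + B *v u t"
    and rest: "AE t in lebesgue_on {0<..<T}. C *v x t + D *v u t - f t \<le> 0" "terminal (x T)" "x 0 = x0"
    by (auto simp: ocp_feasible_def terminal_def)
  have xL: "x \<in> L2_space T" using x by (simp add: H1_space_def)
  have "(\<lambda>t. A *v x t + B *v u t) \<in> L2_space T" by (intro L2_add L2_matrix xL u)
  from is_primitive_AE_cong[OF T0 H1_is_primitive[OF T x] this ode]
  show "adm x u \<and> terminal (x T)" using u rest by (simp add: adm_def)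
next
  assume a: "adm x u \<and> terminal (x T)"
  then have p: "is_primitive T x (\<lambda>t. A *v x t + B *v u t)" by (simp add: adm_def)
  show "(x, u) \<in> feas"
    using a is_primitive_H1[OF T0 p] weak_deriv_of_primitive(2)[OF T p]
    by (auto simp: adm_def ocp_feasible_def terminal_def)
qed

text \<open>Dynamics and mixed constraint are convex. Complementarity is not, which is why the end
  state conditions are kept apart in \<open>terminal\<close>.\<close>

lemma adm_midpoint:
  assumes 1: "adm x u" and 2: "adm x' u'"
  shows "adm (\<lambda>t. (1/2) *\<^sub>R (x t + x' t)) (\<lambda>t. (1/2) *\<^sub>R (u t + u' t))"
  unfolding adm_def
proof (intro conjI)
  show "(\<lambda>t. (1/2) *\<^sub>R (u t + u' t)) \<in> L2_space T" by (intro L2_scaleR L2_add admD[OF 1] admD[OF 2])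
  show "(1/2) *\<^sub>R (x 0 + x' 0) = x0" by (simp add: admD(2)[OF 1] admD(2)[OF 2] scaleR_half_double)
  have "is_primitive T (\<lambda>t. (1/2) *\<^sub>R (x t + x' t)) (\<lambda>t. (1/2) *\<^sub>R ((A *v x t + B *v u t) + (A *v x' t + B *v u' t)))"
    by (intro is_primitive_scaleR is_primitive_add T0 admD[OF 1] admD[OF 2])
  moreover have "(1/2) *\<^sub>R ((A *v x t + B *v u t) + (A *v x' t + B *v u' t)) =
      A *v ((1/2) *\<^sub>R (x t + x' t)) + B *v ((1/2) *\<^sub>R (u t + u' t))" for t
    by (simp add: matrix_vector_mult_scaleR matrix_vector_right_distrib scaleR_add_right)
  ultimately show "is_primitive T (\<lambda>t. (1/2) *\<^sub>R (x t + x' t)) (\<lambda>t. A *v ((1/2) *\<^sub>R (x t + x' t)) + B *v ((1/2) *\<^sub>R (u t + u' t)))"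
    by simp
  from admD(4)[OF 1] admD(4)[OF 2]
  show "AE t in lebesgue_on {0<..<T}. C *v ((1/2) *\<^sub>R (x t + x' t)) + D *v ((1/2) *\<^sub>R (u t + u' t)) - f t \<le> 0"
  proof eventually_elim
    case (elim t)
    have "C *v ((1/2) *\<^sub>R (x t + x' t)) + D *v ((1/2) *\<^sub>R (u t + u' t)) - f t
        = (1/2) *\<^sub>R ((C *v x t + D *v u t - f t) + (C *v x' t + D *v u' t - f t))"
      by (simp add: matrix_vector_mult_scaleR matrix_vector_right_distrib vec_eq_iff field_simps)
    also have "\<dots> \<le> 0"
    proof -
      have "(C *v x t + D *v u t - f t) $ i + (C *v x' t + D *v u' t - f t) $ i \<le> 0" for i
        using elim unfolding less_eq_vec_def by (intro add_nonpos_nonpos) (simp_all only: zero_index)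
      then show ?thesis unfolding less_eq_vec_def by (simp add: mult_nonneg_nonpos)
    qed
    finally show ?case .
  qed
qed

end

lemma tendsto_0_of_nonneg_le:
  fixes a b :: "nat \<Rightarrow> real"
  assumes "\<And>k. 0 \<le> a k" "\<And>k. a k \<le> b k" "b \<longlonglongrightarrow> 0"
  shows "a \<longlonglongrightarrow> 0"
  by (rule tendsto_sandwich[OF _ _ tendsto_const assms(3)]) (use assms(1,2) in \<open>auto intro: always_eventually\<close>)

context terminal_problem
begin

text \<open>The limit state is defined by solving the equation with the limit control; the a priori
  bound makes the states converge uniformly. The violation of the inequality by the limit is bounded
  by the distance to the approximants, so it is zero.\<close>

lemma adm_limit:
  assumes adm: "\<And>k. adm (x k) (u k)" and u: "ub \<in> L2_space T" "(\<lambda>k. norm_L2 T (\<lambda>t. u k t - ub t)) \<longlonglongrightarrow> 0"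
  obtains xb where "adm xb ub" "(\<lambda>k. norm_L2 T (\<lambda>t. x k t - xb t)) \<longlonglongrightarrow> 0" "(\<lambda>k. x k T) \<longlonglongrightarrow> xb T"
proof -
  note a = admD[OF adm]
  obtain xb where xb0: "xb 0 = x0" and xbp: "is_primitive T xb (\<lambda>t. A *v xb t + B *v ub t)"
    using linear_ode_solution_exists[OF T0 L2_matrix(1)[OF u(1), of B], of x0 A] by blast
  have xbL: "xb \<in> L2_space T" by (rule is_primitive_L2[OF T0 xbp])
  define k1 where "k1 = exp (onorm ((*v) A) * T) * (sqrt T * onorm ((*v) B))"
  have k1: "0 \<le> k1"
    unfolding k1_def using T0 by (intro mult_nonneg_nonneg onorm_pos_le matrix_vector_mul_bounded_linear) auto
  define d where "d k = norm_L2 T (\<lambda>t. u k t - ub t)" for k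
  have xd: "norm (x k t - xb t) \<le> k1 * d k" if t: "0 \<le> t" "t \<le> T" for k t
  proof -
    have L: "(\<lambda>t. B *v (u k t - ub t)) \<in> L2_space T" by (intro L2_matrix L2_diff a u)
    have "is_primitive T (\<lambda>t. x k t - xb t) (\<lambda>t. A *v (x k t - xb t) + B *v (u k t - ub t))"
      using is_primitive_diff[OF T0 a(3)[of k] xbp] by (simp add: matrix_vector_mult_diff_distrib algebra_simps)
    from linear_ode_bound[OF T0 L this t]
    have "norm (x k t - xb t) \<le> exp (onorm ((*v) A) * T) * (norm (x k 0 - xb 0) + sqrt T * norm_L2 T (\<lambda>t. B *v (u k t - ub t)))" .
    also have "\<dots> \<le> exp (onorm ((*v) A) * T) * (0 + sqrt T * (onorm ((*v) B) * d k))"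
      unfolding d_def using T0
      by (intro mult_left_mono add_mono L2_matrix(2) L2_diff a(1) u(1)) (auto simp: a(2) xb0)
    finally show ?thesis by (simp add: k1_def mult.assoc)
  qed
  have xn: "norm_L2 T (\<lambda>t. x k t - xb t) \<le> k1 * d k * sqrt T" for k
    using xd k1 by (intro L2_space_bounded(2)[OF T0 L2_spaceD(1)[OF L2_diff[OF a(5) xbL]]])
      (auto simp: d_def)
  have d0: "d \<longlonglongrightarrow> 0" using u(2) by (simp add: d_def[abs_def])
  have "(\<lambda>k. k1 * d k * sqrt T) \<longlonglongrightarrow> k1 * 0 * sqrt T" by (intro tendsto_intros d0)
  then have b1: "(\<lambda>k. k1 * d k * sqrt T) \<longlonglongrightarrow> 0" by simp
  have xlim: "(\<lambda>k. norm_L2 T (\<lambda>t. x k t - xb t)) \<longlonglongrightarrow> 0"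
    by (rule tendsto_0_of_nonneg_le[OF norm_L2_nonneg xn b1])
  have "(\<lambda>k. k1 * d k) \<longlonglongrightarrow> k1 * 0" by (intro tendsto_intros d0)
  then have b2: "(\<lambda>k. k1 * d k) \<longlonglongrightarrow> 0" by simp
  have "(\<lambda>k. norm (x k T - xb T)) \<longlonglongrightarrow> 0"
    by (rule tendsto_sandwich[OF _ _ tendsto_const b2]) (use xd T0 in \<open>auto intro: always_eventually\<close>)
  then have xT: "(\<lambda>k. x k T) \<longlonglongrightarrow> xb T" by (simp add: tendsto_norm_zero_iff LIM_zero_iff)
  have "AE t in lebesgue_on {0<..<T}. C *v xb t + D *v ub t - f t \<le> 0"
  proof -
    let ?g = "\<lambda>t. C *v xb t + D *v ub t - f t"
    have gL: "?g \<in> L2_space T" by (intro L2_diff L2_add L2_matrix xbL u(1) data)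
    have gk: "(\<lambda>t. C *v x k t + D *v u k t - f t) \<in> L2_space T" for k by (intro L2_diff L2_add L2_matrix a data)
    have "norm_L2 T (\<lambda>t. pos_part (?g t)) \<le> onorm ((*v) C) * norm_L2 T (\<lambda>t. x k t - xb t) + onorm ((*v) D) * d k" for k
    proof -
      have "norm_L2 T (\<lambda>t. pos_part (?g t)) \<le> norm_L2 T (\<lambda>t. ?g t - (C *v x k t + D *v u k t - f t))"
        by (rule L2_pos_part(2)[OF gL gk a(4)])
      also have "\<dots> = norm_L2 T (\<lambda>t. (C *v x k t + D *v u k t - f t) - ?g t)" by (rule norm_L2_minus_commute)
      also have "(\<lambda>t. (C *v x k t + D *v u k t - f t) - ?g t) = (\<lambda>t. C *v (x k t - xb t) + D *v (u k t - ub t))"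
        by (simp add: matrix_vector_mult_diff_distrib algebra_simps)
      also have "norm_L2 T (\<lambda>t. C *v (x k t - xb t) + D *v (u k t - ub t)) \<le> norm_L2 T (\<lambda>t. C *v (x k t - xb t)) + norm_L2 T (\<lambda>t. D *v (u k t - ub t))"
        by (intro norm_L2_triangle L2_matrix L2_diff a u(1) xbL)
      also have "\<dots> \<le> onorm ((*v) C) * norm_L2 T (\<lambda>t. x k t - xb t) + onorm ((*v) D) * d k"
        unfolding d_def by (intro add_mono L2_matrix(2) L2_diff a u(1) xbL)
      finally show ?thesis .
    qed
    moreover have "(\<lambda>k. onorm ((*v) C) * norm_L2 T (\<lambda>t. x k t - xb t) + onorm ((*v) D) * d k) \<longlonglongrightarrow> onorm ((*v) C) * 0 + onorm ((*v) D) * 0"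
      by (intro tendsto_intros xlim d0)
    ultimately have "norm_L2 T (\<lambda>t. pos_part (?g t)) \<le> 0"
      by (intro tendsto_lowerbound[where F=sequentially]) (auto intro: always_eventually)
    then have "norm_L2 T (\<lambda>t. pos_part (?g t)) = 0" by (simp add: antisym)
    from norm_L2_eq_0_AE[OF L2_pos_part(1)[OF gL gk a(4)] this] show ?thesis
      by (simp add: pos_part_props(2))
  qed
  then have "adm xb ub" using u(1) xb0 xbp by (simp add: adm_def)
  with xlim xT that show ?thesis by blast
qed

lemma J_continuous:
  assumes "x \<in> L2_space T" "\<And>k. x' k \<in> L2_space T" "u \<in> L2_space T" "\<And>k. u' k \<in> L2_space T"
    and "(\<lambda>k. norm_L2 T (\<lambda>t. x' k t - x t)) \<longlonglongrightarrow> 0" "(\<lambda>k. norm_L2 T (\<lambda>t. u' k t - u t)) \<longlonglongrightarrow> 0"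
  shows "(\<lambda>k. J (x' k) (u' k)) \<longlonglongrightarrow> J x u"
proof -
  have *: "(\<lambda>k. norm_L2 T (\<lambda>t. v' k t - w t)) \<longlonglongrightarrow> norm_L2 T (\<lambda>t. v t - w t)"
    if "v \<in> L2_space T" "\<And>k. v' k \<in> L2_space T" "w \<in> L2_space T" "(\<lambda>k. norm_L2 T (\<lambda>t. v' k t - v t)) \<longlonglongrightarrow> 0"
    for v w :: "real \<Rightarrow> 'z::euclidean_space" and v'
  proof -
    have "norm (norm_L2 T (\<lambda>t. v' k t - w t) - norm_L2 T (\<lambda>t. v t - w t)) \<le> norm_L2 T (\<lambda>t. v' k t - v t)" for k
      using norm_L2_abs_diff[OF L2_diff[OF that(2,3)] L2_diff[OF that(1,3)], of k] by simp
    then have "(\<lambda>k. norm_L2 T (\<lambda>t. v' k t - w t) - norm_L2 T (\<lambda>t. v t - w t)) \<longlonglongrightarrow> 0"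
      by (intro Lim_null_comparison[OF _ that(4)] always_eventually allI)
    then show ?thesis by (simp add: LIM_zero_iff)
  qed
  show ?thesis unfolding J_def
    by (intro tendsto_intros * assms data)
qed

text \<open>The parallelogram identity: the midpoint of two members has the same end state, hence
  cost at least \<open>q\<close>, so two nearly optimal members must have close controls. The
  quadratic cost thus yields strong convergence without weak compactness.\<close>

lemma adm_cauchy:
  assumes adm: "\<And>k. adm (x k) (u k)" and z: "\<And>k. x k T = z"
    and low: "\<And>x u. adm x u \<Longrightarrow> x T = z \<Longrightarrow> q \<le> J x u" and lim: "(\<lambda>k. J (x k) (u k)) \<longlonglongrightarrow> q"
  obtains xb ub where "adm xb ub" "xb T = z" "J xb ub = q"
    "(\<lambda>k. norm_L2 T (\<lambda>t. x k t - xb t)) \<longlonglongrightarrow> 0" "(\<lambda>k. norm_L2 T (\<lambda>t. u k t - ub t)) \<longlonglongrightarrow> 0"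
proof -
  note a = admD[OF adm]
  have par: "\<delta> / 2 * (norm_L2 T (\<lambda>t. u k t - u l t))\<^sup>2 \<le> 2 * J (x k) (u k) + 2 * J (x l) (u l) - 4 * q" for k l
  proof -
    define m n where "m = (\<lambda>t. (1/2) *\<^sub>R (x k t + x l t))" and "n = (\<lambda>t. (1/2) *\<^sub>R (u k t + u l t))"
    have "adm m n" unfolding m_def n_def by (rule adm_midpoint[OF adm adm])
    moreover have "m T = z" by (simp add: m_def z scaleR_half_double)
    ultimately have q: "q \<le> J m n" by (rule low)
    have half: "(\<lambda>t. (1/2) *\<^sub>R (v t - d t + (w t - d t))) = (\<lambda>t. (1/2) *\<^sub>R (v t + w t) - d t)" for v w d :: "real \<Rightarrow> 'z::real_vector"
    proof
      fix t
      have "(1/2) *\<^sub>R (v t - d t + (w t - d t)) = (1/2) *\<^sub>R (v t + w t) - (1/2) *\<^sub>R (d t + d t)"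
        by (simp only: scaleR_diff_right[symmetric]) (simp add: algebra_simps)
      then show "(1/2) *\<^sub>R (v t - d t + (w t - d t)) = (1/2) *\<^sub>R (v t + w t) - d t" by (simp only: scaleR_half_double)
    qed
    have x: "(norm_L2 T (\<lambda>t. x k t - x l t))\<^sup>2 = 2 * (norm_L2 T (\<lambda>t. x k t - xd t))\<^sup>2 + 2 * (norm_L2 T (\<lambda>t. x l t - xd t))\<^sup>2 - 4 * (norm_L2 T (\<lambda>t. m t - xd t))\<^sup>2"
      using norm_L2_parallelogram[OF L2_diff[OF a(5) data(2)] L2_diff[OF a(5) data(2)], of k l]
      unfolding half m_def by simp
    have u: "(norm_L2 T (\<lambda>t. u k t - u l t))\<^sup>2 = 2 * (norm_L2 T (\<lambda>t. u k t - ud t))\<^sup>2 + 2 * (norm_L2 T (\<lambda>t. u l t - ud t))\<^sup>2 - 4 * (norm_L2 T (\<lambda>t. n t - ud t))\<^sup>2"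
      using norm_L2_parallelogram[OF L2_diff[OF a(1) data(3)] L2_diff[OF a(1) data(3)], of k l]
      unfolding half n_def by simp
    have "1/2 * (norm_L2 T (\<lambda>t. x k t - x l t))\<^sup>2 + \<delta> / 2 * (norm_L2 T (\<lambda>t. u k t - u l t))\<^sup>2 = 2 * J (x k) (u k) + 2 * J (x l) (u l) - 4 * J m n"
      unfolding x u J_def by (simp add: algebra_simps)
    moreover have "0 \<le> 1/2 * (norm_L2 T (\<lambda>t. x k t - x l t))\<^sup>2" by simp
    ultimately show ?thesis using q by linarith
  qed
  have "\<exists>N. \<forall>k\<ge>N. \<forall>l\<ge>N. norm_L2 T (\<lambda>t. u k t - u l t) \<le> e" if e: "0 < e" for e
  proof -
    have "\<forall>\<^sub>F k in sequentially. J (x k) (u k) < q + \<delta> * e\<^sup>2 / 8"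
      using e \<delta> by (intro order_tendstoD(2)[OF lim]) auto
    then obtain N where N: "\<And>k. k \<ge> N \<Longrightarrow> J (x k) (u k) < q + \<delta> * e\<^sup>2 / 8" by (auto simp: eventually_sequentially)
    have "norm_L2 T (\<lambda>t. u k t - u l t) \<le> e" if "k \<ge> N" "l \<ge> N" for k l
    proof -
      have "\<delta> / 2 * (norm_L2 T (\<lambda>t. u k t - u l t))\<^sup>2 \<le> \<delta> / 2 * e\<^sup>2"
        using par[of k l] N[OF that(1)] N[OF that(2)] by simp
      then have "(norm_L2 T (\<lambda>t. u k t - u l t))\<^sup>2 \<le> e\<^sup>2" using \<delta> by simp
      then show ?thesis by (rule power2_le_imp_le) (use e in simp)
    qed
    then show ?thesis by blast
  qed
  from L2_complete[OF T0 a(1) this] obtain ub where ub: "ub \<in> L2_space T" "(\<lambda>k. norm_L2 T (\<lambda>t. u k t - ub t)) \<longlonglongrightarrow> 0" by blast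
  obtain xb where xb: "adm xb ub" "(\<lambda>k. norm_L2 T (\<lambda>t. x k t - xb t)) \<longlonglongrightarrow> 0" "(\<lambda>k. x k T) \<longlonglongrightarrow> xb T"
    using adm_limit[OF adm ub] by blast
  have "xb T = z" using xb(3) unfolding z by (simp add: LIMSEQ_const_iff)
  moreover have "J xb ub = q"
    using J_continuous[OF admD(5)[OF xb(1)] a(5) ub(1) a(1) xb(2) ub(2)] lim by (rule LIMSEQ_unique)
  ultimately show ?thesis using that xb ub by blast
qed

text \<open>
  Almost feasible trajectories are corrected to feasible ones with the limiting end state; strong
  convexity in the control makes the corrected minimizing sequence Cauchy.
\<close>

lemma almost_feasible_limit:
  assumes u: "\<And>k. u k \<in> L2_space T" and p: "\<And>k. is_primitive T (x k) (y k)" and init: "\<And>k. x k 0 = x0"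
    and res: "(\<lambda>k. norm_L2 T (\<lambda>t. y k t - (A *v x k t + B *v u k t))) \<longlonglongrightarrow> 0"
    and r: "\<And>k. r k \<in> L2_space T" "(\<lambda>k. norm_L2 T (r k)) \<longlonglongrightarrow> 0"
    and con: "\<And>k. AE t in lebesgue_on {0<..<T}. C *v x k t + D *v u k t - f t \<le> r k t"
    and z: "(\<lambda>k. x k T) \<longlonglongrightarrow> z" "terminal z"
    and v: "\<And>s. s \<in> feas \<Longrightarrow> v \<le> cost s"
    and lim: "\<And>\<eta>. 0 < \<eta> \<Longrightarrow> \<forall>\<^sub>F k in sequentially. \<phi> z + J (x k) (u k) \<le> v + \<eta>"
  obtains xb ub where "(xb, ub) \<in> minimizers feas cost" "cost (xb, ub) = v"
    "(\<lambda>k. norm_H1 T (\<lambda>t. x k t - xb t) + norm_L2 T (\<lambda>t. u k t - ub t)) \<longlonglongrightarrow> 0"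
proof -
  have xL: "x k \<in> L2_space T" and yL: "y k \<in> L2_space T" for k
    using is_primitive_L2[OF T0 p] is_primitiveD(1)[OF p] by auto
  define \<rho> where "\<rho> k t = A *v x k t + B *v u k t - y k t" for k t
  have \<rho>L: "\<rho> k \<in> L2_space T" for k unfolding \<rho>_def by (intro L2_diff L2_add L2_matrix xL u yL)
  have \<rho>n: "norm_L2 T (\<rho> k) = norm_L2 T (\<lambda>t. y k t - (A *v x k t + B *v u k t))" for k
    unfolding \<rho>_def by (rule norm_L2_minus_commute)
  obtain c where c: "0 \<le> c" and corr: "\<And>\<rho> r \<zeta>. \<rho> \<in> L2_space T \<Longrightarrow> r \<in> L2_space T \<Longrightarrow> (\<exists>e w. w \<in> L2_space T \<and> e 0 = 0 \<and>
     is_primitive T e (\<lambda>t. A *v e t + B *v w t + \<rho> t) \<and> (\<forall>t. C *v e t + D *v w t = r t) \<and> e T = \<zeta> \<and>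
     (\<forall>t\<in>{0..T}. norm (e t) \<le> c * (norm_L2 T \<rho> + norm_L2 T r + norm \<zeta>)) \<and>
     norm_L2 T w \<le> c * (norm_L2 T \<rho> + norm_L2 T r + norm \<zeta>))"
    using continuous_correction by blast
  \<comment> \<open>The size of the correction that removes the dynamic defect and the constraint
    violation and moves the end state to \<open>z\<close>; it tends to 0.\<close>
  define s where "s k = c * (norm_L2 T (\<rho> k) + norm_L2 T (r k) + norm (z - x k T))" for k
  have s0: "0 \<le> s k" for k using c by (simp add: s_def)
  have "s \<longlonglongrightarrow> c * (0 + 0 + norm (z - z))"
    unfolding s_def[abs_def] \<rho>n by (intro tendsto_intros res r z(1))
  then have slim: "s \<longlonglongrightarrow> 0" by simp
  define Q where "Q k e w \<longleftrightarrow> w \<in> L2_space T \<and> e 0 = 0 \<and>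
     is_primitive T e (\<lambda>t. A *v e t + B *v w t + \<rho> k t) \<and> (\<forall>t. C *v e t + D *v w t = - r k t) \<and> e T = z - x k T \<and>
     (\<forall>t\<in>{0..T}. norm (e t) \<le> s k) \<and> norm_L2 T w \<le> s k" for k e w
  have "\<exists>e w. Q k e w" for k
    using corr[OF \<rho>L[of k] L2_uminus[OF r(1)[of k]], of "z - x k T"] by (simp add: Q_def s_def)
  then obtain e w where "\<And>k. Q k (e k) (w k)" by metis
  then have wL: "w k \<in> L2_space T" and e0: "e k 0 = 0" and ep: "is_primitive T (e k) (\<lambda>t. A *v e k t + B *v w k t + \<rho> k t)"
    and er: "C *v e k t + D *v w k t = - r k t" and eT: "e k T = z - x k T"
    and eb: "t \<in> {0..T} \<Longrightarrow> norm (e k t) \<le> s k" and wb: "norm_L2 T (w k) \<le> s k" for k t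
    unfolding Q_def by blast+
  have eL: "e k \<in> L2_space T" for k by (rule is_primitive_L2[OF T0 ep])
  have en: "norm_L2 T (e k) \<le> s k * sqrt T" for k
    using s0 by (intro L2_space_bounded(2)[OF T0 L2_spaceD(1)[OF eL]] eb) auto
  define x' where "x' k t = x k t + e k t" for k t
  define u' where "u' k t = u k t + w k t" for k t
  have adm: "adm (x' k) (u' k)" for k
    unfolding adm_def
  proof (intro conjI)
    show "u' k \<in> L2_space T" unfolding u'_def by (intro L2_add u wL)
    show "x' k 0 = x0" by (simp add: x'_def init e0)
    have "is_primitive T (\<lambda>t. x k t + e k t) (\<lambda>t. y k t + (A *v e k t + B *v w k t + \<rho> k t))"
      by (intro is_primitive_add T0 p ep)
    moreover have "y k t + (A *v e k t + B *v w k t + \<rho> k t) = A *v x' k t + B *v u' k t" for t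
      by (simp add: \<rho>_def x'_def u'_def matrix_vector_right_distrib)
    ultimately show "is_primitive T (x' k) (\<lambda>t. A *v x' k t + B *v u' k t)" by (simp add: x'_def[abs_def])
    show "AE t in lebesgue_on {0<..<T}. C *v x' k t + D *v u' k t - f t \<le> 0"
      using con[of k]
    proof eventually_elim
      case (elim t)
      have "C *v x' k t + D *v u' k t - f t = (C *v x k t + D *v u k t - f t) + (C *v e k t + D *v w k t)"
        by (simp add: x'_def u'_def matrix_vector_right_distrib)
      also have "\<dots> = (C *v x k t + D *v u k t - f t) - r k t" by (simp add: er)
      also have "\<dots> \<le> 0" using elim by simp
      finally show ?case .
    qed
  qed
  have x'T: "x' k T = z" for k by (simp add: x'_def eT)
  \<comment> \<open>With the end state frozen at \<open>z\<close>, the terminal cost is a constant,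
    and the lower bound for the total cost becomes one for the convex part.\<close>
  have low: "v - \<phi> z \<le> J x u" if "adm x u" "x T = z" for x u
    using v[of "(x, u)"] that z(2) by (simp add: feas_iff cost_eq)
  define \<alpha> where "\<alpha> k = norm_L2 T (\<lambda>t. x k t - xd t)" for k
  define \<beta> where "\<beta> k = norm_L2 T (\<lambda>t. u k t - ud t)" for k
  \<comment> \<open>An eventual bound for both distances: \<open>J\<close> bounds their squares, and
    \<open>t \<le> t^2 + 1\<close> converts this into bounds that are linear in the cost.\<close>
  define m where "m = 2 * (v + 1 - \<phi> z) + 2 / \<delta> * (v + 1 - \<phi> z) + 1"
  have Jab: "J (x k) (u k) = 1/2 * (\<alpha> k)\<^sup>2 + \<delta>/2 * (\<beta> k)\<^sup>2" for k by (simp add: J_def \<alpha>_def \<beta>_def)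
  have bnd: "\<forall>\<^sub>F k in sequentially. \<alpha> k \<le> m \<and> \<beta> k \<le> m"
    using lim[OF zero_less_one]
  proof eventually_elim
    case (elim k)
    define b where "b = v + 1 - \<phi> z"
    have Jb: "1/2 * (\<alpha> k)\<^sup>2 + \<delta>/2 * (\<beta> k)\<^sup>2 \<le> b" using elim by (simp add: Jab b_def)
    have b0: "0 \<le> b" using J_nonneg[of "x k" "u k"] Jb by (simp add: Jab)
    have "0 \<le> \<delta>/2 * (\<beta> k)\<^sup>2" "0 \<le> 1/2 * (\<alpha> k)\<^sup>2" using \<delta> by auto
    then have a2: "(\<alpha> k)\<^sup>2 \<le> 2 * b" and "\<delta>/2 * (\<beta> k)\<^sup>2 \<le> b" using Jb by linarith+
    then have b2: "(\<beta> k)\<^sup>2 \<le> 2 / \<delta> * b" using \<delta> by (simp add: field_simps)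
    have le: "t \<le> t\<^sup>2 + 1" for t :: real
    proof -
      have "0 \<le> (t - 1)\<^sup>2 + t\<^sup>2 + 1" by simp
      then show ?thesis by (simp add: power2_diff)
    qed
    have "0 \<le> 2 / \<delta> * b" using \<delta> b0 by simp
    then show ?case using le[of "\<alpha> k"] le[of "\<beta> k"] a2 b2 b0 unfolding m_def b_def[symmetric] by linarith
  qed
  have sq: "a'\<^sup>2 \<le> a\<^sup>2 + (2 * m + 1) * t" if "0 \<le> a'" "a' \<le> a + t" "0 \<le> t" "t \<le> 1" "a \<le> m" "0 \<le> a" for a a' t :: real
  proof -
    have "a'\<^sup>2 \<le> (a + t)\<^sup>2" using that by (intro power_mono) auto
    also have "\<dots> = a\<^sup>2 + 2 * a * t + t * t" by (simp add: power2_eq_square algebra_simps)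
    also have "\<dots> \<le> a\<^sup>2 + 2 * m * t + 1 * t" using that by (intro add_mono mult_right_mono) auto
    finally show ?thesis by (simp add: algebra_simps)
  qed
  \<comment> \<open>The price of the correction: squaring a perturbed distance costs at most
    \<open>2 m + 1\<close> times the perturbation when the perturbation is at most 1.\<close>
  define \<theta> where "\<theta> k = (2 * m + 1) * (1/2 * (s k * sqrt T) + \<delta>/2 * s k)" for k
  have "(\<lambda>k. (2 * m + 1) * (1/2 * (s k * sqrt T) + \<delta>/2 * s k)) \<longlonglongrightarrow> (2 * m + 1) * (1/2 * (0 * sqrt T) + \<delta>/2 * 0)"
    by (intro tendsto_intros slim)
  then have \<theta>lim: "\<theta> \<longlonglongrightarrow> 0" by (simp add: \<theta>_def[abs_def])
  have sTlim: "(\<lambda>k. s k * sqrt T) \<longlonglongrightarrow> 0" using tendsto_mult[OF slim tendsto_const[of "sqrt T"]] by simp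
  have J': "\<forall>\<^sub>F k in sequentially. J (x' k) (u' k) \<le> J (x k) (u k) + \<theta> k"
    using bnd order_tendstoD(2)[OF slim zero_less_one] order_tendstoD(2)[OF sTlim zero_less_one]
  proof eventually_elim
    case (elim k)
    have "norm_L2 T (\<lambda>t. x' k t - xd t) \<le> \<alpha> k + s k * sqrt T"
      using norm_L2_triangle[OF L2_diff[OF xL data(2)] eL, of k k] en[of k] by (simp add: \<alpha>_def x'_def algebra_simps)
    then have 1: "(norm_L2 T (\<lambda>t. x' k t - xd t))\<^sup>2 \<le> (\<alpha> k)\<^sup>2 + (2 * m + 1) * (s k * sqrt T)"
      using elim s0[of k] T0 by (intro sq) (auto simp: \<alpha>_def)
    have "norm_L2 T (\<lambda>t. u' k t - ud t) \<le> \<beta> k + s k"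
      using norm_L2_triangle[OF L2_diff[OF u data(3)] wL, of k k] wb[of k] by (simp add: \<beta>_def u'_def algebra_simps)
    then have 2: "(norm_L2 T (\<lambda>t. u' k t - ud t))\<^sup>2 \<le> (\<beta> k)\<^sup>2 + (2 * m + 1) * s k"
      using elim s0[of k] by (intro sq) (auto simp: \<beta>_def)
    have "J (x' k) (u' k) \<le> 1/2 * ((\<alpha> k)\<^sup>2 + (2 * m + 1) * (s k * sqrt T)) + \<delta>/2 * ((\<beta> k)\<^sup>2 + (2 * m + 1) * s k)"
      unfolding J_def using 1 2 \<delta> by (intro add_mono mult_left_mono) auto
    also have "\<dots> = J (x k) (u k) + \<theta> k"
    proof -
      have "h * (a + c * t) + d * (b + c * t') = (h * a + d * b) + c * (h * t + d * t')" for a b c d h t t' :: real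
        by (simp add: algebra_simps)
      then show ?thesis unfolding Jab \<theta>_def .
    qed
    finally show ?case .
  qed
  have Jlim: "(\<lambda>k. J (x' k) (u' k)) \<longlonglongrightarrow> v - \<phi> z"
  proof (rule tendstoI)
    fix \<eta> :: real assume \<eta>: "0 < \<eta>"
    then have \<eta>4: "0 < \<eta> / 4" by simp
    show "\<forall>\<^sub>F k in sequentially. dist (J (x' k) (u' k)) (v - \<phi> z) < \<eta>"
      using J' lim[OF \<eta>4] order_tendstoD(2)[OF \<theta>lim \<eta>4]
    proof eventually_elim
      case (elim k)
      have "v - \<phi> z \<le> J (x' k) (u' k)" by (rule low[OF adm x'T])
      then show ?case using elim \<eta> by (simp add: dist_real_def abs_less_iff)
    qed
  qed
  obtain xb ub where b: "adm xb ub" "xb T = z" "J xb ub = v - \<phi> z"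
    and xlim: "(\<lambda>k. norm_L2 T (\<lambda>t. x' k t - xb t)) \<longlonglongrightarrow> 0" and ulim: "(\<lambda>k. norm_L2 T (\<lambda>t. u' k t - ub t)) \<longlonglongrightarrow> 0"
    using adm_cauchy[OF adm x'T low Jlim] by blast
  have feas: "(xb, ub) \<in> feas" and cost: "cost (xb, ub) = v" using b z(2) by (simp_all add: feas_iff cost_eq)
  then have min: "(xb, ub) \<in> minimizers feas cost" using v by (simp add: minimizers_def)
  note bL = admD(5)[OF b(1)] admD(1)[OF b(1)]
  have x'L: "x' k \<in> L2_space T" and u'L: "u' k \<in> L2_space T" for k using admD[OF adm] by auto
  define X where "X k = norm_L2 T (\<lambda>t. x k t - xb t)" for k
  define U where "U k = norm_L2 T (\<lambda>t. u k t - ub t)" for k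
  have Xle: "X k \<le> s k * sqrt T + norm_L2 T (\<lambda>t. x' k t - xb t)" for k
    using norm_L2_triangle_diff[OF xL x'L bL(1), of k k] en[of k] by (simp add: X_def x'_def)
  have Ule: "U k \<le> s k + norm_L2 T (\<lambda>t. u' k t - ub t)" for k
    using norm_L2_triangle_diff[OF u u'L bL(2), of k k] wb[of k] by (simp add: U_def u'_def)
  have X0: "X \<longlonglongrightarrow> 0"
    by (rule tendsto_0_of_nonneg_le[OF _ Xle]) (use tendsto_add[OF sTlim xlim] in \<open>simp_all add: X_def\<close>)
  have U0: "U \<longlonglongrightarrow> 0"
    by (rule tendsto_0_of_nonneg_le[OF _ Ule]) (use tendsto_add[OF slim ulim] in \<open>simp_all add: U_def\<close>)
  define kA kB where "kA = onorm ((*v) A)" and "kB = onorm ((*v) B)"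
  have H1: "norm_H1 T (\<lambda>t. x k t - xb t) \<le> X k + (norm_L2 T (\<rho> k) + (kA * X k + kB * U k))" for k
  proof -
    note d = is_primitive_diff[OF T0 p admD(3)[OF b(1)], of k]
    have "norm_L2 T (\<lambda>t. y k t - (A *v xb t + B *v ub t)) \<le> norm_L2 T (\<rho> k) + (kA * X k + kB * U k)"
    proof -
      have "norm_L2 T (\<lambda>t. y k t - (A *v xb t + B *v ub t))
        \<le> norm_L2 T (\<lambda>t. y k t - (A *v x k t + B *v u k t)) + norm_L2 T (\<lambda>t. (A *v x k t + B *v u k t) - (A *v xb t + B *v ub t))"
        by (intro norm_L2_triangle_diff yL L2_add L2_matrix xL u bL)
      also have "(\<lambda>t. (A *v x k t + B *v u k t) - (A *v xb t + B *v ub t)) = (\<lambda>t. A *v (x k t - xb t) + B *v (u k t - ub t))"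
        by (simp add: matrix_vector_mult_diff_distrib algebra_simps)
      also have "norm_L2 T (\<lambda>t. A *v (x k t - xb t) + B *v (u k t - ub t)) \<le> norm_L2 T (\<lambda>t. A *v (x k t - xb t)) + norm_L2 T (\<lambda>t. B *v (u k t - ub t))"
        by (intro norm_L2_triangle L2_matrix L2_diff xL u bL)
      also have "\<dots> \<le> kA * X k + kB * U k"
        unfolding kA_def kB_def X_def U_def by (intro add_mono L2_matrix(2) L2_diff xL u bL)
      finally show ?thesis by (simp add: \<rho>n)
    qed
    with norm_H1_primitive[OF T d] show ?thesis by (simp add: X_def)
  qed
  have H10: "0 \<le> norm_H1 T x" for x :: "real \<Rightarrow> real^'n" by (simp add: norm_H1_def)
  have "(\<lambda>k. X k + (norm_L2 T (\<rho> k) + (kA * X k + kB * U k)) + U k) \<longlonglongrightarrow> 0 + (0 + (kA * 0 + kB * 0)) + 0"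
    unfolding \<rho>n by (intro tendsto_intros X0 U0 res)
  then have lim0: "(\<lambda>k. X k + (norm_L2 T (\<rho> k) + (kA * X k + kB * U k)) + U k) \<longlonglongrightarrow> 0" by simp
  have "(\<lambda>k. norm_H1 T (\<lambda>t. x k t - xb t) + U k) \<longlonglongrightarrow> 0"
  proof (rule tendsto_0_of_nonneg_le[OF _ _ lim0])
    show "0 \<le> norm_H1 T (\<lambda>t. x k t - xb t) + U k" for k using H10 by (simp add: U_def)
    show "norm_H1 T (\<lambda>t. x k t - xb t) + U k \<le> X k + (norm_L2 T (\<rho> k) + (kA * X k + kB * U k)) + U k" for k
      using H1[of k] by simp
  qed
  with min cost that show ?thesis by (simp add: U_def)
qed


section \<open>Existence of optimal solutions\<close>

lemma terminal_limit:
  assumes z: "w \<longlonglongrightarrow> z" "\<And>k. terminal (w k)"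
  shows "terminal z"
proof -
  have M: "(\<lambda>k. M (w k)) \<longlonglongrightarrow> M z" and H: "(\<lambda>k. H (w k)) \<longlonglongrightarrow> H z"
    using cont z(1) by (auto intro: continuous_on_tendsto_compose)
  have t: "0 \<le> w k $ i" "0 \<le> M (w k) $ i" "w k \<bullet> M (w k) = 0" "H (w k) \<in> K" for k i
    using z(2)[of k] by (auto simp: terminal_def less_eq_vec_def)
  have "0 \<le> z $ i" for i
    by (rule tendsto_lowerbound[OF tendsto_vec_nth[OF z(1)]]) (auto simp: t)
  moreover have "0 \<le> M z $ i" for i
    by (rule tendsto_lowerbound[OF tendsto_vec_nth[OF M]]) (auto simp: t)
  moreover have "z \<bullet> M z = 0"
    using tendsto_inner[OF z(1) M] by (simp add: t LIMSEQ_const_iff)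
  moreover have "H z \<in> K" by (rule closed_sequentially[OF K, of "\<lambda>k. H (w k)"]) (use t H in auto)
  ultimately show ?thesis by (simp add: terminal_def less_eq_vec_def)
qed

text \<open>Starting from the uncontrolled trajectory, the correction is asked to meet the mixed
  constraint with equality and to end at \<open>z\<close>; hence every end state can be reached
  admissibly.\<close>

lemma adm_reaching:
  obtains x u where "adm x u" "x T = z"
proof -
  obtain xa where xa: "xa 0 = x0" "is_primitive T xa (\<lambda>t. A *v xa t + 0)"
    using linear_ode_solution_exists[OF T0 L2_zero, of x0 A] by blast
  have xaL: "xa \<in> L2_space T" by (rule is_primitive_L2[OF T0 xa(2)])
  have rL: "(\<lambda>t. f t - C *v xa t) \<in> L2_space T" by (intro L2_diff data L2_matrix xaL)
  obtain e w where ew: "w \<in> L2_space T" "e 0 = 0" "is_primitive T e (\<lambda>t. A *v e t + B *v w t + 0)"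
      "\<forall>t. C *v e t + D *v w t = f t - C *v xa t" "e T = z - xa T"
    using continuous_correction L2_zero rL by blast
  have "adm (\<lambda>t. xa t + e t) w"
    unfolding adm_def
  proof (intro conjI ew(1))
    show "xa 0 + e 0 = x0" by (simp add: xa ew)
    show "is_primitive T (\<lambda>t. xa t + e t) (\<lambda>t. A *v (xa t + e t) + B *v w t)"
      using is_primitive_add[OF T0 xa(2) ew(3)] by (simp add: matrix_vector_right_distrib add.assoc)
    have "C *v (xa t + e t) + D *v w t - f t = 0" for t
      using ew(4)[rule_format, of t] by (simp add: matrix_vector_right_distrib add.assoc)
    then show "AE t in lebesgue_on {0<..<T}. C *v (xa t + e t) + D *v w t - f t \<le> 0" by simp
  qed
  moreover have "xa T + e T = z" by (simp add: ew)
  ultimately show ?thesis using that by blast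
qed

lemma adm_end_bound:
  assumes a: "adm x u"
  shows "norm (x T) \<le> exp (onorm ((*v) A) * T) * (norm x0 + sqrt T * (onorm ((*v) B) * norm_L2 T u))"
proof -
  note a = admD[OF a]
  have "norm (x T) \<le> exp (onorm ((*v) A) * T) * (norm (x 0) + sqrt T * norm_L2 T (\<lambda>t. B *v u t))"
    using T0 by (intro linear_ode_bound a L2_matrix) auto
  also have "\<dots> \<le> exp (onorm ((*v) A) * T) * (norm x0 + sqrt T * (onorm ((*v) B) * norm_L2 T u))"
    using T0 by (intro mult_left_mono add_mono L2_matrix(2) a) (auto simp: a)
  finally show ?thesis .
qed

lemma control_bound:
  assumes u: "u \<in> L2_space T" and J: "J x u \<le> c"
  shows "norm_L2 T u \<le> 2 / \<delta> * c + 1 + norm_L2 T ud"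
proof -
  define b where "b = norm_L2 T (\<lambda>t. u t - ud t)"
  have "0 \<le> 1/2 * (norm_L2 T (\<lambda>t. x t - xd t))\<^sup>2" by simp
  then have "\<delta>/2 * b\<^sup>2 \<le> c" using J unfolding J_def b_def by linarith
  then have "b\<^sup>2 \<le> 2 / \<delta> * c" using \<delta> by (simp add: field_simps)
  moreover have "b \<le> b\<^sup>2 + 1"
  proof -
    have "0 \<le> (b - 1)\<^sup>2 + b\<^sup>2 + 1" by simp
    then show ?thesis by (simp add: power2_diff)
  qed
  moreover have "norm_L2 T u \<le> b + norm_L2 T ud"
    using norm_L2_triangle[OF L2_diff[OF u data(3)] data(3)] by (simp add: b_def)
  ultimately show ?thesis by linarith
qed

text \<open>The lower bound on \<phi> bounds the controls of a minimizing sequence, and these bound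
  the end states, which subconverge to a point satisfying the closed terminal conditions.
  \<open>almost_feasible_limit\<close>, with zero defects, provides the minimizer.\<close>

theorem minimizer_exists: "\<exists>s. s \<in> minimizers feas cost"
proof -
  obtain z0 where z0: "terminal z0" using terminal_nonempty by (auto simp: terminal_def)
  obtain xz uz where "adm xz uz" "xz T = z0" by (rule adm_reaching[of z0])
  with z0 have ne: "feas \<noteq> {}" using feas_iff by blast
  obtain b where b: "\<And>z. b \<le> \<phi> z" using below by blast
  have costb: "b \<le> cost s" for s
    using b[of "fst s T"] J_nonneg[of "fst s" "snd s"] cost_eq[of "fst s" "snd s"] by simp
  define v where "v = Inf (cost ` feas)"
  have bdd: "bdd_below (cost ` feas)" by (rule bdd_belowI[of _ b]) (auto intro: costb)
  have v: "v \<le> cost s" if "s \<in> feas" for s unfolding v_def using that bdd by (intro cInf_lower) auto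
  have "\<exists>s\<in>feas. cost s < v + 1 / real (Suc k)" for k
  proof -
    have "v < v + 1 / real (Suc k)" by simp
    then show ?thesis unfolding v_def using cInf_lessD[of "cost ` feas"] ne by blast
  qed
  then obtain s where s: "\<And>k. s k \<in> feas" "\<And>k. cost (s k) < v + 1 / real (Suc k)" by metis
  define x u where "x k = fst (s k)" and "u k = snd (s k)" for k
  have sk: "s k = (x k, u k)" for k by (simp add: x_def u_def)
  have a: "adm (x k) (u k)" and t: "terminal (x k T)" for k using s(1)[of k] by (simp_all add: sk feas_iff)
  have c: "\<phi> (x k T) + J (x k) (u k) < v + 1 / real (Suc k)" for k using s(2)[of k] by (simp add: sk cost_eq)
  have c1: "J (x k) (u k) \<le> v + 1 - b" for k
  proof -
    have "1 / real (Suc k) \<le> 1" by simp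
    then show ?thesis using c[of k] b[of "x k T"] by linarith
  qed
  define r0 where "r0 = exp (onorm ((*v) A) * T) * (norm x0 + sqrt T * (onorm ((*v) B) * (2 / \<delta> * (v + 1 - b) + 1 + norm_L2 T ud)))"
  have "norm (x k T) \<le> r0" for k
  proof -
    have "norm (x k T) \<le> exp (onorm ((*v) A) * T) * (norm x0 + sqrt T * (onorm ((*v) B) * norm_L2 T (u k)))"
      by (rule adm_end_bound[OF a])
    also have "\<dots> \<le> r0"
      unfolding r0_def using T0
      by (intro mult_left_mono add_left_mono control_bound[OF admD(1)[OF a] c1] onorm_pos_le matrix_vector_mul_bounded_linear) auto
    finally show ?thesis .
  qed
  then have "bounded (range (\<lambda>k. x k T))" by (auto simp: bounded_iff)
  then obtain z \<sigma> where \<sigma>: "strict_mono \<sigma>" and z: "((\<lambda>k. x k T) \<circ> \<sigma>) \<longlonglongrightarrow> z"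
    using bounded_imp_convergent_subsequence by blast
  have zT: "(\<lambda>k. x (\<sigma> k) T) \<longlonglongrightarrow> z" using z by (simp add: o_def)
  have tz: "terminal z" by (rule terminal_limit[OF zT]) (rule t)
  have \<phi>z: "(\<lambda>k. \<phi> (x (\<sigma> k) T)) \<longlonglongrightarrow> \<phi> z" using continuous_on_tendsto_compose[OF cont(1) zT] by simp
  have lim: "\<forall>\<^sub>F k in sequentially. \<phi> z + J (x (\<sigma> k)) (u (\<sigma> k)) \<le> v + \<eta>" if \<eta>: "0 < \<eta>" for \<eta>
  proof -
    have "(\<lambda>k. 1 / real (Suc k)) \<longlonglongrightarrow> 0" using LIMSEQ_inverse_real_of_nat by (simp add: inverse_eq_divide)
    then have "(\<lambda>k. 1 / real (Suc (\<sigma> k))) \<longlonglongrightarrow> 0" using LIMSEQ_subseq_LIMSEQ[OF _ \<sigma>] by (fastforce simp: o_def)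
    then have "\<forall>\<^sub>F k in sequentially. 1 / real (Suc (\<sigma> k)) < \<eta> / 2" using \<eta> by (intro order_tendstoD(2)) auto
    moreover have "\<forall>\<^sub>F k in sequentially. \<phi> z - \<eta> / 2 < \<phi> (x (\<sigma> k) T)" using \<eta> by (intro order_tendstoD(1)[OF \<phi>z]) auto
    ultimately show ?thesis
    proof eventually_elim
      case (elim k)
      with c[of "\<sigma> k"] show ?case by linarith
    qed
  qed
  have res: "(\<lambda>k. norm_L2 T (\<lambda>t. (A *v x (\<sigma> k) t + B *v u (\<sigma> k) t) - (A *v x (\<sigma> k) t + B *v u (\<sigma> k) t))) \<longlonglongrightarrow> 0"
    by (simp add: norm_L2_def)
  have r0: "(\<lambda>k. norm_L2 T (\<lambda>t. 0 :: real^'l)) \<longlonglongrightarrow> 0" by (simp add: norm_L2_def)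
  have "\<exists>xb ub. (xb, ub) \<in> minimizers feas cost"
    by (rule almost_feasible_limit[where x="\<lambda>k. x (\<sigma> k)" and u="\<lambda>k. u (\<sigma> k)" and y="\<lambda>k t. A *v x (\<sigma> k) t + B *v u (\<sigma> k) t" and r="\<lambda>k t. 0" and z=z and v=v])
      (use admD[OF a] res r0 zT tz v lim in auto)
  then show ?thesis by blast
qed

text \<open>Recovery: the state is sampled at the nodes, the control is replaced by samples of a continuous
  approximation, and the resulting defects are removed by the discrete correction.\<close>

lemma recovery:
  assumes a: "adm x u" and samp: "sampling_consistent T f" and \<eta>: "0 < \<eta>"
  shows "\<forall>\<^sub>F N in sequentially. \<exists>X U. X 0 = x0 \<and> X N = x T \<and>
     (\<forall>i<N. X (Suc i) - X i = (T / real N) *\<^sub>R (A *v X (Suc i)) + (T / real N) *\<^sub>R (B *v U (Suc i)) \<and>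
            C *v X (Suc i) + D *v U (Suc i) - f (node T N (Suc i)) \<le> 0) \<and>
     norm_L2 T (\<lambda>t. X (Suc (cell T N t)) - x t) \<le> \<eta> \<and> norm_L2 T (\<lambda>t. U (Suc (cell T N t)) - u t) \<le> \<eta>"
proof -
  note a = admD[OF a]
  obtain c where c: "0 \<le> c" and corr: "\<forall>\<^sub>F N in sequentially. \<forall>\<rho> r \<zeta>. \<exists>E W. E 0 = 0 \<and> E N = \<zeta> \<and>
     (\<forall>i<N. E (Suc i) - E i = (T / real N) *\<^sub>R (A *v E (Suc i)) + (T / real N) *\<^sub>R (B *v W (Suc i)) + (T / real N) *\<^sub>R \<rho> (Suc i)) \<and>
     (\<forall>i. C *v E i + D *v W i = r i) \<and>
     (\<forall>i\<le>N. norm (E i) \<le> c * ((\<Sum>i<N. T / real N * norm (\<rho> (Suc i))) + norm_L2 T (\<lambda>t. r (Suc (cell T N t))) + norm \<zeta>)) \<and>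
     norm_L2 T (\<lambda>t. W (Suc (cell T N t))) \<le> c * ((\<Sum>i<N. T / real N * norm (\<rho> (Suc i))) + norm_L2 T (\<lambda>t. r (Suc (cell T N t))) + norm \<zeta>)"
    using discrete_correction by blast
  define kA kB kC kD where "kA = onorm ((*v) A)" and "kB = onorm ((*v) B)" and "kC = onorm ((*v) C)" and "kD = onorm ((*v) D)"
  have k: "0 \<le> kA" "0 \<le> kB" "0 \<le> kC" "0 \<le> kD"
    unfolding kA_def kB_def kC_def kD_def by (intro onorm_pos_le matrix_vector_mul_bounded_linear)+
  \<comment> \<open>\<open>kk * e\<close> bounds the total defect when state and data are sampled
    with error \<open>e\<close> and the control with error \<open>2 e\<close>; \<open>m\<close> adds
    the sampling errors and the sizes of the corrections, so \<open>e\<close> is chosen as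
    \<open>\<eta> / m\<close>.\<close>
  define kk where "kk = sqrt T * (kA + kB * 2) + (kC + kD * 2 + 1)"
  have kk: "0 \<le> kk" using k T0 by (simp add: kk_def)
  define m where "m = 2 + c * kk + c * kk * sqrt T"
  have m: "0 < m" using c kk T0 by (simp add: m_def add_pos_nonneg)
  define e where "e = \<eta> / m"
  have e: "0 < e" using \<eta> m by (simp add: e_def)
  obtain v where v: "continuous_on UNIV v" "v \<in> L2_space T" "norm_L2 T (\<lambda>t. u t - v t) < e"
    by (rule L2_dense_continuous[OF a(1) e]) blast
  have vc: "sampling_consistent T v"
    by (rule sampling_consistent_continuous[OF T]) (rule continuous_on_subset[OF v(1)], simp)
  have xc: "sampling_consistent T x"
    by (rule sampling_consistent_continuous[OF T is_primitive_continuous[OF T0 a(3)]])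
  from corr sampling_eventually_small[OF vc e] sampling_eventually_small[OF xc e] sampling_eventually_small[OF samp e] eventually_gt_at_top[of 0]
  show ?thesis
  proof eventually_elim
    case (elim N)
    then have N: "0 < N" by simp
    define h where "h = T / real N"
    have h: "0 < h" using T N by (simp add: h_def)
    define X where "X i = x (node T N i)" for i
    define V where "V i = v (node T N i)" for i
    let ?X = "\<lambda>t. X (Suc (cell T N t))" and ?V = "\<lambda>t. V (Suc (cell T N t))" and ?f = "\<lambda>t. f (node T N (Suc (cell T N t)))"
    have XL: "?X \<in> L2_space T" and VL: "?V \<in> L2_space T" and fL: "?f \<in> L2_space T"
      by (rule step_L2(1)[OF T N, of "\<lambda>i. X (Suc i)"] step_L2(1)[OF T N, of "\<lambda>i. V (Suc i)"] step_L2(1)[OF T N, of "\<lambda>i. f (node T N (Suc i))"])+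
    have Xn: "norm_L2 T (\<lambda>t. ?X t - x t) \<le> e" using elim(3) by (simp add: X_def)
    have fn: "norm_L2 T (\<lambda>t. ?f t - f t) \<le> e" using elim(4) by simp
    have Vn: "norm_L2 T (\<lambda>t. ?V t - u t) \<le> 2 * e"
      using norm_L2_triangle_diff[OF VL v(2) a(1)] elim(2) v(3) by (simp add: V_def norm_L2_minus_commute[of T u])
    define S where "S i = A *v X (Suc i) + B *v V (Suc i)" for i
    define \<rho> where "\<rho> i = - (1 / h) *\<^sub>R (X i - X (i - 1) - h *\<^sub>R S (i - 1))" for i
    have h\<rho>: "h *\<^sub>R \<rho> (Suc i) = - (X (Suc i) - X i - h *\<^sub>R S i)" for i using h by (simp add: \<rho>_def)
    have \<rho>n: "(\<Sum>i<N. h * norm (\<rho> (Suc i))) \<le> sqrt T * (kA + kB * 2) * e"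
    proof -
      have "h * norm (\<rho> (Suc i)) = norm (x (node T N (Suc i)) - x (node T N i) - (T / real N) *\<^sub>R S i)" for i
        using h by (simp add: \<rho>_def X_def h_def[symmetric])
      then have "(\<Sum>i<N. h * norm (\<rho> (Suc i))) \<le> sqrt T * norm_L2 T (\<lambda>t. A *v x t + B *v u t - S (cell T N t))"
        using primitive_increments_residual[OF T N a(3), of S] by simp
      also have "norm_L2 T (\<lambda>t. A *v x t + B *v u t - S (cell T N t)) \<le> kA * e + kB * (2 * e)"
      proof -
        have "norm_L2 T (\<lambda>t. A *v x t + B *v u t - S (cell T N t)) = norm_L2 T (\<lambda>t. S (cell T N t) - (A *v x t + B *v u t))"
          by (rule norm_L2_minus_commute)
        also have "(\<lambda>t. S (cell T N t) - (A *v x t + B *v u t)) = (\<lambda>t. A *v (?X t - x t) + B *v (?V t - u t))"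
          by (simp add: S_def matrix_vector_mult_diff_distrib algebra_simps)
        also have "norm_L2 T (\<lambda>t. A *v (?X t - x t) + B *v (?V t - u t)) \<le> norm_L2 T (\<lambda>t. A *v (?X t - x t)) + norm_L2 T (\<lambda>t. B *v (?V t - u t))"
          by (intro norm_L2_triangle L2_matrix L2_diff XL VL a)
        also have "\<dots> \<le> kA * norm_L2 T (\<lambda>t. ?X t - x t) + kB * norm_L2 T (\<lambda>t. ?V t - u t)"
          unfolding kA_def kB_def by (intro add_mono L2_matrix(2) L2_diff XL VL a)
        also have "\<dots> \<le> kA * e + kB * (2 * e)" by (intro add_mono mult_left_mono Xn Vn k)
        finally show ?thesis .
      qed
      finally have "(\<Sum>i<N. h * norm (\<rho> (Suc i))) \<le> sqrt T * (kA * e + kB * (2 * e))"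
        using T0 by (simp add: mult_left_mono)
      then show ?thesis by (simp add: algebra_simps)
    qed
    \<comment> \<open>The correction subtracts exactly the violation at each node.\<close>
    define r where "r i = - pos_part (C *v X i + D *v V i - f (node T N i))" for i
    have rn: "norm_L2 T (\<lambda>t. r (Suc (cell T N t))) \<le> (kC + kD * 2 + 1) * e"
    proof -
      let ?g = "\<lambda>t. C *v ?X t + D *v ?V t - ?f t" and ?h = "\<lambda>t. C *v x t + D *v u t - f t"
      have gL: "?g \<in> L2_space T" by (intro L2_diff L2_add L2_matrix XL VL fL)
      have hL: "?h \<in> L2_space T" by (intro L2_diff L2_add L2_matrix a data)
      have "norm_L2 T (\<lambda>t. r (Suc (cell T N t))) = norm_L2 T (\<lambda>t. pos_part (?g t))" by (simp add: r_def)
      also have "\<dots> \<le> norm_L2 T (\<lambda>t. ?g t - ?h t)" by (rule L2_pos_part(2)[OF gL hL a(4)])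
      also have "(\<lambda>t. ?g t - ?h t) = (\<lambda>t. (C *v (?X t - x t) + D *v (?V t - u t)) + - (?f t - f t))"
        by (simp add: matrix_vector_mult_diff_distrib algebra_simps)
      also have "norm_L2 T (\<lambda>t. (C *v (?X t - x t) + D *v (?V t - u t)) + - (?f t - f t))
          \<le> norm_L2 T (\<lambda>t. C *v (?X t - x t) + D *v (?V t - u t)) + norm_L2 T (\<lambda>t. - (?f t - f t))"
        by (intro norm_L2_triangle L2_add L2_matrix L2_diff L2_uminus XL VL fL a data)
      also have "norm_L2 T (\<lambda>t. C *v (?X t - x t) + D *v (?V t - u t)) \<le> kC * e + kD * (2 * e)"
      proof -
        have "norm_L2 T (\<lambda>t. C *v (?X t - x t) + D *v (?V t - u t)) \<le> norm_L2 T (\<lambda>t. C *v (?X t - x t)) + norm_L2 T (\<lambda>t. D *v (?V t - u t))"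
          by (intro norm_L2_triangle L2_matrix L2_diff XL VL a)
        also have "\<dots> \<le> kC * norm_L2 T (\<lambda>t. ?X t - x t) + kD * norm_L2 T (\<lambda>t. ?V t - u t)"
          unfolding kC_def kD_def by (intro add_mono L2_matrix(2) L2_diff XL VL a)
        also have "\<dots> \<le> kC * e + kD * (2 * e)" by (intro add_mono mult_left_mono Xn Vn k)
        finally show ?thesis .
      qed
      also have "norm_L2 T (\<lambda>t. - (?f t - f t)) \<le> e" unfolding norm_L2_uminus by (rule fn)
      finally show ?thesis by (simp add: algebra_simps)
    qed
    \<comment> \<open>The target is zero: the sampled state already ends at \<open>x T\<close>, and
      the correction must not move it, so the competitor has the exact end state.\<close>
    obtain E W where EW: "E 0 = 0" "E N = 0"
      "\<And>i. i < N \<Longrightarrow> E (Suc i) - E i = h *\<^sub>R (A *v E (Suc i)) + h *\<^sub>R (B *v W (Suc i)) + h *\<^sub>R \<rho> (Suc i)"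
      "\<And>i. C *v E i + D *v W i = r i"
      "\<And>i. i \<le> N \<Longrightarrow> norm (E i) \<le> c * ((\<Sum>i<N. h * norm (\<rho> (Suc i))) + norm_L2 T (\<lambda>t. r (Suc (cell T N t))) + norm (0::real^'n))"
      "norm_L2 T (\<lambda>t. W (Suc (cell T N t))) \<le> c * ((\<Sum>i<N. h * norm (\<rho> (Suc i))) + norm_L2 T (\<lambda>t. r (Suc (cell T N t))) + norm (0::real^'n))"
      using elim(1)[rule_format, of 0 \<rho> r] unfolding h_def by blast
    have tot: "c * ((\<Sum>i<N. h * norm (\<rho> (Suc i))) + norm_L2 T (\<lambda>t. r (Suc (cell T N t))) + norm (0::real^'n)) \<le> c * (kk * e)"
      using \<rho>n rn c by (intro mult_left_mono) (auto simp: kk_def distrib_right)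
    have En: "norm (E i) \<le> c * kk * e" if "i \<le> N" for i using order_trans[OF EW(5)[OF that] tot] by (simp add: mult.assoc)
    have Wn: "norm_L2 T (\<lambda>t. W (Suc (cell T N t))) \<le> c * kk * e" using order_trans[OF EW(6) tot] by (simp add: mult.assoc)
    have EL: "(\<lambda>t. E (Suc (cell T N t))) \<in> L2_space T" and WL: "(\<lambda>t. W (Suc (cell T N t))) \<in> L2_space T"
      by (rule step_L2(1)[OF T N, of "\<lambda>i. E (Suc i)"] step_L2(1)[OF T N, of "\<lambda>i. W (Suc i)"])+
    have EnL: "norm_L2 T (\<lambda>t. E (Suc (cell T N t))) \<le> (c * kk * e) * sqrt T"
      by (rule step_L2_bound[OF T N, of "\<lambda>i. E (Suc i)"]) (use En c kk e in auto)
    have me: "m * e = \<eta>" using m by (simp add: e_def)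
    show ?case
    proof (intro exI[of _ "\<lambda>i. X i + E i"] exI[of _ "\<lambda>i. V i + W i"] conjI allI impI)
      show "X 0 + E 0 = x0" by (simp add: X_def EW a(2))
      show "X N + E N = x T" by (simp add: X_def EW node_N[OF N])
      fix i assume i: "i < N"
      have "X (Suc i) + E (Suc i) - (X i + E i) = (X (Suc i) - X i) + (E (Suc i) - E i)" by simp
      also have "\<dots> = h *\<^sub>R S i + (h *\<^sub>R (A *v E (Suc i)) + h *\<^sub>R (B *v W (Suc i)))"
        unfolding EW(3)[OF i] h\<rho> by simp
      also have "\<dots> = h *\<^sub>R (A *v (X (Suc i) + E (Suc i))) + h *\<^sub>R (B *v (V (Suc i) + W (Suc i)))"
        by (simp add: S_def matrix_vector_right_distrib scaleR_add_right)
      finally show "X (Suc i) + E (Suc i) - (X i + E i) = (T / real N) *\<^sub>R (A *v (X (Suc i) + E (Suc i))) + (T / real N) *\<^sub>R (B *v (V (Suc i) + W (Suc i)))"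
        by (simp only: h_def)
      have "C *v (X (Suc i) + E (Suc i)) + D *v (V (Suc i) + W (Suc i)) - f (node T N (Suc i))
          = (C *v X (Suc i) + D *v V (Suc i) - f (node T N (Suc i))) + (C *v E (Suc i) + D *v W (Suc i))"
        by (simp add: matrix_vector_right_distrib)
      also have "\<dots> \<le> 0" unfolding EW(4) r_def using pos_part_props(1)[of "C *v X (Suc i) + D *v V (Suc i) - f (node T N (Suc i))"] by simp
      finally show "C *v (X (Suc i) + E (Suc i)) + D *v (V (Suc i) + W (Suc i)) - f (node T N (Suc i)) \<le> 0" .
    next
      have "norm_L2 T (\<lambda>t. (?X t - x t) + E (Suc (cell T N t))) \<le> e + (c * kk * e) * sqrt T"
        using norm_L2_triangle[OF L2_diff[OF XL a(5)] EL] Xn EnL by linarith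
      also have "\<dots> \<le> m * e"
        using e c kk unfolding m_def distrib_right by (simp add: mult_ac)
      also note me
      finally show "norm_L2 T (\<lambda>t. X (Suc (cell T N t)) + E (Suc (cell T N t)) - x t) \<le> \<eta>"
        by (simp add: algebra_simps)
      have "norm_L2 T (\<lambda>t. (?V t - u t) + W (Suc (cell T N t))) \<le> 2 * e + c * kk * e"
        using norm_L2_triangle[OF L2_diff[OF VL a(1)] WL] Vn Wn by linarith
      also have "\<dots> \<le> m * e"
        using e c kk T0 unfolding m_def distrib_right by (simp add: mult_ac)
      also note me
      finally show "norm_L2 T (\<lambda>t. V (Suc (cell T N t)) + W (Suc (cell T N t)) - u t) \<le> \<eta>"
        by (simp add: algebra_simps)
    qed
  qed
qed


section \<open>The discrete problem, its bounds and its interpolants\<close>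

definition "euler N X U \<longleftrightarrow> X 0 = x0 \<and>
  (\<forall>i<N. X (Suc i) - X i = (T / real N) *\<^sub>R (A *v X (Suc i)) + (T / real N) *\<^sub>R (B *v U (Suc i)) \<and>
         C *v X (Suc i) + D *v U (Suc i) - f (node T N (Suc i)) \<le> 0)"

text \<open>The running cost of the scheme as norms of step functions, which makes it directly
  comparable with \<open>J\<close>.\<close>

definition "Jh N X U =
  1/2 * (norm_L2 T (\<lambda>t. X (Suc (cell T N t)) - xd (node T N (Suc (cell T N t)))))\<^sup>2 +
  \<delta>/2 * (norm_L2 T (\<lambda>t. U (Suc (cell T N t)) - ud (node T N (Suc (cell T N t)))))\<^sup>2"

lemma tsp_feasible_iff:
  "(X, U) \<in> tsp_feasible T N A B C D f x0 \<epsilon> G' H' K' \<longleftrightarrow>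
    euler N X U \<and> norm (\<chi> i. min (X N $ i) (G' (X N) $ i)) \<le> \<epsilon> \<and> infdist (H' (X N)) K' \<le> \<epsilon>"
  by (auto simp: tsp_feasible_def euler_def)

lemma tsp_cost_eq:
  assumes N: "0 < N"
  shows "tsp_cost T N \<delta> xd ud \<psi> (X, U) = \<psi> (X N) + Jh N X U"
proof -
  have s: "(\<Sum>i=1..N. v i) = (\<Sum>i<N. v (Suc i))" for v :: "nat \<Rightarrow> real"
    by (simp add: sum.atLeast1_atMost_eq)
  have *: "(norm_L2 T (\<lambda>t. v (Suc (cell T N t)) - w (node T N (Suc (cell T N t)))))\<^sup>2
      = T / real N * (\<Sum>i<N. (norm (v (Suc i) - w (node T N (Suc i))))\<^sup>2)" for v :: "nat \<Rightarrow> 'z::euclidean_space" and w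
    by (rule step_L2(2)[OF T N, of "\<lambda>i. v (Suc i) - w (node T N (Suc i))"])
  show ?thesis
    unfolding tsp_cost_def Jh_def * s sum.distrib sum_distrib_left[symmetric] split
    by (simp add: algebra_simps add_divide_distrib)
qed

text \<open>For a discrete control of norm \<open>b\<close>, \<open>bnd b\<close> bounds the states
  at the nodes by stability of the scheme, and \<open>slope b\<close> bounds the L2 norm of the
  derivative of the state interpolant.\<close>

definition "bnd b = exp (2 * onorm ((*v) A) * T) * (norm x0 + sqrt T * (onorm ((*v) B) * b))"
definition "slope b = onorm ((*v) A) * (bnd b * sqrt T) + onorm ((*v) B) * b"

lemma onorm_matrix_nonneg: "0 \<le> onorm ((*v) (Z::real^'a^'b))"
  by (intro onorm_pos_le matrix_vector_mul_bounded_linear)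

lemma bnd_mono: "b \<le> b' \<Longrightarrow> bnd b \<le> bnd b'"
  unfolding bnd_def using T0 by (intro mult_left_mono add_left_mono onorm_matrix_nonneg) auto

lemma euler_bound:
  assumes N: "0 < N" "T / real N * onorm ((*v) A) \<le> 1 / 2" and e: "euler N X U" and i: "i \<le> N"
  shows "norm (X i) \<le> bnd (norm_L2 T (control_interpolant T N U))"
proof -
  have rec: "X (Suc i) - X i = (T / real N) *\<^sub>R (A *v X (Suc i)) + (T / real N) *\<^sub>R (B *v U (Suc i))" if "i < N" for i
    using e that by (simp add: euler_def)
  have h: "0 \<le> T / real N" using T by simp
  have "norm (X i) \<le> exp (2 * onorm ((*v) A) * (T / real N * real N)) * (norm (X 0) + (\<Sum>j<N. T / real N * norm (B *v U (Suc j))))"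
    by (rule implicit_euler_bound[where \<sigma>="\<lambda>j. B *v U j", OF h N(2) rec i])
  also have "\<dots> = exp (2 * onorm ((*v) A) * T) * (norm x0 + (\<Sum>j<N. T / real N * norm (B *v U (Suc j))))"
    using e N by (simp add: euler_def)
  also have "\<dots> \<le> exp (2 * onorm ((*v) A) * T) * (norm x0 + sqrt T * norm_L2 T (\<lambda>t. B *v U (Suc (cell T N t))))"
    by (intro mult_left_mono add_left_mono step_L1_le_L2[OF T N(1), of "\<lambda>j. B *v U (Suc j)"]) simp
  also have "\<dots> \<le> bnd (norm_L2 T (control_interpolant T N U))"
    unfolding bnd_def control_interpolant_def using T0 step_L2(1)[OF T N(1), of "\<lambda>i. U (Suc i)"]
    by (intro mult_left_mono add_left_mono L2_matrix(2)) auto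
  finally show ?thesis .
qed

lemma control_interpolant_L2: "0 < N \<Longrightarrow> control_interpolant T N U \<in> L2_space T"
  using step_L2(1)[OF T, of N "\<lambda>i. U (Suc i)"] by (simp add: control_interpolant_def[abs_def])

lemma state_interpolant_T:
  assumes N: "0 < N"
  shows "state_interpolant T N X T = X N"
proof -
  obtain k where k: "N = Suc k" using N by (cases N) auto
  have c: "cell T N T = k"
    by (rule cell_eq[OF T N]) (use T N in \<open>auto simp: node_def k field_simps\<close>)
  have "T = real N * (T / real N)" using N by simp
  also have "\<dots> = node T N k + T / real N" by (simp add: node_def k distrib_right del: times_divide_eq_right)
  finally have "T - node T N k = T / real N" by linarith
  then have "(T - node T N k) / (T / real N) = 1" using T N by simp
  then show ?thesis unfolding state_interpolant_def c Let_def by (simp add: k)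
qed

text \<open>On each cell the scheme says that the slope of the interpolant is
  \<open>A X + B u\<close> with \<open>X\<close> the state at the right node. The only errors are
  therefore the distance of the interpolant to that node value, at most the mesh size times the
  slope, and the sampling error of \<open>f\<close>.\<close>

lemma interpolant_defects:
  assumes N: "0 < N" "T / real N * onorm ((*v) A) \<le> 1 / 2" and e: "euler N X U"
    and b: "norm_L2 T (control_interpolant T N U) \<le> b"
  defines "x \<equiv> state_interpolant T N X" and "u \<equiv> control_interpolant T N U" and "h \<equiv> T / real N"
  shows "norm_L2 T (\<lambda>t. x t - X (Suc (cell T N t))) \<le> h * slope b" (is ?dist)
    and "\<exists>y r. is_primitive T x y \<and> norm_L2 T (\<lambda>t. y t - (A *v x t + B *v u t)) \<le> onorm ((*v) A) * (h * slope b) \<and>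
      r \<in> L2_space T \<and>
      norm_L2 T r \<le> onorm ((*v) C) * (h * slope b) + norm_L2 T (\<lambda>t. f (node T N (Suc (cell T N t))) - f t) \<and>
      (AE t in lebesgue_on {0<..<T}. C *v x t + D *v u t - f t \<le> r t)" (is ?defects)
proof -
  have h: "0 < h" using T N by (simp add: h_def)
  let ?X = "\<lambda>t. X (Suc (cell T N t))" and ?f = "\<lambda>t. f (node T N (Suc (cell T N t)))"
  define y where "y t = A *v ?X t + B *v u t" for t
  have XL: "?X \<in> L2_space T" and fL: "?f \<in> L2_space T"
    by (rule step_L2(1)[OF T N(1), of "\<lambda>i. X (Suc i)"] step_L2(1)[OF T N(1), of "\<lambda>i. f (node T N (Suc i))"])+
  have uL: "u \<in> L2_space T" unfolding u_def by (rule control_interpolant_L2[OF N(1)])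
  have yL: "y \<in> L2_space T" unfolding y_def by (intro L2_add L2_matrix XL uL)
  have inc: "X (Suc (cell T N t)) - X (cell T N t) = h *\<^sub>R y t" if t: "0 < t" "t < T" for t
  proof -
    have "cell T N t < N" using cell_props(3)[OF T N(1) t(1)] t by simp
    then show ?thesis using e by (simp add: euler_def y_def u_def control_interpolant_def h_def scaleR_add_right)
  qed
  have p0: "is_primitive T x (\<lambda>t. (1 / h) *\<^sub>R (X (Suc (cell T N t)) - X (cell T N t)))"
    unfolding x_def h_def by (rule state_interpolant_primitive[OF T N(1)])
  have p: "is_primitive T x y"
    by (rule is_primitive_AE_cong[OF T0 p0 yL]) (use h inc in \<open>auto simp: space_restrict_space intro!: AE_I2\<close>)
  have xL: "x \<in> L2_space T" by (rule is_primitive_L2[OF T0 p])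
  have b0: "0 \<le> b" using b norm_L2_nonneg order_trans by blast
  have bnd0: "0 \<le> bnd b" using T0 b0 by (simp add: bnd_def onorm_matrix_nonneg)
  have Xn: "norm_L2 T ?X \<le> bnd b * sqrt T"
    by (rule step_L2_bound[OF T N(1), of "\<lambda>i. X (Suc i)"])
      (use order_trans[OF euler_bound[OF N e] bnd_mono[OF b]] bnd0 in auto)
  have yn: "norm_L2 T y \<le> slope b"
  proof -
    have "norm_L2 T y \<le> norm_L2 T (\<lambda>t. A *v ?X t) + norm_L2 T (\<lambda>t. B *v u t)"
      unfolding y_def by (intro norm_L2_triangle L2_matrix XL uL)
    also have "\<dots> \<le> onorm ((*v) A) * norm_L2 T ?X + onorm ((*v) B) * norm_L2 T u"
      by (intro add_mono L2_matrix(2) XL uL)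
    also have "\<dots> \<le> slope b"
      unfolding slope_def using b by (intro add_mono mult_left_mono Xn onorm_matrix_nonneg) (auto simp: u_def)
    finally show ?thesis .
  qed
  have "norm (x t - ?X t) \<le> h * norm (y t)" if t: "0 < t" "t < T" for t
  proof -
    note c = cell_props[OF T N(1) t(1)]
    define \<theta> where "\<theta> = (t - node T N (cell T N t)) / h"
    have "node T N (Suc (cell T N t)) = node T N (cell T N t) + h" by (simp add: node_def h_def distrib_right del: times_divide_eq_right)
    then have \<theta>: "0 \<le> \<theta>" "\<theta> \<le> 1" using c(1,2) t h by (simp_all add: \<theta>_def)
    have "x t = X (cell T N t) + \<theta> *\<^sub>R (h *\<^sub>R y t)"
      by (simp add: x_def state_interpolant_def Let_def \<theta>_def h_def[symmetric] inc[OF t])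
    moreover have "?X t = X (cell T N t) + h *\<^sub>R y t" using inc[OF t] by (simp add: algebra_simps)
    ultimately have "x t - ?X t = - ((1 - \<theta>) *\<^sub>R (h *\<^sub>R y t))" by (simp add: algebra_simps)
    then have "norm (x t - ?X t) = (1 - \<theta>) * (h * norm (y t))" using \<theta> h by simp
    also have "\<dots> \<le> 1 * (h * norm (y t))" using \<theta> h by (intro mult_right_mono) auto
    finally show ?thesis by simp
  qed
  then have "AE t in lebesgue_on {0<..<T}. norm (x t - ?X t) \<le> h * norm (y t)"
    by (auto simp: space_restrict_space intro!: AE_I2)
  from L2_space_bound(2)[OF L2_spaceD(1)[OF L2_diff[OF xL XL]] yL this]
  have "norm_L2 T (\<lambda>t. x t - ?X t) \<le> h * norm_L2 T y" using h by simp
  also have "\<dots> \<le> h * slope b" using yn h by simp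
  finally show d: ?dist .
  have "norm_L2 T (\<lambda>t. y t - (A *v x t + B *v u t)) \<le> onorm ((*v) A) * (h * slope b)"
  proof -
    have "norm_L2 T (\<lambda>t. y t - (A *v x t + B *v u t)) = norm_L2 T (\<lambda>t. (A *v x t + B *v u t) - y t)"
      by (rule norm_L2_minus_commute)
    also have "(\<lambda>t. (A *v x t + B *v u t) - y t) = (\<lambda>t. A *v (x t - ?X t))"
      by (simp add: y_def matrix_vector_mult_diff_distrib)
    also have "norm_L2 T (\<lambda>t. A *v (x t - ?X t)) \<le> onorm ((*v) A) * norm_L2 T (\<lambda>t. x t - ?X t)"
      by (intro L2_matrix(2) L2_diff xL XL)
    also have "\<dots> \<le> onorm ((*v) A) * (h * slope b)" by (intro mult_left_mono d onorm_matrix_nonneg)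
    finally show ?thesis .
  qed
  moreover define r where "r t = C *v (x t - ?X t) + (?f t - f t)" for t
  have "r \<in> L2_space T" unfolding r_def by (intro L2_add L2_matrix L2_diff xL XL fL data)
  moreover have "norm_L2 T r \<le> onorm ((*v) C) * (h * slope b) + norm_L2 T (\<lambda>t. ?f t - f t)"
  proof -
    have "norm_L2 T r \<le> norm_L2 T (\<lambda>t. C *v (x t - ?X t)) + norm_L2 T (\<lambda>t. ?f t - f t)"
      unfolding r_def by (intro norm_L2_triangle L2_matrix L2_diff xL XL fL data)
    also have "norm_L2 T (\<lambda>t. C *v (x t - ?X t)) \<le> onorm ((*v) C) * norm_L2 T (\<lambda>t. x t - ?X t)"
      by (intro L2_matrix(2) L2_diff xL XL)
    also have "\<dots> \<le> onorm ((*v) C) * (h * slope b)" by (intro mult_left_mono d onorm_matrix_nonneg)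
    finally show ?thesis by simp
  qed
  moreover have "C *v x t + D *v u t - f t \<le> r t" if t: "0 < t" "t < T" for t
  proof -
    have "cell T N t < N" using cell_props(3)[OF T N(1) t(1)] t by simp
    then have "C *v ?X t + D *v u t - ?f t \<le> 0"
      using e by (simp add: euler_def u_def control_interpolant_def)
    then show ?thesis by (simp add: r_def matrix_vector_mult_diff_distrib less_eq_vec_def algebra_simps)
  qed
  then have "AE t in lebesgue_on {0<..<T}. C *v x t + D *v u t - f t \<le> r t"
    by (auto simp: space_restrict_space intro!: AE_I2)
  ultimately show ?defects using p by blast
qed


abbreviation "sampled N y t \<equiv> y (node T N (Suc (cell T N t)))"

lemma sampled_L2: "0 < N \<Longrightarrow> sampled N y \<in> L2_space T"
  for y :: "real \<Rightarrow> 'z::euclidean_space"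
  using step_L2(1)[OF T, of N "\<lambda>i. y (node T N (Suc i))"] by simp

lemma shifted_step_L2: "0 < N \<Longrightarrow> (\<lambda>t. S (Suc (cell T N t))) \<in> L2_space T"
  for S :: "nat \<Rightarrow> 'z::euclidean_space"
  using step_L2(1)[OF T, of N "\<lambda>i. S (Suc i)"] by simp

text \<open>Estimates the discrete cost of the recovery competitor by the continuous cost; each
  distance changes by the approximation error plus the sampling error.\<close>

lemma Jh_le:
  assumes N: "0 < N" and L: "x \<in> L2_space T" "u \<in> L2_space T"
    and d: "norm_L2 T (\<lambda>t. X (Suc (cell T N t)) - x t) \<le> e" "norm_L2 T (\<lambda>t. U (Suc (cell T N t)) - u t) \<le> e"
    and s: "norm_L2 T (\<lambda>t. sampled N xd t - xd t) \<le> e" "norm_L2 T (\<lambda>t. sampled N ud t - ud t) \<le> e"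
  shows "Jh N X U \<le> 1/2 * (norm_L2 T (\<lambda>t. x t - xd t) + 2 * e)\<^sup>2 + \<delta>/2 * (norm_L2 T (\<lambda>t. u t - ud t) + 2 * e)\<^sup>2"
proof -
  have *: "norm_L2 T (\<lambda>t. V t - W t) \<le> norm_L2 T (\<lambda>t. v t - w t) + 2 * e"
    if "V \<in> L2_space T" "W \<in> L2_space T" "v \<in> L2_space T" "w \<in> L2_space T"
      "norm_L2 T (\<lambda>t. V t - v t) \<le> e" "norm_L2 T (\<lambda>t. W t - w t) \<le> e"
    for V W v w :: "real \<Rightarrow> 'z::euclidean_space"
    using norm_L2_triangle_diff[OF that(1,3,2)] norm_L2_triangle_diff[OF that(3,4,2)] that(5,6)
    by (simp add: norm_L2_minus_commute[of T w])
  show ?thesis unfolding Jh_def using \<delta>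
    by (intro add_mono mult_left_mono power_mono * sampled_L2 shifted_step_L2 N L data d s) auto
qed

lemma le_of_quadratic:
  fixes s a c :: real
  assumes "a * s\<^sup>2 \<le> c" "0 < a" "0 \<le> c"
  shows "s \<le> c / a + 1"
proof -
  have "s\<^sup>2 \<le> c / a" using assms by (simp add: field_simps)
  moreover have "0 \<le> (s - 1)\<^sup>2 + s\<^sup>2 + 1" by simp
  then have "s \<le> s\<^sup>2 + 1" by (simp add: power2_diff)
  ultimately show ?thesis by linarith
qed

text \<open>The opposite comparison, for discrete solutions: passing to interpolants and unsampled
  data changes each distance by at most \<open>t\<close>, and a bound on the discrete cost controls
  the resulting change of the squares.\<close>

lemma J_interpolant_le:
  assumes N: "0 < N" "T / real N * onorm ((*v) A) \<le> 1 / 2" and e: "euler N X U"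
    and b: "norm_L2 T (control_interpolant T N U) \<le> b" and c: "Jh N X U \<le> c"
    and s: "norm_L2 T (\<lambda>t. sampled N xd t - xd t) \<le> \<eta>" "norm_L2 T (\<lambda>t. sampled N ud t - ud t) \<le> \<eta>"
  defines "t \<equiv> T / real N * slope b + \<eta>"
  shows "J (state_interpolant T N X) (control_interpolant T N U)
    \<le> Jh N X U + (1/2 + \<delta>/2) * (2 * (2 * c + 2 / \<delta> * c + 1) * t + t\<^sup>2)"
proof -
  let ?x = "state_interpolant T N X" and ?u = "control_interpolant T N U"
  define m where "m = 2 * c + 2 / \<delta> * c + 1"
  define \<alpha> \<beta> where "\<alpha> = norm_L2 T (\<lambda>t. X (Suc (cell T N t)) - sampled N xd t)"
    and "\<beta> = norm_L2 T (\<lambda>t. U (Suc (cell T N t)) - sampled N ud t)"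
  have Jh: "Jh N X U = 1/2 * \<alpha>\<^sup>2 + \<delta>/2 * \<beta>\<^sup>2" by (simp add: Jh_def \<alpha>_def \<beta>_def)
  have nn: "0 \<le> 1/2 * \<alpha>\<^sup>2" "0 \<le> \<delta>/2 * \<beta>\<^sup>2" using \<delta> by auto
  then have c0: "0 \<le> c" and a2: "1/2 * \<alpha>\<^sup>2 \<le> c" and b2: "\<delta>/2 * \<beta>\<^sup>2 \<le> c" using c Jh by linarith+
  have "0 \<le> 2 / \<delta> * c" using \<delta> c0 by simp
  moreover have "\<alpha> \<le> 2 * c + 1" "\<beta> \<le> 2 / \<delta> * c + 1"
    using le_of_quadratic[OF a2 _ c0] le_of_quadratic[OF b2 _ c0] \<delta> by (simp_all add: mult.commute)
  ultimately have m: "\<alpha> \<le> m" "\<beta> \<le> m" using c0 unfolding m_def by linarith+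
  have uL: "?u \<in> L2_space T" by (rule control_interpolant_L2[OF N(1)])
  have xL: "?x \<in> L2_space T" by (rule is_primitive_L2[OF T0 state_interpolant_primitive[OF T N(1)]])
  note L = shifted_step_L2[OF N(1), of X] sampled_L2[OF N(1), of xd] sampled_L2[OF N(1), of ud]
  have \<eta>: "0 \<le> \<eta>" using s(1) norm_L2_nonneg order_trans by blast
  have hs: "0 \<le> T / real N * slope b"
    using interpolant_defects(1)[OF N e b] norm_L2_nonneg order_trans by blast
  have x: "norm_L2 T (\<lambda>t. ?x t - xd t) \<le> \<alpha> + t"
    using norm_L2_triangle_diff[OF xL L(1) data(2)] norm_L2_triangle_diff[OF L(1,2) data(2)]
      interpolant_defects(1)[OF N e b] s(1) unfolding \<alpha>_def t_def by linarith
  have u: "norm_L2 T (\<lambda>t. ?u t - ud t) \<le> \<beta> + t"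
    using norm_L2_triangle_diff[OF uL L(3) data(3)] s(2) hs unfolding \<beta>_def t_def by (simp add: control_interpolant_def)
  have sq: "p\<^sup>2 \<le> a\<^sup>2 + (2 * m * t + t\<^sup>2)" if "0 \<le> p" "p \<le> a + t" "a \<le> m" for p a :: real
  proof -
    have "p\<^sup>2 \<le> (a + t)\<^sup>2" using that by (intro power_mono) auto
    also have "\<dots> = a\<^sup>2 + (2 * a * t + t\<^sup>2)" by (simp add: power2_sum algebra_simps)
    also have "\<dots> \<le> a\<^sup>2 + (2 * m * t + t\<^sup>2)"
      using that hs \<eta> by (intro add_left_mono add_right_mono mult_right_mono) (auto simp: t_def)
    finally show ?thesis .
  qed
  have "J ?x ?u \<le> 1/2 * (\<alpha>\<^sup>2 + (2 * m * t + t\<^sup>2)) + \<delta>/2 * (\<beta>\<^sup>2 + (2 * m * t + t\<^sup>2))"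
    unfolding J_def using \<delta> by (intro add_mono mult_left_mono sq x u m) auto
  also have "\<dots> = Jh N X U + (1/2 + \<delta>/2) * (2 * m * t + t\<^sup>2)"
    unfolding Jh by (simp only: distrib_left distrib_right add_ac)
  finally show ?thesis unfolding m_def .
qed

text \<open>The cost is quadratic in the control, whereas the end state grows at most linearly in it.\<close>

lemma discrete_control_bound:
  assumes N: "0 < N" "T / real N * onorm ((*v) A) \<le> 1 / 2" and e: "euler N X U"
    and s: "norm_L2 T (\<lambda>t. sampled N ud t - ud t) \<le> 1"
    and J: "Jh N X U \<le> c + L * norm (X N)" and c: "0 \<le> c" "0 \<le> L"
  defines "d \<equiv> norm_L2 T ud + 1" and "p \<equiv> exp (2 * onorm ((*v) A) * T)"
  defines "l \<equiv> L * (p * (sqrt T * onorm ((*v) B)))"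
  shows "norm_L2 T (control_interpolant T N U) \<le> 2 / \<delta> * (c + L * bnd d + l) + 1 + d"
proof -
  let ?u = "control_interpolant T N U"
  define w where "w = norm_L2 T (\<lambda>t. ?u t - sampled N ud t)"
  have uL: "?u \<in> L2_space T" by (rule control_interpolant_L2[OF N(1)])
  note L = sampled_L2[OF N(1), of ud]
  have w0: "0 \<le> w" by (simp add: w_def)
  have l: "0 \<le> l" using c T0 by (simp add: l_def p_def onorm_matrix_nonneg)
  have d: "norm_L2 T (sampled N ud) \<le> d"
    using norm_L2_triangle[OF L2_diff[OF L data(3)] data(3)] s by (simp add: d_def)
  have u: "norm_L2 T ?u \<le> d + w"
    using norm_L2_triangle[OF L2_diff[OF uL L] L] d by (simp add: w_def)
  have d0: "0 \<le> d" by (simp add: d_def)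
  have bnd0: "0 \<le> bnd d" using T0 d0 by (simp add: bnd_def onorm_matrix_nonneg)
  \<comment> \<open>\<open>bnd\<close> is affine in its argument, so the cost of the end state grows
    linearly in \<open>w\<close> with coefficient \<open>l\<close>.\<close>
  have bw: "L * bnd (d + w) = L * bnd d + l * w" by (simp add: bnd_def l_def p_def algebra_simps)
  have "0 \<le> 1/2 * (norm_L2 T (\<lambda>t. X (Suc (cell T N t)) - sampled N xd t))\<^sup>2" by simp
  then have "\<delta>/2 * w\<^sup>2 \<le> Jh N X U" unfolding Jh_def w_def control_interpolant_def by linarith
  also have "\<dots> \<le> c + L * bnd (d + w)"
    using J mult_left_mono[OF order_trans[OF euler_bound[OF N e order_refl] bnd_mono[OF u]] c(2)] by linarith
  finally have q: "\<delta>/2 * w\<^sup>2 \<le> c + L * bnd d + l * w" by (simp add: bw)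
  have c': "0 \<le> c + L * bnd d" using c bnd0 by simp
  have "w \<le> 2 / \<delta> * (c + L * bnd d + l) + 1"
  proof (cases "w \<le> 1")
    case True
    then show ?thesis using c' l \<delta> by (intro order_trans[OF True]) simp
  next
    case False
    \<comment> \<open>For \<open>w > 1\<close> the constant terms are absorbed into a multiple of
      \<open>w\<close>, and one factor \<open>w\<close> cancels from the quadratic
      inequality.\<close>
    then have "c + L * bnd d \<le> (c + L * bnd d) * w" using c' by (simp add: mult_le_cancel_left1)
    then have "\<delta>/2 * w * w \<le> (c + L * bnd d + l) * w" using q by (simp add: power2_eq_square algebra_simps)
    then have "\<delta>/2 * w \<le> c + L * bnd d + l" using False by simp
    then have "w \<le> 2 / \<delta> * (c + L * bnd d + l)" using \<delta> by (simp add: field_simps)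
    then show ?thesis by simp
  qed
  with u show ?thesis by simp
qed

end

section \<open>Passage to the limit along discrete solutions\<close>

text \<open>\<open>min a b = 0\<close> encodes nonnegativity and complementarity in one continuous
  equation, which survives the limit when the relaxation tends to 0.\<close>

lemma min_vec_tendsto_0_imp_complementary:
  fixes z G :: "nat \<Rightarrow> real^'n"
  assumes z: "z \<longlonglongrightarrow> zb" and G: "G \<longlonglongrightarrow> Gb"
    and m: "\<And>k. norm (\<chi> i. min (z k $ i) (G k $ i)) \<le> \<epsilon> k" and \<epsilon>: "\<epsilon> \<longlonglongrightarrow> 0"
  shows "0 \<le> zb" "0 \<le> Gb" "zb \<bullet> Gb = 0"
proof -
  have "min (zb $ i) (Gb $ i) = 0" for i
  proof -
    have "(\<lambda>k. min (z k $ i) (G k $ i)) \<longlonglongrightarrow> 0"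
    proof (rule Lim_null_comparison[OF _ \<epsilon>], intro always_eventually allI)
      fix k
      show "norm (min (z k $ i) (G k $ i)) \<le> \<epsilon> k"
        using Finite_Cartesian_Product.norm_nth_le[of "\<chi> i. min (z k $ i) (G k $ i)" i] m[of k] by simp
    qed
    moreover have "(\<lambda>k. min (z k $ i) (G k $ i)) \<longlonglongrightarrow> min (zb $ i) (Gb $ i)"
      by (intro tendsto_min tendsto_vec_nth z G)
    ultimately show ?thesis using LIMSEQ_unique by blast
  qed
  then have *: "0 \<le> zb $ i" "0 \<le> Gb $ i" "zb $ i * Gb $ i = 0" for i
    by (metis min.cobounded1, metis min.cobounded2, metis min_def mult_eq_0_iff)
  then show "0 \<le> zb" "0 \<le> Gb" by (simp_all add: less_eq_vec_def)
  show "zb \<bullet> Gb = 0" unfolding inner_vec_def inner_real_def by (intro sum.neutral ballI *)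
qed

context terminal_problem
begin

text \<open>Optimality of the discrete pairs enters only through the comparison \<open>le\<close>
  with the recovery competitor. It first gives compactness, then the upper bound that makes the
  interpolants a minimizing sequence. Joint convergence of the sampled maps is what permits moving
  arguments, the discrete end states, along growing sample sizes.\<close>

lemma discrete_minimizers_converge:
  fixes \<phi>s :: "nat \<Rightarrow> real^'n \<Rightarrow> real" and Ms :: "nat \<Rightarrow> real^'n \<Rightarrow> real^'n" and Hs :: "nat \<Rightarrow> real^'n \<Rightarrow> real^'k"
  assumes \<phi>s: "\<And>z. ((\<lambda>(y, n). \<phi>s n y) \<longlongrightarrow> \<phi> z) (nhds z \<times>\<^sub>F sequentially)"
    and Ms: "\<And>z. ((\<lambda>(y, n). Ms n y) \<longlongrightarrow> M z) (nhds z \<times>\<^sub>F sequentially)"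
    and Hs: "\<And>z. ((\<lambda>(y, n). Hs n y) \<longlongrightarrow> H z) (nhds z \<times>\<^sub>F sequentially)"
    and lip: "\<And>k y z. \<bar>\<phi>s (\<nu> k) y - \<phi>s (\<nu> k) z\<bar> \<le> L * norm (y - z)" and L: "0 \<le> L"
    and opt: "(xs, us) \<in> minimizers feas cost"
    and \<nu>: "filterlim \<nu> sequentially sequentially" and \<epsilon>: "\<epsilon> \<longlonglongrightarrow> 0" and \<eta>: "\<eta> \<longlonglongrightarrow> 0" "\<And>k. \<eta> k \<le> 1"
    and N: "filterlim N sequentially sequentially" "\<And>k. 0 < N k" "\<And>k. T / real (N k) * onorm ((*v) A) \<le> 1 / 2"
    and sf: "\<And>k. norm_L2 T (\<lambda>t. sampled (N k) f t - f t) \<le> \<eta> k"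
    and sx: "\<And>k. norm_L2 T (\<lambda>t. sampled (N k) xd t - xd t) \<le> \<eta> k"
    and su: "\<And>k. norm_L2 T (\<lambda>t. sampled (N k) ud t - ud t) \<le> \<eta> k"
    and e: "\<And>k. euler (N k) (X k) (U k)"
    and mn: "\<And>k. norm (\<chi> i. min (X k (N k) $ i) (Ms (\<nu> k) (X k (N k)) $ i)) \<le> \<epsilon> k"
    and inf: "\<And>k. infdist (Hs (\<nu> k) (X k (N k))) K \<le> \<epsilon> k"
    and le: "\<And>k. \<phi>s (\<nu> k) (X k (N k)) + Jh (N k) (X k) (U k) \<le> \<phi>s (\<nu> k) (xs T) +
       (1/2 * (norm_L2 T (\<lambda>t. xs t - xd t) + 2 * \<eta> k)\<^sup>2 + \<delta>/2 * (norm_L2 T (\<lambda>t. us t - ud t) + 2 * \<eta> k)\<^sup>2)"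
  obtains \<sigma> xb ub where "strict_mono \<sigma>" "(xb, ub) \<in> minimizers feas cost"
    "(\<lambda>k. norm_H1 T (\<lambda>t. state_interpolant T (N (\<sigma> k)) (X (\<sigma> k)) t - xb t) +
          norm_L2 T (\<lambda>t. control_interpolant T (N (\<sigma> k)) (U (\<sigma> k)) t - ub t)) \<longlonglongrightarrow> 0"
proof -
  let ?a = "norm_L2 T (\<lambda>t. xs t - xd t)" and ?b = "norm_L2 T (\<lambda>t. us t - ud t)"
  define Ju where "Ju h = 1/2 * (?a + 2 * h)\<^sup>2 + \<delta>/2 * (?b + 2 * h)\<^sup>2" for h
  define zs where "zs = xs T"
  define z where "z k = X k (N k)" for k
  define x where "x k = state_interpolant T (N k) (X k)" for k
  define u where "u k = control_interpolant T (N k) (U k)" for k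
  have \<eta>0: "0 \<le> \<eta> k" for k using sf[of k] norm_L2_nonneg order_trans by blast
  have Ju1: "Ju (\<eta> k) \<le> Ju 1" for k
    unfolding Ju_def using \<delta> \<eta>0[of k] \<eta>(2)[of k] by (intro add_mono mult_left_mono power_mono) auto
  have Ju0: "0 \<le> Ju 1" unfolding Ju_def using \<delta> by auto
  have le': "\<phi>s (\<nu> k) (z k) + Jh (N k) (X k) (U k) \<le> \<phi>s (\<nu> k) zs + Ju (\<eta> k)" for k
    using le[of k] by (simp add: z_def zs_def Ju_def)
  have lipz: "\<phi>s (\<nu> k) zs - \<phi>s (\<nu> k) (z k) \<le> L * norm zs + L * norm (z k)" for k
  proof -
    have "\<phi>s (\<nu> k) zs - \<phi>s (\<nu> k) (z k) \<le> L * norm (zs - z k)" using lip[of k zs "z k"] by linarith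
    also have "\<dots> \<le> L * (norm zs + norm (z k))" by (intro mult_left_mono norm_triangle_ineq4 L)
    finally show ?thesis by (simp add: distrib_left)
  qed
  \<comment> \<open>The Lipschitz bound replaces a lower bound on the sampled terminal cost: the
    difference of its values at the two end states grows at most linearly in the end state.\<close>
  define c where "c = L * norm zs + Ju 1"
  have c: "0 \<le> c" using L Ju0 by (simp add: c_def)
  have Jc: "Jh (N k) (X k) (U k) \<le> c + L * norm (X k (N k))" for k
    using le'[of k] lipz[of k] Ju1[of k] by (simp add: c_def z_def)
  have "\<exists>b. \<forall>k. norm_L2 T (u k) \<le> b"
    unfolding u_def using discrete_control_bound[OF N(2,3) e order_trans[OF su \<eta>(2)] Jc c L] by blast
  then obtain b where b: "\<And>k. norm_L2 T (u k) \<le> b" by blast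
  have zb: "norm (z k) \<le> bnd b" for k
    unfolding z_def using order_trans[OF euler_bound[OF N(2,3) e order_refl] bnd_mono[OF b[unfolded u_def]]] .
  define c2 where "c2 = c + L * bnd b"
  have Jc2: "Jh (N k) (X k) (U k) \<le> c2" for k
    using Jc[of k] mult_left_mono[OF zb L, of k] by (simp add: c2_def z_def)
  define t where "t k = T / real (N k) * slope b + \<eta> k" for k
  define \<tau> where "\<tau> k = (1/2 + \<delta>/2) * (2 * (2 * c2 + 2 / \<delta> * c2 + 1) * t k + (t k)\<^sup>2)" for k
  have J: "J (x k) (u k) \<le> Jh (N k) (X k) (U k) + \<tau> k" for k
    unfolding x_def u_def \<tau>_def t_def by (rule J_interpolant_le[OF N(2,3) e b[unfolded u_def] Jc2 sx su])
  have "bounded (range z)" using zb by (auto simp: bounded_iff)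
  then obtain zb \<sigma> where \<sigma>: "strict_mono \<sigma>" and "(z \<circ> \<sigma>) \<longlonglongrightarrow> zb"
    using bounded_imp_convergent_subsequence by blast
  then have zlim: "(\<lambda>k. z (\<sigma> k)) \<longlonglongrightarrow> zb" by (simp add: o_def)
  have \<sigma>': "filterlim \<sigma> sequentially sequentially" by (rule filterlim_subseq[OF \<sigma>])
  have \<nu>\<sigma>: "filterlim (\<lambda>k. \<nu> (\<sigma> k)) sequentially sequentially" by (rule filterlim_compose[OF \<nu> \<sigma>'])
  have sub: "(\<lambda>k. v (\<sigma> k)) \<longlonglongrightarrow> l" if "v \<longlonglongrightarrow> l" for v :: "nat \<Rightarrow> real" and l
    by (rule filterlim_compose[OF that \<sigma>'])
  have joint: "(\<lambda>k. F (\<nu> (\<sigma> k)) (w k)) \<longlonglongrightarrow> l"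
    if "((\<lambda>(y, n). F n y) \<longlongrightarrow> l) (nhds w0 \<times>\<^sub>F sequentially)" "w \<longlonglongrightarrow> w0"
    for F :: "nat \<Rightarrow> real^'n \<Rightarrow> 'z::topological_space" and l w w0
    using filterlim_compose[OF that(1) filterlim_Pair[OF that(2) \<nu>\<sigma>]] by simp
  have Mlim: "(\<lambda>k. Ms (\<nu> (\<sigma> k)) (z (\<sigma> k))) \<longlonglongrightarrow> M zb" by (rule joint[OF Ms zlim])
  have Hlim: "(\<lambda>k. Hs (\<nu> (\<sigma> k)) (z (\<sigma> k))) \<longlonglongrightarrow> H zb" by (rule joint[OF Hs zlim])
  have \<phi>lim: "(\<lambda>k. \<phi>s (\<nu> (\<sigma> k)) (z (\<sigma> k))) \<longlonglongrightarrow> \<phi> zb" by (rule joint[OF \<phi>s zlim])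
  have \<phi>slim: "(\<lambda>k. \<phi>s (\<nu> (\<sigma> k)) zs) \<longlonglongrightarrow> \<phi> zs" by (rule joint[OF \<phi>s tendsto_const])
  have T1: "(\<lambda>k. T / real (N (\<sigma> k))) \<longlonglongrightarrow> 0"
    by (rule sub[OF filterlim_compose[OF lim_const_over_n N(1)]])
  have tlim: "(\<lambda>k. t (\<sigma> k)) \<longlonglongrightarrow> 0"
    unfolding t_def using tendsto_add[OF tendsto_mult[OF T1 tendsto_const[of "slope b"]] sub[OF \<eta>(1)]] by simp
  have tz: "terminal zb"
  proof -
    note min_vec_tendsto_0_imp_complementary[OF zlim Mlim mn[folded z_def] sub[OF \<epsilon>]]
    moreover have "H zb \<in> K"
    proof -
      have "(\<lambda>k. infdist (Hs (\<nu> (\<sigma> k)) (z (\<sigma> k))) K) \<longlonglongrightarrow> infdist (H zb) K" by (intro tendsto_infdist Hlim)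
      then have "infdist (H zb) K \<le> 0"
        by (rule LIMSEQ_le[OF _ sub[OF \<epsilon>]]) (use inf in \<open>auto simp: z_def\<close>)
      then have "infdist (H zb) K = 0" using infdist_nonneg[of "H zb" K] by linarith
      \<comment> \<open>\<open>infdist\<close> to the empty set is 0 by convention, so nonemptiness
        is required before a zero distance means membership.\<close>
      moreover have "K \<noteq> {}" using terminal_nonempty by auto
      ultimately show ?thesis using in_closed_iff_infdist_zero[OF K] by blast
    qed
    ultimately show ?thesis by (simp add: terminal_def)
  qed
  have \<tau>lim: "(\<lambda>k. \<tau> (\<sigma> k)) \<longlonglongrightarrow> 0"
  proof -
    have "(\<lambda>k. \<tau> (\<sigma> k)) \<longlonglongrightarrow> (1/2 + \<delta>/2) * (2 * (2 * c2 + 2 / \<delta> * c2 + 1) * 0 + 0\<^sup>2)"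
      unfolding \<tau>_def by (intro tendsto_intros tlim)
    then show ?thesis by simp
  qed
  have Julim: "(\<lambda>k. Ju (\<eta> (\<sigma> k))) \<longlonglongrightarrow> J xs us"
  proof -
    have "(\<lambda>k. Ju (\<eta> (\<sigma> k))) \<longlonglongrightarrow> 1/2 * (?a + 2 * 0)\<^sup>2 + \<delta>/2 * (?b + 2 * 0)\<^sup>2"
      unfolding Ju_def by (intro tendsto_intros sub[OF \<eta>(1)])
    then show ?thesis by (simp add: J_def)
  qed
  define v where "v = cost (xs, us)"
  \<comment> \<open>The sampled terminal cost at the discrete end state is exchanged for its limit;
    the right-hand side converges to the optimal value.\<close>
  have upper: "\<phi> zb + J (x (\<sigma> k)) (u (\<sigma> k)) \<le>
      \<phi> zb - \<phi>s (\<nu> (\<sigma> k)) (z (\<sigma> k)) + \<phi>s (\<nu> (\<sigma> k)) zs + Ju (\<eta> (\<sigma> k)) + \<tau> (\<sigma> k)" for k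
    using J[of "\<sigma> k"] le'[of "\<sigma> k"] by linarith
  have upperlim: "(\<lambda>k. \<phi> zb - \<phi>s (\<nu> (\<sigma> k)) (z (\<sigma> k)) + \<phi>s (\<nu> (\<sigma> k)) zs + Ju (\<eta> (\<sigma> k)) + \<tau> (\<sigma> k)) \<longlonglongrightarrow> v"
    using tendsto_add[OF tendsto_add[OF tendsto_add[OF tendsto_diff[OF tendsto_const[of "\<phi> zb"] \<phi>lim] \<phi>slim] Julim] \<tau>lim]
    by (simp add: v_def cost_eq zs_def)
  have lim: "\<forall>\<^sub>F k in sequentially. \<phi> zb + J (x (\<sigma> k)) (u (\<sigma> k)) \<le> v + h" if "0 < h" for h
  proof -
    have "v < v + h" using that by simp
    from order_tendstoD(2)[OF upperlim this] show ?thesis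
    proof eventually_elim
      case (elim k)
      with upper[of k] show ?case by linarith
    qed
  qed
  define Q where "Q k y r \<longleftrightarrow> is_primitive T (x k) y \<and>
      norm_L2 T (\<lambda>t. y t - (A *v x k t + B *v u k t)) \<le> onorm ((*v) A) * (T / real (N k) * slope b) \<and>
      r \<in> L2_space T \<and> norm_L2 T r \<le> onorm ((*v) C) * (T / real (N k) * slope b) + norm_L2 T (\<lambda>t. sampled (N k) f t - f t) \<and>
      (AE t in lebesgue_on {0<..<T}. C *v x k t + D *v u k t - f t \<le> r t)" for k y r
  have "\<exists>y r. Q k y r" for k
    unfolding Q_def x_def u_def by (rule interpolant_defects(2)[OF N(2,3) e b[unfolded u_def]])
  then obtain y r where "\<And>k. Q k (y k) (r k)" by metis
  then have p: "is_primitive T (x k) (y k)"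
    and res: "norm_L2 T (\<lambda>t. y k t - (A *v x k t + B *v u k t)) \<le> onorm ((*v) A) * (T / real (N k) * slope b)"
    and rL: "r k \<in> L2_space T"
    and rn: "norm_L2 T (r k) \<le> onorm ((*v) C) * (T / real (N k) * slope b) + norm_L2 T (\<lambda>t. sampled (N k) f t - f t)"
    and con: "AE t in lebesgue_on {0<..<T}. C *v x k t + D *v u k t - f t \<le> r k t" for k
    unfolding Q_def by blast+
  have b1: "(\<lambda>k. onorm ((*v) A) * (T / real (N (\<sigma> k)) * slope b)) \<longlonglongrightarrow> 0"
    using tendsto_mult[OF tendsto_const[of "onorm ((*v) A)"] tendsto_mult[OF T1 tendsto_const[of "slope b"]]] by simp
  have b2: "(\<lambda>k. onorm ((*v) C) * (T / real (N (\<sigma> k)) * slope b) + \<eta> (\<sigma> k)) \<longlonglongrightarrow> 0"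
    using tendsto_add[OF tendsto_mult[OF tendsto_const[of "onorm ((*v) C)"] tendsto_mult[OF T1 tendsto_const[of "slope b"]]] sub[OF \<eta>(1)]] by simp
  have res0: "(\<lambda>k. norm_L2 T (\<lambda>t. y (\<sigma> k) t - (A *v x (\<sigma> k) t + B *v u (\<sigma> k) t))) \<longlonglongrightarrow> 0"
    by (rule tendsto_0_of_nonneg_le[OF norm_L2_nonneg res b1])
  have r0: "(\<lambda>k. norm_L2 T (r (\<sigma> k))) \<longlonglongrightarrow> 0"
    by (rule tendsto_0_of_nonneg_le[OF norm_L2_nonneg order_trans[OF rn add_left_mono[OF sf]] b2])
  have uL: "u k \<in> L2_space T" for k unfolding u_def by (rule control_interpolant_L2[OF N(2)])
  have x0': "x k 0 = x0" for k using e[of k] by (simp add: x_def state_interpolant_0 euler_def)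
  have xT: "(\<lambda>k. x (\<sigma> k) T) \<longlonglongrightarrow> zb" using zlim by (simp add: x_def z_def state_interpolant_T N(2))
  have v: "v \<le> cost s" if "s \<in> feas" for s using opt that by (simp add: minimizers_def v_def)
  obtain xb ub where "(xb, ub) \<in> minimizers feas cost"
    "(\<lambda>k. norm_H1 T (\<lambda>t. x (\<sigma> k) t - xb t) + norm_L2 T (\<lambda>t. u (\<sigma> k) t - ub t)) \<longlonglongrightarrow> 0"
    using almost_feasible_limit[OF uL p x0' res0 rL r0 con xT tz v lim] by blast
  then show ?thesis using that \<sigma> unfolding x_def u_def by blast
qed


text \<open>The negation of nested eventual statements is a nest of frequent ones, from which a
  diagonal sequence of bad parameters can be picked, each together with all the eventual properties
  available at its level. Its interpolants have a subsequence converging to a minimizer, which is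
  absurd.\<close>

theorem discrete_minimizers_stability:
  fixes \<phi>s :: "nat \<Rightarrow> real^'n \<Rightarrow> real" and Ms :: "nat \<Rightarrow> real^'n \<Rightarrow> real^'n" and Hs :: "nat \<Rightarrow> real^'n \<Rightarrow> real^'k"
  assumes \<phi>s: "\<And>z. ((\<lambda>(y, n). \<phi>s n y) \<longlongrightarrow> \<phi> z) (nhds z \<times>\<^sub>F sequentially)"
    and Ms: "\<And>z. ((\<lambda>(y, n). Ms n y) \<longlongrightarrow> M z) (nhds z \<times>\<^sub>F sequentially)"
    and Hs: "\<And>z. ((\<lambda>(y, n). Hs n y) \<longlongrightarrow> H z) (nhds z \<times>\<^sub>F sequentially)"
    and lip: "\<forall>\<^sub>F n in sequentially. \<forall>y z. \<bar>\<phi>s n y - \<phi>s n z\<bar> \<le> L * norm (y - z)" and L: "0 \<le> L"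
    and samp: "sampling_consistent T f" "sampling_consistent T xd" "sampling_consistent T ud" and \<theta>: "0 < \<theta>"
  shows "\<forall>\<^sub>F \<epsilon> in at_right 0. \<forall>\<^sub>F n in sequentially. \<forall>\<^sub>F N in sequentially.
    \<forall>s\<in>interpolants T N (minimizers (tsp_feasible T N A B C D f x0 \<epsilon> (Ms n) (Hs n) K) (tsp_cost T N \<delta> xd ud (\<phi>s n))).
      dist_set T s (minimizers feas cost) \<le> ennreal \<theta>"
proof (rule ccontr)
  let ?S = "\<lambda>\<epsilon> n N. minimizers (tsp_feasible T N A B C D f x0 \<epsilon> (Ms n) (Hs n) K) (tsp_cost T N \<delta> xd ud (\<phi>s n))"
  assume "\<not> ?thesis"
  then have freq: "\<exists>\<^sub>F \<epsilon> in at_right 0. \<exists>\<^sub>F n in sequentially. \<exists>\<^sub>F N in sequentially.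
    \<exists>s\<in>interpolants T N (?S \<epsilon> n N). \<not> dist_set T s (minimizers feas cost) \<le> ennreal \<theta>"
    unfolding not_eventually by simp
  obtain xs us where opt: "(xs, us) \<in> minimizers feas cost" using minimizer_exists by auto
  then have adm: "adm xs us" and tz: "terminal (xs T)" unfolding minimizers_def by (auto simp: feas_iff)
  define zs where "zs = xs T"
  let ?a = "norm_L2 T (\<lambda>t. xs t - xd t)" and ?b = "norm_L2 T (\<lambda>t. us t - ud t)"
  \<comment> \<open>Whether the fixed optimal end state meets the sampled, relaxed conditions: true
    for large samples at any fixed \<epsilon> > 0. This is where the sample limit has to lie inside
    the \<epsilon>-limit.\<close>
  define relaxed where "relaxed \<epsilon> n \<longleftrightarrow> norm (\<chi> i. min (zs $ i) (Ms n zs $ i)) \<le> \<epsilon> \<and> infdist (Hs n zs) K \<le> \<epsilon>" for \<epsilon> n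
  have relaxed: "\<forall>\<^sub>F n in sequentially. relaxed \<epsilon> n" if \<epsilon>: "0 < \<epsilon>" for \<epsilon>
  proof -
    have at: "filterlim (\<lambda>n. (zs, n)) (nhds zs \<times>\<^sub>F sequentially) sequentially"
      by (intro filterlim_Pair tendsto_const filterlim_ident)
    have m: "(\<lambda>n. Ms n zs) \<longlonglongrightarrow> M zs" and h: "(\<lambda>n. Hs n zs) \<longlonglongrightarrow> H zs"
      using filterlim_compose[OF Ms at] filterlim_compose[OF Hs at] by simp_all
    have z0: "(\<chi> i. min (zs $ i) (M zs $ i)) = 0"
    proof -
      have nn: "0 \<le> zs $ i" "0 \<le> M zs $ i" for i using tz by (simp_all add: terminal_def zs_def less_eq_vec_def)
      have "(\<Sum>i\<in>UNIV. zs $ i * M zs $ i) = 0" using tz by (simp add: terminal_def zs_def inner_vec_def)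
      then have "zs $ i * M zs $ i = 0" for i using nn by (simp add: sum_nonneg_eq_0_iff)
      then show ?thesis using nn unfolding vec_eq_iff vec_lambda_beta zero_index
        by (metis min.absorb1 min.absorb2 mult_eq_0_iff)
    qed
    have "(\<lambda>n. norm (\<chi> i. min (zs $ i) (Ms n zs $ i))) \<longlonglongrightarrow> norm (\<chi> i. min (zs $ i) (M zs $ i))"
      by (intro tendsto_norm tendsto_vec_lambda tendsto_min tendsto_const tendsto_vec_nth m)
    then have 1: "(\<lambda>n. norm (\<chi> i. min (zs $ i) (Ms n zs $ i))) \<longlonglongrightarrow> 0" by (simp add: z0)
    have "(\<lambda>n. infdist (Hs n zs) K) \<longlonglongrightarrow> infdist (H zs) K" by (intro tendsto_infdist h)
    then have 2: "(\<lambda>n. infdist (Hs n zs) K) \<longlonglongrightarrow> 0" using tz by (simp add: terminal_def zs_def)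
    from order_tendstoD(2)[OF 1 \<epsilon>] order_tendstoD(2)[OF 2 \<epsilon>] show ?thesis
      by eventually_elim (simp add: relaxed_def)
  qed
  \<comment> \<open>Collects what a fine mesh provides: stability of the scheme, small sampling
    errors and a recovery competitor with end state \<open>zs\<close>.\<close>
  define good where "good e N \<longleftrightarrow> 0 < N \<and> T / real N * onorm ((*v) A) \<le> 1 / 2 \<and>
    norm_L2 T (\<lambda>t. sampled N f t - f t) \<le> e \<and> norm_L2 T (\<lambda>t. sampled N xd t - xd t) \<le> e \<and>
    norm_L2 T (\<lambda>t. sampled N ud t - ud t) \<le> e \<and>
    (\<exists>X U. euler N X U \<and> X N = zs \<and> norm_L2 T (\<lambda>t. X (Suc (cell T N t)) - xs t) \<le> e \<and>
      norm_L2 T (\<lambda>t. U (Suc (cell T N t)) - us t) \<le> e)" for e N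
  have step: "\<forall>\<^sub>F N in sequentially. 0 < N \<and> T / real N * onorm ((*v) A) < 1 / 2"
    by (rule eventually_step_small) simp
  have good: "\<forall>\<^sub>F N in sequentially. good e N" if e: "0 < e" for e
    using recovery[OF adm samp(1) e] step
      sampling_eventually_small[OF samp(1) e] sampling_eventually_small[OF samp(2) e] sampling_eventually_small[OF samp(3) e]
  proof eventually_elim
    case (elim N)
    then show ?case unfolding good_def euler_def zs_def by (auto simp: less_imp_le)
  qed
  define P where "P k \<epsilon> n N X U \<longleftrightarrow> 0 < \<epsilon> \<and> \<epsilon> < 1 / real (Suc k) \<and> k \<le> n \<and> (\<forall>y z. \<bar>\<phi>s n y - \<phi>s n z\<bar> \<le> L * norm (y - z)) \<and>
    relaxed \<epsilon> n \<and> k \<le> N \<and> good (1 / real (Suc k)) N \<and> (X, U) \<in> ?S \<epsilon> n N \<and>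
    \<not> dist_set T (state_interpolant T N X, control_interpolant T N U) (minimizers feas cost) \<le> ennreal \<theta>" for k \<epsilon> n N X U
  have "\<exists>\<epsilon> n N X U. P k \<epsilon> n N X U" for k
  proof -
    have e: "0 < 1 / real (Suc k)" by simp
    obtain \<epsilon> where \<epsilon>: "0 < \<epsilon>" "\<epsilon> < 1 / real (Suc k)" and f1: "\<exists>\<^sub>F n in sequentially. \<exists>\<^sub>F N in sequentially.
        \<exists>s\<in>interpolants T N (?S \<epsilon> n N). \<not> dist_set T s (minimizers feas cost) \<le> ennreal \<theta>"
      using frequently_ex[OF frequently_eventually_frequently[OF freq eventually_at_right_real[OF e]]] by auto
    obtain n where n: "relaxed \<epsilon> n" "k \<le> n" "\<forall>y z. \<bar>\<phi>s n y - \<phi>s n z\<bar> \<le> L * norm (y - z)" and f2: "\<exists>\<^sub>F N in sequentially.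
        \<exists>s\<in>interpolants T N (?S \<epsilon> n N). \<not> dist_set T s (minimizers feas cost) \<le> ennreal \<theta>"
      using frequently_ex[OF frequently_eventually_frequently[OF f1
          eventually_conj[OF relaxed[OF \<epsilon>(1)] eventually_conj[OF eventually_ge_at_top[of k] lip]]]] by blast
    obtain N where N: "good (1 / real (Suc k)) N" "k \<le> N" and
        f3: "\<exists>s\<in>interpolants T N (?S \<epsilon> n N). \<not> dist_set T s (minimizers feas cost) \<le> ennreal \<theta>"
      using frequently_ex[OF frequently_eventually_frequently[OF f2
          eventually_conj[OF good[OF e] eventually_ge_at_top[of k]]]] by blast
    from f3 obtain X U where "(X, U) \<in> ?S \<epsilon> n N"
        "\<not> dist_set T (state_interpolant T N X, control_interpolant T N U) (minimizers feas cost) \<le> ennreal \<theta>"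
      by (auto simp: interpolants_def)
    then have "P k \<epsilon> n N X U" unfolding P_def using \<epsilon> n N by blast
    then show ?thesis by blast
  qed
  then obtain \<epsilon> n N X U where "\<And>k. P k (\<epsilon> k) (n k) (N k) (X k) (U k)" by metis
  then have \<epsilon>: "0 < \<epsilon> k" "\<epsilon> k < 1 / real (Suc k)" and n: "k \<le> n k"
    and lipk: "\<bar>\<phi>s (n k) y - \<phi>s (n k) z\<bar> \<le> L * norm (y - z)"
    and rel: "relaxed (\<epsilon> k) (n k)" and N: "k \<le> N k" and gd: "good (1 / real (Suc k)) (N k)"
    and min: "(X k, U k) \<in> ?S (\<epsilon> k) (n k) (N k)"
    and far: "\<not> dist_set T (state_interpolant T (N k) (X k), control_interpolant T (N k) (U k)) (minimizers feas cost) \<le> ennreal \<theta>" for k y z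
    unfolding P_def by blast+
  define \<eta> where "\<eta> k = 1 / real (Suc k)" for k
  have \<eta>lim: "\<eta> \<longlonglongrightarrow> 0" using LIMSEQ_inverse_real_of_nat by (simp add: \<eta>_def[abs_def] inverse_eq_divide)
  have \<eta>1: "\<eta> k \<le> 1" for k by (simp add: \<eta>_def)
  have \<epsilon>lim: "\<epsilon> \<longlonglongrightarrow> 0"
    by (rule tendsto_0_of_nonneg_le[OF _ _ \<eta>lim]) (use \<epsilon> in \<open>auto simp: \<eta>_def less_imp_le\<close>)
  have nlim: "filterlim n sequentially sequentially" and Nlim: "filterlim N sequentially sequentially"
    by (rule filterlim_at_top_mono[OF filterlim_ident always_eventually]; use n N in blast)+
  note g = gd[unfolded good_def, folded \<eta>_def]
  have g1: "0 < N k" "T / real (N k) * onorm ((*v) A) \<le> 1 / 2"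
    "norm_L2 T (\<lambda>t. sampled (N k) f t - f t) \<le> \<eta> k" "norm_L2 T (\<lambda>t. sampled (N k) xd t - xd t) \<le> \<eta> k"
    "norm_L2 T (\<lambda>t. sampled (N k) ud t - ud t) \<le> \<eta> k" for k using g[of k] by blast+
  have feasible: "(X k, U k) \<in> tsp_feasible T (N k) A B C D f x0 (\<epsilon> k) (Ms (n k)) (Hs (n k)) K" for k
    using min[of k] by (simp add: minimizers_def)
  have eul: "euler (N k) (X k) (U k)" "norm (\<chi> i. min (X k (N k) $ i) (Ms (n k) (X k (N k)) $ i)) \<le> \<epsilon> k"
      "infdist (Hs (n k) (X k (N k))) K \<le> \<epsilon> k" for k
    using feasible[of k] unfolding tsp_feasible_iff by blast+
  have le: "\<phi>s (n k) (X k (N k)) + Jh (N k) (X k) (U k) \<le> \<phi>s (n k) (xs T) +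
       (1/2 * (?a + 2 * \<eta> k)\<^sup>2 + \<delta>/2 * (?b + 2 * \<eta> k)\<^sup>2)" for k
  proof -
    obtain X' U' where 1: "euler (N k) X' U'" "X' (N k) = zs" "norm_L2 T (\<lambda>t. X' (Suc (cell T (N k) t)) - xs t) \<le> \<eta> k"
        "norm_L2 T (\<lambda>t. U' (Suc (cell T (N k) t)) - us t) \<le> \<eta> k"
      using g[of k] by blast
    have "(X', U') \<in> tsp_feasible T (N k) A B C D f x0 (\<epsilon> k) (Ms (n k)) (Hs (n k)) K"
      using 1 rel[of k] by (simp add: tsp_feasible_iff relaxed_def)
    then have "tsp_cost T (N k) \<delta> xd ud (\<phi>s (n k)) (X k, U k) \<le> tsp_cost T (N k) \<delta> xd ud (\<phi>s (n k)) (X', U')"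
      using min[of k] by (simp add: minimizers_def)
    then have "\<phi>s (n k) (X k (N k)) + Jh (N k) (X k) (U k) \<le> \<phi>s (n k) zs + Jh (N k) X' U'"
      by (simp add: tsp_cost_eq[OF g1(1)] 1(2))
    also have "\<dots> \<le> \<phi>s (n k) zs + (1/2 * (?a + 2 * \<eta> k)\<^sup>2 + \<delta>/2 * (?b + 2 * \<eta> k)\<^sup>2)"
      by (intro add_left_mono Jh_le g1 1 admD[OF adm])
    finally show ?thesis by (simp add: zs_def)
  qed
  obtain \<sigma> xb ub where b: "(xb, ub) \<in> minimizers feas cost"
    and lim: "(\<lambda>k. norm_H1 T (\<lambda>t. state_interpolant T (N (\<sigma> k)) (X (\<sigma> k)) t - xb t) +
          norm_L2 T (\<lambda>t. control_interpolant T (N (\<sigma> k)) (U (\<sigma> k)) t - ub t)) \<longlonglongrightarrow> 0"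
    using discrete_minimizers_converge[OF \<phi>s Ms Hs lipk L opt nlim \<epsilon>lim \<eta>lim \<eta>1 Nlim g1 eul le] by blast
  obtain k where k: "norm_H1 T (\<lambda>t. state_interpolant T (N (\<sigma> k)) (X (\<sigma> k)) t - xb t) +
          norm_L2 T (\<lambda>t. control_interpolant T (N (\<sigma> k)) (U (\<sigma> k)) t - ub t) < \<theta>"
    using eventually_happens'[OF sequentially_bot order_tendstoD(2)[OF lim \<theta>]] by blast
  have "dist_set T (state_interpolant T (N (\<sigma> k)) (X (\<sigma> k)), control_interpolant T (N (\<sigma> k)) (U (\<sigma> k))) (minimizers feas cost)
      \<le> ennreal \<theta>"
    unfolding dist_set_def by (rule INF_lower2[OF b]) (use k in \<open>simp add: ennreal_leI less_imp_le\<close>)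
  with far[of "\<sigma> k"] show False by blast
qed

end

section \<open>Convergence of the optimal solutions\<close>

lemma C1_fun_continuous: "C1_fun f \<Longrightarrow> continuous_on UNIV f"
  unfolding C1_fun_def by (metis continuous_at_imp_continuous_on has_derivative_continuous)

text \<open>The exceptional null set depends on \<open>z\<close>. Countably many of them are united
  over a dense set, and continuity in \<open>z\<close> extends the inequality to all points.\<close>

lemma AE_le_all_of_continuous:
  fixes h k :: "'a::euclidean_space \<Rightarrow> 's \<Rightarrow> real"
  assumes le: "\<And>z. AE s in L. h z s \<le> k z s"
    and cont: "AE s in L. continuous_on UNIV (\<lambda>z. h z s) \<and> continuous_on UNIV (\<lambda>z. k z s)"
  shows "AE s in L. \<forall>z. h z s \<le> k z s"
proof -
  obtain Q :: "'a set" where Q: "countable Q" "\<And>X. open X \<Longrightarrow> X \<noteq> {} \<Longrightarrow> \<exists>d\<in>Q. d \<in> X"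
    by (rule countable_dense_setE) blast
  have "AE s in L. \<forall>z\<in>Q. h z s \<le> k z s" using Q(1) le by (simp add: AE_ball_countable)
  with cont show ?thesis
  proof eventually_elim
    case (elim s)
    have "open {z. k z s < h z s}" using elim(1) by (intro open_Collect_less) auto
    then have "{z. k z s < h z s} = {}" using Q(2) elim(2) by force
    then show ?case by (auto simp: not_less)
  qed
qed

text \<open>Each limit value along a converging sequence of arguments is approximated by a value at
  a large index; the joint limit applies to these diagonal values. This supplies continuity of the
  expectations.\<close>

lemma continuous_of_joint_limit:
  fixes h :: "'a::metric_space \<Rightarrow> 'b::metric_space"
  assumes lim: "\<And>z. ((\<lambda>(y, n). hs n y) \<longlongrightarrow> h z) (nhds z \<times>\<^sub>F sequentially)"
  shows "continuous_on UNIV h"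
proof (rule continuous_at_imp_continuous_on, intro ballI)
  fix z
  show "isCont h z"
    unfolding continuous_at_sequentially
  proof (intro allI impI)
    fix y :: "nat \<Rightarrow> 'a" assume y: "y \<longlonglongrightarrow> z"
    have "\<exists>n\<ge>k. dist (h (y k)) (hs n (y k)) < 1 / real (Suc k)" for k
    proof -
      have "filterlim (\<lambda>n. (y k, n)) (nhds (y k) \<times>\<^sub>F sequentially) sequentially"
        by (intro filterlim_Pair tendsto_const filterlim_ident)
      from filterlim_compose[OF lim this] have "(\<lambda>n. hs n (y k)) \<longlonglongrightarrow> h (y k)" by simp
      then have "\<forall>\<^sub>F n in sequentially. dist (hs n (y k)) (h (y k)) < 1 / real (Suc k)" by (rule tendstoD) simp
      from eventually_happens'[OF sequentially_bot eventually_conj[OF this eventually_ge_at_top[of k]]]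
      show ?thesis by (auto simp: dist_commute)
    qed
    then obtain n where n: "\<And>k. k \<le> n k" "\<And>k. dist (h (y k)) (hs (n k) (y k)) < 1 / real (Suc k)" by metis
    have "filterlim n sequentially sequentially"
      by (rule filterlim_at_top_mono[OF filterlim_ident always_eventually]) (use n in blast)
    from filterlim_compose[OF lim filterlim_Pair[OF y this]] have 1: "(\<lambda>k. hs (n k) (y k)) \<longlonglongrightarrow> h z" by simp
    have "(\<lambda>k. 1 / real (Suc k)) \<longlonglongrightarrow> 0" using LIMSEQ_inverse_real_of_nat by (simp add: inverse_eq_divide)
    from tendsto_0_of_nonneg_le[OF zero_le_dist less_imp_le[OF n(2)] this]
    have 2: "(\<lambda>k. dist (h (y k)) (hs (n k) (y k))) \<longlonglongrightarrow> 0" .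
    have "(\<lambda>k. dist (h (y k)) (h z)) \<longlonglongrightarrow> 0"
      by (rule tendsto_0_of_nonneg_le[OF zero_le_dist dist_triangle tendsto_add_zero[OF 2 iffD1[OF tendsto_dist_iff 1]]])
    then show "(h \<circ> y) \<longlonglongrightarrow> h z" unfolding o_def by (rule iffD2[OF tendsto_dist_iff])
  qed
qed

text \<open>\<open>norm\<close> of a matrix is the Euclidean norm of all entries (Frobenius norm);
  Cauchy-Schwarz is applied to each row.\<close>

lemma norm_matrix_vector_mult_le: "norm (A *v x) \<le> norm A * norm x"
  for A :: "real^'n^'m"
proof -
  have "norm (A *v x) \<le> L2_set (\<lambda>i. norm (A $ i) * norm x) UNIV"
    unfolding norm_vec_def[of "A *v x"]
    by (intro L2_set_mono) (auto simp: matrix_vector_mul_component intro: Cauchy_Schwarz_ineq2)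
  also have "\<dots> = norm A * norm x" by (simp add: norm_vec_def[of A] L2_set_left_distrib)
  finally show ?thesis .
qed

text \<open>Full row rank makes the transpose injective, so the Gram matrix has trivial kernel and
  is invertible; it then cancels in the explicit formula for the pseudoinverse.\<close>

lemma pseudoinverse_right_inverse:
  fixes D :: "real^'m^'l"
  assumes r: "rank D = CARD('l)"
  shows "D ** pseudoinverse D = mat 1"
proof -
  let ?G = "D ** transpose D"
  have "v = 0" if "?G *v v = 0" for v
  proof -
    have "(v v* D) \<bullet> (v v* D) = v \<bullet> (?G *v v)"
      by (simp add: dot_lmul_matrix matrix_vector_mul_assoc[symmetric])
    then have "transpose D *v v = transpose D *v 0" using that by simp
    moreover have "inj ((*v) (transpose D))"
      using r full_rank_injective[of "transpose D"] by (simp add: rank_transpose)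
    ultimately show ?thesis by (rule injD[rotated])
  qed
  then obtain L where L: "L ** ?G = mat 1" using matrix_left_invertible_ker by blast
  then have "?G ** L = mat 1" by (simp add: matrix_left_right_inverse)
  with L have "\<exists>X. ?G ** X = mat 1 \<and> X ** ?G = mat 1" by blast
  then have "?G ** matrix_inv ?G = mat 1" unfolding matrix_inv_def by (rule someI2_ex) simp
  then show ?thesis by (simp add: pseudoinverse_full_row_rank[OF r] matrix_mul_assoc)
qed

text \<open>Upper limits express the inner limits without claiming beforehand that they exist; for
  nonnegative quantities their tending to 0 is the full statement.\<close>

lemma nested_limsup_tendsto_0:
  fixes X :: "real \<Rightarrow> nat \<Rightarrow> nat \<Rightarrow> ennreal"
  assumes "\<And>\<theta>. 0 < \<theta> \<Longrightarrow> \<forall>\<^sub>F \<epsilon> in at_right 0. \<forall>\<^sub>F n in sequentially. \<forall>\<^sub>F N in sequentially. X \<epsilon> n N \<le> ennreal \<theta>"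
  shows "((\<lambda>\<epsilon>. limsup (\<lambda>n. limsup (X \<epsilon> n))) \<longlongrightarrow> 0) (at_right 0)"
proof (rule order_tendstoI)
  fix a :: ennreal assume "0 < a"
  then obtain c where c: "0 < c" "c < a" using dense by blast
  then have "c \<noteq> \<top>" by (metis less_top top.not_eq_extremum order_less_trans)
  then obtain \<theta> where \<theta>: "c = ennreal \<theta>" "0 \<le> \<theta>" by (cases c) auto
  with c have "0 < \<theta>" by simp
  from assms[OF this] show "\<forall>\<^sub>F \<epsilon> in at_right 0. limsup (\<lambda>n. limsup (X \<epsilon> n)) < a"
  proof eventually_elim
    case (elim \<epsilon>)
    then have "\<forall>\<^sub>F n in sequentially. limsup (X \<epsilon> n) \<le> ennreal \<theta>"
      by eventually_elim (rule Limsup_bounded)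
    then have "limsup (\<lambda>n. limsup (X \<epsilon> n)) \<le> c" unfolding \<theta>(1) by (rule Limsup_bounded)
    with c(2) show ?case by simp
  qed
qed simp

theorem theorem4p2:
  fixes P :: "'w measure"
    and \<xi> :: "'w \<Rightarrow> real^'d"
    and \<xi>s :: "nat \<Rightarrow> 'w \<Rightarrow> real^'d"
    and A :: "real^'n^'n" and B :: "real^'m^'n" and C :: "real^'n^'l" and D :: "real^'m^'l"
    and Y :: "real^'p^'m"
    and x0 :: "real^'n"
    and T \<delta> :: real
    and f :: "real \<Rightarrow> real^'l" and xd :: "real \<Rightarrow> real^'n" and ud :: "real \<Rightarrow> real^'m"
    and K :: "(real^'k) set"
    and F :: "real^'n \<Rightarrow> real^'d \<Rightarrow> real"
    and g :: "real^'n \<Rightarrow> real^'d \<Rightarrow> real^'k"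
    and M :: "real^'d \<Rightarrow> real^'n^'n"
    and q :: "real^'d \<Rightarrow> real^'n"
    and \<kappa>1 \<kappa>2 \<kappa>3 \<kappa>4 :: "real^'d \<Rightarrow> real"
  defines "\<Xi> \<equiv> \<xi> ` space P"
    and "EM \<equiv> (\<integral>\<omega>. M (\<xi> \<omega>) \<partial>P)"
    and "Eq \<equiv> (\<integral>\<omega>. q (\<xi> \<omega>) \<partial>P)"
    and "EF \<equiv> (\<lambda>z. \<integral>\<omega>. F z (\<xi> \<omega>) \<partial>P)"
    and "Eg \<equiv> (\<lambda>z. \<integral>\<omega>. g z (\<xi> \<omega>) \<partial>P)"
    and "EMq \<equiv> (\<lambda>z. \<integral>\<omega>. M (\<xi> \<omega>) *v z + q (\<xi> \<omega>) \<partial>P)"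
  defines "S_hat \<equiv> minimizers (ocp_feasible T A B C D f x0 EMq Eg K) (ocp_cost T \<delta> xd ud EF)"
    and "S_hat_h \<equiv> (\<lambda>\<omega> \<epsilon> \<nu> N. interpolants T N
           (minimizers
              (tsp_feasible T N A B C D f x0 \<epsilon>
                 (\<lambda>z. sample_mean \<nu> (\<lambda>j. M (\<xi>s j \<omega>) *v z + q (\<xi>s j \<omega>)))
                 (\<lambda>z. sample_mean \<nu> (\<lambda>j. g z (\<xi>s j \<omega>))) K)
              (tsp_cost T N \<delta> xd ud (\<lambda>z. sample_mean \<nu> (\<lambda>j. F z (\<xi>s j \<omega>))))))"
  assumes prob: "prob_space P"
    and xi: "\<xi> \<in> borel_measurable P"
    and sample: "iid_sample P \<xi> \<xi>s"
    and T_pos: "0 < T" and delta_pos: "0 < \<delta>"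
    and data_L2: "f \<in> L2_space T" "xd \<in> L2_space T" "ud \<in> L2_space T"
    and data_sampling: "sampling_consistent T f" "sampling_consistent T xd" "sampling_consistent T ud"
    and K: "K \<noteq> {}" "closed K" "convex K"
    and F_C1: "AE s in Xi_law P \<xi>. C1_fun (\<lambda>z. F z s)"
    and g_C1: "AE s in Xi_law P \<xi>. C1_fun (\<lambda>z. g z s)"
    and F_meas: "\<And>z. F z \<in> borel_measurable (Xi_space P \<xi>)"
    and g_meas: "\<And>z. g z \<in> borel_measurable (Xi_space P \<xi>)"
    and M_meas: "M \<in> borel_measurable (Xi_space P \<xi>)"
    and q_meas: "q \<in> borel_measurable (Xi_space P \<xi>)"
    and F_integrable: "\<And>z. integrable P (\<lambda>\<omega>. F z (\<xi> \<omega>))"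
    and a_kappa: "\<And>\<kappa>. \<kappa> \<in> {\<kappa>1, \<kappa>2, \<kappa>3, \<kappa>4} \<Longrightarrow>
           \<kappa> \<in> borel_measurable (Xi_space P \<xi>) \<and> (\<forall>s\<in>\<Xi>. 0 \<le> \<kappa> s) \<and> integrable P (\<lambda>\<omega>. \<kappa> (\<xi> \<omega>))"
    and a_F: "\<And>z1 z2. AE s in Xi_law P \<xi>. \<bar>F z1 s - F z2 s\<bar> \<le> \<kappa>1 s * norm (z1 - z2)"
    and a_g: "\<And>z. AE s in Xi_law P \<xi>. norm (g z s) \<le> \<kappa>2 s * norm z"
    and a_M: "\<And>s. s \<in> \<Xi> \<Longrightarrow> norm (M s) \<le> \<kappa>3 s"
    and a_q: "\<And>s. s \<in> \<Xi> \<Longrightarrow> norm (q s) \<le> \<kappa>4 s"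
    and b_D: "rank D = CARD('l)" "CARD('l) < CARD('m)"
    and b_Y: "CARD('p) = CARD('m) - CARD('l)" "rank Y = CARD('p)" "D ** Y = 0"
    and b_R: "rank (controllability_matrix (A - B ** pseudoinverse D ** C) (B ** Y)) = CARD('n)"
    and c: "cball 0 (lcp_beta EM * (\<integral>\<omega>. \<kappa>2 (\<xi> \<omega>) \<partial>P) * norm1 Eq) \<subseteq> K"
    and d: "{v. 0 \<le> EMq v \<and> 0 \<le> v} \<noteq> {}"
    and e: "adequate EM \<or> Z_matrix EM"
    and f_bound: "\<exists>b. \<forall>z. b \<le> EF z"
  shows "AE \<omega> in P.
           ((\<lambda>\<epsilon>. limsup (\<lambda>\<nu>. limsup (\<lambda>N. excess T (S_hat_h \<omega> \<epsilon> \<nu> N) S_hat))) \<longlongrightarrow> 0) (at_right 0)"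
proof -
  note defs = assms(1-8)
  interpret prob_space P by (rule prob)
  note law = prob xi sample
  have \<kappa>: "\<kappa>1 \<in> borel_measurable (Xi_space P \<xi>)" "\<kappa>2 \<in> borel_measurable (Xi_space P \<xi>)"
      "\<kappa>3 \<in> borel_measurable (Xi_space P \<xi>)" "\<kappa>4 \<in> borel_measurable (Xi_space P \<xi>)"
      "integrable P (\<lambda>\<omega>. \<kappa>1 (\<xi> \<omega>))" "integrable P (\<lambda>\<omega>. \<kappa>2 (\<xi> \<omega>))" "integrable P (\<lambda>\<omega>. \<kappa>3 (\<xi> \<omega>))" "integrable P (\<lambda>\<omega>. \<kappa>4 (\<xi> \<omega>))"
      "\<And>s. s \<in> \<Xi> \<Longrightarrow> 0 \<le> \<kappa>1 s" "\<And>s. s \<in> \<Xi> \<Longrightarrow> 0 \<le> \<kappa>2 s"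
    using a_kappa[of \<kappa>1] a_kappa[of \<kappa>2] a_kappa[of \<kappa>3] a_kappa[of \<kappa>4] by auto
  have \<Xi>: "\<xi> \<omega> \<in> \<Xi>" if "\<omega> \<in> space P" for \<omega> using that by (simp add: defs)
  have \<Xi>_law: "AE s in Xi_law P \<xi>. s \<in> \<Xi>"
    by (rule AE_I2) (simp add: Xi_law_def Xi_space_def space_restrict_space defs)
  have E\<kappa>: "0 \<le> (\<integral>\<omega>. \<kappa>1 (\<xi> \<omega>) \<partial>P)" "0 \<le> (\<integral>\<omega>. \<kappa>2 (\<xi> \<omega>) \<partial>P)"
    using \<kappa> \<Xi> by (auto intro!: integral_nonneg_AE AE_I2)
  have F_cont: "AE s in Xi_law P \<xi>. continuous_on UNIV (\<lambda>z. F z s)"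
    using F_C1 by eventually_elim (rule C1_fun_continuous)
  have g_cont: "AE s in Xi_law P \<xi>. continuous_on UNIV (\<lambda>z. g z s)"
    using g_C1 by eventually_elim (rule C1_fun_continuous)
  \<comment> \<open>The pair of arguments is treated as one point of the product space, so that one
    density argument removes the dependence of the null set on both.\<close>
  have F_lip: "AE s in Xi_law P \<xi>. \<forall>p. \<bar>F (fst p) s - F (snd p) s\<bar> \<le> \<kappa>1 s * norm (fst p - snd p)"
  proof (rule AE_le_all_of_continuous[OF a_F])
    show "AE s in Xi_law P \<xi>. continuous_on UNIV (\<lambda>p. \<bar>F (fst p) s - F (snd p) s\<bar>) \<and>
        continuous_on UNIV (\<lambda>p. \<kappa>1 s * norm (fst p - snd p))"
      using F_cont by eventually_elim
        (auto intro!: continuous_intros continuous_on_compose2[of UNIV "\<lambda>z. F z _"])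
  qed
  have g_dom: "AE s in Xi_law P \<xi>. \<forall>z. norm (g z s) \<le> \<kappa>2 s * norm z"
    by (rule AE_le_all_of_continuous[OF a_g]) (use g_cont in \<open>eventually_elim, auto intro!: continuous_intros\<close>)
  \<comment> \<open>The Lipschitz bound against the point 0 gives the linear growth demanded by the
    uniform law, with \<open>|F 0 s|\<close> as its integrable constant part.\<close>
  have F_dom: "AE s in Xi_law P \<xi>. \<forall>z. norm (F z s) \<le> \<bar>F 0 s\<bar> + \<kappa>1 s * norm z"
    using F_lip
  proof (eventually_elim, intro allI)
    fix s z assume "\<forall>p. \<bar>F (fst p) s - F (snd p) s\<bar> \<le> \<kappa>1 s * norm (fst p - snd p)"
    from spec[OF this, of "(z, 0)"] show "norm (F z s) \<le> \<bar>F 0 s\<bar> + \<kappa>1 s * norm z" by simp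
  qed
  have Mq_dom: "AE s in Xi_law P \<xi>. \<forall>z. norm (M s *v z + q s) \<le> \<kappa>4 s + \<kappa>3 s * norm z"
    using \<Xi>_law
  proof (eventually_elim, intro allI)
    fix s z assume s: "s \<in> \<Xi>"
    have "norm (M s *v z + q s) \<le> norm (M s) * norm z + norm (q s)"
      by (intro norm_triangle_mono norm_matrix_vector_mult_le order_refl)
    also have "\<dots> \<le> \<kappa>3 s * norm z + \<kappa>4 s" by (intro add_mono mult_right_mono a_M a_q s) simp
    finally show "norm (M s *v z + q s) \<le> \<kappa>4 s + \<kappa>3 s * norm z" by simp
  qed
  have bl: "bounded_linear (\<lambda>A::real^'n^'n. A *v z)" for z :: "real^'n"
    by (rule bounded_linear_intro[where K="norm z"])
      (simp_all add: matrix_vector_mult_add_rdistrib scaleR_matrix_vector_assoc[symmetric] norm_matrix_vector_mult_le)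
  have Mv_meas: "(\<lambda>s. M s *v z) \<in> borel_measurable (Xi_space P \<xi>)" for z
    by (rule borel_measurable_continuous_on[OF _ M_meas]) (rule linear_continuous_on[OF bl])
  have Mq_meas: "(\<lambda>s. M s *v z + q s) \<in> borel_measurable (Xi_space P \<xi>)" for z
    by (intro borel_measurable_add Mv_meas q_meas)
  note xm = measurable_Xi[OF law]
  have M_int: "integrable P (\<lambda>\<omega>. M (\<xi> \<omega>))"
    by (rule Bochner_Integration.integrable_bound[OF \<kappa>(7) measurable_compose[OF xm M_meas]])
      (auto intro!: AE_I2 order_trans[OF a_M] \<Xi>)
  have q_int: "integrable P (\<lambda>\<omega>. q (\<xi> \<omega>))"
    by (rule Bochner_Integration.integrable_bound[OF \<kappa>(8) measurable_compose[OF xm q_meas]])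
      (auto intro!: AE_I2 order_trans[OF a_q] \<Xi>)
  have EMq_eq: "EMq z = EM *v z + Eq" for z
    using integral_bounded_linear[OF bl M_int] integrable_bounded_linear[OF bl M_int] q_int by (simp add: defs)
  have uF: "AE \<omega> in P. \<forall>z. ((\<lambda>(y, n). sample_mean n (\<lambda>j. F y (\<xi>s j \<omega>))) \<longlongrightarrow> EF z) (nhds z \<times>\<^sub>F sequentially)"
    unfolding defs(4) using F_integrable
    by (intro uniform_law[OF law F_meas F_cont F_dom _ \<kappa>(1) _ \<kappa>(5)] borel_measurable_abs F_meas integrable_abs)
  have ug: "AE \<omega> in P. \<forall>z. ((\<lambda>(y, n). sample_mean n (\<lambda>j. g y (\<xi>s j \<omega>))) \<longlongrightarrow> Eg z) (nhds z \<times>\<^sub>F sequentially)"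
    unfolding defs(5) using g_dom by (intro uniform_law[OF law g_meas g_cont, of "\<lambda>_. 0" \<kappa>2] \<kappa>) auto
  have uM: "AE \<omega> in P. \<forall>z. ((\<lambda>(y, n). sample_mean n (\<lambda>j. M (\<xi>s j \<omega>) *v y + q (\<xi>s j \<omega>))) \<longlongrightarrow> EMq z) (nhds z \<times>\<^sub>F sequentially)"
    unfolding defs(6)
    by (rule uniform_law[OF law Mq_meas _ Mq_dom \<kappa>(4,3,8,7)])
      (auto intro!: AE_I2 continuous_intros matrix_vector_mult_linear_continuous_on)
  have u\<kappa>: "AE \<omega> in P. (\<lambda>n. sample_mean n (\<lambda>j. \<kappa>1 (\<xi>s j \<omega>))) \<longlonglongrightarrow> (\<integral>\<omega>. \<kappa>1 (\<xi> \<omega>) \<partial>P)"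
    by (rule iid_strong_law[OF law \<kappa>(1,5)])
  have Eg_bound: "norm (Eg z) \<le> (\<integral>\<omega>. \<kappa>2 (\<xi> \<omega>) \<partial>P) * norm z" for z
  proof -
    have "AE \<omega> in P. norm (g z (\<xi> \<omega>)) \<le> \<kappa>2 (\<xi> \<omega>) * norm z" by (rule AE_law_imp_AE[OF law a_g])
    then have "(\<integral>\<omega>. norm (g z (\<xi> \<omega>)) \<partial>P) \<le> (\<integral>\<omega>. \<kappa>2 (\<xi> \<omega>) * norm z \<partial>P)"
      using \<kappa> \<Xi> by (intro integral_mono_AE') auto
    then have "(\<integral>\<omega>. norm (g z (\<xi> \<omega>)) \<partial>P) \<le> (\<integral>\<omega>. \<kappa>2 (\<xi> \<omega>) \<partial>P) * norm z" by simp
    then show ?thesis unfolding defs(5) by (rule order_trans[OF integral_norm_bound])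
  qed
  obtain v where v: "0 \<le> EMq v" "0 \<le> v" using d by blast
  have "0 \<le> v $ i" "0 \<le> (EM *v v + Eq) $ i" for i
    using v unfolding EMq_eq less_eq_vec_def by simp_all
  from lcp_bounded_solution[OF e this] obtain z where z: "lcp_solution EM Eq z" "norm z \<le> lcp_beta EM * norm1 Eq"
    by blast
  \<comment> \<open>The radius in assumption \<open>c\<close> is exactly this product, so the
    bounded complementarity solution satisfies the constraint on g.\<close>
  have "norm (Eg z) \<le> (\<integral>\<omega>. \<kappa>2 (\<xi> \<omega>) \<partial>P) * (lcp_beta EM * norm1 Eq)"
    by (rule order_trans[OF Eg_bound mult_left_mono[OF z(2) E\<kappa>(2)]])
  then have "Eg z \<in> K" using c by (auto simp: mult_ac)
  moreover have "0 \<le> z" "0 \<le> EMq z" "z \<bullet> EMq z = 0"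
    using z(1) by (auto simp: lcp_solution_def EMq_eq less_eq_vec_def inner_vec_def intro!: sum.neutral)
  ultimately have ne: "\<exists>z. 0 \<le> z \<and> z \<bullet> EMq z = 0 \<and> 0 \<le> EMq z \<and> Eg z \<in> K" by blast
  show ?thesis
    using uF ug uM u\<kappa> AE_law_imp_AE_sample[OF law F_lip]
  proof eventually_elim
    case (elim \<omega>)
    note lim = elim(1-3)[rule_format]
    let ?Fs = "\<lambda>n z. sample_mean n (\<lambda>j. F z (\<xi>s j \<omega>))"
    interpret terminal_problem T A B C D "pseudoinverse D" Y f xd ud \<delta> x0 EF EMq Eg K
      using T_pos pseudoinverse_right_inverse[OF b_D(1)] b_Y(3) b_R data_L2 delta_pos
        continuous_of_joint_limit[OF lim(1)] continuous_of_joint_limit[OF lim(2)] continuous_of_joint_limit[OF lim(3)]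
        K(2) f_bound ne
      by unfold_locales auto
    \<comment> \<open>The added 1 gives room: the sample means of \<kappa>1 converge to its
      expectation and are eventually below \<open>L\<close>, which then serves as a common Lipschitz
      constant.\<close>
    define L where "L = (\<integral>\<omega>. \<kappa>1 (\<xi> \<omega>) \<partial>P) + 1"
    have L: "0 \<le> L" using E\<kappa>(1) by (simp add: L_def)
    have "(\<integral>\<omega>. \<kappa>1 (\<xi> \<omega>) \<partial>P) < L" by (simp add: L_def)
    from order_tendstoD(2)[OF elim(4) this]
    have lip: "\<forall>\<^sub>F n in sequentially. \<forall>y z. \<bar>?Fs n y - ?Fs n z\<bar> \<le> L * norm (y - z)"
    proof (eventually_elim, intro allI)
      fix n y z assume n: "sample_mean n (\<lambda>j. \<kappa>1 (\<xi>s j \<omega>)) < L"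
      have "\<bar>?Fs n y - ?Fs n z\<bar> = 1 / real n * \<bar>\<Sum>j=1..n. F y (\<xi>s j \<omega>) - F z (\<xi>s j \<omega>)\<bar>"
        by (simp add: sample_mean_def sum_subtractf abs_mult flip: right_diff_distrib diff_divide_distrib)
      also have "\<dots> \<le> 1 / real n * (\<Sum>j=1..n. \<kappa>1 (\<xi>s j \<omega>) * norm (y - z))"
      proof (intro mult_left_mono order_trans[OF sum_abs] sum_mono)
        fix j assume "j \<in> {1..n}"
        then show "\<bar>F y (\<xi>s j \<omega>) - F z (\<xi>s j \<omega>)\<bar> \<le> \<kappa>1 (\<xi>s j \<omega>) * norm (y - z)"
          using elim(5)[rule_format, of j "(y, z)"] by simp
      qed simp
      also have "\<dots> = sample_mean n (\<lambda>j. \<kappa>1 (\<xi>s j \<omega>)) * norm (y - z)"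
        by (simp add: sample_mean_def sum_distrib_right)
      also have "\<dots> \<le> L * norm (y - z)" using n by (intro mult_right_mono) auto
      finally show "\<bar>?Fs n y - ?Fs n z\<bar> \<le> L * norm (y - z)" .
    qed
    show ?case
    proof (rule nested_limsup_tendsto_0)
      fix \<theta> :: real assume "0 < \<theta>"
      from discrete_minimizers_stability[OF lim(1) lim(3) lim(2) lip L data_sampling this]
      show "\<forall>\<^sub>F \<epsilon> in at_right 0. \<forall>\<^sub>F \<nu> in sequentially. \<forall>\<^sub>F N in sequentially.
          excess T (S_hat_h \<omega> \<epsilon> \<nu> N) S_hat \<le> ennreal \<theta>"
        unfolding excess_def SUP_le_iff defs(7,8) .
    qed
  qed
qed

end
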